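(* Let $X_n$ be the final altitude of a random meander with catastrophes of length $n$, i.e. $\Pr(X_n=k)=[z^nu^k]F(z,u)/[z^n]F(z,1)$ with $F(z,u)=D(z)M(z,u)$. Then $X_n$ admits a discrete limit distribution: $\lim_{n\to\infty}\Pr(X_n=k)=[u^k]\,\omega(u)$, where \[ \omega(u)=\begin{cases}\displaystyle\prod_{\ell=1}^d\frac{1-v_\ell(\rho_0)}{u-v_\ell(\rho_0)} & \text{if } \rho_0\le\rho,\\[3mm] \displaystyle\frac{\eta D(\rho)+\frac{C}{\tau-u}}{\eta D(\rho)+\frac{C}{\tau-1}}\prod_{\ell=1}^d\frac{1-v_\ell(\rho)}{u-v_\ell(\rho)} & \text{if } \rho_0 \text{ does not exist},\end{cases} \] with $C=\sqrt{2P(\tau)/P''(\tau)}$.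
   Context: Fix integers $c,d\ge1$ and non-negative real weights $p_{-c},\dots,p_d$ with $p_{-c}\neq0\neq p_d$; jump set $\mathcal J=\{i: p_i\neq0\}$, jump polynomial $P(u)=\sum_{i=-c}^dp_iu^i$. Standing assumption: $P$ is aperiodic (there are no integer $b$, integer $p\ge2$ and Laurent polynomial $H$ with $P(u)=u^bH(u^p)$). A catastrophe is a step from an altitude $h>0$ with $-h\notin\mathcal J$ directly to altitude $0$, of weight $q>0$. Paths start at altitude $0$; each step is a jump $i\in\mathcal J$ (weight $p_i$) or a catastrophe; the weight of a path is the product of its step weights. Meanders never go below $0$; excursions are meanders ending at $0$. Let $M(z,u)=\sum m_{n,k}z^nu^k$, with $m_{n,k}$ the total weight of catastrophe-free meanders of length $n$ ending at altitude $k$; $M_k(z)=[u^k]M(z,u)$, $M(z)=M(z,1)$, $E(z)=M_0(z)$. Let $Q(z)=zq\big(M(z)-E(z)-\sum_{j>0,-j\in\mathcal J}M_j(z)\big)$ and $D(z)=1/(1-Q(z))$. The large roots $v_1(z),\dots,v_d(z)$ are the $d$ solutions of $1-zP(u)=0$ with $|v_\ell(z)|\to\infty$ as $z\to0$. Let $\tau>0$ be the minimal positive real solution of $P'(\tau)=0$ and $\rho=1/P(\tau)$. Let $\rho_0$ be the smallest positive real zero of $1-Q(z)$ satisfying $\rho_0\le\rho$, if it exists ("$\rho_0$ does not exist" otherwise). When $\rho_0$ does not exist, $\eta$ is defined by $Q(z)=Q(\rho)-\eta\sqrt{1-z/\rho}+O(1-z/\rho)$ as $z\to\rho$. *)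

theory Defs
  imports "HOL-Analysis.Analysis" "HOL-Computational_Algebra.Formal_Power_Series"
          "HOL-Computational_Algebra.Polynomial" "HOL-Library.Landau_Symbols"
begin

definition jumpset :: "(int \<Rightarrow> real) \<Rightarrow> int set" where
  "jumpset p = {i. p i \<noteq> 0}"

text \<open>Aperiodicity: there are no integer b, integer per >= 2 and Laurent polynomial H
  (finitely supported coefficient function h) with P(u) = u^b H(u^per), written
  coefficientwise.\<close>
definition aperiodic :: "(int \<Rightarrow> real) \<Rightarrow> bool" where
  "aperiodic p \<longleftrightarrow> \<not> (\<exists>(b::int) (per::int) (h::int \<Rightarrow> real).
      per \<ge> 2 \<and> finite {j. h j \<noteq> 0} \<and>
      (\<forall>i. p i = (if per dvd (i - b) then h ((i - b) div per) else 0)))"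

definition meanders :: "(int \<Rightarrow> real) \<Rightarrow> nat \<Rightarrow> int list set" where
  "meanders p n = {ws. length ws = n \<and> set ws \<subseteq> jumpset p \<and>
                       (\<forall>j\<le>n. 0 \<le> sum_list (take j ws))}"

definition path_weight :: "(int \<Rightarrow> real) \<Rightarrow> int list \<Rightarrow> real" where
  "path_weight p ws = prod_list (map p ws)"

definition mcoef :: "(int \<Rightarrow> real) \<Rightarrow> nat \<Rightarrow> nat \<Rightarrow> real" where
  "mcoef p n k = (\<Sum>ws \<in> {ws \<in> meanders p n. sum_list ws = int k}. path_weight p ws)"

definition mtot :: "(int \<Rightarrow> real) \<Rightarrow> nat \<Rightarrow> real" where
  "mtot p n = (\<Sum>ws \<in> meanders p n. path_weight p ws)"

text \<open>[z^n] Q(z), where Q(z) = z q (M(z) - E(z) - sum_{j>0, -j in J} M_j(z))\<close>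
definition Qcoef :: "(int \<Rightarrow> real) \<Rightarrow> real \<Rightarrow> nat \<Rightarrow> real" where
  "Qcoef p q n = (case n of 0 \<Rightarrow> 0
     | Suc m \<Rightarrow> q * (mtot p m - mcoef p m 0
                 - (\<Sum>j \<in> {j::nat. j > 0 \<and> - int j \<in> jumpset p}. mcoef p m j)))"

definition Qfun :: "(int \<Rightarrow> real) \<Rightarrow> real \<Rightarrow> real \<Rightarrow> real" where
  "Qfun p q z = (\<Sum>n. Qcoef p q n * z ^ n)"

definition Dfps :: "(int \<Rightarrow> real) \<Rightarrow> real \<Rightarrow> real fps" where
  "Dfps p q = inverse (1 - Abs_fps (Qcoef p q))"

definition Fcoef :: "(int \<Rightarrow> real) \<Rightarrow> real \<Rightarrow> nat \<Rightarrow> nat \<Rightarrow> real" where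
  "Fcoef p q n k = (\<Sum>a\<le>n. fps_nth (Dfps p q) a * mcoef p (n - a) k)"

definition F1coef :: "(int \<Rightarrow> real) \<Rightarrow> real \<Rightarrow> nat \<Rightarrow> real" where
  "F1coef p q n = (\<Sum>a\<le>n. fps_nth (Dfps p q) a * mtot p (n - a))"

definition prob_alt :: "(int \<Rightarrow> real) \<Rightarrow> real \<Rightarrow> nat \<Rightarrow> nat \<Rightarrow> real" where
  "prob_alt p q n k = Fcoef p q n k / F1coef p q n"

definition jump_poly_real :: "nat \<Rightarrow> nat \<Rightarrow> (int \<Rightarrow> real) \<Rightarrow> real \<Rightarrow> real" where
  "jump_poly_real c d p x = (\<Sum>i\<in>{- int c..int d}. p i * x powi i)"

definition jump_poly_complex :: "nat \<Rightarrow> nat \<Rightarrow> (int \<Rightarrow> real) \<Rightarrow> complex \<Rightarrow> complex" where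
  "jump_poly_complex c d p u = (\<Sum>i\<in>{- int c..int d}. complex_of_real (p i) * u powi i)"

text \<open>The kernel polynomial u^c (1 - t P(u)), used to count multiplicities of roots.\<close>
definition kernel_poly :: "nat \<Rightarrow> nat \<Rightarrow> (int \<Rightarrow> real) \<Rightarrow> real \<Rightarrow> complex poly" where
  "kernel_poly c d p t = monom 1 c - smult (complex_of_real t)
       (\<Sum>i\<in>{- int c..int d}. monom (complex_of_real (p i)) (nat (i + int c)))"

text \<open>v 0, ..., v (d-1) are the large roots of 1 - z P(u) = 0, followed as continuous
  branches along z in (0,R]: each is a root, tends to infinity as z -> 0+, and together
  they respect root multiplicities.\<close>
definition large_roots :: "nat \<Rightarrow> nat \<Rightarrow> (int \<Rightarrow> real) \<Rightarrow> real \<Rightarrow> (nat \<Rightarrow> real \<Rightarrow> complex) \<Rightarrow> bool" where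
  "large_roots c d p R v \<longleftrightarrow>
     (\<forall>l<d. continuous_on {0<..R} (v l)
        \<and> filterlim (\<lambda>t. norm (v l t)) at_top (at_right 0)
        \<and> (\<forall>t\<in>{0<..R}. v l t \<noteq> 0 \<and> 1 - complex_of_real t * jump_poly_complex c d p (v l t) = 0))
     \<and> (\<forall>t\<in>{0<..R}. \<forall>w. card {l\<in>{..<d}. v l t = w} \<le> order w (kernel_poly c d p t))"

definition taylor_coeff :: "(complex \<Rightarrow> complex) \<Rightarrow> nat \<Rightarrow> complex" where
  "taylor_coeff f k = (deriv ^^ k) f 0 / fact k"

end

theory Submission
  imports Defs "HOL-Probability.Probability" "HOL-Complex_Analysis.Complex_Analysis" "HOL-Real_Asymp.Real_Asymp"
    "HOL-Computational_Algebra.Fundamental_Theorem_Algebra"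
begin

text \<open>Let \<open>M(z, u)\<close> be the generating function of catastrophe-free meanders. Splitting each power \<open>P(u)\<^sup>n\<close> into its
  nonnegative and negative parts gives a Wiener-Hopf factorization of \<open>1 - z P(u)\<close>, and hence Spitzer's identity
  \<open>M(z, u) = exp (\<Sum>n\<ge>1. z\<^sup>n / n * [u\<^sup>\<ge>\<^sup>0] P(u)\<^sup>n)\<close>. Under the exponential tilt by \<open>\<tau>\<close> the jumps are centred, so a local
  limit theorem with error \<open>O(1/n)\<close> shows that the exponent at \<open>\<rho>\<close> has coefficients \<open>\<alpha> b\<^sub>n + O(1/n\<^sup>2)\<close>, where \<open>b\<^sub>n\<close> are the
  coefficients of \<open>1 - sqrt (1 - z)\<close>. This form is stable under products and exponentials, so it passes to \<open>M\<^sub>k\<close>, \<open>M\<close> and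
  \<open>Q\<close>; no analytic continuation beyond the disc of convergence is needed.

  The coefficients of \<open>D = 1 / (1 - Q)\<close> form a renewal sequence. If \<open>Q(r) = 1\<close> with \<open>r < \<rho>\<close>, they converge after scaling by
  \<open>r\<^sup>n\<close>; if \<open>Q(\<rho>) = 1\<close>, they behave like the coefficients of \<open>(1 - z) powr (-1/2)\<close>; if \<open>Q(\<rho>) < 1\<close>, they are asymptotic to a
  multiple of \<open>b\<^sub>n\<close>. Convolution with the \<open>M\<^sub>k\<close> yields the limits \<open>M\<^sub>k(r) / M(r)\<close> in the first two regimes and an extra term from
  the square-root singularity of \<open>M\<close> in the third. Finally \<open>M(t, u) = 1 / (- t p\<^sub>d \<Prod>l (u - v\<^sub>l(t)))\<close>, because
  \<open>1 / M(t, u)\<close> converges wherever \<open>M(t, u)\<close> does, so that \<open>M(t, u)\<close> cancels exactly the large roots of the kernel.\<close>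

section \<open>Coefficients of square-root singularities\<close>

text \<open>At \<rho> a small and a large root of the kernel merge at \<tau>. Instead of expanding
  these roots there, the square root is produced by probability: the coefficients of P^n decay like
  n powr (-1/2) after scaling, and the factor 1/n in Spitzer's exponent turns this into the order of
  \<open>bb n\<close>. An error merely small against \<open>bb n\<close> would do for products, but
  the critical renewal case needs 1 - Q and its derivative at complex points near 1; hence the
  quantitative class with error O(1/n^2). Evaluation at u = 1 requires sums over all altitudes,
  which at \<rho> are geometric in 1/\<tau> and so need \<tau> > 1. For \<tau> \<le> 1 the drift is
  nonnegative, Q diverges at 1/P(1) \<le> \<rho>, and Q takes the value 1 strictly before that
  point. So singular behaviour at \<rho> matters only if \<tau> > 1. For t < \<rho> the circle of
  radius \<tau> separates the large roots of the kernel from the others. At t = \<rho> this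
  separation is lost, and the factorization is carried over by continuity.\<close>

text \<open>\<open>cc\<close> and \<open>bb\<close> are the coefficients of \<open>(1 - x) powr (-1/2)\<close> and \<open>1 - sqrt (1 - x)\<close>.\<close>
definition cc :: "nat \<Rightarrow> real" where "cc n = (-1) ^ n * ((-1/2) gchoose n)"

definition bb :: "nat \<Rightarrow> real" where
  "bb n = (if n = 0 then 0 else - ((-1) ^ n * ((1/2) gchoose n)))"

lemma gchoose_Suc_right: "(a gchoose Suc n) = (a gchoose n) * (a - of_nat n) / of_nat (Suc n)"
  for a :: "'a :: field_char_0"
  by (simp add: gbinomial_prod_rev prod.atLeast0_lessThan_Suc)

lemma cc_0 [simp]: "cc 0 = 1" by (simp add: cc_def)
lemma cc_Suc: "cc (Suc n) = cc n * (2 * real n + 1) / (2 * real n + 2)"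
  by (simp add: cc_def gchoose_Suc_right field_simps)
lemma bb_0 [simp]: "bb 0 = 0" by (simp add: bb_def)
lemma bb_1 [simp]: "bb (Suc 0) = 1/2" by (simp add: bb_def)
lemma bb_Suc: "n > 0 \<Longrightarrow> bb (Suc n) = bb n * (2 * real n - 1) / (2 * real n + 2)"
  by (simp add: bb_def gchoose_Suc_right field_simps)

lemma cc_pos: "cc n > 0" by (induction n) (auto simp: cc_Suc intro!: divide_pos_pos mult_pos_pos)
lemma bb_pos: "n > 0 \<Longrightarrow> bb n > 0"
proof (induction n rule: nat_induct_non_zero)
  case (Suc n) thus ?case by (auto simp: bb_Suc intro!: divide_pos_pos mult_pos_pos)
qed auto
lemma bb_nonneg: "bb n \<ge> 0" using bb_pos[of n] by (cases n) auto

lemma bb_eq_cc: "n > 0 \<Longrightarrow> bb n = cc n / (2 * real n - 1)"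
proof (induction n rule: nat_induct_non_zero)
  case (Suc n)
  have "2 * real n - 1 > 0" using Suc by auto
  thus ?case using Suc by (simp add: bb_Suc cc_Suc divide_simps)
qed (auto simp: cc_Suc[of 0, simplified])

text \<open>The series sqrt (1 - x) and its inverse. They are polymorphic because real coefficients
  serve the convolution estimates and complex ones the evaluation in the disc.\<close>

definition Sfps :: "'a :: real_normed_field fps" where "Sfps = 1 - Abs_fps (\<lambda>n. of_real (bb n))"
definition Cfps :: "'a :: real_normed_field fps" where "Cfps = Abs_fps (\<lambda>n. of_real (cc n))"

lemma Sfps_nth: "fps_nth Sfps n = of_real ((-1) ^ n * ((1/2) gchoose n))"
  by (simp add: Sfps_def bb_def)
lemma Cfps_nth: "fps_nth Cfps n = of_real ((-1) ^ n * ((-1/2) gchoose n))"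
  by (simp add: Cfps_def cc_def)

text \<open>Vandermonde convolution for powers of 1 - x, the sign being split over the two factors.
  Exponent sums 1, 0 and -1 give \<open>Sfps_square\<close>, \<open>Cfps_Sfps\<close> and
  \<open>cc_conv\<close>.\<close>

lemma gbinomial_alt_conv:
  "(\<Sum>i=0..n. ((-1)^i * (a gchoose i)) * ((-1)^(n-i) * (b gchoose (n-i)))) = (-1)^n * ((a + b) gchoose n)"
  for a b :: real
proof -
  have "(\<Sum>i=0..n. ((-1)^i * (a gchoose i)) * ((-1)^(n-i) * (b gchoose (n-i)))) 
    = (\<Sum>i=0..n. (-1)^n * ((a gchoose i) * (b gchoose (n-i))))"
  proof (intro sum.cong refl)
    fix i assume "i \<in> {0..n}"
    hence "(-1::real)^i * (-1)^(n-i) = (-1)^n" by (simp flip: power_add)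
    thus "((-1)^i * (a gchoose i)) * ((-1)^(n-i) * (b gchoose (n-i))) = (-1)^n * ((a gchoose i) * (b gchoose (n-i)))"
      by (metis (no_types, lifting) mult.assoc mult.left_commute)
  qed
  thus ?thesis by (simp add: gbinomial_Vandermonde flip: sum_distrib_left)
qed

lemma Sfps_square: "Sfps * Sfps = (1 - fps_X :: 'a :: real_normed_field fps)"
proof (rule fps_ext)
  fix n
  have "fps_nth (Sfps * Sfps) n = (of_real ((-1)^n * ((1/2 + 1/2) gchoose n)) :: 'a)"
    unfolding fps_mult_nth Sfps_nth of_real_mult[symmetric] of_real_sum[symmetric]
      gbinomial_alt_conv ..
  also have "(1/2 + 1/2 :: real) gchoose n = of_nat (1 choose n)"
    using binomial_gbinomial[of 1 n, where 'a = real] by simp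
  also have "of_real ((-1)^n * of_nat (1 choose n)) = fps_nth (1 - fps_X :: 'a fps) n"
    by (cases n; cases "n - 1") (auto simp: binomial_eq_0)
  finally show "fps_nth (Sfps * Sfps) n = fps_nth (1 - fps_X :: 'a fps) n" .
qed

lemma Cfps_Sfps: "Cfps * Sfps = (1 :: 'a :: real_normed_field fps)"
proof (rule fps_ext)
  fix n
  have "fps_nth (Cfps * Sfps) n = (of_real ((-1)^n * ((-1/2 + 1/2) gchoose n)) :: 'a)"
    unfolding fps_mult_nth Sfps_nth Cfps_nth of_real_mult[symmetric] of_real_sum[symmetric]
      gbinomial_alt_conv ..
  also have "\<dots> = fps_nth 1 n" by (cases n) auto
  finally show "fps_nth (Cfps * Sfps) n = fps_nth (1 :: 'a fps) n" .
qed

lemma cc_conv: "(\<Sum>i=0..n. cc i * cc (n - i)) = 1"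
  unfolding cc_def gbinomial_alt_conv
  by (simp add: gbinomial_minus) (metis binomial_n_n gbinomial_prod_rev of_nat_1 power_mult_distrib
      mult_1 binomial_gbinomial power_one mult_minus1 minus_mult_minus)

text \<open>With B = 1 - S and S * S = 1 - x one has B * B = 2 * B - x, so squaring reproduces
  \<open>bb\<close> up to a single coefficient.\<close>

lemma bb_conv: "fps_nth (Abs_fps bb * Abs_fps bb) n = 2 * bb n - (if n = 1 then 1 else 0)"
proof -
  have "Abs_fps bb = 1 - Sfps" by (simp add: Sfps_def)
  hence "Abs_fps bb * Abs_fps bb = 1 - 2 * Sfps + Sfps * Sfps"
    by (simp only: left_diff_distrib right_diff_distrib mult_1_left mult_1_right) (simp add: algebra_simps)
  also have "\<dots> = 2 * Abs_fps bb - fps_X"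
    unfolding Sfps_square by (simp add: Sfps_def algebra_simps)
  finally show ?thesis by auto
qed

text \<open>\<open>cc n\<close> is the central binomial coefficient over 4^n, so the Wallis product
  supplies the constant 1 / sqrt pi in its asymptotics.\<close>

lemma wallis_cc: "(\<Prod>k=1..n. (4*real k^2) / (4*real k^2 - 1)) = 1 / (cc n ^ 2 * (2 * real n + 1))"
proof (induction n)
  case (Suc n)
  have "cc n > 0" by (rule cc_pos)
  have *: "4 * real (Suc n) ^ 2 - 1 = (2 * real n + 1) * (2 * real n + 3)" by (simp add: algebra_simps power2_eq_square)
  have "(\<Prod>k=1..Suc n. (4*real k^2) / (4*real k^2 - 1)) =
      1 / (cc n ^ 2 * (2 * real n + 1)) * (4 * real (Suc n) ^ 2 / ((2 * real n + 1) * (2 * real n + 3)))"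
    using Suc * by simp
  also have "\<dots> = 1 / (cc (Suc n) ^ 2 * (2 * real (Suc n) + 1))"
    using \<open>cc n > 0\<close> unfolding cc_Suc power_mult_distrib power_divide
    by (simp add: divide_simps) (simp add: algebra_simps power2_eq_square)
  finally show ?case .
qed auto

lemma cc_sq_lim: "(\<lambda>n. cc n ^ 2 * (2 * real n + 1)) \<longlonglongrightarrow> 2 / pi"
  using tendsto_inverse[OF wallis] unfolding wallis_cc by (simp add: field_simps)

text \<open>Two normalisations tend to the same limit, one decreasing and the other increasing;
  hence the limit yields bounds valid for every n.\<close>

lemma cc_bounds:
  shows "cc n ^ 2 * (2 * real n + 1) \<ge> 2 / pi" and "cc n ^ 2 * (2 * real n) \<le> 2 / pi"
proof -
  have "decseq (\<lambda>n. cc n ^ 2 * (2 * real n + 1))"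
  proof (rule decseq_SucI)
    fix n
    have "((2 * real n + 1) / (2 * real n + 2))^2 * (2 * real (Suc n) + 1) \<le> 2 * real n + 1"
      by (simp add: divide_simps) (simp add: algebra_simps power2_eq_square)
    hence "cc n ^ 2 * (((2 * real n + 1) / (2 * real n + 2))^2 * (2 * real (Suc n) + 1)) \<le> cc n ^ 2 * (2 * real n + 1)"
      by (intro mult_left_mono) auto
    thus "cc (Suc n) ^ 2 * (2 * real (Suc n) + 1) \<le> cc n ^ 2 * (2 * real n + 1)"
      by (simp add: cc_Suc power_mult_distrib power_divide)
  qed
  thus "cc n ^ 2 * (2 * real n + 1) \<ge> 2 / pi" by (rule decseq_ge[OF _ cc_sq_lim])
  have "incseq (\<lambda>n. cc n ^ 2 * (2 * real n))"
  proof (rule incseq_SucI)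
    fix n
    have "2 * real n \<le> ((2 * real n + 1) / (2 * real n + 2))^2 * (2 * real (Suc n))"
      by (simp add: divide_simps) (simp add: algebra_simps power2_eq_square)
    hence "cc n ^ 2 * (2 * real n) \<le> cc n ^ 2 * (((2 * real n + 1) / (2 * real n + 2))^2 * (2 * real (Suc n)))"
      by (intro mult_left_mono) auto
    thus "cc n ^ 2 * (2 * real n) \<le> cc (Suc n) ^ 2 * (2 * real (Suc n))"
      by (simp add: cc_Suc power_mult_distrib power_divide)
  qed
  moreover have "(\<lambda>n. cc n ^ 2 * (2 * real n)) \<longlonglongrightarrow> 2 / pi"
  proof -
    have "(\<lambda>n. (cc n ^ 2 * (2 * real n + 1)) * (2 * real n / (2 * real n + 1))) \<longlonglongrightarrow> 2 / pi * 1"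
      by (intro tendsto_mult cc_sq_lim) real_asymp
    moreover have "(\<lambda>n. (cc n ^ 2 * (2 * real n + 1)) * (2 * real n / (2 * real n + 1))) = (\<lambda>n. cc n ^ 2 * (2 * real n))"
      by (intro ext) (simp add: divide_simps)
    ultimately show ?thesis by simp
  qed
  ultimately show "cc n ^ 2 * (2 * real n) \<le> 2 / pi" by (rule incseq_le)
qed

lemma cc_lower: "cc n \<ge> 1 / sqrt (pi * (real n + 1/2))"
proof -
  have "(1 / sqrt (pi * (real n + 1/2)))^2 \<le> cc n ^ 2"
    using cc_bounds(1)[of n] by (simp add: power_divide divide_simps) (simp add: algebra_simps)
  thus ?thesis using cc_pos[of n] by (simp add: power_mono_iff)
qed

lemma cc_upper: "n > 0 \<Longrightarrow> cc n \<le> 1 / sqrt (pi * real n)"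
proof -
  assume "n > 0"
  have "cc n ^ 2 \<le> (1 / sqrt (pi * real n))^2"
    using cc_bounds(2)[of n] \<open>n > 0\<close> by (simp add: power_divide field_simps)
  thus ?thesis using cc_pos[of n] by (simp add: power_mono_iff)
qed

text \<open>A weak bound, but enough to replace the weight 1 / (j + 1) by \<open>cc j\<close> in
  \<open>sum_bb_inverse_le\<close>, where the convolution of \<open>cc\<close> with itself is
  exactly 1.\<close>

lemma cc_ge: "1 / (real n + 1) \<le> 2 * cc n"
proof -
  have "1 / (real n + 1) \<le> 2 / sqrt (pi * (real n + 1/2))"
  proof -
    have "sqrt (pi * (real n + 1/2)) \<le> sqrt ((2 * (real n + 1))^2)"
    proof (intro real_sqrt_le_mono)
      have "pi * (real n + 1/2) \<le> 4 * (real n + 1/2)" using pi_less_4 by (intro mult_right_mono) auto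
      also have "\<dots> \<le> (2 * (real n + 1))^2" by (simp add: power2_eq_square algebra_simps)
      finally show "pi * (real n + 1/2) \<le> (2 * (real n + 1))^2" .
    qed
    moreover have "sqrt (pi * (real n + 1/2)) > 0" by simp
    ultimately show ?thesis by (simp add: divide_simps)
  qed
  also have "\<dots> \<le> 2 * cc n" using cc_lower[of n] by simp
  finally show ?thesis .
qed

lemma bb_cc_le: "real n * bb n \<le> cc n"
proof (cases "n = 0")
  case False
  hence "real n \<le> 2 * real n - 1" by simp
  hence "real n / (2 * real n - 1) \<le> 1" using False by simp
  hence "cc n * (real n / (2 * real n - 1)) \<le> cc n * 1" using cc_pos[of n] by (intro mult_left_mono) auto
  thus ?thesis using False by (simp add: bb_eq_cc mult.commute)
qed (auto simp: cc_pos less_imp_le)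

lemma bb_Suc_le: "n > 0 \<Longrightarrow> bb (Suc n) \<le> bb n"
proof -
  assume "n > 0"
  hence "bb n * ((2 * real n - 1) / (2 * real n + 2)) \<le> bb n * 1"
    using bb_nonneg by (intro mult_left_mono) auto
  thus ?thesis using \<open>n > 0\<close> by (simp add: bb_Suc)
qed

lemma bb_antimono:
  assumes "0 < m" "m \<le> n"
  shows "bb n \<le> bb m"
  using assms(2,1)
proof (induction n rule: dec_induct)
  case (step n) thus ?case using bb_Suc_le[of n] by auto
qed auto

lemma bb_le_inverse: "bb n \<le> 1 / (real n + 1)"
proof (cases "n = 0")
  case False
  hence "n > 0" by simp
  hence "(real n + 1) * bb n \<le> 1"
  proof (induction n rule: nat_induct_non_zero)
    case (Suc n)
    have "(real (Suc n) + 1) * bb (Suc n) = bb n * ((real n + 2) * (2 * real n - 1) / (2 * real n + 2))"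
      using Suc by (simp add: bb_Suc)
    also have "\<dots> \<le> bb n * (real n + 1)"
      using Suc by (intro mult_left_mono bb_nonneg) (simp add: divide_simps, simp add: algebra_simps)
    finally show ?case using Suc by (simp add: mult.commute)
  qed auto
  thus ?thesis by (simp add: field_simps)
qed auto

text \<open>Together with \<open>bb_antimono\<close> this plays the role of regular variation:
  \<open>bb n\<close> decreases, but no faster than n^(-2), so its values at m and n are comparable
  when n \<le> 2 * m.\<close>

lemma bb_sq_mono:
  assumes "0 < m" "m \<le> n"
  shows "bb m * real m ^ 2 \<le> bb n * real n ^ 2"
  using assms(2)
proof (induction n rule: dec_induct)
  case (step n)
  have n: "n > 0" using step assms by auto
  have "bb n * real n ^ 2 \<le> bb n * ((2 * real n - 1) / (2 * real n + 2) * real (Suc n) ^ 2)"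
    using n by (intro mult_left_mono bb_nonneg) (simp add: divide_simps, simp add: algebra_simps power2_eq_square, use mult_left_mono[of 1 "real n" "real n"] in linarith)
  thus ?case using step n by (simp add: bb_Suc)
qed auto

text \<open>The growth of n^2 * \<open>bb n\<close> limits the relative decrease to 1 - (m / n)^2,
  which is linear in n - m.\<close>

lemma bb_diff_le:
  assumes "0 < m" "m \<le> n"
  shows "\<bar>bb m - bb n\<bar> \<le> 4 * bb m * (real (n - m) / (real n + 1))"
proof -
  note * = bb_sq_mono[OF assms]
  have n: "real n > 0" "real m > 0" "real n \<ge> real m" "real n \<ge> 1" using assms by auto
  have "bb m - bb n \<le> bb m - bb m * real m ^ 2 / real n ^ 2"
    using * n by (simp add: field_simps)
  also have "\<dots> = bb m * ((real n - real m) * ((real n + real m) / real n ^ 2))"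
    using n by (simp add: field_simps power2_eq_square)
  also have "\<dots> \<le> bb m * ((real n - real m) * (4 / (real n + 1)))"
  proof (intro mult_left_mono bb_nonneg)
    have "(real n + real m) / real n ^ 2 \<le> 2 / real n" using n by (simp add: divide_simps power2_eq_square)
    also have "\<dots> \<le> 4 / (real n + 1)" using n by (simp add: divide_simps)
    finally show "(real n + real m) / real n ^ 2 \<le> 4 / (real n + 1)" .
  qed (use n in auto)
  finally have "bb m - bb n \<le> 4 * bb m * (real (n - m) / (real n + 1))" using assms by (simp add: of_nat_diff mult_ac)
  moreover have "bb m - bb n \<ge> 0" using bb_antimono assms by simp
  ultimately show ?thesis by simp
qed

lemma bb_sums: "bb sums 1"
proof -
  have part: "(\<Sum>i\<le>n. bb i) = 1 - cc n" for n
  proof (induction n)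
    case (Suc n)
    have "bb (Suc n) = cc n - cc (Suc n)" by (simp add: bb_eq_cc cc_Suc divide_simps) (simp add: algebra_simps)?
    thus ?case using Suc by simp
  qed auto
  have "cc \<longlonglongrightarrow> 0"
  proof (rule tendsto_sandwich[of "\<lambda>_. 0" _ _ "\<lambda>n. 1 / sqrt (pi * real n)"])
    show "\<forall>\<^sub>F n in sequentially. cc n \<le> 1 / sqrt (pi * real n)"
      using eventually_gt_at_top[of 0] by eventually_elim (rule cc_upper)
    show "(\<lambda>n. 1 / sqrt (pi * real n)) \<longlonglongrightarrow> 0" by real_asymp
  qed (auto intro!: always_eventually less_imp_le cc_pos)
  hence "(\<lambda>n. 1 - cc n) \<longlonglongrightarrow> 1 - 0" by (intro tendsto_intros)
  hence "(\<lambda>n. \<Sum>i\<le>n. bb i) \<longlonglongrightarrow> 1" by (simp add: part)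
  thus ?thesis by (simp add: sums_def_le)
qed

lemma bb_summable: "summable bb" using bb_sums sums_summable by blast

lemma sum_bb_le: "finite A \<Longrightarrow> sum bb A \<le> 1"
  using sum_le_suminf[OF bb_summable] bb_nonneg bb_sums by (auto simp: sums_iff)

text \<open>The upper and lower bounds for \<open>cc\<close> differ by a relative O(1/n), which
  makes the error even smaller than stated; 1/n^2 is the order that the local limit theorem
  permits.\<close>

lemma bb_asymp: "\<exists>K. \<forall>n>0. \<bar>bb n - 1 / (2 * sqrt pi * real n * sqrt (real n))\<bar> \<le> K / (real n + 1)^2"
proof (intro exI allI impI)
  fix n :: nat assume n: "n > 0"
  define L where "L = 1 / (sqrt pi * sqrt (real n))"
  have sq: "sqrt (real n) \<ge> 1" using n by simp
  have spi: "sqrt pi \<ge> 1" using pi_gt3 by simp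
  have L: "0 < L" "L \<le> 1 / sqrt (real n)" using n spi sq by (auto simp: L_def divide_simps mult_le_cancel_right1)
  have up: "cc n \<le> L" using cc_upper[OF n] by (simp add: L_def real_sqrt_mult)
  have lo: "cc n \<ge> L * (1 - 1 / (2 * real n))"
  proof -
    have "(1 - 1 / (2 * real n)) \<le> sqrt (real n / (real n + 1/2))"
    proof (rule real_le_rsqrt)
      have "(1 - 1/(2 * real n))^2 \<le> (1 - 1/(2*real n))"
        using n by (auto simp: power2_eq_square divide_simps algebra_simps)
      also have "\<dots> \<le> real n / (real n + 1/2)" using n by (simp add: divide_simps, simp add: algebra_simps)
      finally show "(1 - 1/(2 * real n))^2 \<le> real n / (real n + 1/2)" .
    qed
    hence "L * (1 - 1 / (2 * real n)) \<le> L * sqrt (real n / (real n + 1/2))"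
      using L by (intro mult_left_mono) auto
    also have "\<dots> = 1 / sqrt (pi * (real n + 1/2))" using n by (simp add: L_def real_sqrt_divide real_sqrt_mult)
    also have "\<dots> \<le> cc n" by (rule cc_lower)
    finally show ?thesis .
  qed
  have e: "1 / (2 * sqrt pi * real n * sqrt (real n)) = L / (2 * real n)" by (simp add: L_def)
  have p: "2 * real n - 1 > 0" using n by simp
  have "bb n - L / (2 * real n) \<le> L / (2 * real n - 1) - L / (2 * real n)"
    using up p n by (simp add: bb_eq_cc divide_right_mono)
  also have "\<dots> = L / ((2 * real n - 1) * (2 * real n))" using p n by (simp add: field_simps)
  also have "\<dots> \<le> 1 / ((2 * real n - 1) * (2 * real n))" using L sq p n by (intro divide_right_mono) (auto intro: order.trans)
  also have "\<dots> \<le> 4 / (real n + 1)^2" using p n by (simp add: divide_simps) (simp add: algebra_simps power2_eq_square, use mult_left_mono[of 1 "real n" "real n"] in linarith)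
  finally have 1: "bb n - L / (2 * real n) \<le> 4 / (real n + 1)^2" .
  have "L * (1 - 1 / (2 * real n)) / (2 * real n - 1) = L / (2 * real n)" using p n by (simp add: field_simps)
  moreover have "L * (1 - 1 / (2 * real n)) / (2 * real n - 1) \<le> bb n"
    using lo p n unfolding bb_eq_cc[OF n] by (intro divide_right_mono) auto
  ultimately have 2: "bb n - L / (2 * real n) \<ge> 0" by simp
  show "\<bar>bb n - 1 / (2 * sqrt pi * real n * sqrt (real n))\<bar> \<le> 4 / (real n + 1)^2"
    unfolding e using 1 2 by simp
qed

text \<open>The \<open>O(1/n\<^sup>2)\<close> error is summable and small against \<open>bb n\<close>, which is of order \<open>n powr (-3/2)\<close>; it makes the class closed under products and exponentials.\<close>
definition srate :: "real \<Rightarrow> real \<Rightarrow> real fps \<Rightarrow> bool" where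
  "srate \<phi> K f \<longleftrightarrow> (\<forall>n. \<bar>fps_nth f n - \<phi> * bb n\<bar> \<le> K / (real n + 1)^2)"

lemma summable_inverse_sq: "summable (\<lambda>n. 1 / (real n + 1)^2)"
  using inverse_squares_sums sums_summable by (simp add: add.commute)

lemma srate_K_nonneg: "srate \<phi> K f \<Longrightarrow> K \<ge> 0"
  unfolding srate_def using abs_ge_zero[of "fps_nth f 0 - \<phi> * bb 0"] by (auto dest!: spec[of _ 0])

lemma srate_abs_le:
  assumes "srate \<phi> K f"
  shows "\<bar>fps_nth f n\<bar> \<le> \<bar>\<phi>\<bar> * bb n + K / (real n + 1)^2"
proof -
  have "\<bar>fps_nth f n\<bar> \<le> \<bar>fps_nth f n - \<phi> * bb n\<bar> + \<bar>\<phi> * bb n\<bar>" by linarith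
  moreover have "\<bar>fps_nth f n - \<phi> * bb n\<bar> \<le> K / (real n + 1)^2" using assms by (simp add: srate_def)
  ultimately show ?thesis using bb_nonneg[of n] by (simp add: abs_mult)
qed

lemma srate_majorant_summable: "summable (\<lambda>n. a * bb n + K / (real n + 1)^2)"
  using summable_mult[OF bb_summable, of a] summable_mult[OF summable_inverse_sq, of K]
  by (intro summable_add) auto

lemma srate_abs_summable:
  assumes "srate \<phi> K f"
  shows "summable (\<lambda>n. \<bar>fps_nth f n\<bar>)"
  by (rule summable_comparison_test'[OF srate_majorant_summable[of "\<bar>\<phi>\<bar>" K], of 0])
     (use srate_abs_le[OF assms] in auto)

lemma srate_summable: "srate \<phi> K f \<Longrightarrow> summable (fps_nth f)"
  using srate_abs_summable summable_rabs_cancel by blast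

lemma srate_add: "srate \<phi> K f \<Longrightarrow> srate \<gamma> L g \<Longrightarrow> srate (\<phi> + \<gamma>) (K + L) (f + g)"
  unfolding srate_def
proof safe
  fix n assume *: "\<forall>n. \<bar>fps_nth f n - \<phi> * bb n\<bar> \<le> K / (real n + 1)\<^sup>2" "\<forall>n. \<bar>fps_nth g n - \<gamma> * bb n\<bar> \<le> L / (real n + 1)\<^sup>2"
  show "\<bar>fps_nth (f + g) n - (\<phi> + \<gamma>) * bb n\<bar> \<le> (K + L) / (real n + 1)\<^sup>2"
    using spec[OF *(1), of n] spec[OF *(2), of n] by (simp add: algebra_simps add_divide_distrib)
qed

lemma srate_cmult: "srate \<phi> K f \<Longrightarrow> srate (c * \<phi>) (\<bar>c\<bar> * K) (fps_const c * f)"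
  unfolding srate_def
proof safe
  fix n assume *: "\<forall>n. \<bar>fps_nth f n - \<phi> * bb n\<bar> \<le> K / (real n + 1)\<^sup>2"
  have "\<bar>c\<bar> * \<bar>fps_nth f n - \<phi> * bb n\<bar> \<le> \<bar>c\<bar> * (K / (real n + 1)\<^sup>2)"
    using * by (intro mult_left_mono) auto
  thus "\<bar>fps_nth (fps_const c * f) n - (c * \<phi>) * bb n\<bar> \<le> \<bar>c\<bar> * K / (real n + 1)\<^sup>2"
    by (simp add: abs_mult[symmetric] algebra_simps)
qed

lemma srate_mono: "srate \<phi> K f \<Longrightarrow> K \<le> L \<Longrightarrow> srate \<phi> L f"
  unfolding srate_def by (meson divide_right_mono order.trans zero_le_power2)

lemma tail_inverse_sq_le:
  fixes t :: "nat \<Rightarrow> real"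
  assumes "\<And>n. \<bar>t n\<bar> \<le> K / (real n + 1)^2"
  shows "\<bar>suminf t - (\<Sum>j\<le>n. t j)\<bar> \<le> K / (real n + 1)"
proof -
  have K: "K \<ge> 0" using assms[of 0] abs_ge_zero[of "t 0"] by auto
  have sm: "summable t"
    by (rule summable_comparison_test'[OF summable_mult[OF summable_inverse_sq, of K], of 0]) (use assms in auto)
  \<comment> \<open>The telescoping majorant K / ((i + n + 1) * (i + n + 2)) dominates the tail and
    sums to K / (n + 1).\<close>
  have tel: "(\<lambda>i. K / (real (i + n) + 1) - K / (real (Suc i + n) + 1)) sums (K / (real (0 + n) + 1) - 0)"
    by (rule telescope_sums') real_asymp
  have "suminf t - (\<Sum>j\<le>n. t j) = (\<Sum>i. t (i + Suc n))"
    using suminf_minus_initial_segment[OF sm, of "Suc n"] by (simp add: lessThan_Suc_atMost)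
  also have "\<bar>\<dots>\<bar> \<le> (\<Sum>i. K / (real (i + n) + 1) - K / (real (Suc i + n) + 1))"
  proof -
    have le: "norm (t (i + Suc n)) \<le> K / (real (i + n) + 1) - K / (real (Suc i + n) + 1)" for i
    proof -
      have "norm (t (i + Suc n)) \<le> K / (real (i + Suc n) + 1)^2" using assms[of "i + Suc n"] by simp
      also have "\<dots> \<le> K / ((real (i + n) + 1) * (real (Suc i + n) + 1))"
        using K by (intro divide_left_mono) (auto simp: power2_eq_square intro!: mult_right_mono mult_pos_pos)
      also have "\<dots> = K / (real (i + n) + 1) - K / (real (Suc i + n) + 1)" by (simp add: field_simps)
      finally show ?thesis .
    qed
    show ?thesis using norm_suminf_le[OF le sums_summable[OF tel]] by simp
  qed
  also have "\<dots> = K / (real n + 1)" using sums_unique[OF tel] by simp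
  finally show ?thesis .
qed

text \<open>Split n + 1 = (j + 1) + (n - j). The first part leaves a partial sum of
  \<open>bb\<close>. In the second, (n - j) * \<open>bb (n - j)\<close> \<le>
  \<open>cc (n - j)\<close> and 1 / (j + 1) \<le> 2 * \<open>cc j\<close>, and the resulting
  convolution of \<open>cc\<close> is 1.\<close>

lemma sum_bb_inverse_le: "(\<Sum>j=0..n. bb (n - j) / (real j + 1)) \<le> 3 / (real n + 1)"
proof -
  have "(\<Sum>j=0..n. bb (n - j) / (real j + 1)) \<le> (\<Sum>j=0..n. (bb (n - j) + 2 * (cc j * cc (n - j))) / (real n + 1))"
  proof (intro sum_mono)
    fix j assume j: "j \<in> {0..n}"
    have "bb (n - j) / (real j + 1) = (bb (n - j) + real (n - j) * bb (n - j) * (1 / (real j + 1))) / (real n + 1)"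
      using j by (simp add: divide_simps of_nat_diff) (simp add: algebra_simps)
    also have "\<dots> \<le> (bb (n - j) + cc (n - j) * (2 * cc j)) / (real n + 1)"
      using bb_cc_le[of "n - j"] cc_ge[of j] cc_pos[of "n-j"]
      by (intro divide_right_mono add_left_mono mult_mono) auto
    finally show "bb (n - j) / (real j + 1) \<le> (bb (n - j) + 2 * (cc j * cc (n - j))) / (real n + 1)" by (simp add: mult_ac)
  qed
  also have "\<dots> = ((\<Sum>j=0..n. bb (n - j)) + 2 * (\<Sum>j=0..n. cc j * cc (n - j))) / (real n + 1)"
    by (simp add: sum_divide_distrib sum_distrib_left sum.distrib add_divide_distrib)
  also have "(\<Sum>j=0..n. bb (n - j)) = (\<Sum>j=0..n. bb j)"
    using sum.atLeastAtMost_rev[of bb 0 n] by simp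
  also have "((\<Sum>j=0..n. bb j) + 2 * (\<Sum>j=0..n. cc j * cc (n - j))) / (real n + 1) \<le> (1 + 2 * 1) / (real n + 1)"
    unfolding cc_conv by (intro divide_right_mono add_right_mono sum_bb_le) auto
  finally show ?thesis by simp
qed

text \<open>Replacing \<open>bb (n - j)\<close> by \<open>bb n\<close> costs a difference controlled
  by \<open>bb_diff_le\<close>; the extra factor j there lowers the weight 1/j^2 of t to 1/j, which
  \<open>sum_bb_inverse_le\<close> handles. The constant is 14 = 4 * 3 + 1 + 1.\<close>

lemma conv_bb_rate:
  assumes "\<And>n. \<bar>fps_nth t n\<bar> \<le> K / (real n + 1)^2"
  shows "\<bar>fps_nth (t * Abs_fps bb) n - suminf (fps_nth t) * bb n\<bar> \<le> 14 * K / (real n + 1)^2"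
proof -
  have K: "K \<ge> 0" using assms[of 0] abs_ge_zero[of "fps_nth t 0"] by auto
  have "fps_nth (t * Abs_fps bb) n - suminf (fps_nth t) * bb n =
      (\<Sum>j=0..n. fps_nth t j * (bb (n - j) - bb n)) - (suminf (fps_nth t) - (\<Sum>j\<le>n. fps_nth t j)) * bb n"
    by (simp add: fps_mult_nth right_diff_distrib left_diff_distrib sum_subtractf sum_distrib_right atMost_atLeast0)
  also have "\<bar>\<dots>\<bar> \<le> \<bar>\<Sum>j=0..n. fps_nth t j * (bb (n - j) - bb n)\<bar> + \<bar>suminf (fps_nth t) - (\<Sum>j\<le>n. fps_nth t j)\<bar> * bb n"
    by (rule order.trans[OF abs_triangle_ineq4]) (simp add: abs_mult bb_nonneg)
  also have "\<bar>suminf (fps_nth t) - (\<Sum>j\<le>n. fps_nth t j)\<bar> * bb n \<le> K / (real n + 1) * (1 / (real n + 1))"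
    using tail_inverse_sq_le[OF assms] bb_le_inverse K bb_nonneg by (intro mult_mono) auto
  also have "\<bar>\<Sum>j=0..n. fps_nth t j * (bb (n - j) - bb n)\<bar> \<le> (\<Sum>j=0..n. \<bar>fps_nth t j * (bb (n - j) - bb n)\<bar>)"
    by (rule sum_abs)
  \<comment> \<open>The index j = n is split off: \<open>bb 0\<close> is 0, so monotonicity of
    \<open>bb\<close> starts only at 1.\<close>
  also have "\<dots> \<le> (\<Sum>j=0..n. 4 * K / (real n + 1) * (bb (n - j) / (real j + 1)) + (if j = n then K / (real n + 1)^2 else 0))"
  proof (intro sum_mono)
    fix j assume j: "j \<in> {0..n}"
    show "\<bar>fps_nth t j * (bb (n - j) - bb n)\<bar> \<le> 4 * K / (real n + 1) * (bb (n - j) / (real j + 1)) + (if j = n then K / (real n + 1)^2 else 0)"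
    proof (cases "j = n")
      case True
      have "bb n \<le> 1" using sum_bb_le[of "{n}"] by simp
      hence "\<bar>fps_nth t n\<bar> * bb n \<le> K / (real n + 1)^2 * 1"
        using assms[of n] bb_nonneg K by (intro mult_mono) auto
      thus ?thesis using True bb_nonneg[of n] by (simp add: abs_mult)
    next
      case False
      hence j': "j < n" using j by auto
      have "\<bar>fps_nth t j\<bar> * \<bar>bb (n - j) - bb n\<bar> \<le> K / (real j + 1)^2 * (4 * bb (n - j) * (real j / (real n + 1)))"
        using bb_diff_le[of "n - j" n] j' assms[of j] K by (intro mult_mono) auto
      also have "\<dots> = (4 * K / (real n + 1) * bb (n - j)) * (real j / (real j + 1)^2)" by (simp add: mult_ac)
      also have "\<dots> \<le> (4 * K / (real n + 1) * bb (n - j)) * (1 / (real j + 1))"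
        using K bb_nonneg by (intro mult_left_mono mult_nonneg_nonneg divide_nonneg_nonneg)
          (auto simp: divide_simps power2_eq_square)
      finally show ?thesis using False by (simp add: abs_mult)
    qed
  qed
  also have "\<dots> = 4 * K / (real n + 1) * (\<Sum>j=0..n. bb (n - j) / (real j + 1)) + K / (real n + 1)^2"
    by (simp add: sum.distrib sum_distrib_left)
  also have "4 * K / (real n + 1) * (\<Sum>j=0..n. bb (n - j) / (real j + 1)) \<le> 4 * K / (real n + 1) * (3 / (real n + 1))"
    using K by (intro mult_left_mono sum_bb_inverse_le) auto
  finally show ?thesis by (simp add: power2_eq_square add_divide_distrib[symmetric])
qed

definition Wsq :: real where "Wsq = (\<Sum>n. 1 / (real n + 1)^2)"

lemma Wsq_ge_1: "Wsq \<ge> 1"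
  using sum_le_suminf[OF summable_inverse_sq, of "{0}"] by (simp add: Wsq_def)

text \<open>Partial fractions 1 / (a * b) = (1/a + 1/b) / (a + b) with a + b = n + 2, then squared,
  pull out the factor 1/n^2 and leave two convergent sums.\<close>

lemma conv_inverse_sq:
  assumes "\<And>n. \<bar>fps_nth r n\<bar> \<le> K / (real n + 1)^2" and "\<And>n. \<bar>fps_nth t n\<bar> \<le> L / (real n + 1)^2"
  shows "\<bar>fps_nth (r * t) n\<bar> \<le> 4 * Wsq * K * L / (real n + 1)^2"
proof -
  have K: "K \<ge> 0" using assms(1)[of 0] abs_ge_zero[of "fps_nth r 0"] by auto
  have L: "L \<ge> 0" using assms(2)[of 0] abs_ge_zero[of "fps_nth t 0"] by auto
  have "\<bar>fps_nth (r * t) n\<bar> \<le> (\<Sum>j=0..n. \<bar>fps_nth r j * fps_nth t (n - j)\<bar>)"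
    unfolding fps_mult_nth by (rule sum_abs)
  also have "\<dots> \<le> (\<Sum>j=0..n. 2 * K * L / (real n + 1)^2 * (1 / (real j + 1)^2 + 1 / (real (n - j) + 1)^2))"
  proof (intro sum_mono)
    fix j assume j: "j \<in> {0..n}"
    define a b where "a = real j + 1" and "b = real (n - j) + 1"
    have ab: "a > 0" "b > 0" "a + b = real n + 2" using j by (auto simp: a_def b_def)
    have "1/a + 1/b = (a + b) / (a * b)" using ab by (simp add: field_simps)
    hence "1 / (a^2 * b^2) = (1/a + 1/b)^2 / (a + b)^2" using ab(1,2) by (simp add: power_divide power_mult_distrib)
    also have "\<dots> \<le> (2 * (1/a^2 + 1/b^2)) / (a + b)^2"
      using sum_squares_ge_zero[of "1/a - 1/b" 0] ab
      by (intro divide_right_mono) (auto simp: power2_eq_square algebra_simps)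
    also have "\<dots> \<le> (2 * (1/a^2 + 1/b^2)) / (real n + 1)^2"
      using ab by (intro divide_left_mono power_mono) auto
    finally have *: "1 / (a^2 * b^2) \<le> 2 / (real n + 1)^2 * (1/a^2 + 1/b^2)" by simp
    have "\<bar>fps_nth r j * fps_nth t (n - j)\<bar> \<le> (K / a^2) * (L / b^2)"
      unfolding abs_mult a_def b_def using assms K L by (intro mult_mono) auto
    also have "\<dots> = K * L * (1 / (a^2 * b^2))" by simp
    also have "\<dots> \<le> K * L * (2 / (real n + 1)^2 * (1/a^2 + 1/b^2))" using * K L by (intro mult_left_mono) auto
    finally show "\<bar>fps_nth r j * fps_nth t (n - j)\<bar> \<le> 2 * K * L / (real n + 1)^2 * (1 / (real j + 1)^2 + 1 / (real (n - j) + 1)^2)"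
      by (simp add: a_def b_def mult_ac)
  qed
  also have "\<dots> = 2 * K * L / (real n + 1)^2 * ((\<Sum>j=0..n. 1 / (real j + 1)^2) + (\<Sum>j=0..n. 1 / (real (n - j) + 1)^2))"
    by (subst sum_distrib_left[symmetric]) (simp only: sum.distrib)
  also have "(\<Sum>j=0..n. 1 / (real (n - j) + 1)^2) = (\<Sum>j=0..n. 1 / (real j + 1)^2)"
    using sum.atLeastAtMost_rev[of "\<lambda>j. 1 / (real j + 1)^2" 0 n] by simp
  also have "2 * K * L / (real n + 1)^2 * ((\<Sum>j=0..n. 1 / (real j + 1)^2) + (\<Sum>j=0..n. 1 / (real j + 1)^2))
     \<le> 2 * K * L / (real n + 1)^2 * (Wsq + Wsq)"
    unfolding Wsq_def using K L
    by (intro mult_left_mono add_mono sum_le_suminf summable_inverse_sq) auto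
  finally show ?thesis by (simp add: mult_ac)
qed

lemma srate_suminf_diff:
  assumes "srate \<phi> K f"
  shows "suminf (fps_nth (f - fps_const \<phi> * Abs_fps bb)) = suminf (fps_nth f) - \<phi>"
  using suminf_diff[OF srate_summable[OF assms] summable_mult[OF bb_summable, of \<phi>]]
    suminf_mult[OF bb_summable, of \<phi>] bb_sums
  by (simp add: sums_iff fps_sub_nth[abs_def])

text \<open>Write both factors as a multiple of B plus an O(1/n^2) remainder. Since B * B has
  leading coefficient 2 and B(1) = 1, the contributions add up to a product rule. The error constant
  is kept as a product of one quantity per factor so that powers can be iterated.\<close>

lemma srate_mult:
  assumes "srate \<phi> K f" "srate \<gamma> L g"
  shows "srate (\<phi> * suminf (fps_nth g) + \<gamma> * suminf (fps_nth f)) (16 * Wsq * (\<bar>\<phi>\<bar> + K) * (\<bar>\<gamma>\<bar> + L)) (f * g)"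
  unfolding srate_def
proof
  fix n
  define B where "B = Abs_fps bb"
  define r where "r = f - fps_const \<phi> * B"
  define t where "t = g - fps_const \<gamma> * B"
  have K: "K \<ge> 0" "L \<ge> 0" using assms srate_K_nonneg by auto
  have r: "\<bar>fps_nth r n\<bar> \<le> K / (real n + 1)^2" for n using assms(1) by (simp add: r_def B_def srate_def)
  have t: "\<bar>fps_nth t n\<bar> \<le> L / (real n + 1)^2" for n using assms(2) by (simp add: t_def B_def srate_def)
  have fg: "f = fps_const \<phi> * B + r" "g = fps_const \<gamma> * B + t" by (auto simp: r_def t_def)
  have "f * g = fps_const (\<phi> * \<gamma>) * (B * B) + fps_const \<phi> * (t * B) + fps_const \<gamma> * (r * B) + r * t"
    unfolding fg by (simp add: algebra_simps fps_const_mult[symmetric] del: fps_const_mult)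
  hence n: "fps_nth (f * g) n = \<phi> * \<gamma> * fps_nth (B * B) n + \<phi> * fps_nth (t * B) n + \<gamma> * fps_nth (r * B) n + fps_nth (r * t) n"
    by simp
  define w where "w = 1 / (real n + 1)^2"
  have w0: "w \<ge> 0" by (simp add: w_def)
  have "\<bar>fps_nth (B * B) n - 2 * bb n\<bar> \<le> 4 * w"
    unfolding B_def bb_conv by (auto simp: w_def power2_eq_square)
  hence 1: "\<bar>\<phi> * \<gamma>\<bar> * \<bar>fps_nth (B * B) n - 2 * bb n\<bar> \<le> \<bar>\<phi> * \<gamma>\<bar> * (4 * w)" by (intro mult_left_mono) auto
  have "\<bar>fps_nth (t * B) n - (suminf (fps_nth g) - \<gamma>) * bb n\<bar> \<le> 14 * L * w"
    using conv_bb_rate[OF t, of n] srate_suminf_diff[OF assms(2)] by (simp add: B_def t_def w_def)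
  hence 2: "\<bar>\<phi>\<bar> * \<bar>fps_nth (t * B) n - (suminf (fps_nth g) - \<gamma>) * bb n\<bar> \<le> \<bar>\<phi>\<bar> * (14 * L * w)"
    by (intro mult_left_mono) auto
  have "\<bar>fps_nth (r * B) n - (suminf (fps_nth f) - \<phi>) * bb n\<bar> \<le> 14 * K * w"
    using conv_bb_rate[OF r, of n] srate_suminf_diff[OF assms(1)] by (simp add: B_def r_def w_def)
  hence 3: "\<bar>\<gamma>\<bar> * \<bar>fps_nth (r * B) n - (suminf (fps_nth f) - \<phi>) * bb n\<bar> \<le> \<bar>\<gamma>\<bar> * (14 * K * w)"
    by (intro mult_left_mono) auto
  have 4: "\<bar>fps_nth (r * t) n\<bar> \<le> 4 * Wsq * K * L * w"
    using conv_inverse_sq[OF r t, of n] by (simp add: w_def)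
  have "fps_nth (f * g) n - (\<phi> * suminf (fps_nth g) + \<gamma> * suminf (fps_nth f)) * bb n
     = \<phi> * \<gamma> * (fps_nth (B * B) n - 2 * bb n) + \<phi> * (fps_nth (t * B) n - (suminf (fps_nth g) - \<gamma>) * bb n)
       + \<gamma> * (fps_nth (r * B) n - (suminf (fps_nth f) - \<phi>) * bb n) + fps_nth (r * t) n"
    unfolding n by (simp add: algebra_simps)
  hence "\<bar>fps_nth (f * g) n - (\<phi> * suminf (fps_nth g) + \<gamma> * suminf (fps_nth f)) * bb n\<bar>
     \<le> \<bar>\<phi> * \<gamma>\<bar> * \<bar>fps_nth (B * B) n - 2 * bb n\<bar> + \<bar>\<phi>\<bar> * \<bar>fps_nth (t * B) n - (suminf (fps_nth g) - \<gamma>) * bb n\<bar>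
       + \<bar>\<gamma>\<bar> * \<bar>fps_nth (r * B) n - (suminf (fps_nth f) - \<phi>) * bb n\<bar> + \<bar>fps_nth (r * t) n\<bar>"
    unfolding abs_mult[symmetric] by linarith
  also have "\<dots> \<le> \<bar>\<phi> * \<gamma>\<bar> * (4 * w) + \<bar>\<phi>\<bar> * (14 * L * w) + \<bar>\<gamma>\<bar> * (14 * K * w) + 4 * Wsq * K * L * w"
    using 1 2 3 4 by linarith
  also have "\<dots> \<le> 16 * Wsq * (\<bar>\<phi>\<bar> * \<bar>\<gamma>\<bar> * w) + 16 * Wsq * (\<bar>\<phi>\<bar> * L * w) + 16 * Wsq * (\<bar>\<gamma>\<bar> * K * w) + 16 * Wsq * (K * L * w)"
  proof (intro add_mono)
    have *: "a * x \<le> 16 * Wsq * x" if "a \<le> 16" "x \<ge> 0" for a x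
    proof -
      have "a \<le> 16 * Wsq" using that Wsq_ge_1 by simp
      thus ?thesis using that by (intro mult_right_mono)
    qed
    show "\<bar>\<phi> * \<gamma>\<bar> * (4 * w) \<le> 16 * Wsq * (\<bar>\<phi>\<bar> * \<bar>\<gamma>\<bar> * w)"
      using *[of 4 "\<bar>\<phi>\<bar> * \<bar>\<gamma>\<bar> * w"] w0 by (simp add: abs_mult mult_ac)
    show "\<bar>\<phi>\<bar> * (14 * L * w) \<le> 16 * Wsq * (\<bar>\<phi>\<bar> * L * w)"
      using *[of 14 "\<bar>\<phi>\<bar> * L * w"] w0 K by (simp add: abs_mult mult_ac)
    show "\<bar>\<gamma>\<bar> * (14 * K * w) \<le> 16 * Wsq * (\<bar>\<gamma>\<bar> * K * w)"
      using *[of 14 "\<bar>\<gamma>\<bar> * K * w"] w0 K by (simp add: abs_mult mult_ac)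
    show "4 * Wsq * K * L * w \<le> 16 * Wsq * (K * L * w)"
      using K w0 Wsq_ge_1 by (simp add: mult_ac)
  qed
  also have "\<dots> = 16 * Wsq * (\<bar>\<phi>\<bar> + K) * (\<bar>\<gamma>\<bar> + L) / (real n + 1)^2"
    by (simp add: w_def algebra_simps add_divide_distrib)
  finally show "\<bar>fps_nth (f * g) n - (\<phi> * suminf (fps_nth g) + \<gamma> * suminf (fps_nth f)) * bb n\<bar>
    \<le> 16 * Wsq * (\<bar>\<phi>\<bar> + K) * (\<bar>\<gamma>\<bar> + L) / (real n + 1)^2" .
qed

lemma fps_mult_sums:
  fixes f g :: "'a :: {real_normed_field, banach} fps"
  assumes "summable (\<lambda>n. norm (fps_nth f n))" "summable (\<lambda>n. norm (fps_nth g n))"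
  shows "fps_nth (f * g) sums (suminf (fps_nth f) * suminf (fps_nth g))"
  using Cauchy_product_sums[OF assms] by (simp add: fps_mult_nth[abs_def] atMost_atLeast0)

lemma suminf_swap_of_product_bound:
  fixes f :: "nat \<Rightarrow> nat \<Rightarrow> real"
  assumes bnd: "\<And>i n. \<bar>f i n\<bar> \<le> x i * y n" and x: "summable x" and y: "summable y"
    and xnn: "\<And>i. x i \<ge> 0" and ynn: "\<And>n. y n \<ge> 0"
  shows "(\<lambda>n. \<Sum>i. f i n) sums (\<Sum>i. \<Sum>n. f i n)"
proof -
  have sn: "summable (f i)" for i
    by (rule summable_comparison_test'[OF summable_mult[OF y, of "x i"], of 0]) (use bnd in auto)
  have si: "summable (\<lambda>i. f i n)" for n
    by (rule summable_comparison_test'[OF summable_mult2[OF x, of "y n"], of 0]) (use bnd in auto)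
  have "((\<lambda>N. \<Sum>i. \<Sum>n<N. f i n) \<longlongrightarrow> (\<Sum>i. \<Sum>n. f i n)) sequentially"
  proof (rule conjunct2[OF conjunct2[OF tannerys_theorem]])
    show "(\<lambda>N. \<Sum>n<N. f i n) \<longlonglongrightarrow> (\<Sum>n. f i n)" for i
      using summable_LIMSEQ[OF sn] .
    show "\<forall>\<^sub>F (i, N) in at_top \<times>\<^sub>F sequentially. norm (\<Sum>n<N. f i n) \<le> x i * suminf y"
    proof (intro always_eventually, clarify)
      fix i N
      have "norm (\<Sum>n<N. f i n) \<le> (\<Sum>n<N. x i * y n)" by (rule sum_norm_le) (use bnd in auto)
      also have "\<dots> = x i * (\<Sum>n<N. y n)" by (simp add: sum_distrib_left)
      also have "\<dots> \<le> x i * suminf y" by (intro mult_left_mono sum_le_suminf y xnn) (use ynn in auto)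
      finally show "norm (\<Sum>n<N. f i n) \<le> x i * suminf y" .
    qed
    show "summable (\<lambda>i. x i * suminf y)" by (rule summable_mult2[OF x])
  qed auto
  thus ?thesis unfolding sums_def by (simp add: suminf_sum[OF si])
qed

lemma srate_one: "srate 0 1 1"
  unfolding srate_def
proof
  fix n show "\<bar>fps_nth 1 n - 0 * bb n\<bar> \<le> 1 / (real n + 1)\<^sup>2" by (cases n) auto
qed

text \<open>L is chosen so that one more factor A costs at most a factor L, both in the error
  constant (first summand, with 32 = 2 * 16) and in the leading coefficient (next two summands).
  Geometric growth in i is harmless after division by i! in the exponential series.\<close>

lemma srate_power:
  assumes "srate \<alpha> K A"
  defines "s \<equiv> suminf (fps_nth A)"
  defines "L \<equiv> 32 * Wsq * (\<bar>\<alpha>\<bar> + K) + \<bar>s\<bar> + \<bar>\<alpha>\<bar> + 1"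
  shows "srate (real i * \<alpha> * s ^ (i - 1)) (L ^ i) (A ^ i) \<and> suminf (fps_nth (A ^ i)) = s ^ i
     \<and> \<bar>real i * \<alpha> * s ^ (i - 1)\<bar> \<le> L ^ i"
proof (induction i)
  case 0
  have "(\<lambda>n. if n = 0 then 1 else 0 :: real) sums 1" using sums_If_finite[of "\<lambda>n. n = 0" "\<lambda>_. 1 :: real"] by simp
  thus ?case using srate_one by (simp add: sums_iff)
next
  case (Suc i)
  have K: "K \<ge> 0" using assms srate_K_nonneg by auto
  have L: "L \<ge> 32 * Wsq * (\<bar>\<alpha>\<bar> + K)" "L \<ge> \<bar>s\<bar> + \<bar>\<alpha>\<bar>" "L \<ge> 0" "L \<ge> 1"
    using K Wsq_ge_1 by (auto simp: L_def intro!: add_nonneg_nonneg mult_nonneg_nonneg)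
  let ?\<phi> = "real i * \<alpha> * s ^ (i - 1)"
  have IH: "srate ?\<phi> (L ^ i) (A ^ i)" "suminf (fps_nth (A ^ i)) = s ^ i" "\<bar>?\<phi>\<bar> \<le> L ^ i" using Suc by auto
  have e: "real (Suc i) * \<alpha> * s ^ (Suc i - 1) = ?\<phi> * s + \<alpha> * s ^ i"
    by (cases i) (auto simp: algebra_simps)
  have "srate (?\<phi> * s + \<alpha> * s ^ i) (16 * Wsq * (\<bar>?\<phi>\<bar> + L ^ i) * (\<bar>\<alpha>\<bar> + K)) (A ^ i * A)"
    using srate_mult[OF IH(1) assms(1)] IH(2) by (simp add: s_def)
  moreover have "16 * Wsq * (\<bar>?\<phi>\<bar> + L ^ i) * (\<bar>\<alpha>\<bar> + K) \<le> L ^ Suc i"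
  proof -
    have "16 * Wsq * (\<bar>?\<phi>\<bar> + L ^ i) * (\<bar>\<alpha>\<bar> + K) \<le> 16 * Wsq * (L ^ i + L ^ i) * (\<bar>\<alpha>\<bar> + K)"
      using IH(3) K Wsq_ge_1 by (intro mult_right_mono mult_left_mono) auto
    also have "\<dots> = L ^ i * (32 * Wsq * (\<bar>\<alpha>\<bar> + K))" by (simp add: algebra_simps)
    also have "\<dots> \<le> L ^ i * L" using L by (intro mult_left_mono) auto
    finally show ?thesis by (simp add: mult.commute)
  qed
  ultimately have "srate (?\<phi> * s + \<alpha> * s ^ i) (L ^ Suc i) (A ^ Suc i)"
    using srate_mono by (simp add: mult.commute)
  moreover have "suminf (fps_nth (A ^ Suc i)) = s ^ Suc i"
    using fps_mult_sums[of A "A ^ i"] srate_abs_summable[OF assms(1)] srate_abs_summable[OF IH(1)] IH(2)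
    by (simp add: sums_iff s_def)
  moreover have "\<bar>?\<phi> * s + \<alpha> * s ^ i\<bar> \<le> L ^ Suc i"
  proof -
    have "\<bar>s\<bar> ^ i \<le> L ^ i" using L by (intro power_mono) auto
    have "\<bar>?\<phi> * s + \<alpha> * s ^ i\<bar> \<le> \<bar>?\<phi>\<bar> * \<bar>s\<bar> + \<bar>\<alpha>\<bar> * \<bar>s\<bar> ^ i"
      by (metis abs_mult abs_triangle_ineq power_abs)
    also have "\<dots> \<le> L ^ i * \<bar>s\<bar> + \<bar>\<alpha>\<bar> * L ^ i"
      using IH(3) \<open>\<bar>s\<bar> ^ i \<le> L ^ i\<close> by (intro add_mono mult_left_mono mult_right_mono) auto
    also have "\<dots> = L ^ i * (\<bar>s\<bar> + \<bar>\<alpha>\<bar>)" by (simp add: algebra_simps)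
    also have "\<dots> \<le> L ^ i * L" using L by (intro mult_left_mono) auto
    finally show ?thesis by (simp add: mult.commute)
  qed
  ultimately show ?case unfolding e by blast
qed

lemma fps_linear_ode_unique:
  fixes f g a :: "'a :: field_char_0 fps"
  assumes "fps_deriv f = a * f" "fps_deriv g = a * g" "fps_nth f 0 = fps_nth g 0"
  shows "f = g"
proof (rule fps_ext)
  fix n show "fps_nth f n = fps_nth g n"
  proof (induction n rule: less_induct)
    case (less n)
    show ?case
    proof (cases n)
      case (Suc m)
      have "of_nat n * fps_nth f n = fps_nth (a * f) m" "of_nat n * fps_nth g n = fps_nth (a * g) m"
        using assms(1,2)[symmetric] Suc by simp_all
      moreover have "fps_nth (a * f) m = fps_nth (a * g) m"
        unfolding fps_mult_nth using less Suc by (intro sum.cong) auto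
      ultimately have "of_nat n * fps_nth f n = of_nat n * fps_nth g n" by simp
      thus ?thesis using Suc by (simp del: of_nat_Suc)
    qed (use assms in auto)
  qed
qed

text \<open>The hypothesis M' = A' * M is the form in which Spitzer's identity is available; it
  forces M = exp A. Summing the leading coefficients i * \<alpha> * s^(i-1) / i! gives \<alpha> *
  exp s = \<alpha> * M(1).\<close>

lemma srate_exp:
  assumes A: "srate \<alpha> K A" and A0: "fps_nth A 0 = 0"
    and M0: "fps_nth M 0 = 1" and ode: "fps_deriv M = fps_deriv A * M"
  shows "\<exists>K'. srate (\<alpha> * suminf (fps_nth M)) K' M"
proof -
  define s where "s = suminf (fps_nth A)"
  define L where "L = 32 * Wsq * (\<bar>\<alpha>\<bar> + K) + \<bar>s\<bar> + \<bar>\<alpha>\<bar> + 1"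
  define \<phi> where "\<phi> = (\<lambda>i::nat. real i * \<alpha> * s ^ (i - 1))"
  have K: "K \<ge> 0" using assms srate_K_nonneg by auto
  have L: "L \<ge> 0"
    using K Wsq_ge_1 by (auto simp: L_def intro!: add_nonneg_nonneg mult_nonneg_nonneg)
  have pw: "srate (\<phi> i) (L ^ i) (A ^ i)" "suminf (fps_nth (A ^ i)) = s ^ i" "\<bar>\<phi> i\<bar> \<le> L ^ i" for i
    using srate_power[OF A, of i] by (auto simp: \<phi>_def L_def s_def)
  have ME: "M = fps_exp 1 oo A"
    by (rule fps_linear_ode_unique[OF ode]) (use A0 M0 in \<open>auto simp: fps_compose_deriv mult.commute\<close>)
  have Msum: "(\<lambda>i. fps_nth (A ^ i) n / fact i) sums fps_nth M n" for n
  proof -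
    have "fps_nth M n = (\<Sum>i\<in>{0..n}. fps_nth (A ^ i) n / fact i)"
      unfolding ME fps_compose_nth by (intro sum.cong) auto
    moreover have "fps_nth (A ^ i) n = 0" if "i \<notin> {0..n}" for i
      using startsby_zero_power_prefix[OF A0, of i] that by auto
    ultimately show ?thesis using sums_finite[of "{0..n}" "\<lambda>i. fps_nth (A ^ i) n / fact i"] by simp
  qed
  have expL: "(\<lambda>i. x ^ i / fact i) sums exp x" for x :: real
    using exp_converges[of x] by (simp add: divide_inverse mult.commute scaleR_conv_of_real)
  have \<phi>sum: "(\<lambda>i. \<phi> i / fact i) sums (\<alpha> * exp s)"
  proof -
    have "(\<lambda>i. \<phi> (Suc i) / fact (Suc i)) = (\<lambda>i. \<alpha> * (s ^ i / fact i))"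
      by (intro ext) (simp add: \<phi>_def fact_Suc del: of_nat_Suc)
    hence "(\<lambda>i. \<phi> (Suc i) / fact (Suc i)) sums (\<alpha> * exp s)"
      using sums_mult[OF expL[of s], of \<alpha>] by simp
    thus ?thesis using sums_Suc_iff[of "\<lambda>i. \<phi> i / fact i" "\<alpha> * exp s"] by (simp add: \<phi>_def)
  qed
  have rate: "srate (\<alpha> * exp s) (exp L) M"
    unfolding srate_def
  proof
    fix n
    have "(\<lambda>i. fps_nth (A ^ i) n / fact i - \<phi> i / fact i * bb n) sums (fps_nth M n - \<alpha> * exp s * bb n)"
      by (intro sums_diff Msum sums_mult2 \<phi>sum)
    hence e: "fps_nth M n - \<alpha> * exp s * bb n = (\<Sum>i. fps_nth (A ^ i) n / fact i - \<phi> i / fact i * bb n)"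
      by (rule sums_unique)
    have le: "norm (fps_nth (A ^ i) n / fact i - \<phi> i / fact i * bb n) \<le> (L ^ i / fact i) * (1 / (real n + 1)^2)" for i
    proof -
      have "\<bar>fps_nth (A ^ i) n - \<phi> i * bb n\<bar> / fact i \<le> (L ^ i / (real n + 1)^2) / fact i"
        using pw(1)[of i] unfolding srate_def by (intro divide_right_mono) auto
      thus ?thesis by (simp add: diff_divide_distrib[symmetric] mult.commute)
    qed
    have sm: "(\<lambda>i. (L ^ i / fact i) * (1 / (real n + 1)^2)) sums (exp L * (1 / (real n + 1)^2))"
      by (intro sums_mult2 expL)
    show "\<bar>fps_nth M n - \<alpha> * exp s * bb n\<bar> \<le> exp L / (real n + 1)^2"
      using norm_suminf_le[OF le sums_summable[OF sm]] sums_unique[OF sm] unfolding e by simp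
  qed
  have "(\<lambda>n. \<Sum>i. fps_nth (A ^ i) n / fact i) sums (\<Sum>i. \<Sum>n. fps_nth (A ^ i) n / fact i)"
  proof (rule suminf_swap_of_product_bound[where x = "\<lambda>i. L ^ i / fact i" and y = "\<lambda>n. 1 * bb n + 1 / (real n + 1)^2"])
    fix i n
    have "\<bar>fps_nth (A ^ i) n\<bar> \<le> \<bar>\<phi> i\<bar> * bb n + L ^ i / (real n + 1)^2" by (rule srate_abs_le[OF pw(1)])
    also have "\<dots> \<le> L ^ i * bb n + L ^ i / (real n + 1)^2" using pw(3)[of i] bb_nonneg[of n] by (intro add_mono mult_right_mono) auto
    finally have "\<bar>fps_nth (A ^ i) n\<bar> / fact i \<le> (L ^ i * bb n + L ^ i / (real n + 1)^2) / fact i"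
      by (intro divide_right_mono) auto
    thus "\<bar>fps_nth (A ^ i) n / fact i\<bar> \<le> L ^ i / fact i * (1 * bb n + 1 / (real n + 1)\<^sup>2)"
      by (simp add: algebra_simps add_divide_distrib)
  qed (use L bb_nonneg expL[of L] srate_majorant_summable[of 1 1] in \<open>auto simp: sums_iff\<close>)
  moreover have "(\<Sum>n. fps_nth (A ^ i) n / fact i) = s ^ i / fact i" for i
    using suminf_divide[OF srate_summable[OF pw(1)]] pw(2) by simp
  ultimately have "fps_nth M sums exp s"
    using Msum expL[of s] by (simp add: sums_iff)
  thus ?thesis using rate by (auto simp: sums_iff)
qed

section \<open>Asymptotic equivalents under convolution\<close>

lemma tendsto_imp_bounded:
  fixes x :: "nat \<Rightarrow> real"
  assumes "x \<longlonglongrightarrow> l"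
  shows "\<exists>H>0. \<forall>n. \<bar>x n\<bar> \<le> H"
  using convergent_imp_Bseq[OF convergentI[OF assms]] by (auto simp: Bseq_def)

text \<open>Dominated convergence over the part of a convolution where the index of h is at least
  n/2, so that \<open>w (n - j)\<close> is comparable to \<open>w n\<close>. The function
  \<open>cut\<close> covers both halves of a product, whose bounds n div 2 and (n - 1) div 2 differ
  by rounding; w is used with \<open>bb\<close> and with \<open>cc\<close>.\<close>

lemma tannery_half:
  fixes f h w :: "nat \<Rightarrow> real" and cut :: "nat \<Rightarrow> nat"
  assumes f: "summable (\<lambda>n. \<bar>f n\<bar>)" and h: "(\<lambda>n. h n / w n) \<longlonglongrightarrow> \<gamma>"
    and wpos: "\<And>n. n > 0 \<Longrightarrow> w n > 0"
    and w1: "\<And>j. (\<lambda>n. w (n - j) / w n) \<longlonglongrightarrow> 1"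
    and wK: "\<And>m n. 0 < m \<Longrightarrow> m \<le> n \<Longrightarrow> n \<le> 2 * m \<Longrightarrow> w m \<le> K * w n"
    and cut: "\<And>n. cut n \<le> n div 2" "filterlim cut at_top sequentially"
  shows "(\<lambda>n. (\<Sum>j\<le>cut n. f j * h (n - j)) / w n) \<longlonglongrightarrow> \<gamma> * suminf f"
proof -
  obtain H where H: "\<And>n. \<bar>h n / w n\<bar> \<le> H" "H > 0" using tendsto_imp_bounded[OF h] by blast
  define a where "a = (\<lambda>j n. if j \<le> cut n \<and> n > 0 then f j * (h (n - j) / w n) else 0)"
  have lim: "(\<lambda>n. a j n) \<longlonglongrightarrow> f j * \<gamma>" for j
  proof -
    have "(\<lambda>n. f j * ((h (n - j) / w (n - j)) * (w (n - j) / w n))) \<longlonglongrightarrow> f j * (\<gamma> * 1)"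
      by (intro tendsto_mult tendsto_const w1 filterlim_compose[OF h] filterlim_minus_const_nat_at_top)
    moreover have "\<forall>\<^sub>F n in sequentially. f j * ((h (n - j) / w (n - j)) * (w (n - j) / w n)) = a j n"
    proof -
      have "\<forall>\<^sub>F n in sequentially. j \<le> cut n" using cut(2) by (simp add: filterlim_at_top)
      thus ?thesis using eventually_gt_at_top[of j]
      proof eventually_elim
        case (elim n)
        thus ?case using wpos[of "n - j"] by (auto simp: a_def)
      qed
    qed
    ultimately show ?thesis using tendsto_cong by fastforce
  qed
  have bnd: "norm (a j n) \<le> \<bar>f j\<bar> * (H * K)" for j n
  proof (cases "j \<le> cut n \<and> n > 0")
    case True
    have nj: "n - j > 0" "n \<le> 2 * (n - j)" using True cut(1)[of n] by auto
    have "\<bar>h (n - j) / w n\<bar> = \<bar>h (n - j) / w (n - j)\<bar> * (w (n - j) / w n)"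
      using wpos[OF nj(1)] wpos[of n] True by (simp add: abs_mult)
    also have "\<dots> \<le> H * K" using wK[OF nj(1) _ nj(2)] wpos[of n] wpos[OF nj(1)] True H(2)
      by (intro mult_mono H(1)) (auto simp: pos_divide_le_eq)
    finally have "\<bar>f j\<bar> * \<bar>h (n - j) / w n\<bar> \<le> \<bar>f j\<bar> * (H * K)" by (intro mult_left_mono) auto
    thus ?thesis using True by (simp add: a_def abs_mult)
  next
    case False
    have "K > 0" using wK[of 1 1] wpos[of 1] by (simp add: zero_less_mult_iff)
    thus ?thesis using False H by (auto simp: a_def)
  qed
  have "((\<lambda>n. \<Sum>j. a j n) \<longlongrightarrow> (\<Sum>j. f j * \<gamma>)) sequentially"
  proof (rule conjunct2[OF conjunct2[OF tannerys_theorem[where M = "\<lambda>j. \<bar>f j\<bar> * (H * K)"]]])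
    show "\<forall>\<^sub>F (j, n) in at_top \<times>\<^sub>F sequentially. norm (a j n) \<le> \<bar>f j\<bar> * (H * K)"
      using bnd by (intro always_eventually) auto
    show "summable (\<lambda>j. \<bar>f j\<bar> * (H * K))" by (rule summable_mult2[OF f])
  qed (use lim in auto)
  moreover have "(\<Sum>j. f j * \<gamma>) = \<gamma> * suminf f"
    using suminf_mult2[OF summable_rabs_cancel[OF f], of \<gamma>] by (simp add: mult.commute)
  moreover have "\<forall>\<^sub>F n in sequentially. (\<Sum>j. a j n) = (\<Sum>j\<le>cut n. f j * h (n - j)) / w n"
    using eventually_gt_at_top[of 0]
  proof eventually_elim
    case (elim n)
    have "(\<lambda>j. a j n) sums (\<Sum>j\<le>cut n. a j n)" by (rule sums_finite) (auto simp: a_def)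
    thus ?case using elim by (simp add: sums_iff a_def sum_divide_distrib)
  qed
  ultimately show ?thesis using tendsto_cong by fastforce
qed

lemma half_cuts:
  "filterlim (\<lambda>n. n div 2) at_top (sequentially :: nat filter)"
  "filterlim (\<lambda>n. (n - 1) div 2) at_top (sequentially :: nat filter)"
  unfolding filterlim_at_top
proof safe
  fix Z :: nat
  show "\<forall>\<^sub>F n in sequentially. Z \<le> n div 2"
    using eventually_ge_at_top[of "2 * Z + 1"] by eventually_elim auto
  show "\<forall>\<^sub>F n in sequentially. Z \<le> (n - 1) div 2"
    using eventually_ge_at_top[of "2 * Z + 1"] by eventually_elim auto
qed

text \<open>The upper half is reflected so that in each half the small index sits on one fixed
  factor, as \<open>tannery_half\<close> expects.\<close>

lemma fps_mult_nth_halves: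
  fixes f g :: "'a :: comm_ring_1 fps"
  assumes "n > 0"
  shows "fps_nth (f * g) n = (\<Sum>j\<le>n div 2. fps_nth f j * fps_nth g (n - j)) + (\<Sum>j\<le>(n - 1) div 2. fps_nth g j * fps_nth f (n - j))"
proof -
  have "{0..n} = {..n div 2} \<union> {n div 2 <..n}" by auto
  hence "fps_nth (f * g) n = (\<Sum>j\<le>n div 2. fps_nth f j * fps_nth g (n - j)) + (\<Sum>j\<in>{n div 2 <..n}. fps_nth f j * fps_nth g (n - j))"
    unfolding fps_mult_nth by (simp only:) (rule sum.union_disjoint, auto)
  also have "(\<Sum>j\<in>{n div 2 <..n}. fps_nth f j * fps_nth g (n - j)) = (\<Sum>j\<le>(n - 1) div 2. fps_nth g j * fps_nth f (n - j))"
    by (rule sum.reindex_bij_witness[where i = "\<lambda>j. n - j" and j = "\<lambda>j. n - j"]) (use assms in auto)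
  finally show ?thesis .
qed

lemma bb_le_4: "0 < m \<Longrightarrow> m \<le> n \<Longrightarrow> n \<le> 2 * m \<Longrightarrow> bb m \<le> 4 * bb n"
proof -
  assume *: "0 < m" "m \<le> n" "n \<le> 2 * m"
  have "bb m * real m ^ 2 \<le> bb n * real n ^ 2" using bb_sq_mono * by blast
  also have "\<dots> \<le> bb n * (2 * real m) ^ 2" using * bb_nonneg by (intro mult_left_mono power_mono) auto
  finally show ?thesis using * by (simp add: power_mult_distrib)
qed

lemma bb_shift_lim: "(\<lambda>n. bb (n - j) / bb n) \<longlonglongrightarrow> 1"
proof -
  have "(\<lambda>n. bb (n - j) / bb n - 1) \<longlonglongrightarrow> 0"
  proof (rule Lim_null_comparison)
    show "\<forall>\<^sub>F n in sequentially. norm (bb (n - j) / bb n - 1) \<le> 16 * (real j / (real n + 1))"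
      using eventually_gt_at_top[of "2 * j"]
    proof eventually_elim
      case (elim n)
      have n: "bb n > 0" using bb_pos elim by simp
      have "\<bar>bb (n - j) - bb n\<bar> \<le> 4 * bb (n - j) * (real j / (real n + 1))"
        using bb_diff_le[of "n - j" n] elim by simp
      also have "\<dots> \<le> 4 * (4 * bb n) * (real j / (real n + 1))"
        using bb_le_4[of "n - j" n] elim by (intro mult_right_mono mult_left_mono) auto
      finally have *: "\<bar>bb (n - j) - bb n\<bar> / bb n \<le> 16 * (real j / (real n + 1))" using n by (simp add: field_simps)
      have "bb (n - j) / bb n - 1 = (bb (n - j) - bb n) / bb n" using n by (simp add: field_simps)
      thus ?case using * n by (simp add: abs_divide)
    qed
    show "(\<lambda>n. 16 * (real j / (real n + 1))) \<longlonglongrightarrow> 0" by real_asymp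
  qed
  thus ?thesis by (simp add: LIM_zero_iff)
qed

lemma bb_div_self_lim: "(\<lambda>n. bb n / bb n) \<longlonglongrightarrow> 1"
proof (rule tendsto_eventually)
  show "\<forall>\<^sub>F n in sequentially. bb n / bb n = 1"
    using eventually_gt_at_top[of 0]
  proof eventually_elim
    case (elim n) thus ?case using bb_pos[of n] by simp
  qed
qed

lemma cc_eq_bb: "n > 0 \<Longrightarrow> cc n = (2 * real n - 1) * bb n"
  by (simp add: bb_eq_cc)

lemma cc_le_4: "0 < m \<Longrightarrow> m \<le> n \<Longrightarrow> n \<le> 2 * m \<Longrightarrow> cc m \<le> 4 * cc n"
proof -
  assume *: "0 < m" "m \<le> n" "n \<le> 2 * m"
  have "cc m \<le> (2 * real n - 1) * (4 * bb n)"
    unfolding cc_eq_bb[OF *(1)] using bb_le_4[OF *] * bb_nonneg by (intro mult_mono) auto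
  thus ?thesis using * by (simp add: cc_eq_bb)
qed

lemma cc_shift_lim: "(\<lambda>n. cc (n - j) / cc n) \<longlonglongrightarrow> 1"
proof -
  have "(\<lambda>n. (2 * (real n - real j) - 1) / (2 * real n - 1) * (bb (n - j) / bb n)) \<longlonglongrightarrow> 1 * 1"
    by (intro tendsto_mult bb_shift_lim) real_asymp
  moreover have "\<forall>\<^sub>F n in sequentially. (2 * (real n - real j) - 1) / (2 * real n - 1) * (bb (n - j) / bb n) = cc (n - j) / cc n"
    using eventually_gt_at_top[of j] by eventually_elim (simp add: cc_eq_bb of_nat_diff)
  ultimately show ?thesis using tendsto_cong by fastforce
qed

lemma asymp_bb_abs_summable:
  assumes "(\<lambda>n. f n / bb n) \<longlonglongrightarrow> \<phi>"
  shows "summable (\<lambda>n. \<bar>f n\<bar>)"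
proof -
  obtain H where H: "\<And>n. \<bar>f n / bb n\<bar> \<le> H"
using tendsto_imp_bounded[OF assms] by blast
  show ?thesis
  proof (rule summable_comparison_test'[OF summable_mult[OF bb_summable, of H], of 1])
    fix n :: nat assume "n \<ge> 1"
    hence "bb n > 0" by (intro bb_pos) auto
    thus "norm \<bar>f n\<bar> \<le> H * bb n" using H[of n] by (simp add: abs_divide divide_simps)
  qed
qed

lemma asymp_bb_mult:
  fixes f g :: "real fps"
  assumes "(\<lambda>n. fps_nth f n / bb n) \<longlonglongrightarrow> \<phi>" "(\<lambda>n. fps_nth g n / bb n) \<longlonglongrightarrow> \<gamma>"
  shows "(\<lambda>n. fps_nth (f * g) n / bb n) \<longlonglongrightarrow> \<phi> * suminf (fps_nth g) + \<gamma> * suminf (fps_nth f)"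
proof -
  have 1: "(\<lambda>n. (\<Sum>j\<le>n div 2. fps_nth f j * fps_nth g (n - j)) / bb n) \<longlonglongrightarrow> \<gamma> * suminf (fps_nth f)"
    by (rule tannery_half[OF asymp_bb_abs_summable[OF assms(1)] assms(2), where K = 4])
       (auto simp: bb_pos bb_shift_lim bb_le_4 half_cuts)
  have 2: "(\<lambda>n. (\<Sum>j\<le>(n - 1) div 2. fps_nth g j * fps_nth f (n - j)) / bb n) \<longlonglongrightarrow> \<phi> * suminf (fps_nth g)"
    by (rule tannery_half[OF asymp_bb_abs_summable[OF assms(2)] assms(1), where K = 4])
       (auto simp: bb_pos bb_shift_lim bb_le_4 half_cuts[unfolded One_nat_def])
  have "\<forall>\<^sub>F n in sequentially. (\<Sum>j\<le>n div 2. fps_nth f j * fps_nth g (n - j)) / bb n +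
     (\<Sum>j\<le>(n - 1) div 2. fps_nth g j * fps_nth f (n - j)) / bb n = fps_nth (f * g) n / bb n"
    using eventually_gt_at_top[of 0] by eventually_elim (simp add: fps_mult_nth_halves add_divide_distrib)
  thus ?thesis using tendsto_add[OF 1 2] tendsto_cong by (fastforce simp: add.commute)
qed

lemma srate_asymp: "srate \<phi> K f \<Longrightarrow> (\<lambda>n. fps_nth f n / bb n) \<longlonglongrightarrow> \<phi>"
proof -
  assume f: "srate \<phi> K f"
  have "(\<lambda>n. fps_nth f n / bb n - \<phi>) \<longlonglongrightarrow> 0"
  proof (rule Lim_null_comparison)
    show "\<forall>\<^sub>F n in sequentially. norm (fps_nth f n / bb n - \<phi>) \<le> K * (2 * sqrt (pi * (real n + 1/2)) / (real n + 1))"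
      using eventually_gt_at_top[of 0]
    proof eventually_elim
      case (elim n)
      have b: "bb n > 0" using elim bb_pos by simp
      have K: "K \<ge> 0" using srate_K_nonneg[OF f] .
      have "fps_nth f n / bb n - \<phi> = (fps_nth f n - \<phi> * bb n) / bb n" using b by (simp add: field_simps)
      hence "norm (fps_nth f n / bb n - \<phi>) = \<bar>fps_nth f n - \<phi> * bb n\<bar> / bb n" using b by (simp add: abs_divide)
      also have "\<dots> \<le> (K / (real n + 1)^2) / bb n" using f b unfolding srate_def by (intro divide_right_mono) auto
      also have "\<dots> \<le> (K / (real n + 1)^2) / (1 / (sqrt (pi * (real n + 1/2)) * (2 * (real n + 1))))"
      proof (intro divide_left_mono)
        have "1 / (sqrt (pi * (real n + 1/2)) * (2 * (real n + 1))) = (1 / sqrt (pi * (real n + 1/2))) / (2 * (real n + 1))" by simp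
        also have "\<dots> \<le> cc n / (2 * real n - 1)" using cc_lower[of n] cc_pos[of n] elim by (intro frac_le) auto
        finally show "1 / (sqrt (pi * (real n + 1/2)) * (2 * (real n + 1))) \<le> bb n" using elim by (simp add: bb_eq_cc)
      qed (use K b in auto)
      also have "\<dots> = K * (2 * sqrt (pi * (real n + 1/2)) / (real n + 1))" by (simp add: power2_eq_square divide_simps) (simp add: algebra_simps)?
      finally show ?case .
    qed
    show "(\<lambda>n. K * (2 * sqrt (pi * (real n + 1/2)) / (real n + 1))) \<longlonglongrightarrow> 0" by real_asymp
  qed
  thus ?thesis by (simp add: LIM_zero_iff)
qed

lemma sum_cc: "(\<Sum>i\<le>n. cc i) = (2 * real n + 1) * cc n"
  by (induction n) (auto simp: cc_Suc divide_simps, simp add: algebra_simps)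

lemma cc_tendsto_0: "cc \<longlonglongrightarrow> 0"
proof (rule tendsto_sandwich[of "\<lambda>_. 0" _ _ "\<lambda>n. 1 / sqrt (pi * real n)"])
  show "\<forall>\<^sub>F n in sequentially. cc n \<le> 1 / sqrt (pi * real n)"
    using eventually_gt_at_top[of 0] by eventually_elim (rule cc_upper)
  show "(\<lambda>n. 1 / sqrt (pi * real n)) \<longlonglongrightarrow> 0" by real_asymp
qed (auto intro!: always_eventually less_imp_le cc_pos)

text \<open>Here d need not be summable. In the half where d has the small index, its partial sums
  are O(n * \<open>cc n\<close>) while the coefficients of m are O(\<open>cc n\<close> / n), so this
  half is O(\<open>cc n\<close> ^ 2) and drops out.\<close>

lemma asymp_cc_mult:
  fixes d m :: "real fps"
  assumes d: "(\<lambda>n. fps_nth d n / cc n) \<longlonglongrightarrow> \<gamma>" and m: "(\<lambda>n. fps_nth m n / bb n) \<longlonglongrightarrow> \<beta>"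
  shows "(\<lambda>n. fps_nth (d * m) n / cc n) \<longlonglongrightarrow> \<gamma> * suminf (fps_nth m)"
proof -
  have 1: "(\<lambda>n. (\<Sum>j\<le>n div 2. fps_nth m j * fps_nth d (n - j)) / cc n) \<longlonglongrightarrow> \<gamma> * suminf (fps_nth m)"
    by (rule tannery_half[OF asymp_bb_abs_summable[OF m] d, where K = 4])
       (auto simp: cc_pos cc_shift_lim cc_le_4 half_cuts)
  obtain H where H: "\<And>n. \<bar>fps_nth m n / bb n\<bar> \<le> H" "H > 0"
using tendsto_imp_bounded[OF m] by blast
  obtain G where G: "\<And>n. \<bar>fps_nth d n / cc n\<bar> \<le> G" "G > 0"
using tendsto_imp_bounded[OF d] by blast
  have d': "\<bar>fps_nth d n\<bar> \<le> G * cc n" for n using G(1)[of n] cc_pos[of n] by (simp add: abs_divide divide_simps)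
  have 2: "(\<lambda>n. (\<Sum>j\<le>(n - 1) div 2. fps_nth d j * fps_nth m (n - j)) / cc n) \<longlonglongrightarrow> 0"
  proof (rule Lim_null_comparison)
    show "\<forall>\<^sub>F n in sequentially. norm ((\<Sum>j\<le>(n - 1) div 2. fps_nth d j * fps_nth m (n - j)) / cc n) \<le> 4 * G * H * ((2 * real n + 1) / (2 * real n - 1) * cc n)"
      using eventually_gt_at_top[of 0]
    proof eventually_elim
      case (elim n)
      have "norm (\<Sum>j\<le>(n - 1) div 2. fps_nth d j * fps_nth m (n - j)) \<le> (\<Sum>j\<le>(n - 1) div 2. (G * cc j) * (H * (4 * bb n)))"
      proof (rule sum_norm_le)
        fix j assume "j \<in> {..(n - 1) div 2}"
        hence j: "n - j > 0" "n \<le> 2 * (n - j)" using elim by auto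
        have "\<bar>fps_nth m (n - j)\<bar> \<le> H * bb (n - j)" using H(1)[of "n - j"] bb_pos[OF j(1)] by (simp add: abs_divide divide_simps)
        also have "\<dots> \<le> H * (4 * bb n)" using H j bb_le_4[of "n - j" n] by (intro mult_left_mono) auto
        finally show "norm (fps_nth d j * fps_nth m (n - j)) \<le> (G * cc j) * (H * (4 * bb n))"
          using d'[of j] G(2) cc_pos[of j] by (simp only: real_norm_def abs_mult) (intro mult_mono, auto)
      qed
      also have "\<dots> = 4 * G * H * bb n * (\<Sum>j\<le>(n - 1) div 2. cc j)" by (simp add: sum_distrib_left mult_ac)
      also have "\<dots> \<le> 4 * G * H * bb n * (\<Sum>j\<le>n. cc j)"
        using G H bb_nonneg cc_pos[THEN less_imp_le] elim by (intro mult_left_mono sum_mono2) auto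
      also have "\<dots> = 4 * G * H * ((2 * real n + 1) / (2 * real n - 1) * cc n) * cc n"
        using elim by (simp add: sum_cc bb_eq_cc)
      finally show ?case using cc_pos[of n] by (simp add: norm_divide pos_divide_le_eq)
    qed
    have "(\<lambda>n. 4 * G * H * ((2 * real n + 1) / (2 * real n - 1) * cc n)) \<longlonglongrightarrow> 4 * G * H * (1 * 0)"
      by (intro tendsto_mult tendsto_const cc_tendsto_0) real_asymp
    thus "(\<lambda>n. 4 * G * H * ((2 * real n + 1) / (2 * real n - 1) * cc n)) \<longlonglongrightarrow> 0" by simp
  qed
  have "\<forall>\<^sub>F n in sequentially. (\<Sum>j\<le>n div 2. fps_nth m j * fps_nth d (n - j)) / cc n +
     (\<Sum>j\<le>(n - 1) div 2. fps_nth d j * fps_nth m (n - j)) / cc n = fps_nth (m * d) n / cc n"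
    using eventually_gt_at_top[of 0] by eventually_elim (simp add: fps_mult_nth_halves add_divide_distrib)
  thus ?thesis using tendsto_add[OF 1 2] tendsto_cong by (fastforce simp: mult.commute)
qed

lemma tendsto_conv_summable:
  fixes d m :: "real fps"
  assumes d: "fps_nth d \<longlonglongrightarrow> \<delta>" and m: "summable (\<lambda>n. \<bar>fps_nth m n\<bar>)"
  shows "fps_nth (d * m) \<longlonglongrightarrow> \<delta> * suminf (fps_nth m)"
proof -
  obtain H where H: "\<And>n. \<bar>fps_nth d n\<bar> \<le> H" "H > 0"
using tendsto_imp_bounded[OF d] by blast
  define a where "a = (\<lambda>j n. if j \<le> n then fps_nth m j * fps_nth d (n - j) else 0)"
  have "((\<lambda>n. \<Sum>j. a j n) \<longlongrightarrow> (\<Sum>j. fps_nth m j * \<delta>)) sequentially"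
  proof (rule conjunct2[OF conjunct2[OF tannerys_theorem[where M = "\<lambda>j. \<bar>fps_nth m j\<bar> * H"]]])
    show "\<forall>\<^sub>F (j, n) in at_top \<times>\<^sub>F sequentially. norm (a j n) \<le> \<bar>fps_nth m j\<bar> * H"
      using H by (intro always_eventually) (auto simp: a_def abs_mult intro!: mult_left_mono mult_nonneg_nonneg)
    show "summable (\<lambda>j. \<bar>fps_nth m j\<bar> * H)" by (rule summable_mult2[OF m])
    show "(\<lambda>n. a j n) \<longlonglongrightarrow> fps_nth m j * \<delta>" for j
    proof -
      have "(\<lambda>n. fps_nth m j * fps_nth d (n - j)) \<longlonglongrightarrow> fps_nth m j * \<delta>"
        by (intro tendsto_mult tendsto_const filterlim_compose[OF d] filterlim_minus_const_nat_at_top)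
      moreover have "\<forall>\<^sub>F n in sequentially. fps_nth m j * fps_nth d (n - j) = a j n"
        using eventually_ge_at_top[of j] by eventually_elim (auto simp: a_def)
      ultimately show ?thesis using tendsto_cong by fastforce
    qed
  qed auto
  moreover have "(\<Sum>j. fps_nth m j * \<delta>) = \<delta> * suminf (fps_nth m)"
    using suminf_mult2[OF summable_rabs_cancel[OF m], of \<delta>] by (simp add: mult.commute)
  moreover have "(\<Sum>j. a j n) = fps_nth (d * m) n" for n
  proof -
    have "(\<lambda>j. a j n) sums (\<Sum>j\<le>n. a j n)" by (rule sums_finite) (auto simp: a_def)
    thus ?thesis by (simp add: sums_iff a_def mult.commute[of d] fps_mult_nth atMost_atLeast0)
  qed
  ultimately show ?thesis by simp
qed

section \<open>Renewal sequences\<close>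

text \<open>The number U in the proof is the limit superior of |x n|, encoded as the infimum of
  eventual bounds; the step property forces U \<le> S * U, hence U = 0.\<close>

lemma eventually_contraction_imp_null:
  fixes x :: "nat \<Rightarrow> real"
  assumes bnd: "\<And>n. \<bar>x n\<bar> \<le> H" and S: "0 \<le> S" "S < 1"
    and step: "\<And>u \<epsilon>. u \<ge> 0 \<Longrightarrow> \<epsilon> > 0 \<Longrightarrow> \<forall>\<^sub>F n in sequentially. \<bar>x n\<bar> \<le> u \<Longrightarrow> \<forall>\<^sub>F n in sequentially. \<bar>x n\<bar> \<le> S * u + \<epsilon>"
  shows "x \<longlonglongrightarrow> 0"
proof -
  define Us where "Us = {u. u \<ge> 0 \<and> (\<forall>\<^sub>F n in sequentially. \<bar>x n\<bar> \<le> u)}"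
  have ne: "H \<in> Us" using bnd order.trans[OF abs_ge_zero bnd[of 0]] by (auto simp: Us_def)
  have bdd: "bdd_below Us" by (auto simp: Us_def intro!: bdd_belowI[of _ 0])
  define U where "U = Inf Us"
  have U0: "U \<ge> 0" unfolding U_def using ne by (intro cInf_greatest) (auto simp: Us_def)
  have "U = 0"
  proof (rule ccontr)
    assume "U \<noteq> 0"
    hence Up: "U > 0" using U0 by simp
    define \<epsilon> where "\<epsilon> = (1 - S) * U / 4"
    have e: "\<epsilon> > 0" using Up S by (simp add: \<epsilon>_def)
    obtain u where u: "u \<in> Us" "u < U + \<epsilon>" using cInf_lessD[of Us "U + \<epsilon>"] ne e by (auto simp: U_def)
    have "S * u + \<epsilon> \<in> Us" using step[of u \<epsilon>] u e S by (auto simp: Us_def)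
    hence "U \<le> S * u + \<epsilon>" unfolding U_def using bdd by (intro cInf_lower)
    also have "\<dots> \<le> S * (U + \<epsilon>) + \<epsilon>" using u S by (intro add_right_mono mult_left_mono) auto
    also have "\<dots> \<le> S * U + 2 * \<epsilon>" using S e mult_right_mono[of S 1 \<epsilon>] by (simp add: algebra_simps)
    also have "\<dots> = U - (1 - S) * U / 2" by (simp add: \<epsilon>_def field_simps)
    also have "\<dots> < U" using Up S by simp
    finally show False by simp
  qed
  show ?thesis
  proof (rule tendstoI)
    fix e :: real assume "e > 0"
    then obtain u where u: "u \<in> Us" "u < e" using cInf_lessD[of Us e] ne \<open>U = 0\<close> by (auto simp: U_def)
    hence "\<forall>\<^sub>F n in sequentially. \<bar>x n\<bar> \<le> u" by (auto simp: Us_def)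
    thus "\<forall>\<^sub>F n in sequentially. dist (x n) 0 < e" by (rule eventually_mono) (use u(2) in auto)
  qed
qed

section \<open>The subcritical renewal equation, Q(1) < 1\<close>

context
  fixes Q D :: "real fps" and \<kappa> S :: real
  assumes Qnn: "\<And>n. fps_nth Q n \<ge> 0" and Q0: "fps_nth Q 0 = 0"
    and Qas: "(\<lambda>n. fps_nth Q n / bb n) \<longlonglongrightarrow> \<kappa>"
    and S_def: "S = suminf (fps_nth Q)" and S1: "S < 1"
    and D_eq: "D = 1 + Q * D"
begin

lemma renewal_nonneg: "fps_nth D n \<ge> 0"
proof (induction n rule: less_induct)
  case (less n)
  have "fps_nth D n = fps_nth 1 n + (\<Sum>i=0..n. fps_nth Q i * fps_nth D (n - i))"
    by (subst D_eq) (simp add: fps_mult_nth)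
  moreover have "fps_nth Q i * fps_nth D (n - i) \<ge> 0" if "i \<in> {0..n}" for i
    using less[of "n - i"] Qnn[of i] Q0 that by (cases "i = 0") auto
  ultimately show ?case by (auto intro!: add_nonneg_nonneg sum_nonneg)
qed

lemma Q_summable: "summable (fps_nth Q)"
  using summable_rabs_cancel[OF asymp_bb_abs_summable[OF Qas]] .

lemma S_nonneg: "S \<ge> 0" unfolding S_def by (intro suminf_nonneg Q_summable Qnn)

lemma kappa_nonneg: "\<kappa> \<ge> 0"
  by (rule tendsto_lowerbound[OF Qas]) (auto intro!: always_eventually divide_nonneg_nonneg Qnn bb_nonneg)

text \<open>Strong induction with the hypothesis d \<le> K * \<open>bb\<close>. It closes because
  the convolution of Q with \<open>bb\<close>, without the first N terms of \<open>bb\<close>, is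
  eventually below (1 + S) / 2 times \<open>bb n\<close>; the first N values of d enter through a
  separate constant C.\<close>

lemma renewal_bounded: "\<exists>K\<ge>0. \<forall>n>0. fps_nth D n \<le> K * bb n"
proof -
  define d where "d = fps_nth D"
  have d0: "d n \<ge> 0" for n using renewal_nonneg by (simp add: d_def)
  have Qb: "(\<lambda>n. fps_nth (Q * Abs_fps bb) n / bb n) \<longlonglongrightarrow> \<kappa> * 1 + 1 * S"
  proof -
    have "suminf (fps_nth (Abs_fps bb)) = 1" using bb_sums by (simp add: sums_iff fps_nth_Abs_fps[abs_def])
    thus ?thesis using asymp_bb_mult[OF Qas, of "Abs_fps bb" 1] bb_div_self_lim by (simp add: S_def)
  qed
  have fin: "(\<lambda>n. (\<Sum>i<N. a i * fps_nth Q (n - i)) / bb n) \<longlonglongrightarrow> (\<Sum>i<N. a i * \<kappa>)" for a :: "nat \<Rightarrow> real" and N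
  proof -
    have "(\<lambda>n. \<Sum>i<N. a i * (fps_nth Q (n - i) / bb (n - i) * (bb (n - i) / bb n))) \<longlonglongrightarrow> (\<Sum>i<N. a i * (\<kappa> * 1))"
      by (intro tendsto_sum tendsto_mult tendsto_const bb_shift_lim filterlim_compose[OF Qas] filterlim_minus_const_nat_at_top)
    moreover have "\<forall>\<^sub>F n in sequentially. (\<Sum>i<N. a i * (fps_nth Q (n - i) / bb (n - i) * (bb (n - i) / bb n))) = (\<Sum>i<N. a i * fps_nth Q (n - i)) / bb n"
      using eventually_gt_at_top[of N]
    proof eventually_elim
      case (elim n)
      have "bb (n - i) \<noteq> 0" if "i < N" for i using bb_pos[of "n - i"] that elim by auto
      thus ?case by (simp add: sum_divide_distrib)
    qed
    ultimately show ?thesis using tendsto_cong by fastforce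
  qed
  \<comment> \<open>The expression is the limit, relative to \<open>bb n\<close>, of the convolution
    truncated at N; it tends to S, which leaves room below (1 + S) / 2.\<close>
  have "(\<lambda>N. S + \<kappa> * (1 - (\<Sum>i<N. bb i))) \<longlonglongrightarrow> S + \<kappa> * (1 - 1)"
    using bb_sums unfolding sums_def by (intro tendsto_intros)
  hence "\<forall>\<^sub>F N in sequentially. S + \<kappa> * (1 - (\<Sum>i<N. bb i)) < (1 + S) / 2"
    using S1 by (intro order_tendstoD) auto
  then obtain N where N: "S + \<kappa> * (1 - (\<Sum>i<N. bb i)) < (1 + S) / 2" "N > 0"
    using eventually_happens'[OF _ eventually_conj[OF _ eventually_gt_at_top[of 0]]] by fastforce
  have "(\<lambda>n. fps_nth (Q * Abs_fps bb) n / bb n - (\<Sum>i<N. bb i * fps_nth Q (n - i)) / bb n) \<longlonglongrightarrow> \<kappa> * 1 + 1 * S - (\<Sum>i<N. bb i * \<kappa>)"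
    by (intro tendsto_diff Qb fin)
  moreover have "\<kappa> * 1 + 1 * S - (\<Sum>i<N. bb i * \<kappa>) < (1 + S) / 2"
    using N by (simp add: algebra_simps sum_distrib_left)
  ultimately have ev1: "\<forall>\<^sub>F n in sequentially. fps_nth (Q * Abs_fps bb) n / bb n - (\<Sum>i<N. bb i * fps_nth Q (n - i)) / bb n < (1 + S) / 2"
    by (rule order_tendstoD)
  define C where "C = (\<Sum>i<N. d i * \<kappa>) + 1"
  have C0: "C > 0" unfolding C_def using d0 kappa_nonneg by (intro add_nonneg_pos sum_nonneg) auto
  have ev2: "\<forall>\<^sub>F n in sequentially. (\<Sum>i<N. d i * fps_nth Q (n - i)) / bb n < C"
    by (rule order_tendstoD(2)[OF fin]) (simp add: C_def)
  obtain n0 where n0: "\<And>n. n \<ge> n0 \<Longrightarrow> fps_nth (Q * Abs_fps bb) n / bb n - (\<Sum>i<N. bb i * fps_nth Q (n - i)) / bb n < (1 + S) / 2"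
     "\<And>n. n \<ge> n0 \<Longrightarrow> (\<Sum>i<N. d i * fps_nth Q (n - i)) / bb n < C" "n0 > N"
    using eventually_conj[OF ev1 eventually_conj[OF ev2 eventually_gt_at_top[of N]]]
    unfolding eventually_sequentially by (meson order.refl order.trans)
  \<comment> \<open>The first entry makes C \<le> K * (1 - S) / 2, exactly the room left by the
    contraction; the second covers the finitely many n < n0.\<close>
  define K where "K = max (2 * C / (1 - S)) (\<Sum>i<n0. d i / bb i)"
  have K0: "K \<ge> 0" using C0 S1 by (simp add: K_def max.coboundedI1)
  have "d n \<le> K * bb n" if "n > 0" for n
    using that
  proof (induction n rule: less_induct)
    case (less n)
    have b: "bb n > 0" using less.prems bb_pos by simp
    show ?case
    proof (cases "n < n0")
      case True
      have "d n / bb n \<le> (\<Sum>i<n0. d i / bb i)"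
        using True d0 bb_nonneg by (intro member_le_sum) auto
      hence "d n / bb n \<le> K" by (simp add: K_def)
      thus ?thesis using b by (simp add: divide_simps)
    next
      case False
      hence n: "n \<ge> n0" "n > N" using n0(3) by auto
      have split: "(\<Sum>i=0..n. a i * fps_nth Q (n - i)) = (\<Sum>i<N. a i * fps_nth Q (n - i)) + (\<Sum>i\<in>{N..n}. a i * fps_nth Q (n - i))" for a :: "nat \<Rightarrow> real"
      proof -
        have "{0..n} = {..<N} \<union> {N..n}" using n by auto
        thus ?thesis by (simp only:) (rule sum.union_disjoint, auto)
      qed
      have "d n = fps_nth (D * Q) n"
        unfolding d_def by (subst D_eq) (use n in \<open>simp add: mult.commute\<close>)
      also have "\<dots> = (\<Sum>i=0..n. d i * fps_nth Q (n - i))" by (simp add: fps_mult_nth d_def)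
      also have "\<dots> = (\<Sum>i<N. d i * fps_nth Q (n - i)) + (\<Sum>i\<in>{N..n}. d i * fps_nth Q (n - i))" by (rule split)
      also have "(\<Sum>i<N. d i * fps_nth Q (n - i)) \<le> C * bb n" using n0(2)[OF n(1)] b by (simp add: divide_simps)
      also have "(\<Sum>i\<in>{N..n}. d i * fps_nth Q (n - i)) \<le> (\<Sum>i\<in>{N..n}. (K * bb i) * fps_nth Q (n - i))"
      proof (intro sum_mono)
        fix i assume "i \<in> {N..n}"
        thus "d i * fps_nth Q (n - i) \<le> (K * bb i) * fps_nth Q (n - i)"
          using less.IH[of i] N(2) Qnn Q0 by (cases "i = n") (auto intro!: mult_right_mono)
      qed
      also have "\<dots> = K * (fps_nth (Q * Abs_fps bb) n - (\<Sum>i<N. bb i * fps_nth Q (n - i)))"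
        using split[of bb] by (simp add: mult.commute[of Q] fps_mult_nth sum_distrib_left mult.assoc)
      also have "\<dots> \<le> K * ((1 + S) / 2 * bb n)"
        using n0(1)[OF n(1)] b K0 by (intro mult_left_mono) (auto simp: diff_divide_distrib[symmetric] divide_simps)
      also have "C * bb n + K * ((1 + S) / 2 * bb n) \<le> K * bb n"
      proof -
        have "2 * C / (1 - S) \<le> K" by (simp add: K_def)
        hence "C \<le> K * (1 - S) / 2" using S1 by (simp add: divide_simps)
        hence "C * bb n \<le> K * (1 - S) / 2 * bb n" using b by (intro mult_right_mono) auto
        thus ?thesis by (simp add: field_simps)
      qed
      finally show ?thesis by simp
    qed
  qed
  thus ?thesis using K0 unfolding d_def by blast
qed

lemma renewal_summable: "summable (fps_nth D)"
proof -
  obtain K where K: "K \<ge> 0" "\<forall>n>0. fps_nth D n \<le> K * bb n" using renewal_bounded by blast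
  show ?thesis
    by (rule summable_comparison_test'[OF summable_mult[OF bb_summable, of K], of 1]) (use K renewal_nonneg in auto)
qed

lemma renewal_suminf: "suminf (fps_nth D) = 1 / (1 - S)"
proof -
  have "fps_nth (Q * D) sums (S * suminf (fps_nth D))"
    using fps_mult_sums[of Q D] Qnn renewal_nonneg Q_summable renewal_summable by (simp add: S_def)
  moreover have "(\<lambda>n. if n = 0 then 1 else 0 :: real) sums 1" using sums_If_finite[of "\<lambda>n. n = 0" "\<lambda>_. 1 :: real"] by simp
  ultimately have "(\<lambda>n. (if n = 0 then 1 else 0) + fps_nth (Q * D) n) sums (1 + S * suminf (fps_nth D))"
    by (intro sums_add)
  moreover have "(\<lambda>n. (if n = 0 then 1 else 0) + fps_nth (Q * D) n) = fps_nth D"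
    by (intro ext, subst (2) D_eq) simp
  ultimately have "suminf (fps_nth D) = 1 + S * suminf (fps_nth D)" by (simp add: sums_iff)
  thus ?thesis using S1 by (simp add: field_simps)
qed

text \<open>The candidate limit rs is the fixed point of r = S * r + \<kappa> / (1 - S): the two
  summands come from the halves of Q * D in which Q, respectively D, carries the small index. The
  deviation x from it contracts by the factor S.\<close>

lemma renewal_subcritical: "(\<lambda>n. fps_nth D n / bb n) \<longlonglongrightarrow> \<kappa> / (1 - S)^2"
proof -
  define d where "d = fps_nth D"
  define rs where "rs = \<kappa> / (1 - S)^2"
  define x where "x = (\<lambda>n. if n = 0 then 0 else d n / bb n - rs)"
  obtain K where K: "K \<ge> 0" "\<And>n. n > 0 \<Longrightarrow> d n \<le> K * bb n" using renewal_bounded unfolding d_def by blast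
  have d0: "d n \<ge> 0" for n using renewal_nonneg by (simp add: d_def)
  have rs: "rs * S + \<kappa> * (1 / (1 - S)) = rs" using S1 unfolding rs_def by (simp add: divide_simps power2_eq_square) (simp add: algebra_simps)
  have A: "(\<lambda>n. (\<Sum>j\<le>n div 2. fps_nth Q j * bb (n - j)) / bb n) \<longlonglongrightarrow> 1 * S"
    unfolding S_def
  proof (rule tannery_half[OF asymp_bb_abs_summable[OF Qas], where K = 4])
    show "(\<lambda>n. bb n / bb n) \<longlonglongrightarrow> 1"
      by (rule bb_div_self_lim)
  qed (auto simp: bb_pos bb_shift_lim bb_le_4 half_cuts)
  have B: "(\<lambda>n. (\<Sum>j\<le>(n - 1) div 2. d j * fps_nth Q (n - j)) / bb n) \<longlonglongrightarrow> \<kappa> * (1 / (1 - S))"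
    unfolding renewal_suminf[symmetric] d_def
    by (rule tannery_half[where K = 4])
       (use renewal_summable renewal_nonneg Qas in \<open>auto simp: bb_pos bb_shift_lim bb_le_4 half_cuts[unfolded One_nat_def]\<close>)
  define e where "e = (\<lambda>n. rs * ((\<Sum>j\<le>n div 2. fps_nth Q j * bb (n - j)) / bb n) + (\<Sum>j\<le>(n - 1) div 2. d j * fps_nth Q (n - j)) / bb n - rs)"
  have e: "e \<longlonglongrightarrow> 0"
  proof -
    have "e \<longlonglongrightarrow> rs * (1 * S) + \<kappa> * (1 / (1 - S)) - rs"
      unfolding e_def by (intro tendsto_intros A B)
    thus ?thesis using rs by simp
  qed
  have xe: "x n = (\<Sum>j\<le>n div 2. fps_nth Q j * bb (n - j) * x (n - j)) / bb n + e n" if "n > 0" for n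
  proof -
    have b: "bb n > 0" using that bb_pos by simp
    have "d n = fps_nth (Q * D) n" unfolding d_def by (subst D_eq) (use that in simp)
    also have "\<dots> = (\<Sum>j\<le>n div 2. fps_nth Q j * d (n - j)) + (\<Sum>j\<le>(n - 1) div 2. d j * fps_nth Q (n - j))"
      using that by (simp add: fps_mult_nth_halves d_def)
    also have "(\<Sum>j\<le>n div 2. fps_nth Q j * d (n - j)) = (\<Sum>j\<le>n div 2. fps_nth Q j * bb (n - j) * x (n - j) + rs * (fps_nth Q j * bb (n - j)))"
    proof (intro sum.cong refl)
      fix j assume "j \<in> {..n div 2}"
      hence nj: "n - j > 0" using that by auto
      hence "d (n - j) = bb (n - j) * (x (n - j) + rs)" using bb_pos[OF nj] by (simp add: x_def)
      thus "fps_nth Q j * d (n - j) = fps_nth Q j * bb (n - j) * x (n - j) + rs * (fps_nth Q j * bb (n - j))"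
        by (simp add: algebra_simps)
    qed
    finally show ?thesis using that b by (simp add: x_def e_def sum.distrib sum_distrib_left add_divide_distrib)
  qed
  have "x \<longlonglongrightarrow> 0"
  proof (rule eventually_contraction_imp_null)
    have rs0: "rs \<ge> 0" using kappa_nonneg by (simp add: rs_def)
    show "\<bar>x n\<bar> \<le> K + rs" for n
    proof (cases "n = 0")
      case False
      have "0 \<le> d n / bb n" "d n / bb n \<le> K" using K(2)[of n] False bb_pos[of n] d0[of n] by (auto simp: divide_simps)
      thus ?thesis using False rs0 by (auto simp: x_def)
    qed (use K rs0 in \<open>auto simp: x_def\<close>)
    show "0 \<le> S" "S < 1" using S_nonneg S1 by auto
    fix u \<epsilon> :: real assume u: "u \<ge> 0" and \<epsilon>: "\<epsilon> > 0" and ev: "\<forall>\<^sub>F n in sequentially. \<bar>x n\<bar> \<le> u"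
    then obtain N where N: "\<And>n. n \<ge> N \<Longrightarrow> \<bar>x n\<bar> \<le> u" by (auto simp: eventually_sequentially)
    have "(\<lambda>n. ((\<Sum>j\<le>n div 2. fps_nth Q j * bb (n - j)) / bb n) * u + \<bar>e n\<bar>) \<longlonglongrightarrow> (1 * S) * u + \<bar>0\<bar>"
      by (intro tendsto_intros A e)
    hence "\<forall>\<^sub>F n in sequentially. ((\<Sum>j\<le>n div 2. fps_nth Q j * bb (n - j)) / bb n) * u + \<bar>e n\<bar> < S * u + \<epsilon>"
      using \<epsilon> by (intro order_tendstoD) auto
    thus "\<forall>\<^sub>F n in sequentially. \<bar>x n\<bar> \<le> S * u + \<epsilon>" using eventually_gt_at_top[of "2 * N"]
    proof eventually_elim
      case (elim n)
      hence n: "n > 0" by auto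
      have b: "bb n > 0" using n bb_pos by simp
      have "\<bar>\<Sum>j\<le>n div 2. fps_nth Q j * bb (n - j) * x (n - j)\<bar> \<le> (\<Sum>j\<le>n div 2. fps_nth Q j * bb (n - j) * u)"
        unfolding real_norm_def[symmetric]
      proof (rule sum_norm_le)
        fix j assume "j \<in> {..n div 2}"
        hence "n - j \<ge> N" using elim by auto
        thus "norm (fps_nth Q j * bb (n - j) * x (n - j)) \<le> fps_nth Q j * bb (n - j) * u"
          using N Qnn bb_nonneg by (simp add: abs_mult mult_left_mono)
      qed
      hence "\<bar>(\<Sum>j\<le>n div 2. fps_nth Q j * bb (n - j) * x (n - j)) / bb n\<bar> \<le> (\<Sum>j\<le>n div 2. fps_nth Q j * bb (n - j)) / bb n * u"
        using b by (simp add: abs_divide divide_right_mono sum_distrib_right)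
      thus ?case using xe[OF n] elim by linarith
    qed
  qed
  hence "(\<lambda>n. x n + rs) \<longlonglongrightarrow> 0 + rs" by (intro tendsto_intros)
  moreover have "\<forall>\<^sub>F n in sequentially. x n + rs = d n / bb n"
    using eventually_gt_at_top[of 0] by eventually_elim (simp add: x_def)
  ultimately show ?thesis unfolding rs_def d_def using tendsto_cong by fastforce
qed

end

text \<open>The number s = 1 - B(x) satisfies s^2 = 1 - x; nonnegativity, from B(x) \<le> B(1) = 1,
  selects the root.\<close>

lemma bb_powser: "0 \<le> x \<Longrightarrow> x < 1 \<Longrightarrow> (\<lambda>n. bb n * x ^ n) sums (1 - sqrt (1 - x))"
proof -
  assume x: "0 \<le> x" "x < 1"
  have le: "bb n * x ^ n \<le> bb n" for n using x bb_nonneg[of n] power_le_one[of x n] by (simp add: mult_left_le)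
  have sm: "summable (\<lambda>n. bb n * x ^ n)"
    by (rule summable_comparison_test'[OF bb_summable, of 0]) (use le x bb_nonneg in auto)
  define s where "s = 1 - (\<Sum>n. bb n * x ^ n)"
  have s0: "s \<ge> 0" using suminf_le[OF le sm bb_summable] bb_sums by (simp add: s_def sums_iff)
  define f where "f = Abs_fps (\<lambda>n. fps_nth (Sfps :: real fps) n * x ^ n)"
  have one: "(\<lambda>n. if n = 0 then 1 else 0 :: real) sums 1" using sums_If_finite[of "\<lambda>n. n = 0" "\<lambda>_. 1 :: real"] by simp
  have "(\<lambda>n. (if n = 0 then 1 else 0) - bb n * x ^ n) sums s"
    unfolding s_def by (intro sums_diff one summable_sums sm)
  moreover have fn: "fps_nth f = (\<lambda>n. (if n = 0 then 1 else 0) - bb n * x ^ n)"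
    by (intro ext) (auto simp: f_def Sfps_def algebra_simps)
  ultimately have f: "fps_nth f sums s" by simp
  have fa: "summable (\<lambda>n. norm (fps_nth f n))"
  proof (rule summable_comparison_test'[of "\<lambda>n. (if n = 0 then 1 else 0) + bb n * x ^ n" 0])
    show "summable (\<lambda>n. (if n = 0 then 1 else 0) + bb n * x ^ n)" using one sm by (intro summable_add) (auto simp: sums_iff)
  qed (use bb_nonneg x in \<open>auto simp: fn\<close>)
  have "fps_nth (f * f) = (\<lambda>n. fps_nth (1 - fps_X) n * x ^ n)"
  proof
    fix n
    have "fps_nth (f * f) n = fps_nth (Sfps * Sfps :: real fps) n * x ^ n"
      unfolding fps_mult_nth sum_distrib_right f_def
      by (intro sum.cong refl) (simp add: power_add[symmetric] algebra_simps flip: power_add)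
    thus "fps_nth (f * f) n = fps_nth (1 - fps_X) n * x ^ n" by (simp add: Sfps_square)
  qed
  moreover have "(\<lambda>n. fps_nth (1 - fps_X) n * x ^ n) sums (1 - x)"
  proof -
    have "(\<lambda>n. fps_nth (1 - fps_X) n * x ^ n) sums (\<Sum>n\<in>{0,1}. fps_nth (1 - fps_X) n * x ^ n)"
      by (rule sums_finite) auto
    thus ?thesis by simp
  qed
  ultimately have "s * s = 1 - x"
    using fps_mult_sums[OF fa fa] f by (simp add: sums_iff)
  hence "s = sqrt (1 - x)" using s0 real_sqrt_unique[of s "1 - x"] by (simp add: power2_eq_square)
  hence "(\<Sum>n. bb n * x ^ n) = 1 - sqrt (1 - x)" by (simp add: s_def)
  thus ?thesis using summable_sums[OF sm] by simp
qed

lemma one_minus_power_le: "0 \<le> x \<Longrightarrow> x \<le> 1 \<Longrightarrow> 1 - x ^ n \<le> real n * (1 - x)" for x :: real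
  using Bernoulli_inequality[of "x - 1" n] by (simp add: algebra_simps)

text \<open>Termwise comparison of Q with \<kappa> * \<open>bb\<close>: finitely many terms
  contribute O(1 - x), the others an \<epsilon>-fraction of sqrt (1 - x). It serves to identify the
  \<eta> of the theorem, known only through the expansion of Q from the left, with the coefficient
  constant \<kappa>.\<close>

lemma abelian_sqrt:
  fixes Q :: "nat \<Rightarrow> real"
  assumes Qas: "(\<lambda>n. Q n / bb n) \<longlonglongrightarrow> \<kappa>"
  shows "((\<lambda>x. (suminf Q - (\<Sum>n. Q n * x ^ n)) / sqrt (1 - x)) \<longlongrightarrow> \<kappa>) (at_left 1)"
proof -
  have Qa: "summable (\<lambda>n. \<bar>Q n\<bar>)" by (rule asymp_bb_abs_summable[OF Qas])
  have Qs: "summable Q" by (rule summable_rabs_cancel[OF Qa])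
  have "((\<lambda>x. (suminf Q - (\<Sum>n. Q n * x ^ n)) / sqrt (1 - x) - \<kappa>) \<longlongrightarrow> 0) (at_left 1)"
  proof (rule tendstoI)
    fix \<epsilon> :: real assume \<epsilon>: "\<epsilon> > 0"
    have "\<forall>\<^sub>F n in sequentially. dist (Q n / bb n) \<kappa> < \<epsilon> / 2" using tendstoD[OF Qas, of "\<epsilon>/2"] \<epsilon> by simp
    then obtain N where N: "\<And>n. n \<ge> N \<Longrightarrow> \<bar>Q n / bb n - \<kappa>\<bar> < \<epsilon> / 2" by (auto simp: eventually_sequentially dist_real_def)
    define e where "e = (\<lambda>n. Q n - \<kappa> * bb n)"
    have e: "\<bar>e n\<bar> \<le> \<epsilon> / 2 * bb n" if "n \<ge> Suc N" for n
    proof -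
      have b: "bb n > 0" using that bb_pos by simp
      have "Q n / bb n - \<kappa> = e n / bb n" using b by (simp add: e_def field_simps)
      hence "\<bar>e n\<bar> / bb n < \<epsilon> / 2" using N[of n] that b by (simp add: abs_divide)
      thus ?thesis using b by (simp add: divide_simps mult.commute)
    qed
    define C where "C = (\<Sum>n<Suc N. \<bar>e n\<bar> * real n)"
    have C0: "C \<ge> 0" unfolding C_def by (intro sum_nonneg) auto
    have main: "\<bar>(suminf Q - (\<Sum>n. Q n * x ^ n)) / sqrt (1 - x) - \<kappa>\<bar> \<le> C * sqrt (1 - x) + \<epsilon> / 2" if x: "0 < x" "x < 1" for x
    proof -
      have Qx: "summable (\<lambda>n. Q n * x ^ n)"
      proof (rule summable_comparison_test'[OF Qa, of 0])
        show "norm (Q n * x ^ n) \<le> \<bar>Q n\<bar>" for n using x power_le_one[of x n] by (simp add: abs_mult mult_left_le)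
      qed
      have bs: "(\<lambda>n. bb n * (1 - x ^ n)) sums sqrt (1 - x)"
        using sums_diff[OF bb_sums bb_powser[of x]] x by (simp add: algebra_simps)
      have Qd: "(\<lambda>n. Q n * (1 - x ^ n)) sums (suminf Q - (\<Sum>n. Q n * x ^ n))"
        using sums_diff[OF summable_sums[OF Qs] summable_sums[OF Qx]] by (simp add: algebra_simps)
      have es: "(\<lambda>n. e n * (1 - x ^ n)) sums (suminf Q - (\<Sum>n. Q n * x ^ n) - \<kappa> * sqrt (1 - x))"
        using sums_diff[OF Qd sums_mult[OF bs, of \<kappa>]] by (simp add: e_def algebra_simps)
      have fs: "(\<lambda>n. if n < Suc N then \<bar>e n\<bar> * real n * (1 - x) else 0) sums (C * (1 - x))"
      proof -
        have "(\<lambda>n. if n < Suc N then \<bar>e n\<bar> * real n * (1 - x) else 0) sums (\<Sum>n<Suc N. if n < Suc N then \<bar>e n\<bar> * real n * (1 - x) else 0)"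
          by (rule sums_finite) auto
        thus ?thesis by (simp add: C_def sum_distrib_right del: sum.lessThan_Suc)
      qed
      have maj: "(\<lambda>n. (if n < Suc N then \<bar>e n\<bar> * real n * (1 - x) else 0) + \<epsilon> / 2 * (bb n * (1 - x ^ n))) sums (C * (1 - x) + \<epsilon> / 2 * sqrt (1 - x))"
        by (intro sums_add fs sums_mult bs)
      have le: "norm (e n * (1 - x ^ n)) \<le> (if n < Suc N then \<bar>e n\<bar> * real n * (1 - x) else 0) + \<epsilon> / 2 * (bb n * (1 - x ^ n))" for n
      proof -
        have x1: "x ^ n \<le> 1" using x by (intro power_le_one) auto
        show ?thesis
        proof (cases "n < Suc N")
          case True
          have "\<bar>e n\<bar> * (1 - x ^ n) \<le> \<bar>e n\<bar> * (real n * (1 - x))" using one_minus_power_le[of x n] x by (intro mult_left_mono) auto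
          moreover have "0 \<le> \<epsilon> / 2 * (bb n * (1 - x ^ n))" using \<epsilon> bb_nonneg x1 by auto
          ultimately show ?thesis using True x1 by (simp add: abs_mult mult.assoc)
        next
          case False
          hence "\<bar>e n\<bar> * (1 - x ^ n) \<le> \<epsilon> / 2 * bb n * (1 - x ^ n)" using e[of n] x1 by (intro mult_right_mono) auto
          thus ?thesis using False x1 by (simp add: abs_mult mult.assoc)
        qed
      qed
      have "\<bar>suminf Q - (\<Sum>n. Q n * x ^ n) - \<kappa> * sqrt (1 - x)\<bar> \<le> C * (1 - x) + \<epsilon> / 2 * sqrt (1 - x)"
        using norm_suminf_le[OF le sums_summable[OF maj]] sums_unique[OF maj] sums_unique[OF es] by simp
      also have "C * (1 - x) + \<epsilon> / 2 * sqrt (1 - x) = (C * sqrt (1 - x) + \<epsilon> / 2) * sqrt (1 - x)"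
        using x by (simp add: algebra_simps)
      finally have "\<bar>suminf Q - (\<Sum>n. Q n * x ^ n) - \<kappa> * sqrt (1 - x)\<bar> / sqrt (1 - x) \<le> C * sqrt (1 - x) + \<epsilon> / 2"
        using x by (simp add: divide_simps)
      moreover have "(suminf Q - (\<Sum>n. Q n * x ^ n)) / sqrt (1 - x) - \<kappa> = (suminf Q - (\<Sum>n. Q n * x ^ n) - \<kappa> * sqrt (1 - x)) / sqrt (1 - x)"
        using x by (simp add: field_simps)
      ultimately show ?thesis using x by (simp add: abs_divide)
    qed
    have "((\<lambda>x. C * sqrt (1 - x) + \<epsilon> / 2) \<longlongrightarrow> C * sqrt (1 - 1) + \<epsilon> / 2) (at_left 1)"
      by (intro tendsto_intros)
    hence "\<forall>\<^sub>F x in at_left 1. C * sqrt (1 - x) + \<epsilon> / 2 < \<epsilon>" by (rule order_tendstoD) (use \<epsilon> in simp)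
    moreover have "\<forall>\<^sub>F x in at_left 1. x \<in> {0<..<1::real}" by (rule eventually_at_left_real) auto
    ultimately show "\<forall>\<^sub>F x in at_left 1. dist ((suminf Q - (\<Sum>n. Q n * x ^ n)) / sqrt (1 - x) - \<kappa>) 0 < \<epsilon>"
      by eventually_elim (use main in force)
  qed
  thus ?thesis by (simp add: LIM_zero_iff)
qed

section \<open>Power series in the complex unit disc\<close>

lemma has_integral_cis:
  "((\<lambda>\<theta>. cis (of_int j * \<theta>)) has_integral (if j = 0 then of_real (2 * pi) else 0)) {-pi..pi}"
proof (cases "j = 0")
  case True
  thus ?thesis using has_integral_const_real[of "1 :: complex" "-pi" pi] by (simp add: scaleR_conv_of_real)
next
  case False
  have "((\<lambda>\<theta>. cis (of_int j * \<theta>)) has_integral (cis (of_int j * pi) / (\<i> * of_int j) - cis (of_int j * (-pi)) / (\<i> * of_int j))) {-pi..pi}"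
  proof (rule fundamental_theorem_of_calculus)
    fix x :: real assume "x \<in> {-pi..pi}"
    have "((\<lambda>z. exp (\<i> * of_int j * z) / (\<i> * of_int j)) has_field_derivative exp (\<i> * of_int j * of_real x)) (at (of_real x))"
      using False by (auto intro!: derivative_eq_intros)
    hence "((\<lambda>t. exp (\<i> * of_int j * of_real t) / (\<i> * of_int j)) has_vector_derivative exp (\<i> * of_int j * of_real x)) (at x within {-pi..pi})"
      by (rule has_vector_derivative_real_field)
    thus "((\<lambda>\<theta>. cis (of_int j * \<theta>) / (\<i> * of_int j)) has_vector_derivative cis (of_int j * x)) (at x within {-pi..pi})"
      by (simp add: cis_conv_exp mult.assoc)
  qed auto
  moreover have "cis (of_int j * pi) = cis (of_int j * (-pi))"
    using sin_zero_iff_int2[of "of_int j * pi"] by (auto simp: complex_eq_iff)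
  ultimately show ?thesis using False by simp
qed

text \<open>Cauchy's estimate with an integrable majorant g in place of a supremum: on circles close
  to the unit circle the integrand of interest peaks near \<theta> = 0, and only its mean is small
  enough.\<close>

lemma fps_coeff_integral_bound:
  fixes G :: "complex fps" and r :: real
  assumes r: "0 < r" "ereal r < fps_conv_radius G"
    and bnd: "\<And>\<theta>. \<theta> \<in> {-pi..pi} \<Longrightarrow> \<theta> \<noteq> 0 \<Longrightarrow> norm (eval_fps G (of_real r * cis \<theta>)) \<le> g \<theta>"
    and g: "(g has_integral I) {-pi..pi}"
  shows "norm (fps_nth G m) * r ^ m \<le> I / (2 * pi)"
proof -
  define f where "f = (\<lambda>k \<theta>. fps_nth G k * of_real r ^ k * cis (of_int (int k - int m) * \<theta>))"
  define h where "h = (\<lambda>\<theta>. eval_fps G (of_real r * cis \<theta>) * cis (- real m * \<theta>))"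
  have sm: "summable (\<lambda>k. norm (fps_nth G k * of_real r ^ k))"
    using norm_summable_fps[of "of_real r" G] r by simp
  have fe: "f k \<theta> = fps_nth G k * (of_real r * cis \<theta>) ^ k * cis (- real m * \<theta>)" for k \<theta>
  proof -
    have "cis (of_int (int k - int m) * \<theta>) = cis \<theta> ^ k * cis (- real m * \<theta>)"
      by (simp add: Complex.DeMoivre cis_mult left_diff_distrib)
    thus ?thesis by (simp add: f_def power_mult_distrib)
  qed
  have hs: "h \<theta> = (\<Sum>k. f k \<theta>)" for \<theta>
  proof -
    have "(\<lambda>k. fps_nth G k * (of_real r * cis \<theta>) ^ k) sums eval_fps G (of_real r * cis \<theta>)"
      using sums_eval_fps[of "of_real r * cis \<theta>" G] r by (simp add: norm_mult)
    thus ?thesis unfolding h_def fe by (auto simp: sums_iff suminf_mult2[symmetric])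
  qed
  have ul: "uniform_limit {-pi..pi} (\<lambda>N \<theta>. \<Sum>k<N. f k \<theta>) h sequentially"
    unfolding hs[abs_def] by (rule Weierstrass_m_test[OF _ sm]) (simp add: f_def norm_mult)
  obtain In J where IJ: "\<And>N. ((\<lambda>\<theta>. \<Sum>k<N. f k \<theta>) has_integral In N) {-pi..pi}" "(h has_integral J) {-pi..pi}" "In \<longlonglongrightarrow> J"
    by (rule uniform_limit_integral[OF ul]) (auto simp: f_def intro!: continuous_intros)
  have "In N = fps_nth G m * of_real r ^ m * of_real (2 * pi)" if "N > m" for N
  proof -
    have "((\<lambda>\<theta>. \<Sum>k<N. f k \<theta>) has_integral (\<Sum>k<N. fps_nth G k * of_real r ^ k * (if int k - int m = 0 then of_real (2 * pi) else 0))) {-pi..pi}"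
      unfolding f_def by (intro has_integral_sum has_integral_mult_right has_integral_cis) auto
    also have "(\<Sum>k<N. fps_nth G k * of_real r ^ k * (if int k - int m = 0 then of_real (2 * pi) else 0)) =
        (\<Sum>k<N. if k = m then fps_nth G k * of_real r ^ k * of_real (2 * pi) else 0)"
      by (intro sum.cong) auto
    also have "\<dots> = fps_nth G m * of_real r ^ m * of_real (2 * pi)" using that by simp
    finally show ?thesis using IJ(1)[of N] has_integral_unique by blast
  qed
  hence "In \<longlonglongrightarrow> fps_nth G m * of_real r ^ m * of_real (2 * pi)"
    by (intro tendsto_eventually) (use eventually_gt_at_top[of m] in eventually_elim, simp)
  hence J: "J = fps_nth G m * of_real r ^ m * of_real (2 * pi)" using IJ(3) LIMSEQ_unique by blast
  \<comment> \<open>A negative power of |\<theta>| evaluates to 0 at \<theta> = 0, so the majorant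
    is corrected at this one point.\<close>
  define g' where "g' = (\<lambda>\<theta>. if \<theta> = 0 then norm (h 0) else g \<theta>)"
  have g': "(g' has_integral I) {-pi..pi}"
    by (rule has_integral_spike_finite[OF _ _ g, of "{0}"]) (auto simp: g'_def)
  have "norm J \<le> I"
  proof -
    have "norm (integral {-pi..pi} h) \<le> integral {-pi..pi} g'"
      using IJ(2) g' by (intro integral_norm_bound_integral)
         (auto simp: integrable_on_def, auto simp: g'_def h_def norm_mult intro!: bnd)
    thus ?thesis using IJ(2) g' by (simp add: integral_unique)
  qed
  thus ?thesis using r by (simp add: J norm_mult field_simps norm_power)
qed

lemma norm_one_minus_power_le:
  fixes x :: complex assumes "norm x \<le> 1"
  shows "norm (1 - x ^ n) \<le> real n * norm (1 - x)"
  using norm_power_diff[of 1 x n] assms by simp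

text \<open>Interpolates between the bounds n * |1 - x| and 2. The exponent 3/4 lies above 1/2, to
  be negligible against sqrt (1 - x), and below 1, so that the sum of n powr (3/4) / n^2
  converges.\<close>

lemma norm_one_minus_power_le_powr:
  fixes x :: complex assumes "norm x \<le> 1"
  shows "norm (1 - x ^ n) \<le> 2 * (real n * norm (1 - x)) powr (3/4)"
proof -
  define y where "y = real n * norm (1 - x)"
  have y: "y \<ge> 0" "norm (1 - x ^ n) \<le> y" using norm_one_minus_power_le[OF assms] by (auto simp: y_def)
  have 2: "norm (1 - x ^ n) \<le> 2"
    using norm_triangle_ineq4[of 1 "x ^ n"] power_le_one[of "norm x" n] assms by (simp add: norm_power)
  show ?thesis
  proof (cases "y \<le> 1")
    case True
    have "y \<le> y powr (3/4)"
    proof (cases "y = 0")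
      case False
      thus ?thesis using powr_mono'[of "3/4" 1 y] True y by simp
    qed auto
    thus ?thesis using y by (simp add: y_def[symmetric])
  next
    case False
    hence "1 \<le> y powr (3/4)" by (intro ge_one_powr_ge_zero) auto
    thus ?thesis using 2 by (simp add: y_def[symmetric])
  qed
qed

lemma summable_powr_54: "summable (\<lambda>n. (real n + 1) powr (-5/4))"
  using summable_Suc_iff[of "\<lambda>n. real n powr (-5/4)"] summable_real_powr_iff[of "-5/4"] by (simp add: add.commute)

text \<open>Both estimates leave the summable weights (n + 1) powr (-5/4): the first by
  interpolation, the second by extracting (n + 1) powr (-1/4) from the decay of |x|^n. They control
  the error part of Q and its derivative.\<close>

lemma powser_inverse_sq_bound:
  fixes e :: "nat \<Rightarrow> real" and x :: complex
  assumes e: "\<And>n. \<bar>e n\<bar> \<le> K / (real n + 1)^2" and x: "norm x < 1"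
  defines "Z \<equiv> (\<Sum>n. (real n + 1) powr (-5/4))"
  shows "norm (\<Sum>n. of_real (e n) * (1 - x ^ n)) \<le> 2 * K * Z * norm (1 - x) powr (3/4)"
    and "norm (\<Sum>n. of_nat (Suc n) * of_real (e (Suc n)) * x ^ n) \<le> K * Z * (1 - norm x) powr (-1/4)"
proof -
  have K: "K \<ge> 0" using e[of 0] abs_ge_zero[of "e 0"] by auto
  have 1: "norm (of_real (e n) * (1 - x ^ n)) \<le> (real n + 1) powr (-5/4) * (2 * K * norm (1 - x) powr (3/4))" for n
  proof -
    have "norm (of_real (e n) * (1 - x ^ n)) \<le> (K / (real n + 1)^2) * (2 * (real n * norm (1 - x)) powr (3/4))"
      unfolding norm_mult using e[of n] norm_one_minus_power_le_powr[of x n] x K by (intro mult_mono) auto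
    also have "\<dots> \<le> (K / (real n + 1)^2) * (2 * ((real n + 1) * norm (1 - x)) powr (3/4))"
      using K by (intro mult_left_mono powr_mono2 mult_right_mono) auto
    also have "\<dots> = (real n + 1) powr (3/4) / (real n + 1) powr 2 * (2 * K * norm (1 - x) powr (3/4))"
      by (simp add: powr_mult)
    also have "(real n + 1) powr (3/4) / (real n + 1) powr 2 = (real n + 1) powr (-5/4)"
      by (simp add: powr_diff[symmetric] del: powr_numeral)
    finally show ?thesis .
  qed
  have s1: "summable (\<lambda>n. (real n + 1) powr (-5/4) * (2 * K * norm (1 - x) powr (3/4)))"
    by (intro summable_mult2 summable_powr_54)
  show "norm (\<Sum>n. of_real (e n) * (1 - x ^ n)) \<le> 2 * K * Z * norm (1 - x) powr (3/4)"
    using norm_suminf_le[OF 1 s1] suminf_mult2[OF summable_powr_54, of "2 * K * norm (1 - x) powr (3/4)"]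
    by (simp add: Z_def mult_ac)
  define r where "r = norm x"
  have r: "0 \<le> r" "r < 1" using x by (auto simp: r_def)
  \<comment> \<open>Comparison of r^m with a geometric sum; the power 1/4 of this bound trades the
    decay of r^n for (n + 1) powr (-1/4).\<close>
  have geo: "(real m + 1) * (1 - r) * r ^ m \<le> 1" for m
  proof -
    have "(real m + 1) * r ^ m = (\<Sum>k<Suc m. r ^ m)" by simp
    also have "\<dots> \<le> (\<Sum>k<Suc m. r ^ k)" using r by (intro sum_mono power_decreasing) auto
    also have "\<dots> = (1 - r ^ Suc m) / (1 - r)" using r by (subst sum_gp_strict) auto
    also have "\<dots> \<le> 1 / (1 - r)" using r by (intro divide_right_mono) auto
    finally show ?thesis using r by (simp add: field_simps)
  qed
  have 2: "norm (of_nat (Suc n) * of_real (e (Suc n)) * x ^ n) \<le> (real n + 1) powr (-5/4) * (K * (1 - r) powr (-1/4))" for n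
  proof -
    have rn: "r ^ n \<le> ((real n + 1) * (1 - r)) powr (-1/4)"
    proof -
      have p: "(real n + 1) * (1 - r) > 0" using r by simp
      have "r ^ n \<le> (r ^ n) powr (1/4)"
      proof (cases "r ^ n = 0")
        case False
        thus ?thesis using powr_mono'[of "1/4" 1 "r ^ n"] r by (simp add: power_le_one)
      next
        case True
        thus ?thesis by (simp only: True) simp
      qed
      also have "\<dots> \<le> (1 / ((real n + 1) * (1 - r))) powr (1/4)"
        using geo[of n] r p by (intro powr_mono2) (auto simp: pos_le_divide_eq mult_ac)
      also have "\<dots> = ((real n + 1) * (1 - r)) powr (-1/4)" using p by (simp add: powr_divide powr_minus_divide)
      finally show ?thesis .
    qed
    have "norm (of_nat (Suc n) :: complex) = real n + 1" by (simp only: norm_of_nat)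
    hence "norm (of_nat (Suc n) * of_real (e (Suc n)) * x ^ n) = (real n + 1) * \<bar>e (Suc n)\<bar> * r ^ n"
      by (simp add: norm_mult norm_power r_def del: of_nat_Suc)
    also have "\<dots> \<le> (real n + 1) * (K / (real n + 1)^2) * ((real n + 1) * (1 - r)) powr (-1/4)"
    proof (intro mult_mono rn mult_left_mono)
      have "\<bar>e (Suc n)\<bar> \<le> K / (real (Suc n) + 1)^2" by (rule e)
      also have "\<dots> \<le> K / (real n + 1)^2" using K by (intro divide_left_mono power_mono) auto
      finally show "\<bar>e (Suc n)\<bar> \<le> K / (real n + 1)^2" .
    qed (use r K in auto)
    also have "\<dots> = (real n + 1) powr (-1/4) / (real n + 1) powr 1 * (K * (1 - r) powr (-1/4))"
      using r by (simp add: powr_mult power2_eq_square)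
    also have "(real n + 1) powr (-1/4) / (real n + 1) powr 1 = (real n + 1) powr (-5/4)"
      by (simp only: powr_diff[symmetric]) simp
    finally show ?thesis .
  qed
  have s2: "summable (\<lambda>n. (real n + 1) powr (-5/4) * (K * (1 - r) powr (-1/4)))"
    by (intro summable_mult2 summable_powr_54)
  show "norm (\<Sum>n. of_nat (Suc n) * of_real (e (Suc n)) * x ^ n) \<le> K * Z * (1 - norm x) powr (-1/4)"
    using norm_suminf_le[OF 2 s2] suminf_mult2[OF summable_powr_54, of "K * (1 - r) powr (-1/4)"]
    by (simp add: Z_def r_def mult_ac)
qed

lemma fps_conv_radius_ge_1:
  assumes "\<And>n. norm (fps_nth f n) \<le> 1"
  shows "fps_conv_radius (f :: complex fps) \<ge> 1"
  unfolding fps_conv_radius_def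
proof (rule conv_radius_geI_ex)
  fix r :: real assume r: "0 < r" "ereal r < 1"
  have "summable (\<lambda>n. fps_nth f n * of_real r ^ n)"
  proof (rule summable_comparison_test'[of "\<lambda>n. r ^ n" 0])
    show "norm (fps_nth f n * of_real r ^ n) \<le> r ^ n" for n
      using assms[of n] r by (simp add: norm_mult norm_power mult_left_le_one_le)
  qed (use r in simp)
  thus "\<exists>z. norm z = r \<and> summable (\<lambda>n. fps_nth f n * z ^ n)" using r by (intro exI[of _ "of_real r"]) auto
qed

lemma eval_Sfps_sq:
  assumes "norm (x :: complex) < 1"
  shows "eval_fps Sfps x ^ 2 = 1 - x" and "eval_fps Cfps x * eval_fps Sfps x = 1"
    and "fps_conv_radius (Sfps :: complex fps) \<ge> 1" and "fps_conv_radius (Cfps :: complex fps) \<ge> 1"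
proof -
  show S: "fps_conv_radius (Sfps :: complex fps) \<ge> 1"
  proof (rule fps_conv_radius_ge_1)
    fix n show "norm (fps_nth (Sfps :: complex fps) n) \<le> 1"
      using sum_bb_le[of "{n}"] bb_nonneg[of n] by (cases n) (auto simp: Sfps_def)
  qed
  show C: "fps_conv_radius (Cfps :: complex fps) \<ge> 1"
  proof (rule fps_conv_radius_ge_1)
    fix n have "cc n \<le> 1"
    proof (induction n)
      case (Suc n)
      have "cc n * ((2 * real n + 1) / (2 * real n + 2)) \<le> 1 * 1" using Suc by (intro mult_mono) auto
      thus ?case by (simp add: cc_Suc)
    qed auto
    thus "norm (fps_nth (Cfps :: complex fps) n) \<le> 1" using cc_pos[of n] by (simp add: Cfps_def)
  qed
  have x: "ereal (norm x) < fps_conv_radius (Sfps :: complex fps)" "ereal (norm x) < fps_conv_radius (Cfps :: complex fps)"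
    using assms by (auto intro: less_le_trans[OF _ S] less_le_trans[OF _ C])
  show "eval_fps Sfps x ^ 2 = 1 - x"
    using eval_fps_mult[OF x(1) x(1)] by (simp add: Sfps_square power2_eq_square eval_fps_diff)
  show "eval_fps Cfps x * eval_fps Sfps x = 1"
    using eval_fps_mult[OF x(2) x(1)] by (simp add: Cfps_Sfps)
qed

text \<open>For r \<ge> 1/2 the squared distance is at least 1 - cos \<theta> = 2 *
  sin(\<theta>/2)^2, and sin t \<ge> t/3 on [0, pi/2] turns this into \<theta>^2 / 18, which exceeds
  \<theta>^2 / 25.\<close>

lemma norm_one_minus_cis_ge:
  assumes "1/2 \<le> r" "r < 1" "\<bar>\<theta>\<bar> \<le> pi"
  shows "norm (1 - of_real r * cis \<theta>) \<ge> \<bar>\<theta>\<bar> / 5" and "norm (1 - of_real r * cis \<theta>) \<ge> 1 - r"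
proof -
  show "norm (1 - of_real r * cis \<theta>) \<ge> 1 - r"
    using norm_triangle_ineq2[of 1 "of_real r * cis \<theta>"] assms by (simp add: norm_mult)
  define t where "t = \<bar>\<theta>\<bar> / 2"
  have t: "0 \<le> t" "t \<le> pi / 2" using assms by (auto simp: t_def)
  have cost: "cos \<theta> = 1 - 2 * sin t ^ 2"
    using cos_double_sin[of t] by (simp add: t_def abs_if split: if_splits)
  have "sin t \<ge> t / 3"
  proof (cases "t \<le> pi / 3")
    case True
    have "(\<lambda>x. sin x - x / 3) 0 \<le> (\<lambda>x. sin x - x / 3) t"
    proof (rule DERIV_nonneg_imp_nondecreasing[OF t(1)])
      fix x assume x: "0 \<le> x" "x \<le> t"
      have "cos (pi / 3) \<le> cos x" using x True by (intro cos_monotone_0_pi_le) auto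
      hence "cos x - 1 / 3 \<ge> 0" by (simp add: cos_60)
      moreover have "((\<lambda>x. sin x - x / 3) has_real_derivative (cos x - 1 / 3)) (at x)" by (auto intro!: derivative_eq_intros)
      ultimately show "\<exists>y. ((\<lambda>x. sin x - x / 3) has_real_derivative y) (at x) \<and> y \<ge> 0" by blast
    qed
    thus ?thesis by simp
  next
    case False
    have "sin t \<ge> sin (pi / 3)" using False t by (intro sin_monotone_2pi_le) auto
    moreover have "sqrt 3 / 2 \<ge> (2 / 3 :: real)"
      using real_le_rsqrt[of "4/3" 3] by (simp add: power2_eq_square)
    moreover have "t / 3 \<le> 2 / 3" using t pi_less_4 by simp
    ultimately show ?thesis by (simp add: sin_60)
  qed
  hence "sin t ^ 2 \<ge> (t / 3) ^ 2" using t by (intro power_mono) auto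
  hence s: "sin t ^ 2 \<ge> t ^ 2 / 9" by (simp add: power_divide)
  have "norm (1 - of_real r * cis \<theta>) ^ 2 = (1 - r * cos \<theta>)^2 + (r * sin \<theta>)^2"
    by (simp add: cmod_power2)
  also have "\<dots> = (1 - r)^2 + 2 * r * (1 - cos \<theta>)"
  proof -
    have "(r * sin \<theta>)^2 = r^2 * (1 - cos \<theta> ^ 2)" by (simp add: power_mult_distrib sin_squared_eq)
    thus ?thesis by (simp add: power2_eq_square algebra_simps)
  qed
  also have "\<dots> \<ge> 0 + 1 * (1 - cos \<theta>)" using assms by (intro add_mono mult_right_mono) auto
  finally have "norm (1 - of_real r * cis \<theta>) ^ 2 \<ge> 2 * sin t ^ 2" by (simp add: cost)
  hence "norm (1 - of_real r * cis \<theta>) ^ 2 \<ge> 2 * (t ^ 2 / 9)" using s by linarith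
  moreover have "2 * (t ^ 2 / 9) \<ge> (\<bar>\<theta>\<bar> / 5) ^ 2" by (simp add: t_def power_divide)
  ultimately have "(\<bar>\<theta>\<bar> / 5) ^ 2 \<le> norm (1 - of_real r * cis \<theta>) ^ 2" by linarith
  thus "norm (1 - of_real r * cis \<theta>) \<ge> \<bar>\<theta>\<bar> / 5" by (rule power2_le_imp_le) auto
qed


lemma fps_deriv_of_inverse:
  fixes f g :: "'a :: comm_ring_1 fps"
  assumes "f * g = 1"
  shows "fps_deriv f = - (fps_deriv g * (f * f))"
proof -
  have "fps_deriv (f * g) = 0" using assms by simp
  hence "f * fps_deriv g + fps_deriv f * g = 0" by simp
  hence *: "fps_deriv f * g = - (f * fps_deriv g)" by (simp add: eq_neg_iff_add_eq_0 add.commute)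
  have "fps_deriv f = fps_deriv f * (f * g)" using assms by simp
  also have "\<dots> = f * (fps_deriv f * g)" by (simp only: mult_ac)
  also have "\<dots> = - (fps_deriv g * (f * f))" unfolding * by (simp add: mult_ac)
  finally show ?thesis .
qed

lemma has_integral_abs_powr:
  assumes "a > -1"
  shows "((\<lambda>\<theta>. \<bar>\<theta>\<bar> powr a) has_integral (2 * (pi powr (a + 1) / (a + 1)))) {-pi..pi}"
proof -
  have 1: "((\<lambda>x. \<bar>x\<bar> powr a) has_integral (pi powr (a+1) / (a+1))) {0..pi}"
    using has_integral_powr_from_0[OF assms, of pi] by (rule has_integral_eq[rotated]) auto
  have 2: "((\<lambda>x. \<bar>x\<bar> powr a) has_integral (pi powr (a+1) / (a+1))) {-pi..-0}"
    using iffD2[OF has_integral_reflect_real, OF 1] by simp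
  show ?thesis using has_integral_combine[OF _ _ 2[simplified] 1] by simp
qed


text \<open>Equality would force \<open>x ^ n = 1\<close> at two consecutive exponents.\<close>
lemma powser_neq_1:
  fixes Q :: "nat \<Rightarrow> real" and x :: complex
  assumes Qnn: "\<And>n. Q n \<ge> 0" and Qs: "summable Q" and Q1: "suminf Q = 1"
    and Qpos: "\<And>n. n \<ge> n0 \<Longrightarrow> Q n > 0" and x: "norm x \<le> 1" "x \<noteq> 1"
  shows "(\<Sum>n. of_real (Q n) * x ^ n) \<noteq> 1"
proof
  assume eq: "(\<Sum>n. of_real (Q n) * x ^ n) = 1"
  have xn: "norm (x ^ n) \<le> 1" for n using x by (simp add: norm_power power_le_one)
  have "summable (\<lambda>n. of_real (Q n) * x ^ n)"
  proof (rule summable_comparison_test'[OF Qs, of 0])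
    show "norm (of_real (Q n) * x ^ n) \<le> Q n" for n
      using Qnn[of n] xn[of n] by (simp add: norm_mult mult_left_le)
  qed
  hence s: "(\<lambda>n. of_real (Q n) * x ^ n) sums 1" using eq by (simp add: sums_iff)
  have "(\<lambda>n. Q n * (1 - Re (x ^ n))) sums (1 - 1)"
    using sums_diff[OF summable_sums[OF Qs] sums_Re[OF s]] Q1 by (simp add: algebra_simps)
  hence z: "(\<lambda>n. Q n * (1 - Re (x ^ n))) sums 0" by simp
  have nn: "Q n * (1 - Re (x ^ n)) \<ge> 0" for n
    using Qnn[of n] xn[of n] complex_Re_le_cmod[of "x ^ n"] by auto
  have "Q n * (1 - Re (x ^ n)) = 0" for n
    using z nn suminf_eq_zero_iff[of "\<lambda>n. Q n * (1 - Re (x ^ n))"] by (auto simp: sums_iff)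
  hence R: "Re (x ^ n) = 1" if "n \<ge> n0" for n using Qpos[OF that] by (metis diff_eq_diff_eq diff_self less_irrefl mult_eq_0_iff)
  have "x ^ n = 1" if "n \<ge> n0" for n
  proof -
    have "Re (x ^ n) ^ 2 + Im (x ^ n) ^ 2 \<le> 1" using xn[of n] by (simp add: cmod_power2[symmetric] power_le_one)
    hence "Im (x ^ n) = 0" using R[OF that] by simp
    thus ?thesis using R[OF that] by (simp add: complex_eq_iff)
  qed
  from this[of n0] this[of "Suc n0"] have "x = 1" by simp
  thus False using x by simp
qed

text \<open>In the critical case the derivative of \<open>D(x) - (1 - x) powr (-1/2) / \<kappa>\<close> has integral \<open>O(n powr (3/8))\<close> over the circle of radius
  \<open>1 - 1/n\<close>, so the \<open>n\<close>-th coefficient of the difference is \<open>O(n powr (-5/8))\<close>.\<close>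
context
  fixes Q D :: "real fps" and \<kappa> K :: real and n0 :: nat
  assumes Qnn: "\<And>n. fps_nth Q n \<ge> 0" and Q0: "fps_nth Q 0 = 0"
    and Qr: "srate \<kappa> K Q" and \<kappa>: "\<kappa> > 0"
    and Q1: "suminf (fps_nth Q) = 1"
    and Qpos: "\<And>n. n \<ge> n0 \<Longrightarrow> fps_nth Q n > 0"
    and D_eq: "D = 1 + Q * D"
begin

private definition e where "e n = fps_nth Q n - \<kappa> * bb n"
private definition q where "q x = (\<Sum>n. of_real (fps_nth Q n) * x ^ n)" for x :: complex
private definition Qc :: "complex fps" where "Qc = Abs_fps (\<lambda>n. of_real (fps_nth Q n))"
private definition Dc :: "complex fps" where "Dc = Abs_fps (\<lambda>n. of_real (fps_nth D n))"
private definition ec :: "complex fps" where "ec = Abs_fps (\<lambda>n. of_real (e n))"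

lemma crit_Q_summable: "summable (fps_nth Q)" by (rule srate_summable[OF Qr])

lemma crit_e_bound: "\<bar>e n\<bar> \<le> K / (real n + 1)^2"
  using Qr by (simp add: srate_def e_def)

lemma crit_Q_norm_summable: "norm x \<le> 1 \<Longrightarrow> summable (\<lambda>n. norm (of_real (fps_nth Q n) * x ^ n))" for x :: complex
proof (rule summable_comparison_test'[OF crit_Q_summable, of 0])
  fix n assume "norm x \<le> 1"
  thus "norm (norm (of_real (fps_nth Q n) * x ^ n)) \<le> fps_nth Q n"
    using Qnn[of n] power_le_one[of "norm x" n] by (simp add: norm_mult norm_power mult_left_le)
qed

lemma crit_Q_continuous: "continuous_on (cball 0 1) q"
proof -
  have "uniform_limit (cball 0 1) (\<lambda>N x. \<Sum>n<N. of_real (fps_nth Q n) * x ^ n) q sequentially"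
    unfolding q_def
  proof (rule Weierstrass_m_test[OF _ crit_Q_summable])
    fix n and x :: complex assume "x \<in> cball 0 1"
    thus "norm (of_real (fps_nth Q n) * x ^ n) \<le> fps_nth Q n"
      using Qnn[of n] power_le_one[of "norm x" n] by (simp add: norm_mult norm_power mult_left_le)
  qed
  thus ?thesis by (rule uniform_limit_theorem[rotated]) (auto intro!: always_eventually continuous_intros)
qed

lemma crit_Q_neq_1:
  assumes "norm x \<le> 1" "x \<noteq> 1"
  shows "q x \<noteq> 1"
  unfolding q_def by (rule powser_neq_1[OF Qnn crit_Q_summable Q1 Qpos assms])

lemma crit_D_bounds: "0 \<le> fps_nth D n \<and> fps_nth D n \<le> 1"
proof (induction n rule: less_induct)
  case (less n)
  show ?case
  proof (cases "n = 0")
    case True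
    have "fps_nth D 0 = 1" by (subst D_eq) (simp add: Q0)
    thus ?thesis using True by simp
  next
    case False
    have Dn: "fps_nth D n = (\<Sum>i=0..n. fps_nth Q i * fps_nth D (n - i))"
      by (subst D_eq) (simp add: fps_mult_nth False)
    have b: "0 \<le> fps_nth Q i * fps_nth D (n - i) \<and> fps_nth Q i * fps_nth D (n - i) \<le> fps_nth Q i" if "i \<in> {0..n}" for i
      using less[of "n - i"] Qnn[of i] Q0 that False by (cases "i = 0") (auto simp: mult_left_le)
    have "(\<Sum>i=0..n. fps_nth Q i * fps_nth D (n - i)) \<le> (\<Sum>i=0..n. fps_nth Q i)" using b by (intro sum_mono) auto
    also have "\<dots> \<le> 1" using sum_le_suminf[OF crit_Q_summable, of "{0..n}"] Qnn Q1 by simp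
    finally show ?thesis unfolding Dn using b by (auto intro!: sum_nonneg)
  qed
qed

lemma crit_radius: "fps_conv_radius Qc \<ge> 1" "fps_conv_radius Dc \<ge> 1" "fps_conv_radius ec \<ge> 1"
proof -
  have "fps_nth Q n \<le> 1" for n using sum_le_suminf[OF crit_Q_summable, of "{n}"] Qnn Q1 by simp
  thus "fps_conv_radius Qc \<ge> 1" using Qnn by (intro fps_conv_radius_ge_1) (auto simp: Qc_def)
  thus "fps_conv_radius Dc \<ge> 1" using crit_D_bounds by (intro fps_conv_radius_ge_1) (auto simp: Dc_def)
  have "ec = Qc + fps_const (of_real \<kappa>) * (Sfps - 1)"
    by (rule fps_ext) (simp add: ec_def Qc_def Sfps_def e_def)
  moreover have "fps_conv_radius (Qc + fps_const (of_real \<kappa>) * (Sfps - 1)) \<ge> 1"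
    by (intro order.trans[OF _ fps_conv_radius_add] order.trans[OF _ fps_conv_radius_mult] order.trans[OF _ fps_conv_radius_diff] min.boundedI)
       (auto simp: eval_Sfps_sq[of 0] \<open>fps_conv_radius Qc \<ge> 1\<close>)
  ultimately show "fps_conv_radius ec \<ge> 1" by simp
qed

lemma crit_eval:
  assumes x: "norm x < 1"
  shows "eval_fps Qc x = q x" and "eval_fps Dc x * (1 - q x) = 1"
    and "1 - q x = of_real \<kappa> * eval_fps Sfps x + (\<Sum>n. of_real (e n) * (1 - x ^ n))"
    and "eval_fps (fps_deriv ec) x = (\<Sum>n. of_nat (Suc n) * of_real (e (Suc n)) * x ^ n)"
proof -
  show qe: "eval_fps Qc x = q x" by (simp add: eval_fps_def Qc_def q_def)
  have xr: "ereal (norm x) < fps_conv_radius Qc" "ereal (norm x) < fps_conv_radius Dc"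
    using x by (auto intro: less_le_trans[OF _ crit_radius(1)] less_le_trans[OF _ crit_radius(2)])
  have fe: "Dc = 1 + Qc * Dc"
  proof (rule fps_ext)
    fix n
    have "fps_nth D n = fps_nth 1 n + (\<Sum>i=0..n. fps_nth Q i * fps_nth D (n - i))"
      by (subst D_eq) (simp add: fps_mult_nth)
    thus "fps_nth Dc n = fps_nth (1 + Qc * Dc) n"
      by (simp add: Dc_def Qc_def fps_mult_nth flip: of_real_mult of_real_sum)
  qed
  have "eval_fps (1 + Qc * Dc) x = 1 + eval_fps Qc x * eval_fps Dc x"
    using xr by (subst eval_fps_add) (auto simp: eval_fps_mult intro: less_le_trans[OF _ fps_conv_radius_mult])
  thus "eval_fps Dc x * (1 - q x) = 1" using fe qe by (simp add: algebra_simps)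
  have bs: "(\<lambda>n. of_real (bb n) * x ^ n) sums (1 - eval_fps Sfps x)"
  proof -
    have "ereal (norm x) < fps_conv_radius (Sfps :: complex fps)" using x by (auto intro: less_le_trans[OF _ eval_Sfps_sq(3)[OF x]])
    from sums_eval_fps[OF this]
    have "(\<lambda>n. (if n = 0 then 1 else 0) - fps_nth Sfps n * x ^ n) sums (1 - eval_fps Sfps x)"
      using sums_If_finite[of "\<lambda>n. n = 0" "\<lambda>_. 1 :: complex"] by (intro sums_diff) auto
    moreover have "(\<lambda>n. (if n = 0 then 1 else 0) - fps_nth Sfps n * x ^ n) = (\<lambda>n. of_real (bb n) * x ^ n)"
      by (intro ext) (auto simp: Sfps_def)
    ultimately show ?thesis by simp
  qed
  have qs: "(\<lambda>n. of_real (fps_nth Q n) * x ^ n) sums q x"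
    using summable_sums[OF summable_norm_cancel[OF crit_Q_norm_summable[of x]]] x by (simp add: q_def)
  have Q1c: "(\<lambda>n. of_real (fps_nth Q n)) sums (1 :: complex)"
    using sums_of_real[OF summable_sums[OF crit_Q_summable], where 'a = complex] Q1 by simp
  have b1c: "(\<lambda>n. of_real (bb n)) sums (1 :: complex)"
    using sums_of_real[OF bb_sums, where 'a = complex] by simp
  have "(\<lambda>n. (of_real (fps_nth Q n) - of_real (fps_nth Q n) * x ^ n) - of_real \<kappa> * (of_real (bb n) - of_real (bb n) * x ^ n))
     sums ((1 - q x) - of_real \<kappa> * (1 - (1 - eval_fps Sfps x)))"
    by (intro sums_diff sums_mult Q1c b1c qs bs)
  hence "(\<lambda>n. of_real (e n) * (1 - x ^ n)) sums ((1 - q x) - of_real \<kappa> * eval_fps Sfps x)"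
    by (simp add: e_def algebra_simps)
  thus "1 - q x = of_real \<kappa> * eval_fps Sfps x + (\<Sum>n. of_real (e n) * (1 - x ^ n))"
    by (simp add: sums_iff)
  show "eval_fps (fps_deriv ec) x = (\<Sum>n. of_nat (Suc n) * of_real (e (Suc n)) * x ^ n)"
    by (simp add: eval_fps_def ec_def)
qed

text \<open>Near 1 the term \<kappa> * sqrt (1 - x) dominates the error of exponent 3/4; on the rest
  of the closed disc 1 - q has no zero, and compactness gives a positive minimum.\<close>

lemma crit_lower: "\<exists>A>0. \<forall>x. norm x < 1 \<longrightarrow> norm (1 - q x) \<ge> A * norm (1 - x) powr (1/2)"
proof -
  define Z where "Z = (\<Sum>n. (real n + 1) powr (-5/4))"
  define K1 where "K1 = \<bar>2 * K * Z\<bar> + 1"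
  have K1: "K1 > 0" by (simp add: K1_def)
  \<comment> \<open>Chosen so that K1 * \<delta> powr (1/4) = \<kappa> / 2, half of the leading
    constant.\<close>
  define \<delta> where "\<delta> = (\<kappa> / (2 * K1)) powr 4"
  have \<delta>: "\<delta> > 0" using \<kappa> K1 by (simp add: \<delta>_def)
  have near: "norm (1 - q x) \<ge> (\<kappa> / 2) * norm (1 - x) powr (1/2)" if x: "norm x < 1" "norm (1 - x) < \<delta>" for x
  proof -
    define y where "y = norm (1 - x)"
    have y: "y \<ge> 0" by (simp add: y_def)
    have "norm (eval_fps Sfps x) ^ 2 = y" using eval_Sfps_sq(1)[OF x(1)] by (simp add: norm_power[symmetric] y_def)
    hence sy: "norm (eval_fps Sfps x) = y powr (1/2)" by (metis norm_ge_zero powr_half_sqrt real_sqrt_unique y)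
    have "norm (\<Sum>n. of_real (e n) * (1 - x ^ n)) \<le> 2 * K * Z * y powr (3/4)"
      unfolding Z_def y_def by (rule powser_inverse_sq_bound(1)[OF crit_e_bound x(1)])
    also have "\<dots> \<le> K1 * y powr (3/4)" by (intro mult_right_mono) (auto simp: K1_def)
    also have "y powr (3/4) = y powr (1/4) * y powr (1/2)" by (simp only: powr_add[symmetric]) simp
    also have "y powr (1/4) \<le> \<kappa> / (2 * K1)"
    proof -
      have "y powr (1/4) \<le> \<delta> powr (1/4)" using x(2) y by (intro powr_mono2) (auto simp: y_def)
      thus ?thesis using \<kappa> K1 by (simp add: \<delta>_def powr_powr del: powr_numeral)
    qed
    finally have "norm (\<Sum>n. of_real (e n) * (1 - x ^ n)) \<le> \<kappa> / 2 * y powr (1/2)" using K1 by (simp add: mult_left_mono mult_right_mono)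
    moreover have "norm (1 - q x) \<ge> norm (of_real \<kappa> * eval_fps Sfps x) - norm (\<Sum>n. of_real (e n) * (1 - x ^ n))"
      unfolding crit_eval(3)[OF x(1)] by (rule norm_diff_ineq)
    ultimately show ?thesis using \<kappa> by (simp add: norm_mult sy y_def[symmetric])
  qed
  define X where "X = cball 0 1 - ball (1 :: complex) \<delta>"
  have "\<exists>m>0. \<forall>x\<in>X. norm (1 - q x) \<ge> m"
  proof (cases "X = {}")
    case False
    have "compact X" unfolding X_def by (intro compact_diff) auto
    moreover have "continuous_on X (\<lambda>x. norm (1 - q x))"
      by (intro continuous_intros continuous_on_subset[OF crit_Q_continuous]) (auto simp: X_def)
    ultimately obtain z where z: "z \<in> X" "\<And>x. x \<in> X \<Longrightarrow> norm (1 - q z) \<le> norm (1 - q x)"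
      using continuous_attains_inf[of X] False by blast
    have "z \<noteq> 1" using z(1) \<delta> by (auto simp: X_def)
    hence "q z \<noteq> 1" using crit_Q_neq_1[of z] z(1) by (auto simp: X_def)
    thus ?thesis using z by (intro exI[of _ "norm (1 - q z)"]) auto
  qed (auto intro: exI[of _ 1])
  then obtain m where m: "m > 0" "\<And>x. x \<in> X \<Longrightarrow> norm (1 - q x) \<ge> m" by blast
  show ?thesis
  proof (intro exI[of _ "min (\<kappa> / 2) (m / 2)"] conjI allI impI)
    show "0 < min (\<kappa> / 2) (m / 2)" using \<kappa> m by auto
    fix x :: complex assume x: "norm x < 1"
    show "norm (1 - q x) \<ge> min (\<kappa> / 2) (m / 2) * norm (1 - x) powr (1/2)"
    proof (cases "norm (1 - x) < \<delta>")
      case True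
      have "min (\<kappa> / 2) (m / 2) * norm (1 - x) powr (1/2) \<le> (\<kappa> / 2) * norm (1 - x) powr (1/2)"
        by (intro mult_right_mono) auto
      thus ?thesis using near[OF x True] by simp
    next
      case False
      have "norm (1 - x) \<le> 4" using norm_triangle_ineq4[of 1 x] x by simp
      hence "norm (1 - x) powr (1/2) \<le> 4 powr (1/2)" by (intro powr_mono2) auto
      hence "norm (1 - x) powr (1/2) \<le> 2" by (simp add: powr_half_sqrt)
      hence "min (\<kappa> / 2) (m / 2) * norm (1 - x) powr (1/2) \<le> (m / 2) * 2"
        using m by (intro mult_mono) auto
      also have "\<dots> \<le> norm (1 - q x)" using m(2)[of x] False x by (auto simp: X_def dist_norm norm_minus_commute)
      finally show ?thesis .
    qed
  qed
qed

lemma renewal_critical: "(\<lambda>n. fps_nth D n / cc n) \<longlonglongrightarrow> 1 / \<kappa>"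
proof -
  define E where "E = Dc - fps_const (of_real (1 / \<kappa>)) * Cfps"
  define \<epsilon> where "\<epsilon> = (\<lambda>x :: complex. \<Sum>n. of_real (e n) * (1 - x ^ n))"
  obtain A where A: "A > 0" "\<And>x. norm x < 1 \<Longrightarrow> norm (1 - q x) \<ge> A * norm (1 - x) powr (1/2)"
    using crit_lower by blast
  define a where "a = 1 / A"
  define Z where "Z = (\<Sum>n. (real n + 1) powr (-5/4))"
  have a: "a > 0" using A by (simp add: a_def)
  have K0: "K \<ge> 0" using Qr srate_K_nonneg by blast
  have Z0: "Z \<ge> 0" unfolding Z_def by (intro suminf_nonneg summable_powr_54) auto
  have rm: "fps_conv_radius (f * g) \<ge> 1" if "fps_conv_radius f \<ge> 1" "fps_conv_radius g \<ge> 1" for f g :: "complex fps"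
    by (rule order.trans[OF _ fps_conv_radius_mult]) (use that in auto)
  have ra: "fps_conv_radius (f + g) \<ge> 1" if "fps_conv_radius f \<ge> 1" "fps_conv_radius g \<ge> 1" for f g :: "complex fps"
    by (rule order.trans[OF _ fps_conv_radius_add]) (use that in auto)
  have rs: "fps_conv_radius (f - g) \<ge> 1" if "fps_conv_radius f \<ge> 1" "fps_conv_radius g \<ge> 1" for f g :: "complex fps"
    by (rule order.trans[OF _ fps_conv_radius_diff]) (use that in auto)
  have rd: "fps_conv_radius (fps_deriv f) \<ge> 1" if "fps_conv_radius f \<ge> 1" for f :: "complex fps"
    using fps_conv_radius_deriv[of f] that by (rule order.trans[rotated])
  note rC = eval_Sfps_sq(4)[of 0, simplified] and rS = eval_Sfps_sq(3)[of 0, simplified]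
  \<comment> \<open>The derivative of E, by D' = Q' * D^2, Q' = e' + \<kappa>/2 * C and C' = C^3 /
    2; the leading singularities cancel when it is regrouped in \<open>Tv2\<close>.\<close>
  define T where "T = (fps_deriv ec + fps_const (of_real (\<kappa> / 2)) * Cfps) * (Dc * Dc) - fps_const (of_real (1 / (2 * \<kappa>))) * (Cfps * (Cfps * Cfps))"
  have ET: "fps_deriv E = T"
  proof -
    have fe: "Dc = 1 + Qc * Dc"
    proof (rule fps_ext)
      fix n
      have "fps_nth D n = fps_nth 1 n + (\<Sum>i=0..n. fps_nth Q i * fps_nth D (n - i))"
        by (subst D_eq) (simp add: fps_mult_nth)
      thus "fps_nth Dc n = fps_nth (1 + Qc * Dc) n"
        by (simp add: Dc_def Qc_def fps_mult_nth flip: of_real_mult of_real_sum)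
    qed
    hence DQ: "Dc * (1 - Qc) = 1" by (simp add: algebra_simps)
    have 1: "fps_deriv Dc = fps_deriv Qc * (Dc * Dc)"
      using fps_deriv_of_inverse[OF DQ] by simp
    have "fps_deriv (Sfps * Sfps :: complex fps) = fps_deriv (1 - fps_X)" unfolding Sfps_square ..
    hence SS: "Sfps * fps_deriv Sfps + fps_deriv Sfps * Sfps = (-1 :: complex fps)" by simp
    have "fps_deriv Sfps + fps_deriv Sfps = fps_deriv Sfps * (Cfps * Sfps) + fps_deriv Sfps * (Cfps * Sfps :: complex fps)"
      by (simp add: Cfps_Sfps)
    also have "\<dots> = Cfps * (Sfps * fps_deriv Sfps + fps_deriv Sfps * Sfps)" by (simp only: distrib_left mult_ac)
    also have "\<dots> = - Cfps" unfolding SS by simp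
    finally have "fps_const (1/2) * (fps_deriv Sfps + fps_deriv Sfps) = - (fps_const (1/2) * (Cfps :: complex fps))" by simp
    hence 2: "fps_deriv Sfps = - (fps_const (1/2) * (Cfps :: complex fps))"
      by (simp add: distrib_left[symmetric] fps_eq_iff)
    have 3: "fps_deriv Cfps = fps_const (1/2) * (Cfps * (Cfps * Cfps) :: complex fps)"
      using fps_deriv_of_inverse[OF Cfps_Sfps[where 'a = complex]] by (simp add: 2 mult.assoc)
    have "Qc = ec + fps_const (of_real \<kappa>) * (1 - Sfps)"
      by (rule fps_ext) (simp add: ec_def Qc_def Sfps_def e_def)
    hence 4: "fps_deriv Qc = fps_deriv ec + fps_const (of_real (\<kappa> / 2)) * Cfps"
      by (simp add: 2 mult.assoc[symmetric])
    have "fps_deriv E = fps_deriv Dc - fps_const (of_real (1 / \<kappa>)) * fps_deriv Cfps" by (simp add: E_def)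
    also have "fps_const (of_real (1 / \<kappa>)) * fps_deriv (Cfps :: complex fps) =
        (fps_const (of_real (1 / \<kappa>)) * fps_const (1/2)) * (Cfps * (Cfps * Cfps))" unfolding 3 by (rule mult.assoc[symmetric])
    also have "fps_const (of_real (1 / \<kappa>)) * fps_const (1/2 :: complex) = fps_const (of_real (1 / (2 * \<kappa>)))" by simp
    finally show ?thesis unfolding T_def 1 4 .
  qed
  have rT: "fps_conv_radius T \<ge> 1" unfolding T_def
    by (intro rm ra rs rd crit_radius rC) auto
  define K3 where "K3 = K * Z * a^2 + K * Z * a * (a + 1 / \<kappa>)"
  have K3: "K3 \<ge> 0" using K0 Z0 a \<kappa> by (simp add: K3_def)
  \<comment> \<open>With y = |1 - x| and h = 1 - |x| \<le> y, the two parts of T are of order h powr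
    (-1/4) / y and y powr (-5/4). Trading powers of y for powers of h brings both to h powr (-3/8) *
    y powr (-7/8), where the exponent -7/8 is integrable over the circle.\<close>
  have Tb: "norm (eval_fps T x) \<le> K3 * (1 - norm x) powr (-3/8) * norm (1 - x) powr (-7/8)" if x: "norm x < 1" for x
  proof -
    define y where "y = norm (1 - x)"
    define h where "h = 1 - norm x"
    have h: "h > 0" "h \<le> y" using x norm_triangle_ineq2[of 1 x] by (auto simp: h_def y_def)
    have y: "y > 0" using h by simp
    define Ct Dt St et where "Ct = eval_fps Cfps x" and "Dt = eval_fps Dc x" and "St = eval_fps Sfps x" and "et = eval_fps (fps_deriv ec) x"
    have xr: "ereal (norm x) < fps_conv_radius f" if "fps_conv_radius f \<ge> 1" for f :: "complex fps"
      using x by (auto intro: less_le_trans[OF _ that])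
    have Tv: "eval_fps T x = (et + of_real (\<kappa> / 2) * Ct) * (Dt * Dt) - of_real (1 / (2 * \<kappa>)) * (Ct * (Ct * Ct))"
      unfolding T_def Ct_def Dt_def et_def
      by (simp add: eval_fps_diff eval_fps_add eval_fps_mult xr rm ra rs rd crit_radius rC)
    have CS: "Ct * St = 1" unfolding Ct_def St_def by (rule eval_Sfps_sq(2)[OF x])
    have D1: "Dt * (of_real \<kappa> * St + \<epsilon> x) = 1"
      using crit_eval(2,3)[OF x] by (simp add: Dt_def St_def \<epsilon>_def)
    have k0: "of_real \<kappa> \<noteq> (0 :: complex)" using \<kappa> by simp
    \<comment> \<open>A resolvent identity: the difference carries the factor \<epsilon> x, hence an
      additional y powr (3/4).\<close>
    have DC: "Dt - Ct / of_real \<kappa> = - \<epsilon> x * Dt * Ct / of_real \<kappa>"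
    proof -
      have "of_real \<kappa> * Dt = of_real \<kappa> * Dt * (Ct * St)" by (simp add: CS)
      also have "\<dots> = Ct * (1 - Dt * \<epsilon> x)" using D1 by (simp add: algebra_simps) (metis (no_types, lifting) add_diff_cancel_right' distrib_left mult.left_commute mult_1_right right_diff_distrib)
      finally have "Dt = Ct * (1 - Dt * \<epsilon> x) / of_real \<kappa>" using k0 by (simp add: eq_divide_eq mult.commute)
      hence "Dt - Ct / of_real \<kappa> = Ct * (1 - Dt * \<epsilon> x) / of_real \<kappa> - Ct / of_real \<kappa>" by simp
      also have "\<dots> = - \<epsilon> x * Dt * Ct / of_real \<kappa>" by (simp add: diff_divide_distrib[symmetric] algebra_simps)
      finally show ?thesis .
    qed
    have Tv2: "eval_fps T x = et * (Dt * Dt) + of_real (\<kappa> / 2) * Ct * ((- \<epsilon> x * Dt * Ct / of_real \<kappa>) * (Dt + Ct / of_real \<kappa>))"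
      unfolding Tv DC[symmetric] using k0 by (simp add: field_simps)
    have "norm St ^ 2 = y" using eval_Sfps_sq(1)[OF x] by (simp add: norm_power[symmetric] y_def St_def)
    hence nS: "norm St = y powr (1/2)" using y by (metis less_imp_le norm_ge_zero powr_half_sqrt real_sqrt_unique)
    have nC: "norm Ct = y powr (-1/2)"
    proof -
      have "norm Ct * y powr (1/2) = 1" using arg_cong[OF CS, of norm] by (simp add: norm_mult nS)
      thus ?thesis using y by (simp add: powr_minus_divide field_simps)
    qed
    have nD: "norm Dt \<le> a * y powr (-1/2)"
    proof -
      have "norm Dt * norm (1 - q x) = 1" using crit_eval(2)[OF x] by (simp add: Dt_def norm_mult[symmetric])
      moreover have "A * y powr (1/2) \<le> norm (1 - q x)" using A(2)[OF x] by (simp add: y_def)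
      ultimately have "norm Dt * (A * y powr (1/2)) \<le> 1" by (metis mult_left_mono norm_ge_zero)
      thus ?thesis using y A by (simp add: a_def powr_minus_divide field_simps)
    qed
    have ne: "norm (\<epsilon> x) \<le> 2 * K * Z * y powr (3/4)"
      unfolding \<epsilon>_def Z_def y_def by (rule powser_inverse_sq_bound(1)[OF crit_e_bound x])
    have net: "norm et \<le> K * Z * h powr (-1/4)"
      unfolding et_def Z_def h_def crit_eval(4)[OF x] by (rule powser_inverse_sq_bound(2)[OF crit_e_bound x])
    have "norm (et * (Dt * Dt)) \<le> (K * Z * h powr (-1/4)) * ((a * y powr (-1/2)) * (a * y powr (-1/2)))"
      unfolding norm_mult using net nD K0 Z0 a by (intro mult_mono) auto
    also have "\<dots> = K * Z * a^2 * h powr (-1/4) * (y powr (-1/2) * y powr (-1/2))" by (simp add: power2_eq_square)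
    also have "y powr (-1/2) * y powr (-1/2) = y powr (-1/8) * y powr (-7/8)" by (simp only: powr_add[symmetric]) simp
    also have "K * Z * a^2 * h powr (-1/4) * (y powr (-1/8) * y powr (-7/8)) \<le> K * Z * a^2 * h powr (-1/4) * (h powr (-1/8) * y powr (-7/8))"
      using K0 Z0 h by (intro mult_left_mono mult_right_mono powr_mono2') auto
    also have "\<dots> = K * Z * a^2 * ((h powr (-1/4) * h powr (-1/8)) * y powr (-7/8))" by simp
    also have "h powr (-1/4) * h powr (-1/8) = h powr (-3/8)" by (simp only: powr_add[symmetric]) simp
    finally have p1: "norm (et * (Dt * Dt)) \<le> K * Z * a^2 * (h powr (-3/8) * y powr (-7/8))" .
    have "norm (of_real (\<kappa> / 2) * Ct * ((- \<epsilon> x * Dt * Ct / of_real \<kappa>) * (Dt + Ct / of_real \<kappa>))) =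
       (norm Ct * norm Ct) * norm (\<epsilon> x) * norm Dt * norm (Dt + Ct / of_real \<kappa>) / 2"
      using \<kappa> by (simp add: norm_mult norm_divide)
    also have "\<dots> \<le> (y powr (-1/2) * y powr (-1/2)) * (2 * K * Z * y powr (3/4)) * (a * y powr (-1/2)) * ((a + 1 / \<kappa>) * y powr (-1/2)) / 2"
    proof (intro divide_right_mono mult_mono ne nD)
      have "norm (Dt + Ct / of_real \<kappa>) \<le> norm Dt + norm Ct / \<kappa>"
        using norm_triangle_ineq[of Dt "Ct / of_real \<kappa>"] \<kappa> by (simp add: norm_divide)
      also have "\<dots> \<le> (a + 1 / \<kappa>) * y powr (-1/2)" using nD nC by (simp add: algebra_simps)
      finally show "norm (Dt + Ct / of_real \<kappa>) \<le> (a + 1 / \<kappa>) * y powr (-1/2)" .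
    qed (use nC K0 Z0 a \<kappa> in auto)
    also have "\<dots> = K * Z * a * (a + 1 / \<kappa>) * (y powr (-1/2) * y powr (-1/2) * y powr (3/4) * y powr (-1/2) * y powr (-1/2))"
      by simp
    also have "y powr (-1/2) * y powr (-1/2) * y powr (3/4) * y powr (-1/2) * y powr (-1/2) = y powr (-3/8) * y powr (-7/8)"
      by (simp only: powr_add[symmetric]) simp
    also have "K * Z * a * (a + 1 / \<kappa>) * (y powr (-3/8) * y powr (-7/8)) \<le> K * Z * a * (a + 1 / \<kappa>) * (h powr (-3/8) * y powr (-7/8))"
      using K0 Z0 h a \<kappa> by (intro mult_left_mono mult_right_mono powr_mono2') auto
    finally have p2: "norm (of_real (\<kappa> / 2) * Ct * ((- \<epsilon> x * Dt * Ct / of_real \<kappa>) * (Dt + Ct / of_real \<kappa>)))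
       \<le> K * Z * a * (a + 1 / \<kappa>) * (h powr (-3/8) * y powr (-7/8))" .
    have "norm (eval_fps T x) \<le> K * Z * a^2 * (h powr (-3/8) * y powr (-7/8)) + K * Z * a * (a + 1 / \<kappa>) * (h powr (-3/8) * y powr (-7/8))"
      unfolding Tv2 using norm_triangle_ineq p1 p2 add_mono order.trans by blast
    thus ?thesis by (simp add: K3_def h_def y_def algebra_simps)
  qed
  define K4 where "K4 = K3 * 5 powr (7/8) * (2 * (pi powr (-7/8 + 1) / (-7/8 + 1))) / (2 * pi) * exp 1"
  have K4: "K4 \<ge> 0" using K3 by (simp add: K4_def)
  have Eb: "norm (fps_nth E n) \<le> K4 * real n powr (-5/8)" if n: "n \<ge> 2" for n
  proof -
    obtain m where m: "n = Suc m" "m \<ge> 1" using n by (cases n) auto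
    define r where "r = 1 - 1 / real n"
    have r: "1/2 \<le> r" "r < 1" "r > 0" using n by (auto simp: r_def field_simps)
    define h where "h = 1 / real n"
    have "norm (fps_nth T m) * r ^ m \<le> (K3 * h powr (-3/8) * 5 powr (7/8) * (2 * (pi powr (-7/8 + 1) / (-7/8 + 1)))) / (2 * pi)"
    proof (rule fps_coeff_integral_bound[where g = "\<lambda>\<theta>. K3 * h powr (-3/8) * 5 powr (7/8) * \<bar>\<theta>\<bar> powr (-7/8)"])
      show "ereal r < fps_conv_radius T" using r by (auto intro: less_le_trans[OF _ rT])
      show "((\<lambda>\<theta>. K3 * h powr (-3/8) * 5 powr (7/8) * \<bar>\<theta>\<bar> powr (-7/8)) has_integral
         K3 * h powr (-3/8) * 5 powr (7/8) * (2 * (pi powr (-7/8 + 1) / (-7/8 + 1)))) {-pi..pi}"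
        by (intro has_integral_mult_right has_integral_abs_powr) auto
      fix \<theta> assume \<theta>: "\<theta> \<in> {-pi..pi}" "\<theta> \<noteq> 0"
      define x where "x = of_real r * cis \<theta>"
      have nx: "norm x = r" using r by (simp add: x_def norm_mult)
      have ge: "norm (1 - x) \<ge> \<bar>\<theta>\<bar> / 5" using norm_one_minus_cis_ge(1)[of r \<theta>] r \<theta> by (auto simp: x_def)
      have "norm (eval_fps T x) \<le> K3 * (1 - norm x) powr (-3/8) * norm (1 - x) powr (-7/8)"
        using r by (intro Tb) (simp add: nx)
      also have "\<dots> \<le> K3 * (1 - norm x) powr (-3/8) * (\<bar>\<theta>\<bar> / 5) powr (-7/8)"
        using ge \<theta> K3 by (intro mult_left_mono powr_mono2') auto
      also have "(\<bar>\<theta>\<bar> / 5) powr (-7/8) = 5 powr (7/8) * \<bar>\<theta>\<bar> powr (-7/8)"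
        by (simp add: powr_divide powr_minus_divide)
      finally show "norm (eval_fps T (of_real r * cis \<theta>)) \<le> K3 * h powr (-3/8) * 5 powr (7/8) * \<bar>\<theta>\<bar> powr (-7/8)"
        by (simp add: nx, simp add: x_def r_def h_def)
    qed (use r in auto)
    hence "norm (fps_nth T m) * r ^ m * exp 1 \<le> (K3 * h powr (-3/8) * 5 powr (7/8) * (2 * (pi powr (-7/8 + 1) / (-7/8 + 1)))) / (2 * pi) * exp 1"
      by (intro mult_right_mono) auto
    hence "norm (fps_nth T m) * r ^ m * exp 1 \<le> K4 * h powr (-3/8)"
      by (simp add: K4_def mult_ac)
    \<comment> \<open>With r = m / (m + 1), the factor r^m is at least 1/e, so integrating over the
      circle of radius 1 - 1/n costs only a constant.\<close>
    moreover have "r ^ m * exp 1 \<ge> 1"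
    proof -
      have "(1 + 1 / real m) ^ m \<le> exp (1 / real m) ^ m"
        by (intro power_mono exp_ge_add_one_self) auto
      also have "\<dots> = exp 1" using m by (simp add: exp_of_nat_mult[symmetric])
      finally have *: "(1 + 1 / real m) ^ m \<le> exp 1" .
      have "r * (1 + 1 / real m) = 1" using m by (simp add: r_def divide_simps)
      hence "r ^ m * (1 + 1 / real m) ^ m = 1" by (simp add: power_mult_distrib[symmetric])
      thus ?thesis using * r by (metis mult_left_mono zero_le_power less_imp_le)
    qed
    hence "norm (fps_nth T m) * 1 \<le> norm (fps_nth T m) * (r ^ m * exp 1)" by (intro mult_left_mono) auto
    ultimately have "norm (fps_nth T m) \<le> K4 * h powr (-3/8)" by (simp add: mult.assoc)
    moreover have "fps_nth T m = of_nat n * fps_nth E n" unfolding ET[symmetric] by (simp add: m)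
    ultimately have "real n * norm (fps_nth E n) \<le> K4 * h powr (-3/8)"
      by (simp only: norm_mult norm_of_nat)
    also have "h powr (-3/8) = real n powr (3/8)" using n by (simp add: h_def powr_divide powr_minus_divide)
    finally have "norm (fps_nth E n) \<le> K4 * (real n powr (3/8) / real n powr 1)" using n by (simp add: field_simps)
    also have "real n powr (3/8) / real n powr 1 = real n powr (-5/8)" by (simp only: powr_diff[symmetric]) simp
    finally show ?thesis .
  qed
  have "(\<lambda>n. fps_nth D n / cc n - 1 / \<kappa>) \<longlonglongrightarrow> 0"
  proof (rule Lim_null_comparison)
    show "\<forall>\<^sub>F n in sequentially. norm (fps_nth D n / cc n - 1 / \<kappa>) \<le> K4 * (real n powr (-5/8) * sqrt (pi * (real n + 1/2)))"
      using eventually_ge_at_top[of 2]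
    proof eventually_elim
      case (elim n)
      have c: "cc n > 0" by (rule cc_pos)
      have "fps_nth E n = of_real (fps_nth D n - 1 / \<kappa> * cc n)" by (simp add: E_def Dc_def Cfps_def)
      hence "norm (fps_nth E n) = \<bar>fps_nth D n - 1 / \<kappa> * cc n\<bar>" by (simp only: norm_of_real)
      hence "\<bar>fps_nth D n - 1 / \<kappa> * cc n\<bar> \<le> K4 * real n powr (-5/8)" using Eb[OF elim] by simp
      moreover have "fps_nth D n / cc n - 1 / \<kappa> = (fps_nth D n - 1 / \<kappa> * cc n) * (1 / cc n)" using c by (simp add: diff_divide_distrib)
      moreover have "1 / cc n \<le> sqrt (pi * (real n + 1/2))"
      proof -
        have "sqrt (pi * (real n + 1/2)) > 0" by simp
        thus ?thesis using cc_lower[of n] c by (simp add: divide_simps mult.commute split: if_splits)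
      qed
      ultimately have "norm (fps_nth D n / cc n - 1 / \<kappa>) \<le> (K4 * real n powr (-5/8)) * sqrt (pi * (real n + 1/2))"
        using c K4 by (simp only: real_norm_def abs_mult) (intro mult_mono, auto)
      thus ?case by simp
    qed
    show "(\<lambda>n. K4 * (real n powr (-5/8) * sqrt (pi * (real n + 1/2)))) \<longlonglongrightarrow> 0"
      by (intro tendsto_mult_right_zero) real_asymp
  qed
  thus ?thesis by (simp add: LIM_zero_iff)
qed

end

section \<open>A local limit theorem with error term\<close>

text \<open>The tail beyond R is compared with the first moment: 1 \<le> x / R there, and the
  integral of x * exp (-x^2) over the half-line is 1/2.\<close>

lemma gauss_integral_partial:
  assumes R: "R > 0"
  shows "\<exists>I. ((\<lambda>x::real. exp (- x\<^sup>2)) has_integral I) {0..R} \<and> \<bar>I - sqrt pi / 2\<bar> \<le> 1 / (2 * R)"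
proof -
  have G: "((\<lambda>x::real. exp (- x\<^sup>2)) has_integral (sqrt pi / 2)) {0..}"
  proof -
    have "((\<lambda>x::real. indicator {0..} x *\<^sub>R exp (- x\<^sup>2)) has_integral (sqrt pi / 2)) UNIV"
      using has_integral_integral_lborel[OF conjunct1[OF gaussian_moment_0[unfolded has_bochner_integral_iff]]]
      unfolding has_bochner_integral_integral_eq[OF gaussian_moment_0] .
    also have "(\<lambda>x::real. indicator {0..} x *\<^sub>R exp (- x\<^sup>2)) = (\<lambda>x. if x \<in> {0..} then exp (- x\<^sup>2) else 0)"
      by (auto simp: indicator_def)
    finally show ?thesis by (simp only: has_integral_restrict_UNIV)
  qed
  have H: "((\<lambda>x::real. exp (- x\<^sup>2) * x) has_integral (1 / 2)) {0..}"
  proof -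
    have "((\<lambda>x::real. indicator {0..} x *\<^sub>R (exp (- x\<^sup>2) * x)) has_integral (1 / 2)) UNIV"
      using has_integral_integral_lborel[OF conjunct1[OF gaussian_moment_1[unfolded has_bochner_integral_iff]]]
      unfolding has_bochner_integral_integral_eq[OF gaussian_moment_1] .
    also have "(\<lambda>x::real. indicator {0..} x *\<^sub>R (exp (- x\<^sup>2) * x)) = (\<lambda>x. if x \<in> {0..} then exp (- x\<^sup>2) * x else 0)"
      by (auto simp: indicator_def)
    finally show ?thesis by (simp only: has_integral_restrict_UNIV)
  qed
  have "(\<lambda>x::real. exp (- x\<^sup>2)) integrable_on {0..R}" by (intro integrable_continuous_real continuous_intros)
  then obtain I where I: "((\<lambda>x::real. exp (- x\<^sup>2)) has_integral I) {0..R}" by (auto simp: integrable_on_def)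
  have "(\<lambda>x::real. exp (- x\<^sup>2) * x) integrable_on {0..R}" by (intro integrable_continuous_real continuous_intros)
  then obtain J where J: "((\<lambda>x::real. exp (- x\<^sup>2) * x) has_integral J) {0..R}" by (auto simp: integrable_on_def)
  have J0: "J \<ge> 0" by (rule has_integral_nonneg[OF J]) auto
  have n: "negligible ({0..R} - {0..})" by (rule negligible_subset[of "{}"]) auto
  have GI: "((\<lambda>x::real. exp (- x\<^sup>2)) has_integral (sqrt pi / 2 - I)) ({0..} - {0..R})"
    by (rule has_integral_setdiff[OF G I n])
  have HJ: "((\<lambda>x::real. exp (- x\<^sup>2) * x) has_integral (1 / 2 - J)) ({0..} - {0..R})"
    by (rule has_integral_setdiff[OF H J n])
  have 1: "sqrt pi / 2 - I \<ge> 0" by (rule has_integral_nonneg[OF GI]) auto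
  have "sqrt pi / 2 - I \<le> (1 / 2 - J) * (1 / R)"
  proof (rule has_integral_le[OF GI has_integral_mult_left[OF HJ]])
    fix x assume "x \<in> {0..} - {0..R}"
    hence "x \<ge> R" by auto
    hence "1 \<le> x * (1 / R)" using R by (simp add: field_simps)
    hence "exp (- x\<^sup>2) * 1 \<le> exp (- x\<^sup>2) * (x * (1 / R))" by (intro mult_left_mono) auto
    thus "exp (- x\<^sup>2) \<le> exp (- x\<^sup>2) * x * (1 / R)" by (simp add: mult_ac)
  qed
  also have "\<dots> \<le> (1 / 2) * (1 / R)" using J0 R by (intro mult_right_mono) auto
  finally show ?thesis using I 1 by auto
qed

lemma has_integral_even_extend:
  fixes f :: "real \<Rightarrow> 'a :: banach"
  assumes "(f has_integral I) {0..b}" "b \<ge> 0" "\<And>x. f (-x) = f x"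
  shows "(f has_integral (I + I)) {-b..b}"
proof -
  have "((\<lambda>x. f (-x)) has_integral I) {-b..-0}" using has_integral_reflect_lemma_real[OF assms(1)] .
  hence "(f has_integral I) {-b..0}" by (simp add: assms(3))
  thus ?thesis using has_integral_combine[of "-b" 0 b f I I] assms by simp
qed

lemma gauss_integral_pi:
  assumes a: "a > 0"
  shows "\<exists>I. ((\<lambda>x::real. exp (- a * x\<^sup>2)) has_integral I) {-pi..pi} \<and> \<bar>I - sqrt (pi / a)\<bar> \<le> 1 / a"
proof -
  define R where "R = sqrt a * pi"
  have sa: "sqrt a > 0" using a by simp
  have R: "R > 0" using sa by (simp add: R_def)
  obtain I where I: "((\<lambda>x::real. exp (- x\<^sup>2)) has_integral I) {0..R}" "\<bar>I - sqrt pi / 2\<bar> \<le> 1 / (2 * R)"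
    using gauss_integral_partial[OF R] by blast
  have "((\<lambda>x. exp (- (sqrt a * x)\<^sup>2)) has_integral (I / sqrt a)) ((\<lambda>x. x / sqrt a) ` {0..R})"
    using has_integral_stretch_real[OF I(1), of "sqrt a"] sa by (simp add: divide_inverse mult.commute)
  moreover have "(\<lambda>x. x / sqrt a) ` {0..R} = {0..pi}"
    using sa image_divide_atLeastAtMost[of "sqrt a" 0 R] by (simp add: R_def)
  ultimately have "((\<lambda>x. exp (- a * x\<^sup>2)) has_integral (I / sqrt a)) {0..pi}"
    using a by (simp add: power_mult_distrib)
  hence "((\<lambda>x. exp (- a * x\<^sup>2)) has_integral (I / sqrt a + I / sqrt a)) {-pi..pi}"
    by (rule has_integral_even_extend) auto
  moreover have "\<bar>(I / sqrt a + I / sqrt a) - sqrt (pi / a)\<bar> \<le> 1 / a"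
  proof -
    have "(I / sqrt a + I / sqrt a) - sqrt (pi / a) = (I - sqrt pi / 2) * (2 / sqrt a)"
      using a by (simp add: real_sqrt_divide field_simps)
    hence "\<bar>(I / sqrt a + I / sqrt a) - sqrt (pi / a)\<bar> = \<bar>I - sqrt pi / 2\<bar> * (2 / sqrt a)"
      using sa by (simp only: abs_mult) simp
    also have "\<dots> \<le> 1 / (2 * R) * (2 / sqrt a)" using I(2) sa by (intro mult_right_mono) auto
    also have "\<dots> = 1 / (pi * a)" using a by (simp add: R_def field_simps)
    also have "\<dots> \<le> 1 / (1 * a)" using a pi_ge_two by (intro divide_left_mono mult_right_mono) auto
    finally show ?thesis by simp
  qed
  ultimately show ?thesis by blast
qed

text \<open>The first absolute moment will absorb the phase factor of the Fourier integral; the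
  third one, treated next, absorbs the cubic Taylor error of the characteristic function.\<close>

lemma gauss_moment_1_pi:
  assumes a: "a > 0"
  shows "\<exists>I. ((\<lambda>x::real. \<bar>x\<bar> * exp (- a * x\<^sup>2)) has_integral I) {-pi..pi} \<and> I \<le> 1 / a"
proof -
  have "((\<lambda>x. x * exp (- a * x\<^sup>2)) has_integral (- exp (- a * pi\<^sup>2) / (2 * a) - - exp (- a * 0\<^sup>2) / (2 * a))) {0..pi}"
    by (rule fundamental_theorem_of_calculus)
       (use a in \<open>auto intro!: derivative_eq_intros simp: has_real_derivative_iff_has_vector_derivative[symmetric]\<close>)
  hence "((\<lambda>x. \<bar>x\<bar> * exp (- a * x\<^sup>2)) has_integral (- exp (- a * pi\<^sup>2) / (2 * a) - - exp (- a * 0\<^sup>2) / (2 * a))) {0..pi}"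
    by (rule has_integral_eq[rotated]) auto
  from has_integral_even_extend[OF this]
  have "((\<lambda>x. \<bar>x\<bar> * exp (- a * x\<^sup>2)) has_integral (1 / a - exp (- a * pi\<^sup>2) / a)) {-pi..pi}" by simp
  moreover have "1 / a - exp (- a * pi\<^sup>2) / a \<le> 1 / a" using a by simp
  ultimately show ?thesis by blast
qed

lemma gauss_moment_3_pi:
  assumes a: "a > 0"
  shows "\<exists>I. ((\<lambda>x::real. \<bar>x\<bar> ^ 3 * exp (- a * x\<^sup>2)) has_integral I) {-pi..pi} \<and> I \<le> 1 / a\<^sup>2"
proof -
  have "((\<lambda>x. x ^ 3 * exp (- a * x\<^sup>2)) has_integral (- (1 + a * pi\<^sup>2) * exp (- a * pi\<^sup>2) / (2 * a\<^sup>2) - - (1 + a * 0\<^sup>2) * exp (- a * 0\<^sup>2) / (2 * a\<^sup>2))) {0..pi}"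
  proof (rule fundamental_theorem_of_calculus)
    fix x assume "x \<in> {0..pi}"
    have d1: "((\<lambda>x. exp (- a * x\<^sup>2)) has_real_derivative (exp (- a * x\<^sup>2) * (- (2 * a * x)))) (at x within {0..pi})"
      by (auto intro!: derivative_eq_intros)
    have d2: "((\<lambda>x. - (1 + a * x\<^sup>2)) has_real_derivative - (2 * a * x)) (at x within {0..pi})"
      by (auto intro!: derivative_eq_intros)
    have alg: "- (2 * a * x) * e + e * (- (2 * a * x)) * - (1 + a * x\<^sup>2) = (2 * a\<^sup>2) * (x ^ 3 * e)" for e
      by (simp add: algebra_simps power2_eq_square power3_eq_cube)
    have "((\<lambda>x. - (1 + a * x\<^sup>2) * exp (- a * x\<^sup>2) / (2 * a\<^sup>2)) has_real_derivative
      (2 * a\<^sup>2) * (x ^ 3 * exp (- a * x\<^sup>2)) / (2 * a\<^sup>2)) (at x within {0..pi})"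
      using DERIV_cdivide[OF DERIV_mult[OF d2 d1], of "2 * a\<^sup>2"] unfolding alg .
    also have "(2 * a\<^sup>2) * (x ^ 3 * exp (- a * x\<^sup>2)) / (2 * a\<^sup>2) = x ^ 3 * exp (- a * x\<^sup>2)" using a by simp
    finally show "((\<lambda>x. - (1 + a * x\<^sup>2) * exp (- a * x\<^sup>2) / (2 * a\<^sup>2)) has_vector_derivative x ^ 3 * exp (- a * x\<^sup>2)) (at x within {0..pi})"
      by (simp only: has_real_derivative_iff_has_vector_derivative)
  qed auto
  hence "((\<lambda>x. \<bar>x\<bar> ^ 3 * exp (- a * x\<^sup>2)) has_integral (- (1 + a * pi\<^sup>2) * exp (- a * pi\<^sup>2) / (2 * a\<^sup>2) - - (1 + a * 0\<^sup>2) * exp (- a * 0\<^sup>2) / (2 * a\<^sup>2))) {0..pi}"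
    by (rule has_integral_eq[rotated]) auto
  from has_integral_even_extend[OF this] obtain I where I: "((\<lambda>x::real. \<bar>x\<bar> ^ 3 * exp (- a * x\<^sup>2)) has_integral I) {-pi..pi}"
    "I = (- (1 + a * pi\<^sup>2) * exp (- a * pi\<^sup>2) / (2 * a\<^sup>2) - - (1 + a * 0\<^sup>2) * exp (- a * 0\<^sup>2) / (2 * a\<^sup>2)) +
      (- (1 + a * pi\<^sup>2) * exp (- a * pi\<^sup>2) / (2 * a\<^sup>2) - - (1 + a * 0\<^sup>2) * exp (- a * 0\<^sup>2) / (2 * a\<^sup>2))"
    by auto
  have "I = 1 / a\<^sup>2 - (1 + a * pi\<^sup>2) * exp (- a * pi\<^sup>2) / a\<^sup>2" 
  proof -
    have "- y / (2 * b) - - (1 + a * 0\<^sup>2) * exp (- a * 0\<^sup>2) / (2 * b) + (- y / (2 * b) - - (1 + a * 0\<^sup>2) * exp (- a * 0\<^sup>2) / (2 * b)) = 1 / b - y / b" for y b :: real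
      by simp
    from this[of "(1 + a * pi\<^sup>2) * exp (- a * pi\<^sup>2)" "a\<^sup>2"] show ?thesis unfolding I(2) by (simp only: minus_mult_left)
  qed
  note I = I(1) this
  have "(1 + a * pi\<^sup>2) * exp (- a * pi\<^sup>2) / a\<^sup>2 \<ge> 0" using a by (intro divide_nonneg_nonneg mult_nonneg_nonneg) auto
  thus ?thesis using I by (intro exI[of _ I]) auto
qed

lemma norm_power_diff_le:
  fixes a b :: complex
  assumes "norm a \<le> M" "norm b \<le> M"
  shows "norm (a ^ n - b ^ n) \<le> real n * norm (a - b) * M ^ (n - 1)"
proof (induction n)
  case (Suc n)
  have M: "M \<ge> 0" using assms norm_ge_zero order.trans by blast
  have "a ^ Suc n - b ^ Suc n = a * (a ^ n - b ^ n) + (a - b) * b ^ n" by (simp add: algebra_simps)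
  hence "norm (a ^ Suc n - b ^ Suc n) \<le> norm a * norm (a ^ n - b ^ n) + norm (a - b) * norm b ^ n"
    using norm_triangle_ineq[of "a * (a ^ n - b ^ n)" "(a - b) * b ^ n"] by (simp add: norm_mult norm_power)
  also have "\<dots> \<le> M * (real n * norm (a - b) * M ^ (n - 1)) + norm (a - b) * M ^ n"
    using assms Suc M by (intro add_mono mult_mono power_mono) auto
  also have "\<dots> = real (Suc n) * norm (a - b) * M ^ (Suc n - 1)"
    by (cases n) (auto simp: algebra_simps)
  finally show ?case .
qed auto

lemma norm_cis_minus_1: "norm (cis x - 1) \<le> \<bar>x\<bar>"
  using iexp_approx1[of x 0] by (simp add: cis_conv_exp)

lemma norm_cis_taylor2: "norm (cis x - (1 + \<i> * of_real x - of_real (x\<^sup>2 / 2))) \<le> \<bar>x\<bar> ^ 3 / 6"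
proof -
  have "{..2::nat} = {0, 1, 2}" by auto
  hence s: "(\<Sum>k\<le>2. (\<i> * of_real x) ^ k / fact k) = 1 + \<i> * of_real x - of_real (x\<^sup>2 / 2)"
    by (simp add: power_mult_distrib)
  have f: "\<bar>x\<bar> ^ Suc 2 / fact (Suc 2) = \<bar>x\<bar> ^ 3 / 6"
    by (simp add: fact_numeral numeral_3_eq_3)
  show ?thesis using iexp_approx1[of x 2] unfolding s f cis_conv_exp .
qed

lemma exp_minus_taylor1:
  fixes y :: real
  assumes "y \<ge> 0"
  shows "\<bar>exp (- y) - (1 - y)\<bar> \<le> y\<^sup>2 / 2"
proof -
  have "1 - y \<le> exp (- y)" using exp_ge_add_one_self[of "-y"] by simp
  moreover have "(\<lambda>y. 1 - y + y\<^sup>2 / 2 - exp (- y)) 0 \<le> (\<lambda>y. 1 - y + y\<^sup>2 / 2 - exp (- y)) y"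
  proof (rule DERIV_nonneg_imp_nondecreasing[OF assms])
    fix x :: real assume "0 \<le> x" "x \<le> y"
    have "((\<lambda>y. 1 - y + y\<^sup>2 / 2 - exp (- y)) has_real_derivative (-1 + x + exp (-x))) (at x)"
      by (auto intro!: derivative_eq_intros)
    moreover have "-1 + x + exp (-x) \<ge> 0" using exp_ge_add_one_self[of "-x"] by simp
    ultimately show "\<exists>z. ((\<lambda>y. 1 - y + y\<^sup>2 / 2 - exp (- y)) has_real_derivative z) (at x) \<and> z \<ge> 0" by blast
  qed
  ultimately show ?thesis by simp
qed

text \<open>Comparison of \<phi>^n with the power g^n of a Gaussian: telescoping gives n *
  |\<theta>|^3 times a Gaussian of width n powr (-1/2), hence O(1/n) after integration, and the
  phase contributes |k| / n. The dependence on k is explicit because the bound is later summed over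
  k against powers of 1/\<tau>.\<close>

lemma local_limit_theorem_rate:
  fixes w :: "int \<Rightarrow> real" and J :: "int set"
  assumes J: "finite J" and w: "\<And>j. w j \<ge> 0" and w1: "(\<Sum>j\<in>J. w j) = 1"
    and mean: "(\<Sum>j\<in>J. of_int j * w j) = 0"
    and var: "s2 = (\<Sum>j\<in>J. (of_int j)\<^sup>2 * w j)" "s2 > 0"
  defines "\<phi> \<equiv> \<lambda>\<theta>. \<Sum>j\<in>J. of_real (w j) * cis (of_int j * \<theta>)"
  assumes ap: "\<And>\<theta>. \<bar>\<theta>\<bar> \<le> pi \<Longrightarrow> \<theta> \<noteq> 0 \<Longrightarrow> norm (\<phi> \<theta>) < 1"
  shows "\<exists>K. \<forall>n>0. \<forall>k::int. \<forall>I. ((\<lambda>\<theta>. \<phi> \<theta> ^ n * cis (- of_int k * \<theta>)) has_integral I) {-pi..pi} \<longrightarrow>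
     norm (I - of_real (sqrt (2 * pi / (s2 * real n)))) \<le> K * (1 + \<bar>of_int k\<bar>) / real n"
proof -
  define C1 where "C1 = (\<Sum>j\<in>J. w j * \<bar>of_int j\<bar> ^ 3 / 6)"
  have C10: "C1 \<ge> 0" unfolding C1_def by (intro sum_nonneg) (auto simp: w)
  have t1: "norm (\<phi> \<theta> - of_real (1 - s2 * \<theta>\<^sup>2 / 2)) \<le> C1 * \<bar>\<theta>\<bar> ^ 3" for \<theta>
  proof -
    have "(\<Sum>j\<in>J. of_real (w j) * (1 + \<i> * of_real (of_int j * \<theta>) - of_real ((of_int j * \<theta>)\<^sup>2 / 2)))
        = of_real (\<Sum>j\<in>J. w j) + \<i> * of_real \<theta> * of_real (\<Sum>j\<in>J. of_int j * w j) - of_real (\<Sum>j\<in>J. (of_int j)\<^sup>2 * w j) * of_real (\<theta>\<^sup>2 / 2)"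
      by (simp add: sum_distrib_left sum_distrib_right sum.distrib sum_subtractf algebra_simps power_mult_distrib sum_divide_distrib)
    hence e: "of_real (1 - s2 * \<theta>\<^sup>2 / 2) = (\<Sum>j\<in>J. of_real (w j) * (1 + \<i> * of_real (of_int j * \<theta>) - of_real ((of_int j * \<theta>)\<^sup>2 / 2)))"
      using w1 mean var by simp
    have "\<phi> \<theta> - of_real (1 - s2 * \<theta>\<^sup>2 / 2) = (\<Sum>j\<in>J. of_real (w j) * (cis (of_int j * \<theta>) - (1 + \<i> * of_real (of_int j * \<theta>) - of_real ((of_int j * \<theta>)\<^sup>2 / 2))))"
      unfolding e \<phi>_def by (simp only: sum_subtractf[symmetric] right_diff_distrib)
    also have "norm \<dots> \<le> (\<Sum>j\<in>J. w j * (\<bar>of_int j * \<theta>\<bar> ^ 3 / 6))"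
    proof (rule sum_norm_le)
      fix j assume "j \<in> J"
      show "norm (of_real (w j) * (cis (of_int j * \<theta>) - (1 + \<i> * of_real (of_int j * \<theta>) - of_real ((of_int j * \<theta>)\<^sup>2 / 2)))) \<le> w j * (\<bar>of_int j * \<theta>\<bar> ^ 3 / 6)"
        unfolding norm_mult[of "of_real (w j)"] using w[of j] by (intro mult_mono norm_cis_taylor2) auto
    qed
    also have "\<dots> = C1 * \<bar>\<theta>\<bar> ^ 3" by (simp add: C1_def sum_distrib_right abs_mult power_mult_distrib mult.assoc)
    finally show ?thesis .
  qed
  define C2 where "C2 = C1 + s2\<^sup>2 * pi / 8"
  have t2: "norm (\<phi> \<theta> - of_real (exp (- (s2 / 2 * \<theta>\<^sup>2)))) \<le> C2 * \<bar>\<theta>\<bar> ^ 3" if "\<bar>\<theta>\<bar> \<le> pi" for \<theta>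
  proof -
    have "\<bar>exp (- (s2 / 2 * \<theta>\<^sup>2)) - (1 - s2 / 2 * \<theta>\<^sup>2)\<bar> \<le> (s2 / 2 * \<theta>\<^sup>2)\<^sup>2 / 2"
      using var by (intro exp_minus_taylor1) auto
    also have "\<dots> = s2\<^sup>2 / 8 * \<bar>\<theta>\<bar> ^ 3 * \<bar>\<theta>\<bar>" by (cases "\<theta> \<ge> 0") (auto simp: power2_eq_square power3_eq_cube)
    also have "\<dots> \<le> s2\<^sup>2 / 8 * \<bar>\<theta>\<bar> ^ 3 * pi" using that by (intro mult_left_mono) auto
    finally have *: "\<bar>exp (- (s2 / 2 * \<theta>\<^sup>2)) - (1 - s2 / 2 * \<theta>\<^sup>2)\<bar> \<le> s2\<^sup>2 * pi / 8 * \<bar>\<theta>\<bar> ^ 3" by (simp add: mult_ac)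
    have "norm (of_real (1 - s2 * \<theta>\<^sup>2 / 2) - of_real (exp (- (s2 / 2 * \<theta>\<^sup>2))) :: complex) = \<bar>exp (- (s2 / 2 * \<theta>\<^sup>2)) - (1 - s2 / 2 * \<theta>\<^sup>2)\<bar>"
      unfolding of_real_diff[symmetric] norm_of_real by simp
    hence "norm (of_real (1 - s2 * \<theta>\<^sup>2 / 2) - of_real (exp (- (s2 / 2 * \<theta>\<^sup>2))) :: complex) \<le> s2\<^sup>2 * pi / 8 * \<bar>\<theta>\<bar> ^ 3" using * by simp
    from norm_triangle_le_diff[of "\<phi> \<theta> - of_real (1 - s2 * \<theta>\<^sup>2 / 2)" "of_real (exp (- (s2 / 2 * \<theta>\<^sup>2))) - of_real (1 - s2 * \<theta>\<^sup>2 / 2)", OF add_mono[OF t1 this[unfolded norm_minus_commute[of "of_real (1 - s2 * \<theta>\<^sup>2 / 2)"]]]]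
    show ?thesis by (simp add: C2_def algebra_simps)
  qed
  have cont: "continuous_on X \<phi>" for X unfolding \<phi>_def by (intro continuous_intros)
  \<comment> \<open>A Gaussian bound on the full interval: by Taylor expansion near 0, by
    compactness and \<open>ap\<close> elsewhere. The condition c \<le> s2 / 2 lets the comparison
    Gaussian obey the same bound.\<close>
  have "\<exists>c>0. c \<le> s2 / 2 \<and> (\<forall>\<theta>. \<bar>\<theta>\<bar> \<le> pi \<longrightarrow> norm (\<phi> \<theta>) \<le> exp (- (c * \<theta>\<^sup>2)))"
  proof -
    \<comment> \<open>The first entry keeps the cubic error below half of the quadratic term, the
      second keeps 1 - s2 * \<theta>^2 / 2 nonnegative.\<close>
    define \<delta> where "\<delta> = min (s2 / (4 * (C1 + 1))) (1 / (s2 + 1))"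
    have \<delta>: "\<delta> > 0" using var C10 by (simp add: \<delta>_def)
    have near: "norm (\<phi> \<theta>) \<le> exp (- (s2 / 4 * \<theta>\<^sup>2))" if "\<bar>\<theta>\<bar> \<le> \<delta>" for \<theta>
    proof -
      have d1: "\<bar>\<theta>\<bar> \<le> s2 / (4 * (C1 + 1))" "\<bar>\<theta>\<bar> \<le> 1 / (s2 + 1)" using that by (auto simp: \<delta>_def)
      have "(C1 + 1) * \<bar>\<theta>\<bar> \<le> s2 / 4" using d1(1) C10 by (simp add: field_simps)
      hence "C1 * \<bar>\<theta>\<bar> \<le> s2 / 4" by (simp add: algebra_simps)
      hence c: "C1 * \<bar>\<theta>\<bar> * \<theta>\<^sup>2 \<le> s2 / 4 * \<theta>\<^sup>2" by (intro mult_right_mono) auto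
      have "\<bar>\<theta>\<bar> * \<bar>\<theta>\<bar> \<le> (1 / (s2 + 1)) * 1"
      proof (intro mult_mono d1)
        have "1 / (s2 + 1) \<le> 1" using var by simp
        thus "\<bar>\<theta>\<bar> \<le> 1" using d1(2) by linarith
      qed (use var in auto)
      hence "\<theta>\<^sup>2 \<le> 1 / (s2 + 1)" by (simp add: power2_eq_square)
      hence "s2 * \<theta>\<^sup>2 \<le> s2 * (1 / (s2 + 1))" using var by (intro mult_left_mono) auto
      also have "\<dots> \<le> 1" using var by simp
      finally have s: "s2 * \<theta>\<^sup>2 / 2 \<le> 1" by simp
      have "norm (\<phi> \<theta>) \<le> norm (of_real (1 - s2 * \<theta>\<^sup>2 / 2) :: complex) + norm (\<phi> \<theta> - of_real (1 - s2 * \<theta>\<^sup>2 / 2))"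
        by (metis norm_triangle_sub)
      also have "\<dots> \<le> (1 - s2 * \<theta>\<^sup>2 / 2) + C1 * \<bar>\<theta>\<bar> ^ 3"
        using t1[of \<theta>] s by (simp only: norm_of_real)
      also have "C1 * \<bar>\<theta>\<bar> ^ 3 = C1 * \<bar>\<theta>\<bar> * \<theta>\<^sup>2" by (simp add: power3_eq_cube power2_eq_square)
      also have "(1 - s2 * \<theta>\<^sup>2 / 2) + C1 * \<bar>\<theta>\<bar> * \<theta>\<^sup>2 \<le> 1 + (- (s2 / 4 * \<theta>\<^sup>2))" using c by simp
      also have "\<dots> \<le> exp (- (s2 / 4 * \<theta>\<^sup>2))" by (rule exp_ge_add_one_self)
      finally show ?thesis .
    qed
    define X where "X = {-pi..pi} - {-\<delta><..<\<delta>}"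
    have "\<exists>M<1. M > 0 \<and> (\<forall>\<theta>\<in>X. norm (\<phi> \<theta>) \<le> M)"
    proof (cases "X = {}")
      case False
      have "compact X" unfolding X_def by (intro compact_diff) auto
      moreover have "continuous_on X (\<lambda>x. norm (\<phi> x))" by (intro continuous_intros cont)
      ultimately obtain z where z: "z \<in> X" "\<And>x. x \<in> X \<Longrightarrow> norm (\<phi> x) \<le> norm (\<phi> z)"
        using continuous_attains_sup[of X] False by blast
      have "norm (\<phi> z) < 1" using z(1) \<delta> by (intro ap) (auto simp: X_def)
      thus ?thesis using z by (intro exI[of _ "max (norm (\<phi> z)) (1/2)"]) (auto intro: max.coboundedI1)
    qed (auto intro: exI[of _ "1/2"])
    then obtain M where M: "M < 1" "M > 0" "\<And>\<theta>. \<theta> \<in> X \<Longrightarrow> norm (\<phi> \<theta>) \<le> M" by blast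
    define c where "c = min (s2 / 4) (- ln M / pi\<^sup>2)"
    have "ln M < 0" using M by simp
    hence "- ln M / pi\<^sup>2 > 0" by (intro divide_pos_pos) auto
    hence c: "c > 0" "c \<le> s2 / 4" "c \<le> - ln M / pi\<^sup>2" using var(2) unfolding c_def by linarith+
    show ?thesis
    proof (intro exI[of _ c] conjI allI impI)
      show "c > 0" "c \<le> s2 / 2" using c var by auto
      fix \<theta> :: real assume \<theta>: "\<bar>\<theta>\<bar> \<le> pi"
      show "norm (\<phi> \<theta>) \<le> exp (- (c * \<theta>\<^sup>2))"
      proof (cases "\<bar>\<theta>\<bar> < \<delta>")
        case True
        have "exp (- (s2 / 4 * \<theta>\<^sup>2)) \<le> exp (- (c * \<theta>\<^sup>2))" using mult_right_mono[OF c(2), of "\<theta>\<^sup>2"] by simp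
        thus ?thesis using near[of \<theta>] True by linarith
      next
        case False
        hence "norm (\<phi> \<theta>) \<le> M" using \<theta> by (intro M) (auto simp: X_def)
        also have "M = exp (ln M)" using M by simp
        also have "\<dots> \<le> exp (- (c * \<theta>\<^sup>2))"
        proof -
          have "\<theta>\<^sup>2 \<le> pi\<^sup>2" using \<theta> by (simp add: abs_le_square_iff[symmetric])
          hence "c * \<theta>\<^sup>2 \<le> (- ln M / pi\<^sup>2) * pi\<^sup>2" using c M by (intro mult_mono) auto
          thus ?thesis by simp
        qed
        finally show ?thesis .
      qed
    qed
  qed
  then obtain c where c: "c > 0" "c \<le> s2 / 2" "\<And>\<theta>. \<bar>\<theta>\<bar> \<le> pi \<Longrightarrow> norm (\<phi> \<theta>) \<le> exp (- (c * \<theta>\<^sup>2))" by blast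
  define K where "K = C2 * exp (c * pi\<^sup>2) / c\<^sup>2 + 2 / s2"
  have C20: "C2 \<ge> 0" using C10 by (simp add: C2_def)
  show ?thesis
  proof (rule exI[of _ K], intro allI impI)
    fix n :: nat and k :: int and I
    assume n: "n > 0" and I: "((\<lambda>\<theta>. \<phi> \<theta> ^ n * cis (- of_int k * \<theta>)) has_integral I) {-pi..pi}"
    define a where "a = s2 / 2 * real n"
    have a: "a > 0" using var n by (simp add: a_def)
    obtain G where G: "((\<lambda>x::real. exp (- a * x\<^sup>2)) has_integral G) {-pi..pi}" "\<bar>G - sqrt (pi / a)\<bar> \<le> 1 / a"
      using gauss_integral_pi[OF a] by blast
    obtain I1 where I1: "((\<lambda>x::real. \<bar>x\<bar> * exp (- a * x\<^sup>2)) has_integral I1) {-pi..pi}" "I1 \<le> 1 / a"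
      using gauss_moment_1_pi[OF a] by blast
    define cn where "cn = c * real n"
    have cn: "cn > 0" using c n by (simp add: cn_def)
    obtain I3 where I3: "((\<lambda>x::real. \<bar>x\<bar> ^ 3 * exp (- cn * x\<^sup>2)) has_integral I3) {-pi..pi}" "I3 \<le> 1 / cn\<^sup>2"
      using gauss_moment_3_pi[OF cn] by blast
    have Gc: "((\<lambda>x. of_real (exp (- a * x\<^sup>2)) :: complex) has_integral of_real G) {-pi..pi}"
      by (rule has_integral_of_real[OF G(1)])
    have D: "((\<lambda>\<theta>. \<phi> \<theta> ^ n * cis (- of_int k * \<theta>) - of_real (exp (- a * \<theta>\<^sup>2))) has_integral (I - of_real G)) {-pi..pi}"
      by (intro has_integral_diff I Gc)
    \<comment> \<open>The factor exp (c * pi^2) compensates for the exponent n - 1, instead of n,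
      left by the telescoped difference of powers.\<close>
    define L where "L = real n * C2 * exp (c * pi\<^sup>2)"
    have B: "((\<lambda>\<theta>. L * (\<bar>\<theta>\<bar> ^ 3 * exp (- cn * \<theta>\<^sup>2)) + \<bar>of_int k\<bar> * (\<bar>\<theta>\<bar> * exp (- a * \<theta>\<^sup>2))) has_integral (L * I3 + \<bar>of_int k\<bar> * I1)) {-pi..pi}"
      by (intro has_integral_add has_integral_mult_right I3 I1)
    have "norm (I - of_real G) \<le> L * I3 + \<bar>of_int k\<bar> * I1"
    proof -
      have "norm (integral {-pi..pi} (\<lambda>\<theta>. \<phi> \<theta> ^ n * cis (- of_int k * \<theta>) - of_real (exp (- a * \<theta>\<^sup>2)))) \<le>
        integral {-pi..pi} (\<lambda>\<theta>. L * (\<bar>\<theta>\<bar> ^ 3 * exp (- cn * \<theta>\<^sup>2)) + \<bar>of_int k\<bar> * (\<bar>\<theta>\<bar> * exp (- a * \<theta>\<^sup>2)))"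
      proof (rule integral_norm_bound_integral)
        fix \<theta> assume "\<theta> \<in> {-pi..pi}"
        hence \<theta>: "\<bar>\<theta>\<bar> \<le> pi" by auto
        define g where "g = exp (- (s2 / 2 * \<theta>\<^sup>2))"
        have gn: "exp (- a * \<theta>\<^sup>2) = g ^ n" by (simp add: g_def a_def exp_of_nat_mult[symmetric] mult_ac)
        have gle: "norm (of_real g :: complex) \<le> exp (- (c * \<theta>\<^sup>2))" using mult_right_mono[OF c(2), of "\<theta>\<^sup>2"] by (simp add: g_def)
        have "norm (\<phi> \<theta> ^ n - of_real g ^ n) \<le> real n * norm (\<phi> \<theta> - of_real g) * exp (- (c * \<theta>\<^sup>2)) ^ (n - 1)"
          by (rule norm_power_diff_le[OF c(3)[OF \<theta>] gle])
        also have "\<dots> \<le> real n * (C2 * \<bar>\<theta>\<bar> ^ 3) * (exp (c * pi\<^sup>2) * exp (- cn * \<theta>\<^sup>2))"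
        proof (intro mult_mono mult_left_mono)
          show "norm (\<phi> \<theta> - of_real g) \<le> C2 * \<bar>\<theta>\<bar> ^ 3" unfolding g_def by (rule t2[OF \<theta>])
          have "\<theta>\<^sup>2 \<le> pi\<^sup>2" using \<theta> by (simp add: abs_le_square_iff[symmetric])
          hence "c * \<theta>\<^sup>2 \<le> c * pi\<^sup>2" using c by (intro mult_left_mono) auto
          have "exp (- (c * \<theta>\<^sup>2)) ^ (n - 1) = exp (real (n - 1) * (- (c * \<theta>\<^sup>2)))" by (simp add: exp_of_nat_mult[symmetric])
          also have "\<dots> \<le> exp (c * pi\<^sup>2 + - cn * \<theta>\<^sup>2)"
            using n \<open>c * \<theta>\<^sup>2 \<le> c * pi\<^sup>2\<close> by (simp add: cn_def of_nat_diff algebra_simps)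
          finally show "exp (- (c * \<theta>\<^sup>2)) ^ (n - 1) \<le> exp (c * pi\<^sup>2) * exp (- cn * \<theta>\<^sup>2)" by (simp only: exp_add)
        qed (use C20 in auto)
        finally have p1: "norm (\<phi> \<theta> ^ n - of_real g ^ n) \<le> L * (\<bar>\<theta>\<bar> ^ 3 * exp (- cn * \<theta>\<^sup>2))" by (simp add: L_def mult_ac)
        have "norm (cis (- of_int k * \<theta>) - 1) \<le> \<bar>of_int k\<bar> * \<bar>\<theta>\<bar>" using norm_cis_minus_1[of "- of_int k * \<theta>"] by (simp add: abs_mult)
        hence p2: "norm (of_real g ^ n * (cis (- of_int k * \<theta>) - 1)) \<le> g ^ n * (\<bar>of_int k\<bar> * \<bar>\<theta>\<bar>)"
          unfolding norm_mult norm_power by (intro mult_mono) (auto simp: g_def)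
        have "\<phi> \<theta> ^ n * cis (- of_int k * \<theta>) - of_real (exp (- a * \<theta>\<^sup>2)) =
           (\<phi> \<theta> ^ n - of_real g ^ n) * cis (- of_int k * \<theta>) + of_real g ^ n * (cis (- of_int k * \<theta>) - 1)"
          unfolding gn of_real_power by (simp add: algebra_simps)
        also have "norm \<dots> \<le> norm ((\<phi> \<theta> ^ n - of_real g ^ n) * cis (- of_int k * \<theta>)) + norm (of_real g ^ n * (cis (- of_int k * \<theta>) - 1))"
          by (rule norm_triangle_ineq)
        also have "norm ((\<phi> \<theta> ^ n - of_real g ^ n) * cis (- of_int k * \<theta>)) = norm (\<phi> \<theta> ^ n - of_real g ^ n)" by (simp add: norm_mult)
        finally show "norm (\<phi> \<theta> ^ n * cis (- of_int k * \<theta>) - of_real (exp (- a * \<theta>\<^sup>2))) \<le>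
           L * (\<bar>\<theta>\<bar> ^ 3 * exp (- cn * \<theta>\<^sup>2)) + \<bar>of_int k\<bar> * (\<bar>\<theta>\<bar> * exp (- a * \<theta>\<^sup>2))"
          unfolding gn using p1 p2 by (simp add: mult_ac)
      qed (use D B in \<open>auto simp: integrable_on_def\<close>)
      thus ?thesis using D B by (simp add: integral_unique)
    qed
    also have "\<dots> \<le> L * (1 / cn\<^sup>2) + \<bar>of_int k\<bar> * (1 / a)"
      using I3 I1 C20 by (intro add_mono mult_left_mono) (auto simp: L_def)
    finally have r1: "norm (I - of_real G) \<le> L * (1 / cn\<^sup>2) + \<bar>of_int k\<bar> * (1 / a)" .
    have "norm (I - of_real (sqrt (pi / a))) \<le> norm (I - of_real G) + norm (of_real G - of_real (sqrt (pi / a)) :: complex)"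
      using norm_triangle_ineq[of "I - of_real G" "of_real G - of_real (sqrt (pi / a))"] by simp
    also have "norm (of_real G - of_real (sqrt (pi / a)) :: complex) \<le> 1 / a"
      using G(2) by (simp only: of_real_diff[symmetric] norm_of_real)
    also note r1
    also have "L * (1 / cn\<^sup>2) + \<bar>of_int k\<bar> * (1 / a) + 1 / a = (C2 * exp (c * pi\<^sup>2) / c\<^sup>2 + (2 / s2) * (1 + \<bar>of_int k\<bar>)) / real n"
      using n var by (simp add: L_def cn_def a_def field_simps power2_eq_square)
    also have "\<dots> \<le> (K * (1 + \<bar>of_int k\<bar>)) / real n"
    proof (intro divide_right_mono)
      have "0 \<le> C2 * exp (c * pi\<^sup>2) / c\<^sup>2 * \<bar>of_int k\<bar>" using C20 by auto
      moreover have "K * (1 + \<bar>of_int k\<bar>) = C2 * exp (c * pi\<^sup>2) / c\<^sup>2 + C2 * exp (c * pi\<^sup>2) / c\<^sup>2 * \<bar>of_int k\<bar> + (2 / s2) * (1 + \<bar>of_int k\<bar>)"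
        unfolding K_def by (simp only: distrib_left distrib_right mult_1_right)
      ultimately show "C2 * exp (c * pi\<^sup>2) / c\<^sup>2 + (2 / s2) * (1 + \<bar>of_int k\<bar>) \<le> K * (1 + \<bar>of_int k\<bar>)" by linarith
    qed auto
    finally show "norm (I - of_real (sqrt (2 * pi / (s2 * real n)))) \<le> K * (1 + \<bar>of_int k\<bar>) / real n"
      by (simp add: a_def mult_ac)
  qed
qed

section \<open>Meanders and Spitzer's identity\<close>

locale jump_walk =
  fixes c d :: nat and p :: "int \<Rightarrow> real"
  assumes p_nonneg: "\<And>i. p i \<ge> 0"
    and p_supp: "\<And>i. i < - int c \<or> i > int d \<Longrightarrow> p i = 0"
begin

abbreviation "J \<equiv> {- int c..int d}"

text \<open>Altitudes are integers so that the last-step recurrence can use k - j without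
  truncation; below 0 the weight is 0.\<close>

definition mm :: "nat \<Rightarrow> int \<Rightarrow> real" where
  "mm n k = (\<Sum>ws \<in> {ws \<in> meanders p n. sum_list ws = k}. path_weight p ws)"

lemma mcoef_eq_mm: "mcoef p n k = mm n (int k)"
  by (simp add: mcoef_def mm_def)

lemma jumpset_subset: "jumpset p \<subseteq> J"
  using p_supp by (force simp: jumpset_def)

lemma finite_meanders: "finite (meanders p n)"
proof -
  have "meanders p n \<subseteq> {ws. set ws \<subseteq> J \<and> length ws = n}"
    using jumpset_subset by (auto simp: meanders_def)
  thus ?thesis by (rule finite_subset) (rule finite_lists_length_eq, simp)
qed

lemma meanders_Suc:
  "ws @ [j] \<in> meanders p (Suc n) \<longleftrightarrow> ws \<in> meanders p n \<and> j \<in> jumpset p \<and> 0 \<le> sum_list ws + j"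
proof -
  have "(\<forall>i\<le>Suc n. 0 \<le> sum_list (take i (ws @ [j]))) \<longleftrightarrow> (\<forall>i\<le>n. 0 \<le> sum_list (take i ws)) \<and> 0 \<le> sum_list ws + j"
    if "length ws = n"
  proof -
    have "take i (ws @ [j]) = take i ws" if "i \<le> n" for i using that \<open>length ws = n\<close> by simp
    moreover have "take (Suc n) (ws @ [j]) = ws @ [j]" using \<open>length ws = n\<close> by simp
    moreover have "(\<forall>i\<le>Suc n. P i) \<longleftrightarrow> (\<forall>i\<le>n. P i) \<and> P (Suc n)" for P by (auto simp: le_Suc_eq)
    ultimately show ?thesis using \<open>length ws = n\<close> by simp
  qed
  thus ?thesis by (auto simp: meanders_def)
qed

lemma mm_0: "mm 0 k = (if k = 0 then 1 else 0)"
proof -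
  have "{ws \<in> meanders p 0. sum_list ws = k} = (if k = 0 then {[]} else {})"
    by (auto simp: meanders_def)
  thus ?thesis by (simp add: mm_def path_weight_def)
qed

lemma mm_neg: "k < 0 \<Longrightarrow> mm n k = 0"
proof -
  assume "k < 0"
  have "sum_list ws \<ge> 0" if "ws \<in> meanders p n" for ws
    using that by (auto simp: meanders_def dest!: spec[of _ n])
  hence "{ws \<in> meanders p n. sum_list ws = k} = {}" using \<open>k < 0\<close> by force
  thus ?thesis unfolding mm_def by (simp only: sum.empty)
qed

lemma mm_Suc: "mm (Suc n) k = (if k \<ge> 0 then \<Sum>j\<in>J. p j * mm n (k - j) else 0)"
proof (cases "k \<ge> 0")
  case True
  let ?A = "SIGMA j:jumpset p. {ws \<in> meanders p n. sum_list ws = k - j}"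
  have "mm (Suc n) k = (\<Sum>(j, ws)\<in>?A. p j * path_weight p ws)"
    unfolding mm_def
  proof (rule sum.reindex_bij_witness[where i = "\<lambda>(j, ws). ws @ [j]" and j = "\<lambda>ws. (last ws, butlast ws)"])
    fix ws assume "ws \<in> {ws \<in> meanders p (Suc n). sum_list ws = k}"
    hence ws: "ws \<in> meanders p (Suc n)" "sum_list ws = k" by auto
    hence "ws \<noteq> []" by (auto simp: meanders_def)
    then obtain us j where us: "ws = us @ [j]" by (metis append_butlast_last_id)
    show "(case (last ws, butlast ws) of (j, ws) \<Rightarrow> ws @ [j]) = ws" by (simp add: us)
    show "(last ws, butlast ws) \<in> ?A" using ws meanders_Suc[of us j n] by (auto simp: us)
    show "(case (last ws, butlast ws) of (j, ws) \<Rightarrow> p j * path_weight p ws) = path_weight p ws"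
      by (simp add: us path_weight_def mult.commute)
  next
    fix a assume "a \<in> ?A"
    then obtain j ws where a: "a = (j, ws)" "j \<in> jumpset p" "ws \<in> meanders p n" "sum_list ws = k - j" by auto
    show "(last (case a of (j, ws) \<Rightarrow> ws @ [j]), butlast (case a of (j, ws) \<Rightarrow> ws @ [j])) = a" by (simp add: a)
    show "(case a of (j, ws) \<Rightarrow> ws @ [j]) \<in> {ws \<in> meanders p (Suc n). sum_list ws = k}"
      using a meanders_Suc[of ws j n] True by auto
  qed
  also have "\<dots> = (\<Sum>j\<in>jumpset p. \<Sum>ws\<in>{ws \<in> meanders p n. sum_list ws = k - j}. p j * path_weight p ws)"
    by (rule sum.Sigma[symmetric]) (auto intro: finite_subset[OF jumpset_subset] finite_subset[OF _ finite_meanders])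
  also have "\<dots> = (\<Sum>j\<in>jumpset p. p j * mm n (k - j))" by (simp add: mm_def sum_distrib_left)
  also have "\<dots> = (\<Sum>j\<in>J. p j * mm n (k - j))"
    by (rule sum.mono_neutral_left) (use jumpset_subset in \<open>auto simp: jumpset_def\<close>)
  finally show ?thesis using True by simp
qed (simp add: mm_neg)

lemma mm_nonneg: "mm n k \<ge> 0"
  by (induction n arbitrary: k) (auto simp: mm_0 mm_Suc p_nonneg intro!: sum_nonneg mult_nonneg_nonneg)

lemma mm_upper: "k > int (d * n) \<Longrightarrow> mm n k = 0"
proof (induction n arbitrary: k)
  case (Suc n)
  have "mm n (k - j) = 0" if "j \<in> J" for j using Suc.prems that by (intro Suc.IH) auto
  thus ?case by (simp add: mm_Suc)
qed (auto simp: mm_0)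

lemma mtot_eq_int: "mtot p n = (\<Sum>k\<in>{0..int (d * n)}. mm n k)"
proof -
  have "mtot p n = (\<Sum>k\<in>sum_list ` meanders p n. \<Sum>ws\<in>{ws \<in> meanders p n. sum_list ws = k}. path_weight p ws)"
    unfolding mtot_def by (rule sum.image_gen[OF finite_meanders])
  also have "\<dots> = (\<Sum>k\<in>sum_list ` meanders p n. mm n k)" by (simp add: mm_def)
  also have "\<dots> = (\<Sum>k\<in>sum_list ` meanders p n \<union> {0..int (d * n)}. mm n k)"
  proof (rule sum.mono_neutral_left)
    show "\<forall>i\<in>(sum_list ` meanders p n \<union> {0..int (d * n)}) - sum_list ` meanders p n. mm n i = 0"
    proof
      fix i assume "i \<in> (sum_list ` meanders p n \<union> {0..int (d * n)}) - sum_list ` meanders p n"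
      hence "{ws \<in> meanders p n. sum_list ws = i} = {}" by auto
      thus "mm n i = 0" unfolding mm_def by (simp only: sum.empty)
    qed
  qed (auto intro: finite_meanders)
  also have "\<dots> = (\<Sum>k\<in>{0..int (d * n)}. mm n k)"
  proof (rule sum.mono_neutral_right)
    show "\<forall>i\<in>(sum_list ` meanders p n \<union> {0..int (d * n)}) - {0..int (d * n)}. mm n i = 0"
    proof
      fix i assume "i \<in> (sum_list ` meanders p n \<union> {0..int (d * n)}) - {0..int (d * n)}"
      hence "i < 0 \<or> i > int (d * n)" by auto
      thus "mm n i = 0" using mm_neg mm_upper by blast
    qed
  qed (auto intro: finite_meanders)
  finally show ?thesis .
qed

lemma mtot_eq: "mtot p n = (\<Sum>k\<le>d * n. mm n (int k))"
  unfolding mtot_eq_int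
  by (rule sum.reindex_bij_witness[where i = int and j = nat]) (auto simp: nat_le_iff simp del: of_nat_mult)

text \<open>The jump polynomial as a formal Laurent series, in which negative jumps are ordinary
  coefficients; its powers weigh the unrestricted paths.\<close>

definition PP :: "real fls" where "PP = (\<Sum>j\<in>J. fls_const (p j) * fls_X_intpow j)"

definition pw :: "nat \<Rightarrow> int \<Rightarrow> real" where "pw n k = fls_nth (PP ^ n) k"

lemma PP_times_nth: "fls_nth (PP * f) k = (\<Sum>j\<in>J. p j * fls_nth f (k - j))"
proof -
  have "fls_nth (fls_const (p j) * fls_X_intpow j * f) k = p j * fls_nth f (k - j)" for j
    by (simp only: mult.assoc fls_X_intpow_times_conv_shift(1)[of j f] fls_mult_const_nth fls_shift_nth) simp
  thus ?thesis unfolding PP_def sum_distrib_right fls_nth_sum by simp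
qed

lemma pw_0: "pw 0 k = (if k = 0 then 1 else 0)" by (simp add: pw_def)

lemma pw_Suc: "pw (Suc n) k = (\<Sum>j\<in>J. p j * pw n (k - j))"
  by (simp add: pw_def PP_times_nth)

lemma pw_nonneg: "pw n k \<ge> 0"
  by (induction n arbitrary: k) (auto simp: pw_0 pw_Suc p_nonneg intro!: sum_nonneg mult_nonneg_nonneg)

lemma pw_upper: "k > int (d * n) \<Longrightarrow> pw n k = 0"
proof (induction n arbitrary: k)
  case (Suc n)
  have "pw n (k - j) = 0" if "j \<in> J" for j using Suc.prems that by (intro Suc.IH) auto
  thus ?case by (simp add: pw_Suc)
qed (auto simp: pw_0)

lemma mm_le_pw: "mm n k \<le> pw n k"
  by (induction n arbitrary: k) (auto simp: mm_0 mm_Suc pw_0 pw_Suc p_nonneg pw_nonneg intro!: sum_mono mult_left_mono sum_nonneg mult_nonneg_nonneg)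

definition MM :: "real fps fps" where "MM = Abs_fps (\<lambda>n. Abs_fps (\<lambda>k. mm n (int k)))"

text \<open>The exponent log M(z, u) of Spitzer's identity: the nonnegative powers of u in - log (1
  - z * P(u)).\<close>

definition AA :: "real fps fps" where
  "AA = Abs_fps (\<lambda>n. if n = 0 then 0 else Abs_fps (\<lambda>k. pw n (int k) / real n))"

end

definition fls_nonneg :: "real fls \<Rightarrow> bool" where "fls_nonneg f \<longleftrightarrow> (\<forall>k<0. fls_nth f k = 0)"
definition fls_neg :: "real fls \<Rightarrow> bool" where "fls_neg f \<longleftrightarrow> (\<forall>k\<ge>0. fls_nth f k = 0)"

lemma fls_nonneg_mult: "fls_nonneg f \<Longrightarrow> fls_nonneg g \<Longrightarrow> fls_nonneg (f * g)"
  unfolding fls_nonneg_def fls_times_nth(2)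
proof safe
  fix k :: int assume *: "\<forall>k<0. fls_nth f k = 0" "\<forall>k<0. fls_nth g k = 0" "k < 0"
  show "(\<Sum>i = fls_subdegree f..k - fls_subdegree g. fls_nth f i * fls_nth g (k - i)) = 0"
  proof (intro sum.neutral ballI)
    fix i show "fls_nth f i * fls_nth g (k - i) = 0" using * by (cases "i < 0") auto
  qed
qed

lemma fls_neg_mult: "fls_neg f \<Longrightarrow> fls_neg g \<Longrightarrow> fls_neg (f * g)"
  unfolding fls_neg_def fls_times_nth(2)
proof safe
  fix k :: int assume *: "\<forall>k\<ge>0. fls_nth f k = 0" "\<forall>k\<ge>0. fls_nth g k = 0" "k \<ge> 0"
  show "(\<Sum>i = fls_subdegree f..k - fls_subdegree g. fls_nth f i * fls_nth g (k - i)) = 0"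
  proof (intro sum.neutral ballI)
    fix i show "fls_nth f i * fls_nth g (k - i) = 0" using * by (cases "i \<ge> 0") auto
  qed
qed

lemma fls_of_nat_mult_nth: "fls_nth (of_nat n * f) k = of_nat n * fls_nth f k" for f :: "'a :: comm_ring_1 fls"
  by (simp add: fls_of_nat)

text \<open>The logarithmic derivative T = F' / F is computed from the coefficients of F by
  products, differences and integer multiples only, so it stays in any class R closed under these.
  Since strictly negative Laurent series do not include 1, the constant term of F is treated
  apart.\<close>

lemma fps_log_deriv_invariant:
  fixes F T :: "real fls fps"
  assumes F0: "fps_nth F 0 = 1" and FS: "\<And>n. R (fps_nth F (Suc n))"
    and T: "T * F = fps_deriv F"
    and R0: "R 0" and Radd: "\<And>f g. R f \<Longrightarrow> R g \<Longrightarrow> R (f - g)" and Rm: "\<And>f g. R f \<Longrightarrow> R g \<Longrightarrow> R (f * g)"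
    and Rn: "\<And>n f. R f \<Longrightarrow> R (of_nat n * f)"
  shows "R (fps_nth T n)"
proof (induction n rule: less_induct)
  case (less n)
  have Rsum: "R (\<Sum>i\<in>A. f i)" if "finite A" "\<And>i. i \<in> A \<Longrightarrow> R (f i)" for A :: "nat set" and f
    using that
  proof (induction A rule: finite_induct)
    case (insert x A)
    have "R (f x - (0 - (\<Sum>i\<in>A. f i)))" using insert by (intro Radd R0) auto
    thus ?case using insert by simp
  qed (auto simp: R0)
  have "fps_nth (T * F) n = (\<Sum>i=0..n. fps_nth T i * fps_nth F (n - i))" by (simp add: fps_mult_nth)
  also have "\<dots> = fps_nth T n + (\<Sum>i\<in>{0..<n}. fps_nth T i * fps_nth F (n - i))"
    by (simp add: atLeast0AtMost lessThan_Suc_atMost[symmetric] F0 lessThan_atLeast0)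
  finally have "fps_nth T n = of_nat (Suc n) * fps_nth F (Suc n) - (\<Sum>i\<in>{0..<n}. fps_nth T i * fps_nth F (n - i))"
    unfolding T by simp
  moreover have "R (fps_nth T i * fps_nth F (n - i))" if "i \<in> {0..<n}" for i
    using that less[of i] FS[of "n - i - 1"] by (intro Rm) (auto simp: Suc_diff_Suc)
  ultimately show ?case by (auto intro!: Radd Rn FS Rsum simp del: of_nat_Suc)
qed

context jump_walk begin

text \<open>G = M * (1 - z * P) is 1 plus strictly negative powers of u, since its further
  coefficients record the paths leaving the half-line. The logarithmic derivatives T of M and U of G
  satisfy T - U = P / (1 - z * P), with T nonnegative and U negative in u; thus T is the nonnegative
  part of the right-hand side.\<close>

lemma spitzer: "fps_deriv MM = fps_deriv AA * MM"
proof -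
  define M where "M = Abs_fps (\<lambda>n. fps_to_fls (fps_nth MM n))"
  define S where "S = (1 - fps_X * fps_const PP :: real fls fps)"
  define G where "G = M * S"
  define T where "T = fps_deriv M * inverse M"
  define U where "U = fps_deriv G * inverse G"
  have Mk: "fls_nth (fps_nth M n) k = mm n k" for n k
    by (simp add: M_def MM_def mm_neg)
  have M0: "fps_nth M 0 = 1"
    by (rule fls_eqI) (simp add: Mk mm_0)
  have GS: "fps_nth G (Suc n) = fps_nth M (Suc n) - PP * fps_nth M n" for n
    by (simp add: G_def S_def algebra_simps)
  have G0: "fps_nth G 0 = 1" by (simp add: G_def S_def M0)
  have TM: "T * M = fps_deriv M"
    unfolding T_def by (simp add: mult.assoc inverse_mult_eq_1 M0)
  have UG: "U * G = fps_deriv G"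
    unfolding U_def by (simp add: mult.assoc inverse_mult_eq_1 G0)
  have Tn: "fls_nonneg (fps_nth T n)" for n
  proof (rule fps_log_deriv_invariant[OF M0 _ TM])
    show "fls_nonneg (fps_nth M (Suc n))" for n by (simp add: fls_nonneg_def Mk mm_neg)
  qed (rule fls_nonneg_mult, assumption+ | simp add: fls_nonneg_def fls_of_nat_mult_nth)+
  have Un: "fls_neg (fps_nth U n)" for n
  proof (rule fps_log_deriv_invariant[OF G0 _ UG])
    show "fls_neg (fps_nth G (Suc n))" for n by (simp add: fls_neg_def GS Mk PP_times_nth mm_Suc)
  qed (rule fls_neg_mult, assumption+ | simp add: fls_neg_def fls_of_nat_mult_nth)+
  have "M \<noteq> 0" using M0 by auto
  have "fps_deriv G = fps_deriv M * S - M * fps_const PP"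
    by (simp add: G_def S_def algebra_simps)
  hence "U * (M * S) = T * M * S - M * fps_const PP" unfolding UG[symmetric] TM[symmetric] by (simp add: G_def)
  hence "M * ((T - U) * S) = M * fps_const PP" by (simp add: algebra_simps)
  hence eq: "(T - U) * S = fps_const PP" using \<open>M \<noteq> 0\<close> by simp
  have TU: "fps_nth (T - U) n = PP ^ Suc n" for n
  proof (induction n)
    case 0
    have "fps_nth ((T - U) * S) 0 = PP" unfolding eq by simp
    thus ?case by (simp add: S_def)
  next
    case (Suc n)
    have "fps_nth ((T - U) * S) (Suc n) = 0" unfolding eq by simp
    moreover have "(T - U) * S = (T - U) - fps_X * ((T - U) * fps_const PP)" by (simp add: S_def algebra_simps)
    ultimately have "fps_nth (T - U) (Suc n) = fps_nth (T - U) n * PP"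
      by (simp only: fps_sub_nth[of "T - U"] fps_X_mult_nth fps_mult_right_const_nth) simp
    thus ?case using Suc by (simp only: power_Suc2)
  qed
  have Tk: "fps_nth T n = fps_to_fls (fps_nth (fps_deriv AA) n)" for n
  proof (rule fls_eqI)
    fix k
    show "fls_nth (fps_nth T n) k = fls_nth (fps_to_fls (fps_nth (fps_deriv AA) n)) k"
    proof (cases "k \<ge> 0")
      case True
      have "fls_nth (fps_nth (T - U) n) k = pw (Suc n) k" by (simp only: TU pw_def)
      hence "fls_nth (fps_nth T n) k = pw (Suc n) k" using Un[of n] True by (simp add: fls_neg_def)
      moreover have "fps_nth (of_nat (Suc n) * f) i = of_nat (Suc n) * fps_nth f i" for f :: "real fps" and i
        by (simp only: fps_of_nat[symmetric] fps_mult_left_const_nth)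
      ultimately show ?thesis using True by (simp add: AA_def del: of_nat_Suc)
    next
      case False
      thus ?thesis using Tn[of n] by (simp add: fls_nonneg_def)
    qed
  qed
  show ?thesis
  proof (rule fps_ext)
    fix n
    have "fps_to_fls (fps_nth (fps_deriv MM) n) = fps_nth (fps_deriv M) n"
    proof (rule fls_eqI)
      fix k
      have *: "fps_nth (of_nat (Suc n) * f) i = of_nat (Suc n) * fps_nth f i" for f :: "real fps" and i
        by (simp only: fps_of_nat[symmetric] fps_mult_left_const_nth)
      show "fls_nth (fps_to_fls (fps_nth (fps_deriv MM) n)) k = fls_nth (fps_nth (fps_deriv M) n) k"
        by (simp add: M_def * fls_of_nat_mult_nth del: of_nat_Suc)
    qed
    also have "\<dots> = (\<Sum>i=0..n. fps_nth T i * fps_nth M (n - i))"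
      unfolding TM[symmetric] by (simp add: fps_mult_nth)
    also have "\<dots> = (\<Sum>i=0..n. fps_to_fls (fps_nth (fps_deriv AA) i * fps_nth MM (n - i)))"
      unfolding Tk M_def by (simp only: fls_times_fps_to_fls fps_nth_Abs_fps)
    also have "\<dots> = fps_to_fls (fps_nth (fps_deriv AA * MM) n)"
      by (rule fls_eqI) (simp add: fls_nth_sum fps_mult_nth fps_sum_nth)
    finally show "fps_nth (fps_deriv MM) n = fps_nth (fps_deriv AA * MM) n"
      by (metis fps_to_fls_eq_iff)
  qed
qed

end

text \<open>The derivative in u, whereas \<open>fps_deriv\<close> of a double series is the one in
  z.\<close>

definition fps_inner_deriv :: "real fps fps \<Rightarrow> real fps fps" where
  "fps_inner_deriv f = Abs_fps (\<lambda>n. fps_deriv (fps_nth f n))"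

lemma fps_inner_deriv_mult: "fps_inner_deriv (f * g) = fps_inner_deriv f * g + f * fps_inner_deriv g"
  by (rule fps_ext) (simp add: fps_inner_deriv_def fps_mult_nth fps_deriv_sum sum.distrib[symmetric] add.commute)

lemma fps_inner_deriv_deriv: "fps_inner_deriv (fps_deriv f) = fps_deriv (fps_inner_deriv f)"
proof (rule fps_ext)
  fix n
  show "fps_nth (fps_inner_deriv (fps_deriv f)) n = fps_nth (fps_deriv (fps_inner_deriv f)) n"
    by (simp add: fps_inner_deriv_def fps_of_nat[symmetric] del: of_nat_Suc)
qed

text \<open>The defect Y solves the same linear equation in z as M but starts at 0, so it vanishes.
  This gives M_k recursively in k without forming an exponential of a series in two
  variables.\<close>

lemma (in jump_walk) spitzer_inner: "fps_inner_deriv MM = fps_inner_deriv AA * MM"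
proof -
  define Y where "Y = fps_inner_deriv MM - fps_inner_deriv AA * MM"
  have "fps_deriv (fps_inner_deriv MM) = fps_deriv (fps_inner_deriv AA) * MM + fps_deriv AA * fps_inner_deriv MM"
    unfolding fps_inner_deriv_deriv[symmetric] spitzer fps_inner_deriv_mult ..
  hence ode: "fps_deriv Y = fps_deriv AA * Y"
    by (simp add: Y_def spitzer algebra_simps)
  have Y0: "fps_nth Y 0 = 0"
    by (rule fps_ext) (simp add: Y_def fps_inner_deriv_def MM_def AA_def mm_0)
  have "fps_nth Y n = 0" for n
  proof (induction n rule: less_induct)
    case (less n)
    show ?case
    proof (cases n)
      case (Suc m)
      have "of_nat (Suc m) * fps_nth Y (Suc m) = fps_nth (fps_deriv AA * Y) m" unfolding ode[symmetric] by simp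
      also have "\<dots> = 0" unfolding fps_mult_nth by (intro sum.neutral ballI) (use less Suc in auto)
      finally have "fps_const (of_nat (Suc m)) * fps_nth Y (Suc m) = 0" by (simp only: fps_of_nat)
      hence "fps_nth Y (Suc m) = 0" by (simp add: fps_eq_iff)
      thus ?thesis using Suc by simp
    qed (use Y0 in simp)
  qed
  hence "Y = 0" by (intro fps_ext) simp
  thus ?thesis by (simp add: Y_def)
qed

context jump_walk
begin

definition Pv :: "real \<Rightarrow> real" where "Pv x = (\<Sum>j\<in>J. p j * x powi j)"

lemma Pv_nonneg: "x > 0 \<Longrightarrow> Pv x \<ge> 0"
  unfolding Pv_def by (intro sum_nonneg mult_nonneg_nonneg p_nonneg) auto

text \<open>Exponential Chebyshev bound: tilting by any x > 0 gives the paths of length n the total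
  mass P(x)^n.\<close>

lemma pw_le: "x > 0 \<Longrightarrow> pw n k * x powi k \<le> Pv x ^ n"
proof (induction n arbitrary: k)
  case (Suc n)
  have "pw (Suc n) k * x powi k = (\<Sum>j\<in>J. p j * x powi j * (pw n (k - j) * x powi (k - j)))"
    unfolding pw_Suc sum_distrib_right
  proof (intro sum.cong refl)
    fix j
    have "x powi k = x powi j * x powi (k - j)" using Suc.prems by (subst power_int_add[symmetric]) auto
    thus "p j * pw n (k - j) * x powi k = p j * x powi j * (pw n (k - j) * x powi (k - j))" by simp
  qed
  also have "\<dots> \<le> (\<Sum>j\<in>J. p j * x powi j * Pv x ^ n)"
    using Suc p_nonneg by (intro sum_mono mult_left_mono) auto
  also have "\<dots> = Pv x ^ Suc n" by (simp add: Pv_def sum_distrib_right)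
  finally show ?case .
qed (auto simp: pw_0)

lemma mm_le: "x > 0 \<Longrightarrow> mm n (int k) \<le> Pv x ^ n / x ^ k"
  using order.trans[OF mult_right_mono[OF mm_le_pw[of n "int k"], of "x ^ k"] pw_le[of x n "int k", simplified]]
  by (simp add: field_simps)

lemma mm_sum_extend: "finite A \<Longrightarrow> {0..int (d * n)} \<subseteq> A \<Longrightarrow> (\<Sum>k\<in>A. g k * mm n k) = (\<Sum>k\<in>{0..int (d * n)}. g k * mm n k)"
proof (rule sum.mono_neutral_right)
  assume "finite A" "{0..int (d * n)} \<subseteq> A"
  show "\<forall>i\<in>A - {0..int (d * n)}. g i * mm n i = 0"
  proof
    fix i assume "i \<in> A - {0..int (d * n)}"
    hence "i < 0 \<or> i > int (d * n)" by auto
    thus "g i * mm n i = 0" using mm_neg mm_upper by auto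
  qed
qed auto

lemma mm_sum_shift:
  assumes "j \<in> J"
  shows "(\<Sum>k\<in>{- int c..int (d * Suc n)}. g k * mm n (k - j)) = (\<Sum>i\<in>{0..int (d * n)}. g (i + j) * mm n i)"
proof -
  have "(\<Sum>k\<in>{- int c..int (d * Suc n)}. g k * mm n (k - j)) = (\<Sum>i\<in>{- int c - j..int (d * Suc n) - j}. g (i + j) * mm n i)"
    by (rule sum.reindex_bij_witness[where i = "\<lambda>i. i + j" and j = "\<lambda>k. k - j"]) auto
  also have "\<dots> = (\<Sum>i\<in>{0..int (d * n)}. g (i + j) * mm n i)"
    using assms by (intro mm_sum_extend) auto
  finally show ?thesis .
qed

lemma mtot_nonneg: "mtot p n \<ge> 0"
  unfolding mtot_eq by (intro sum_nonneg mm_nonneg)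

lemma mtot_le: "mtot p n \<le> Pv 1 ^ n"
proof (induction n)
  case 0 thus ?case by (simp add: mtot_eq mm_0)
next
  case (Suc n)
  have "mtot p (Suc n) = (\<Sum>k\<in>{0..int (d * Suc n)}. \<Sum>j\<in>J. p j * mm n (k - j))"
    unfolding mtot_eq_int by (intro sum.cong refl) (simp add: mm_Suc)
  also have "\<dots> \<le> (\<Sum>k\<in>{- int c..int (d * Suc n)}. \<Sum>j\<in>J. p j * mm n (k - j))"
    by (intro sum_mono2) (auto intro!: sum_nonneg mult_nonneg_nonneg p_nonneg mm_nonneg)
  also have "\<dots> = (\<Sum>j\<in>J. p j * (\<Sum>k\<in>{- int c..int (d * Suc n)}. 1 * mm n (k - j)))"
    by (subst sum.swap) (simp add: sum_distrib_left)
  also have "\<dots> = (\<Sum>j\<in>J. p j * mtot p n)"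
    by (intro sum.cong refl, subst mm_sum_shift) (auto simp: mtot_eq_int)
  also have "\<dots> = Pv 1 * mtot p n" by (simp add: Pv_def sum_distrib_right)
  also have "\<dots> \<le> Pv 1 * Pv 1 ^ n" using Suc Pv_nonneg[of 1] by (intro mult_left_mono) auto
  finally show ?case by simp
qed

text \<open>Optional stopping: with nonnegative drift, the total weight of \<open>altitude + 1\<close> over surviving paths grows at least
  by the factor \<open>P(1)\<close> per step, since the paths killed at a step have \<open>altitude + 1 \<le> 0\<close>.\<close>
lemma mtot_lower:
  assumes drift: "(\<Sum>j\<in>J. of_int j * p j) \<ge> 0"
  shows "mtot p n \<ge> Pv 1 ^ n / (real d * real n + 1)"
proof -
  define e where "e = (\<lambda>n. \<Sum>k\<in>{0..int (d * n)}. (of_int k + 1) * mm n k)"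
  have "e n \<ge> Pv 1 ^ n"
  proof (induction n)
    case 0 thus ?case by (simp add: e_def mm_0)
  next
    case (Suc n)
    let ?A = "{- int c..int (d * Suc n)}"
    have "Pv 1 * e n \<le> Pv 1 * e n + (\<Sum>j\<in>J. of_int j * p j) * mtot p n"
      using drift mtot_nonneg[of n] by simp
    also have "\<dots> = (\<Sum>j\<in>J. p j * (e n + of_int j * mtot p n))"
      by (simp add: Pv_def sum_distrib_right sum_distrib_left sum.distrib distrib_left mult_ac)
    also have "\<dots> = (\<Sum>j\<in>J. p j * (\<Sum>i\<in>{0..int (d * n)}. (of_int (i + j) + 1) * mm n i))"
      by (simp add: e_def mtot_eq_int sum_distrib_left sum.distrib[symmetric] algebra_simps)
    also have "\<dots> = (\<Sum>j\<in>J. p j * (\<Sum>k\<in>?A. (of_int k + 1) * mm n (k - j)))"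
      by (intro sum.cong refl, subst mm_sum_shift[where g = "\<lambda>k. of_int k + 1"]) auto
    also have "\<dots> = (\<Sum>k\<in>?A. (of_int k + 1) * (\<Sum>j\<in>J. p j * mm n (k - j)))"
      by (simp only: sum_distrib_left) (subst sum.swap, simp add: mult_ac)
    also have "\<dots> \<le> (\<Sum>k\<in>{0..int (d * Suc n)}. (of_int k + 1) * (\<Sum>j\<in>J. p j * mm n (k - j)))"
    proof -
      have "(\<Sum>k\<in>?A. (of_int k + 1) * (\<Sum>j\<in>J. p j * mm n (k - j))) =
        (\<Sum>k\<in>{0..int (d * Suc n)}. (of_int k + 1) * (\<Sum>j\<in>J. p j * mm n (k - j))) + (\<Sum>k\<in>{- int c..<0}. (of_int k + 1) * (\<Sum>j\<in>J. p j * mm n (k - j)))"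
      proof (subst sum.union_disjoint[symmetric])
        show "sum (\<lambda>k. (of_int k + 1) * (\<Sum>j\<in>J. p j * mm n (k - j))) ?A = sum (\<lambda>k. (of_int k + 1) * (\<Sum>j\<in>J. p j * mm n (k - j))) ({0..int (d * Suc n)} \<union> {- int c..<0})"
        proof (rule sum.cong)
          have "0 \<le> int (d * Suc n)" by simp
          thus "?A = {0..int (d * Suc n)} \<union> {- int c..<0}" by (auto simp del: of_nat_mult)
        qed auto
      qed auto
      moreover have "(\<Sum>k\<in>{- int c..<0}. (of_int k + 1) * (\<Sum>j\<in>J. p j * mm n (k - j))) \<le> 0"
      proof (rule sum_nonpos)
        fix k :: int assume "k \<in> {- int c..<0}"
        hence "k \<le> - 1" by simp
        hence "real_of_int k \<le> real_of_int (- 1)" by (simp only: of_int_le_iff)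
        hence "real_of_int k + 1 \<le> 0" by simp
        moreover have "(\<Sum>j\<in>J. p j * mm n (k - j)) \<ge> 0" by (intro sum_nonneg mult_nonneg_nonneg p_nonneg mm_nonneg)
        ultimately show "(of_int k + 1) * (\<Sum>j\<in>J. p j * mm n (k - j)) \<le> 0" by (rule mult_nonpos_nonneg)
      qed
      ultimately show ?thesis by linarith
    qed
    also have "\<dots> = e (Suc n)" unfolding e_def by (intro sum.cong refl) (simp add: mm_Suc)
    finally have "Pv 1 * e n \<le> e (Suc n)" .
    moreover have "Pv 1 * Pv 1 ^ n \<le> Pv 1 * e n" using Suc Pv_nonneg[of 1] by (intro mult_left_mono) auto
    ultimately show ?case by simp
  qed
  also have "e n \<le> (\<Sum>k\<in>{0..int (d * n)}. (real d * real n + 1) * mm n k)"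
    unfolding e_def
  proof (intro sum_mono mult_right_mono mm_nonneg add_right_mono)
    fix k assume "k \<in> {0..int (d * n)}"
    hence "k \<le> int (d * n)" by simp
    hence "real_of_int k \<le> real_of_int (int (d * n))" by (simp only: of_int_le_iff)
    thus "real_of_int k \<le> real d * real n" by simp
  qed
  also have "\<dots> = (real d * real n + 1) * mtot p n" by (simp add: mtot_eq_int sum_distrib_left)
  finally have "Pv 1 ^ n \<le> (real d * real n + 1) * mtot p n" .
  moreover have "real d * real n + 1 > 0" by (intro add_nonneg_pos) auto
  ultimately show ?thesis by (simp add: pos_divide_le_eq mult.commute)
qed

end

text \<open>Substitution of r * z for z, which moves the point z = r to 1, where the class
  \<open>srate\<close> and the renewal results are set up.\<close>

definition fps_scale :: "real \<Rightarrow> real fps \<Rightarrow> real fps" where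
  "fps_scale r f = Abs_fps (\<lambda>n. fps_nth f n * r ^ n)"

lemma fps_scale_nth [simp]: "fps_nth (fps_scale r f) n = fps_nth f n * r ^ n"
  by (simp add: fps_scale_def)

lemma fps_scale_mult: "fps_scale r (f * g) = fps_scale r f * fps_scale r g"
proof (rule fps_ext)
  fix n
  have "r ^ n = r ^ i * r ^ (n - i)" if "i \<in> {0..n}" for i using that by (simp flip: power_add)
  thus "fps_nth (fps_scale r (f * g)) n = fps_nth (fps_scale r f * fps_scale r g) n"
    unfolding fps_scale_nth fps_mult_nth sum_distrib_right by (intro sum.cong refl) (simp add: mult_ac)
qed

lemma fps_scale_ode:
  assumes "fps_deriv m = fps_deriv a * m"
  shows "fps_deriv (fps_scale r m) = fps_deriv (fps_scale r a) * fps_scale r m"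
proof -
  have *: "fps_deriv (fps_scale r f) = fps_const r * fps_scale r (fps_deriv f)" for f
    by (rule fps_ext) (simp add: mult_ac)
  show ?thesis unfolding * assms fps_scale_mult by (simp add: mult.assoc)
qed

context jump_walk
begin

text \<open>The coefficients of log M(z, u); the value 0 at n = 0 reflects M(0, u) = 1.\<close>

definition acoef :: "nat \<Rightarrow> nat \<Rightarrow> real" where
  "acoef n k = (if n = 0 then 0 else pw n (int k) / real n)"

definition mcol :: "nat \<Rightarrow> real fps" where "mcol k = Abs_fps (\<lambda>n. mm n (int k))"
definition acol :: "nat \<Rightarrow> real fps" where "acol k = Abs_fps (\<lambda>n. acoef n k)"
definition msum :: "real fps" where "msum = Abs_fps (mtot p)"
definition asum :: "real fps" where "asum = Abs_fps (\<lambda>n. \<Sum>k. acoef n k)"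

lemma AA_nth: "fps_nth (fps_nth AA n) k = acoef n k"
  by (simp add: AA_def acoef_def)

lemma acoef_nonneg: "acoef n k \<ge> 0" by (simp add: acoef_def pw_nonneg)

lemma finite_supp_sums:
  shows "(\<lambda>k. acoef n k) sums (\<Sum>k\<le>d * n. acoef n k)" and "(\<lambda>k. mm n (int k)) sums mtot p n"
proof -
  show "(\<lambda>k. acoef n k) sums (\<Sum>k\<le>d * n. acoef n k)"
    by (rule sums_finite) (auto simp: acoef_def intro!: pw_upper simp del: of_nat_mult)
  show "(\<lambda>k. mm n (int k)) sums mtot p n"
    unfolding mtot_eq by (rule sums_finite) (auto intro!: mm_upper simp del: of_nat_mult)
qed

lemma fps_of_nat_mult_nth: "fps_nth (of_nat m * f) i = of_nat m * fps_nth f i" for f :: "real fps"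
  by (simp only: fps_of_nat[symmetric] fps_mult_left_const_nth)

lemma spitzer_nth:
  "(real n + 1) * mm (Suc n) (int k) = (\<Sum>i=0..n. \<Sum>l=0..k. (real i + 1) * acoef (Suc i) l * mm (n - i) (int (k - l)))"
proof -
  have "fps_nth (fps_nth (fps_deriv MM) n) k = fps_nth (fps_nth (fps_deriv AA * MM) n) k"
    by (simp add: spitzer)
  also have "\<dots> = (\<Sum>i=0..n. fps_nth (fps_nth (fps_deriv AA) i * fps_nth MM (n - i)) k)"
    by (simp only: fps_mult_nth[of "fps_deriv AA"] fps_sum_nth)
  also have "\<dots> = (\<Sum>i=0..n. \<Sum>l=0..k. fps_nth (fps_nth (fps_deriv AA) i) l * fps_nth (fps_nth MM (n - i)) (k - l))"
    by (simp only: fps_mult_nth)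
  finally show ?thesis
    by (simp add: fps_of_nat_mult_nth AA_nth MM_def add.commute[of 1] del: of_nat_Suc)
       (simp add: add.commute[of 1])
qed

lemma spitzer_col0: "fps_deriv (mcol 0) = fps_deriv (acol 0) * mcol 0"
proof (rule fps_ext)
  fix n
  show "fps_nth (fps_deriv (mcol 0)) n = fps_nth (fps_deriv (acol 0) * mcol 0) n"
    using spitzer_nth[of n 0] by (simp add: fps_mult_nth mcol_def acol_def add.commute)
qed

text \<open>Setting u = 1 is legitimate coefficientwise in z, since each row has finite support;
  products of rows become products of their sums.\<close>

lemma spitzer_sum: "fps_deriv msum = fps_deriv asum * msum"
proof (rule fps_ext)
  fix n
  define f where "f = (\<lambda>i. fps_const (real i + 1) * Abs_fps (\<lambda>k. acoef (Suc i) k))"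
  define g where "g = (\<lambda>i. Abs_fps (\<lambda>k. mm i (int k)))"
  have fs: "fps_nth (f i) sums ((real i + 1) * (\<Sum>k. acoef (Suc i) k))" for i
    using sums_mult[OF sums_summable[THEN summable_sums, OF finite_supp_sums(1)], of "real i + 1"] by (simp add: f_def fps_mult_left_const_nth[abs_def])
  have gs: "fps_nth (g i) sums mtot p i" for i using finite_supp_sums(2)[of i] by (simp add: g_def fps_nth_Abs_fps[abs_def])
  have fn: "\<bar>fps_nth (f i) k\<bar> = fps_nth (f i) k" for i k by (simp add: f_def acoef_nonneg)
  have gn: "\<bar>fps_nth (g i) k\<bar> = fps_nth (g i) k" for i k by (simp add: g_def mm_nonneg)
  have fg: "fps_nth (f i * g j) sums ((real i + 1) * (\<Sum>k. acoef (Suc i) k) * mtot p j)" for i j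
    using fps_mult_sums[of "f i" "g j"] fs[of i] gs[of j] by (simp add: fn gn sums_iff)
  have S1: "(\<lambda>k. \<Sum>i=0..n. fps_nth (f i * g (n - i)) k) sums (\<Sum>i=0..n. (real i + 1) * (\<Sum>k. acoef (Suc i) k) * mtot p (n - i))"
    by (intro sums_sum fg)
  have eq: "(\<lambda>k. \<Sum>i=0..n. fps_nth (f i * g (n - i)) k) = (\<lambda>k. (real n + 1) * mm (Suc n) (int k))"
  proof -
    have fk: "fps_nth (f i) k = (real i + 1) * acoef (Suc i) k" for i k by (simp add: f_def)
    have gk: "fps_nth (g i) k = mm i (int k)" for i k by (simp add: g_def)
    show ?thesis by (intro ext, subst spitzer_nth) (simp add: fk gk fps_mult_nth)
  qed
  have S2: "(\<lambda>k. (real n + 1) * mm (Suc n) (int k)) sums ((real n + 1) * mtot p (Suc n))"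
    by (intro sums_mult finite_supp_sums)
  have "(real n + 1) * mtot p (Suc n) = (\<Sum>i=0..n. (real i + 1) * (\<Sum>k. acoef (Suc i) k) * mtot p (n - i))"
    by (rule sums_unique2[OF S2 S1[unfolded eq]])
  thus "fps_nth (fps_deriv msum) n = fps_nth (fps_deriv asum * msum) n"
    by (simp add: fps_mult_nth msum_def asum_def add.commute)
qed

text \<open>A coefficient of the u-derivative identity. It expresses column k + 1 of M through the
  earlier columns, so asymptotics spread from column 0 to all columns.\<close>

lemma spitzer_cols: "fps_const (real (Suc k)) * mcol (Suc k) = (\<Sum>i=0..k. fps_const (real (Suc i)) * (acol (Suc i) * mcol (k - i)))"
proof (rule fps_ext)
  fix n
  have "fps_nth (fps_nth (fps_inner_deriv MM) n) k = fps_nth (fps_nth (fps_inner_deriv AA * MM) n) k"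
    by (simp add: spitzer_inner)
  also have "\<dots> = (\<Sum>i=0..n. \<Sum>l=0..k. real (Suc l) * acoef i (Suc l) * mm (n - i) (int (k - l)))"
    by (simp add: fps_inner_deriv_def fps_mult_nth fps_sum_nth AA_nth MM_def)
  finally have "real (Suc k) * mm n (int (Suc k)) = (\<Sum>i=0..n. \<Sum>l=0..k. real (Suc l) * acoef i (Suc l) * mm (n - i) (int (k - l)))"
    by (simp add: fps_inner_deriv_def MM_def)
  also have "\<dots> = (\<Sum>l=0..k. \<Sum>i=0..n. real (Suc l) * acoef i (Suc l) * mm (n - i) (int (k - l)))"
    by (rule sum.swap)
  finally show "fps_nth (fps_const (real (Suc k)) * mcol (Suc k)) n = fps_nth (\<Sum>i=0..k. fps_const (real (Suc i)) * (acol (Suc i) * mcol (k - i))) n"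
    by (simp only: fps_sum_nth fps_mult_left_const_nth) (simp add: fps_mult_nth mcol_def acol_def sum_distrib_left mult.assoc)
qed

end

section \<open>Square-root asymptotics at the structural radius\<close>

text \<open>The condition \<open>crit\<close> is \<tau> * P'(\<tau>) = 0, that is, mean zero for the
  tilted jump weights \<open>wt\<close>.\<close>

locale critical_walk = jump_walk +
  fixes \<tau> :: real
  assumes c_pos: "c \<ge> 1" and d_pos: "d \<ge> 1"
    and p_c: "p (- int c) \<noteq> 0" and p_d: "p (int d) \<noteq> 0"
    and aper: "aperiodic p"
    and tau_pos: "\<tau> > 0"
    and crit: "(\<Sum>j\<in>J. of_int j * p j * \<tau> powi j) = 0"
begin

definition wt :: "int \<Rightarrow> real" where "wt j = p j * \<tau> powi j / Pv \<tau>"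
definition s2 :: real where "s2 = (\<Sum>j\<in>J. (of_int j)\<^sup>2 * wt j)"
definition \<phi> :: "real \<Rightarrow> complex" where "\<phi> \<theta> = (\<Sum>j\<in>J. of_real (wt j) * cis (of_int j * \<theta>))"
definition rho :: real where "rho = 1 / Pv \<tau>"

lemma p_d_pos: "p (int d) > 0" using p_nonneg[of "int d"] p_d by simp

lemma Pv_pos: "x > 0 \<Longrightarrow> Pv x > 0"
  unfolding Pv_def
proof (rule sum_pos2[of J "int d"])
  assume "x > 0"
  thus "0 < p (int d) * x powi int d" using p_d_pos by simp
  show "0 \<le> p j * x powi j" if "j \<in> J" for j using p_nonneg \<open>x > 0\<close> by simp
qed auto

lemma rho_pos: "rho > 0" using Pv_pos[OF tau_pos] by (simp add: rho_def)

lemma wt_nonneg: "wt j \<ge> 0"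
  using p_nonneg tau_pos Pv_pos[OF tau_pos] by (simp add: wt_def)

lemma wt_sum: "(\<Sum>j\<in>J. wt j) = 1"
  using Pv_pos[OF tau_pos] by (simp add: wt_def sum_divide_distrib[symmetric] Pv_def[symmetric])

lemma wt_mean: "(\<Sum>j\<in>J. of_int j * wt j) = 0"
proof -
  have "(\<Sum>j\<in>J. of_int j * wt j) = (\<Sum>j\<in>J. of_int j * p j * \<tau> powi j) / Pv \<tau>"
    by (simp add: wt_def sum_divide_distrib mult.assoc)
  thus ?thesis by (simp add: crit)
qed

lemma wt_pos: "p j \<noteq> 0 \<Longrightarrow> wt j > 0"
  using p_nonneg[of j] tau_pos Pv_pos[OF tau_pos] by (simp add: wt_def zero_less_mult_iff order.not_eq_order_implies_strict)

lemma s2_pos: "s2 > 0"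
  unfolding s2_def
proof (rule sum_pos2[of J "int d"])
  show "0 < (of_int (int d))\<^sup>2 * wt (int d)" using wt_pos[OF p_d] d_pos by simp
qed (auto intro!: mult_nonneg_nonneg wt_nonneg)

text \<open>Equality in the triangle inequality makes cis (j * \<theta>) the same for all jumps j.
  The integers m with cis (m * \<theta>) = 1 form a group, generated by its least positive element
  per, that contains all jump differences. If per \<ge> 2, then P is periodic; if per = 1, then
  \<theta> is a multiple of 2 * pi.\<close>

lemma phi_norm_less_1:
  assumes "\<bar>\<theta>\<bar> \<le> pi" "\<theta> \<noteq> 0"
  shows "norm (\<phi> \<theta>) < 1"
proof (rule ccontr)
  assume "\<not> norm (\<phi> \<theta>) < 1"
  define x where "x = cis \<theta>"
  have le1: "norm (\<phi> \<theta>) \<le> 1"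
  proof -
    have "norm (\<phi> \<theta>) \<le> (\<Sum>j\<in>J. wt j)"
      unfolding \<phi>_def by (rule sum_norm_le) (simp add: norm_mult wt_nonneg)
    thus ?thesis by (simp add: wt_sum)
  qed
  hence n1: "norm (\<phi> \<theta>) = 1" using \<open>\<not> norm (\<phi> \<theta>) < 1\<close> by simp
  define z where "z = \<phi> \<theta>"
  have zc: "z * cnj z = 1" using n1 by (simp add: z_def complex_norm_square[symmetric])
  have nz: "norm z = 1" using n1 by (simp add: z_def)
  define y where "y = (\<lambda>j. cis (of_int j * \<theta>) * cnj z)"
  have ny: "norm (y j) = 1" for j by (simp add: y_def norm_mult nz)
  have "(\<Sum>j\<in>J. of_real (wt j) * y j) = 1"
    using zc by (simp add: y_def z_def \<phi>_def sum_distrib_right mult.assoc)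
  hence "Re (\<Sum>j\<in>J. of_real (wt j) * y j) = 1" by simp
  hence "(\<Sum>j\<in>J. wt j * Re (y j)) = 1" by simp
  hence "(\<Sum>j\<in>J. wt j * (1 - Re (y j))) = 0" by (simp add: right_diff_distrib sum_subtractf wt_sum)
  moreover have "wt j * (1 - Re (y j)) \<ge> 0" for j
    using complex_Re_le_cmod[of "y j"] ny[of j] wt_nonneg[of j] by auto
  ultimately have all0: "wt j * (1 - Re (y j)) = 0" if "j \<in> J" for j
    using that by (subst (asm) sum_nonneg_eq_0_iff) auto
  have yj: "y j = 1" if "p j \<noteq> 0" for j
  proof -
    have "j \<in> J" using jumpset_subset that by (auto simp: jumpset_def)
    hence R: "Re (y j) = 1" using all0[of j] wt_pos[OF that] by auto
    have "Re (y j) ^ 2 + Im (y j) ^ 2 = 1" using ny[of j] by (simp add: cmod_power2[symmetric])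
    thus ?thesis using R by (simp add: complex_eq_iff)
  qed
  define S where "S = {m :: int. cis (of_int m * \<theta>) = 1}"
  have Sadd: "a + b \<in> S" if "a \<in> S" "b \<in> S" for a b
    using that by (simp add: S_def distrib_right cis_mult[symmetric])
  have Sneg: "- a \<in> S" if "a \<in> S" for a
    using that by (simp add: S_def cis_inverse[symmetric] flip: cis_inverse)
  have Sdiff: "a - b \<in> S" if "a \<in> S" "b \<in> S" for a b
    using Sadd[OF that(1) Sneg[OF that(2)]] by simp
  have Sj: "i - j \<in> S" if "p i \<noteq> 0" "p j \<noteq> 0" for i j
  proof -
    have "cis (of_int i * \<theta>) * cnj z = cis (of_int j * \<theta>) * cnj z" using yj[OF that(1)] yj[OF that(2)] by (simp add: y_def)
    moreover have "cnj z \<noteq> 0" using nz by (metis complex_cnj_zero_iff norm_zero zero_neq_one)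
    ultimately have "cis (of_int i * \<theta>) = cis (of_int j * \<theta>)" by simp
    hence "cis (of_int i * \<theta>) / cis (of_int j * \<theta>) = 1" by simp
    thus ?thesis by (simp add: S_def cis_divide left_diff_distrib)
  qed
  have ex: "\<exists>m::nat. m > 0 \<and> int m \<in> S"
    using Sj[OF p_d p_c] d_pos by (intro exI[of _ "d + c"]) auto
  define per where "per = (LEAST m::nat. m > 0 \<and> int m \<in> S)"
  have per: "per > 0" "int per \<in> S" using LeastI_ex[OF ex] by (auto simp: per_def)
  have Smult: "of_nat k * a \<in> S" if "a \<in> S" for k a
  proof (induction k)
    case 0 show ?case by (simp add: S_def)
  next
    case (Suc k) thus ?case using Sadd[OF that Suc] by (simp add: algebra_simps)
  qed
  have Smult': "k * int per \<in> S" for k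
  proof (cases "k \<ge> 0")
    case True thus ?thesis using Smult[OF per(2), of "nat k"] by simp
  next
    case False thus ?thesis using Sneg[OF Smult[OF per(2), of "nat (- k)"]] by simp
  qed
  have dvd: "int per dvd m" if "m \<in> S" for m
  proof -
    have "m mod int per = m - (m div int per) * int per" by (simp add: minus_div_mult_eq_mod)
    hence mS: "m mod int per \<in> S" using Sdiff[OF that Smult'] by simp
    have "m mod int per = 0"
    proof (rule ccontr)
      assume "m mod int per \<noteq> 0"
      hence "m mod int per > 0" using per by (simp add: order.not_eq_order_implies_strict)
      hence "nat (m mod int per) > 0 \<and> int (nat (m mod int per)) \<in> S" using mS by simp
      hence "per \<le> nat (m mod int per)" unfolding per_def by (rule Least_le)
      moreover have "m mod int per < int per" using per by simp
      ultimately show False using \<open>m mod int per > 0\<close> by linarith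
    qed
    thus ?thesis by auto
  qed
  have "per = 1"
  proof (rule ccontr)
    assume "per \<noteq> 1"
    hence p2: "int per \<ge> 2" using per by simp
    \<comment> \<open>The periodic decomposition is based at b = d: all jumps differ from the jump d
      by multiples of per.\<close>
    define h where "h = (\<lambda>j. p (int d + int per * j))"
    have "\<forall>i. p i = (if int per dvd (i - int d) then h ((i - int d) div int per) else 0)"
    proof
      fix i
      show "p i = (if int per dvd (i - int d) then h ((i - int d) div int per) else 0)"
        using dvd[OF Sj[OF _ p_d, of i]] by (auto simp: h_def)
    qed
    moreover have "finite {j. h j \<noteq> 0}"
    proof (rule finite_imageD)
      have "(\<lambda>j. int d + int per * j) ` {j. h j \<noteq> 0} \<subseteq> J"
        using jumpset_subset by (auto simp: h_def jumpset_def)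
      thus "finite ((\<lambda>j. int d + int per * j) ` {j. h j \<noteq> 0})" by (rule finite_subset) auto
      show "inj_on (\<lambda>j. int d + int per * j) {j. h j \<noteq> 0}" using per by (auto simp: inj_on_def)
    qed
    ultimately show False using aper p2 unfolding aperiodic_def by blast
  qed
  hence "cis \<theta> = 1" using per(2) by (simp add: S_def)
  hence "cos \<theta> = 1" by (simp add: complex_eq_iff)
  then obtain k :: int where k: "\<theta> = of_int k * 2 * pi" using cos_one_2pi_int[of \<theta>] by auto
  have "k \<noteq> 0" using k assms(2) by auto
  hence "1 \<le> \<bar>real_of_int k\<bar>" by (simp add: of_int_abs[symmetric] del: of_int_abs)
  hence "2 * pi \<le> \<bar>real_of_int k\<bar> * (2 * pi)" by simp
  also have "\<dots> = \<bar>\<theta>\<bar>" by (simp add: k abs_mult)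
  finally show False using assms(1) pi_gt_zero by linarith
qed

lemma pw_fourier:
  "((\<lambda>\<theta>. \<phi> \<theta> ^ n * cis (- of_int k * \<theta>)) has_integral of_real (2 * pi * (pw n k * \<tau> powi k / Pv \<tau> ^ n))) {-pi..pi}"
proof (induction n arbitrary: k)
  case 0
  show ?case using has_integral_cis[of "-k"] by (cases "k = 0") (simp_all add: pw_0)
next
  case (Suc n)
  have "((\<lambda>\<theta>. \<Sum>j\<in>J. of_real (wt j) * (\<phi> \<theta> ^ n * cis (- of_int (k - j) * \<theta>))) has_integral
      (\<Sum>j\<in>J. of_real (wt j) * of_real (2 * pi * (pw n (k - j) * \<tau> powi (k - j) / Pv \<tau> ^ n)))) {-pi..pi}"
    by (intro has_integral_sum has_integral_mult_right Suc) auto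
  moreover have "(\<lambda>\<theta>. \<Sum>j\<in>J. of_real (wt j) * (\<phi> \<theta> ^ n * cis (- of_int (k - j) * \<theta>))) = (\<lambda>\<theta>. \<phi> \<theta> ^ Suc n * cis (- of_int k * \<theta>))"
  proof
    fix \<theta>
    have "cis (- of_int (k - j) * \<theta>) = cis (of_int j * \<theta>) * cis (- of_int k * \<theta>)" for j
      by (simp add: cis_mult left_diff_distrib)
    hence "(\<Sum>j\<in>J. of_real (wt j) * (\<phi> \<theta> ^ n * cis (- of_int (k - j) * \<theta>))) = (\<Sum>j\<in>J. of_real (wt j) * cis (of_int j * \<theta>)) * (\<phi> \<theta> ^ n * cis (- of_int k * \<theta>))"
      by (simp add: sum_distrib_right sum_distrib_left mult_ac)
    thus "(\<Sum>j\<in>J. of_real (wt j) * (\<phi> \<theta> ^ n * cis (- of_int (k - j) * \<theta>))) = \<phi> \<theta> ^ Suc n * cis (- of_int k * \<theta>)"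
      unfolding \<phi>_def[of \<theta>, symmetric] by (simp only: power_Suc mult.assoc)
  qed
  moreover have "(\<Sum>j\<in>J. of_real (wt j) * of_real (2 * pi * (pw n (k - j) * \<tau> powi (k - j) / Pv \<tau> ^ n))) = (of_real (2 * pi * (pw (Suc n) k * \<tau> powi k / Pv \<tau> ^ Suc n)) :: complex)"
  proof -
    have "(\<Sum>j\<in>J. wt j * (2 * pi * (pw n (k - j) * \<tau> powi (k - j) / Pv \<tau> ^ n))) = (\<Sum>j\<in>J. 2 * pi * (p j * pw n (k - j) * \<tau> powi k / Pv \<tau> ^ Suc n))"
    proof (intro sum.cong refl)
      fix j
      have "\<tau> powi k = \<tau> powi j * \<tau> powi (k - j)" using tau_pos by (subst power_int_add[symmetric]) auto
      thus "wt j * (2 * pi * (pw n (k - j) * \<tau> powi (k - j) / Pv \<tau> ^ n)) = 2 * pi * (p j * pw n (k - j) * \<tau> powi k / Pv \<tau> ^ Suc n)"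
        by (simp add: wt_def)
    qed
    also have "\<dots> = 2 * pi * (pw (Suc n) k * \<tau> powi k / Pv \<tau> ^ Suc n)"
      by (simp add: pw_Suc sum_distrib_left sum_distrib_right sum_divide_distrib)
    finally show ?thesis by (simp only: of_real_mult[symmetric] of_real_sum[symmetric])
  qed
  ultimately show ?case by simp
qed

text \<open>The local limit theorem gives 1 / sqrt (2 * pi * s2 * n) for the tilted weight; after
  division by n, comparison with \<open>bb n\<close> ~ 1 / (2 * sqrt pi * n * sqrt n) leaves the
  constant sqrt (2 / s2).\<close>

lemma acoef_rate:
  "\<exists>K\<ge>0. \<forall>n k. \<bar>acoef n k * rho ^ n - sqrt (2 / s2) / \<tau> ^ k * bb n\<bar> \<le> K * (1 + real k) / \<tau> ^ k / (real n + 1)^2"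
proof -
  obtain K1 where K1: "\<And>n k I. n > 0 \<Longrightarrow> ((\<lambda>\<theta>. \<phi> \<theta> ^ n * cis (- of_int k * \<theta>)) has_integral I) {-pi..pi} \<Longrightarrow>
     norm (I - of_real (sqrt (2 * pi / (s2 * real n)))) \<le> K1 * (1 + \<bar>of_int k\<bar>) / real n"
    using local_limit_theorem_rate[where J = J and w = wt and ?s2.0 = s2, OF _ wt_nonneg wt_sum wt_mean s2_def s2_pos] phi_norm_less_1
    unfolding \<phi>_def[abs_def] by blast
  obtain K2 where K2: "\<And>n. n > 0 \<Longrightarrow> \<bar>bb n - 1 / (2 * sqrt pi * real n * sqrt (real n))\<bar> \<le> K2 / (real n + 1)^2"
    using bb_asymp by blast
  define K where "K = 4 * \<bar>K1\<bar> + sqrt (2 / s2) * \<bar>K2\<bar>"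
  have K0: "K \<ge> 0" using s2_pos by (simp add: K_def)
  have "\<bar>acoef n k * rho ^ n - sqrt (2 / s2) / \<tau> ^ k * bb n\<bar> \<le> K * (1 + real k) / \<tau> ^ k / (real n + 1)^2" for n k
  proof (cases "n = 0")
    case True thus ?thesis using K0 tau_pos by (simp add: acoef_def)
  next
    case False
    hence n: "n > 0" by simp
    define x where "x = pw n (int k) * \<tau> ^ k * rho ^ n"
    have "norm (of_real (2 * pi * (pw n (int k) * \<tau> powi int k / Pv \<tau> ^ n)) - of_real (sqrt (2 * pi / (s2 * real n))) :: complex) \<le> K1 * (1 + \<bar>of_int (int k)\<bar>) / real n"
      by (rule K1[OF n pw_fourier])
    hence "\<bar>2 * pi * (pw n (int k) * \<tau> ^ k / Pv \<tau> ^ n) - sqrt (2 * pi / (s2 * real n))\<bar> \<le> K1 * (1 + real k) / real n"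
      by (simp only: of_real_diff[symmetric] norm_of_real) simp
    also have "pw n (int k) * \<tau> ^ k / Pv \<tau> ^ n = x" by (simp add: x_def rho_def power_divide)
    finally have 1: "\<bar>2 * pi * x - sqrt (2 * pi / (s2 * real n))\<bar> \<le> K1 * (1 + real k) / real n" .
    have e1: "2 * pi * x - sqrt (2 * pi / (s2 * real n)) = 2 * pi * (x - sqrt (2 / s2) / (2 * sqrt pi * sqrt (real n)))"
      using s2_pos n by (simp add: real_sqrt_divide real_sqrt_mult field_simps)
    have "\<bar>x - sqrt (2 / s2) / (2 * sqrt pi * sqrt (real n))\<bar> \<le> 1 * \<bar>x - sqrt (2 / s2) / (2 * sqrt pi * sqrt (real n))\<bar>" by simp
    also have "\<dots> \<le> (2 * pi) * \<bar>x - sqrt (2 / s2) / (2 * sqrt pi * sqrt (real n))\<bar>"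
      using pi_ge_two by (intro mult_right_mono) auto
    also have "\<dots> = \<bar>2 * pi * x - sqrt (2 * pi / (s2 * real n))\<bar>" unfolding e1 by (simp add: abs_mult)
    also have "\<dots> \<le> \<bar>K1\<bar> * (1 + real k) / real n" using 1 by (rule order.trans) (auto intro!: divide_right_mono mult_right_mono)
    finally have 2: "\<bar>x - sqrt (2 / s2) / (2 * sqrt pi * sqrt (real n))\<bar> \<le> \<bar>K1\<bar> * (1 + real k) / real n" .
    have 3: "\<bar>x / real n - sqrt (2 / s2) * (1 / (2 * sqrt pi * real n * sqrt (real n)))\<bar> \<le> 4 * \<bar>K1\<bar> * (1 + real k) / (real n + 1)^2"
    proof -
      have "x / real n - sqrt (2 / s2) * (1 / (2 * sqrt pi * real n * sqrt (real n))) = (x - sqrt (2 / s2) / (2 * sqrt pi * sqrt (real n))) / real n"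
        by (simp add: diff_divide_distrib mult_ac)
      hence "\<bar>x / real n - sqrt (2 / s2) * (1 / (2 * sqrt pi * real n * sqrt (real n)))\<bar> = \<bar>x - sqrt (2 / s2) / (2 * sqrt pi * sqrt (real n))\<bar> / real n"
        by (simp add: abs_divide)
      also have "\<dots> \<le> (\<bar>K1\<bar> * (1 + real k) / real n) / real n" by (intro divide_right_mono 2) auto
      also have "\<dots> = \<bar>K1\<bar> * (1 + real k) * (1 / (real n * real n))" by simp
      also have "\<dots> \<le> \<bar>K1\<bar> * (1 + real k) * (4 / (real n + 1)^2)"
      proof (intro mult_left_mono)
        have "real n + 1 \<le> 2 * real n" using n by simp
        hence "(real n + 1)^2 \<le> (2 * real n)^2" by (intro power_mono) auto
        thus "1 / (real n * real n) \<le> 4 / (real n + 1)^2" using n by (simp add: divide_simps power2_eq_square)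
      qed auto
      finally show ?thesis by (simp add: mult_ac)
    qed
    have 4: "\<bar>sqrt (2 / s2) * (bb n - 1 / (2 * sqrt pi * real n * sqrt (real n)))\<bar> \<le> sqrt (2 / s2) * \<bar>K2\<bar> * (1 + real k) / (real n + 1)^2"
    proof -
      have "\<bar>sqrt (2 / s2) * (bb n - 1 / (2 * sqrt pi * real n * sqrt (real n)))\<bar> \<le> sqrt (2 / s2) * (K2 / (real n + 1)^2)"
        unfolding abs_mult using s2_pos K2[OF n] by (intro mult_mono) auto
      also have "\<dots> \<le> sqrt (2 / s2) * (\<bar>K2\<bar> * (1 + real k) / (real n + 1)^2)"
      proof (intro mult_left_mono divide_right_mono)
        have "K2 \<le> \<bar>K2\<bar> * 1" by simp
        also have "\<dots> \<le> \<bar>K2\<bar> * (1 + real k)" by (intro mult_left_mono) auto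
        finally show "K2 \<le> \<bar>K2\<bar> * (1 + real k)" .
      qed (use s2_pos in auto)
      finally show ?thesis by simp
    qed
    have "\<bar>x / real n - sqrt (2 / s2) * bb n\<bar> \<le> 4 * \<bar>K1\<bar> * (1 + real k) / (real n + 1)^2 + sqrt (2 / s2) * \<bar>K2\<bar> * (1 + real k) / (real n + 1)^2"
      using 3 4 unfolding right_diff_distrib by linarith
    also have "\<dots> = K * (1 + real k) / (real n + 1)^2" by (simp add: K_def add_divide_distrib distrib_right)
    finally have 5: "\<bar>x / real n - sqrt (2 / s2) * bb n\<bar> \<le> K * (1 + real k) / (real n + 1)^2" .
    have tk: "\<tau> ^ k > 0" using tau_pos by simp
    have "acoef n k * rho ^ n - sqrt (2 / s2) / \<tau> ^ k * bb n = (x / real n - sqrt (2 / s2) * bb n) / \<tau> ^ k"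
    proof -
      have "acoef n k * rho ^ n = x / real n / \<tau> ^ k" using tk tau_pos n by (simp add: acoef_def x_def)
      thus ?thesis by (simp add: diff_divide_distrib)
    qed
    hence "\<bar>acoef n k * rho ^ n - sqrt (2 / s2) / \<tau> ^ k * bb n\<bar> = \<bar>x / real n - sqrt (2 / s2) * bb n\<bar> / \<tau> ^ k" using tk by (simp add: abs_divide)
    also have "\<dots> \<le> (K * (1 + real k) / (real n + 1)^2) / \<tau> ^ k" using 5 tk by (intro divide_right_mono) auto
    finally show ?thesis by (simp add: mult_ac)
  qed
  thus ?thesis using K0 by blast
qed

end

context critical_walk
begin

lemma acol_rate: "\<exists>K. srate (sqrt (2 / s2) / \<tau> ^ k) K (fps_scale rho (acol k))"
proof -
  obtain K where K: "\<And>n k. \<bar>acoef n k * rho ^ n - sqrt (2 / s2) / \<tau> ^ k * bb n\<bar> \<le> K * (1 + real k) / \<tau> ^ k / (real n + 1)^2"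
    using acoef_rate by blast
  show ?thesis by (rule exI[of _ "K * (1 + real k) / \<tau> ^ k"]) (use K in \<open>simp add: srate_def acol_def\<close>)
qed

text \<open>Summing over altitudes gives the geometric series in 1/\<tau>, with an additional factor
  1 + k in the error; this is where \<tau> > 1 enters.\<close>

lemma asum_rate:
  assumes "\<tau> > 1"
  shows "\<exists>K. srate (sqrt (2 / s2) * (\<tau> / (\<tau> - 1))) K (fps_scale rho asum)"
proof -
  obtain K where K: "K \<ge> 0" "\<And>n k. \<bar>acoef n k * rho ^ n - sqrt (2 / s2) / \<tau> ^ k * bb n\<bar> \<le> K * (1 + real k) / \<tau> ^ k / (real n + 1)^2"
    using acoef_rate by blast
  define x where "x = 1 / \<tau>"
  have x: "0 < x" "x < 1" using assms by (auto simp: x_def)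
  have xk: "1 / \<tau> ^ k = x ^ k" for k by (simp add: x_def power_divide)
  have geo: "(\<lambda>k. x ^ k) sums (\<tau> / (\<tau> - 1))"
    using geometric_sums[of x] x assms by (simp add: x_def field_simps)
  have lin: "summable (\<lambda>k. (1 + real k) * x ^ k)"
    using sums_summable[OF geometric_deriv_sums[of x]] x by (simp add: mult.commute add.commute)
  define Z where "Z = (\<Sum>k. (1 + real k) * x ^ k)"
  have "srate (sqrt (2 / s2) * (\<tau> / (\<tau> - 1))) (K * Z) (fps_scale rho asum)"
    unfolding srate_def
  proof
    fix n
    have "(\<lambda>k. acoef n k * rho ^ n - sqrt (2 / s2) * bb n * x ^ k) sums (fps_nth asum n * rho ^ n - sqrt (2 / s2) * bb n * (\<tau> / (\<tau> - 1)))"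
      unfolding asum_def
      using sums_diff[OF sums_mult2[OF summable_sums[OF sums_summable[OF finite_supp_sums(1)[of n]]], of "rho ^ n"] sums_mult[OF geo, of "sqrt (2 / s2) * bb n"]] by simp
    hence e: "fps_nth asum n * rho ^ n - sqrt (2 / s2) * bb n * (\<tau> / (\<tau> - 1)) = (\<Sum>k. acoef n k * rho ^ n - sqrt (2 / s2) * bb n * x ^ k)"
      by (rule sums_unique)
    have le: "norm (acoef n k * rho ^ n - sqrt (2 / s2) * bb n * x ^ k) \<le> ((1 + real k) * x ^ k) * (K / (real n + 1)^2)" for k
      using K(2)[of n k] by (simp add: xk[symmetric] mult_ac)
    have "norm (\<Sum>k. acoef n k * rho ^ n - sqrt (2 / s2) * bb n * x ^ k) \<le> (\<Sum>k. ((1 + real k) * x ^ k) * (K / (real n + 1)^2))"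
      by (rule norm_suminf_le[OF le]) (intro summable_mult2 lin)
    also have "\<dots> = Z * (K / (real n + 1)^2)" unfolding Z_def by (rule suminf_mult2[OF lin, symmetric])
    finally show "\<bar>fps_nth (fps_scale rho asum) n - sqrt (2 / s2) * (\<tau> / (\<tau> - 1)) * bb n\<bar> \<le> K * Z / (real n + 1)\<^sup>2"
      unfolding e[symmetric] by (simp add: mult_ac)
  qed
  thus ?thesis by blast
qed

definition Mv :: "real \<Rightarrow> nat \<Rightarrow> real" where "Mv t k = (\<Sum>n. mm n (int k) * t ^ n)"
definition Mtot :: "real \<Rightarrow> real" where "Mtot t = (\<Sum>n. mtot p n * t ^ n)"

lemma Mv_suminf: "suminf (fps_nth (fps_scale t (mcol k))) = Mv t k"
  by (simp add: Mv_def mcol_def fps_scale_nth[abs_def])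

lemma Mtot_suminf: "suminf (fps_nth (fps_scale t msum)) = Mtot t"
  by (simp add: Mtot_def msum_def fps_scale_nth[abs_def])

lemma mcol_scaled_rec:
  "fps_const (real (Suc k)) * fps_scale t (mcol (Suc k)) = (\<Sum>i=0..k. fps_const (real (Suc i)) * (fps_scale t (acol (Suc i)) * fps_scale t (mcol (k - i))))"
proof -
  have scsum: "fps_scale t (\<Sum>i\<in>I. f i) = (\<Sum>i\<in>I. fps_scale t (f i))" for I :: "nat set" and f
    by (rule fps_ext) (simp add: fps_sum_nth sum_distrib_right)
  have scsc: "fps_scale t (fps_const x) = fps_const x" for x
    by (rule fps_ext) simp
  show ?thesis using arg_cong[OF spitzer_cols[of k], of "fps_scale t"] by (simp only: scsum scsc fps_scale_mult)
qed

lemma Mv_rec: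
  assumes "\<And>i. i \<le> j \<Longrightarrow> summable (\<lambda>n. \<bar>fps_nth (fps_scale t (acol (Suc i))) n\<bar>)"
    and "\<And>i. i \<le> j \<Longrightarrow> summable (\<lambda>n. \<bar>fps_nth (fps_scale t (mcol (j - i))) n\<bar>)"
  shows "real (Suc j) * Mv t (Suc j) = (\<Sum>i=0..j. real (Suc i) * (suminf (fps_nth (fps_scale t (acol (Suc i)))) * Mv t (j - i)))"
proof -
  have sm: "fps_nth (fps_scale t (acol (Suc i)) * fps_scale t (mcol (j - i))) sums (suminf (fps_nth (fps_scale t (acol (Suc i)))) * Mv t (j - i))" if "i \<in> {0..j}" for i
    using fps_mult_sums[of "fps_scale t (acol (Suc i))" "fps_scale t (mcol (j - i))"] assms[of i] that
    unfolding Mv_suminf by auto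
  have "(\<lambda>n. \<Sum>i=0..j. real (Suc i) * fps_nth (fps_scale t (acol (Suc i)) * fps_scale t (mcol (j - i))) n) sums (\<Sum>i=0..j. real (Suc i) * (suminf (fps_nth (fps_scale t (acol (Suc i)))) * Mv t (j - i)))"
    by (intro sums_sum sums_mult sm)
  moreover have "(\<lambda>n. \<Sum>i=0..j. real (Suc i) * fps_nth (fps_scale t (acol (Suc i)) * fps_scale t (mcol (j - i))) n) = fps_nth (fps_const (real (Suc j)) * fps_scale t (mcol (Suc j)))"
    unfolding mcol_scaled_rec by (intro ext) (simp only: fps_sum_nth fps_mult_left_const_nth)
  ultimately have s: "(\<lambda>n. real (Suc j) * fps_nth (fps_scale t (mcol (Suc j))) n) sums (\<Sum>i=0..j. real (Suc i) * (suminf (fps_nth (fps_scale t (acol (Suc i)))) * Mv t (j - i)))"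
    by (simp only: fps_mult_left_const_nth[abs_def])
  have "summable (\<lambda>n. 1 / real (Suc j) * (real (Suc j) * fps_nth (fps_scale t (mcol (Suc j))) n))"
    by (intro summable_mult sums_summable[OF s])
  hence "summable (fps_nth (fps_scale t (mcol (Suc j))))" by (simp add: fps_scale_nth[abs_def] del: of_nat_Suc)
  from sums_unique2[OF s sums_mult[OF summable_sums[OF this], of "real (Suc j)"]] show ?thesis
    unfolding Mv_suminf by simp
qed

text \<open>The constant C of the theorem: at the critical point \<tau>^2 * P''(\<tau>) = s2 *
  P(\<tau>).\<close>

definition Cst :: real where "Cst = sqrt (2 / s2) * \<tau>"

lemma msum_rate:
  assumes "\<tau> > 1"
  shows "\<exists>K. srate (Cst / (\<tau> - 1) * Mtot rho) K (fps_scale rho msum)"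
proof -
  obtain K where K: "srate (sqrt (2 / s2) * (\<tau> / (\<tau> - 1))) K (fps_scale rho asum)"
    using asum_rate[OF assms] by blast
  have "\<exists>K. srate (sqrt (2 / s2) * (\<tau> / (\<tau> - 1)) * suminf (fps_nth (fps_scale rho msum))) K (fps_scale rho msum)"
    by (rule srate_exp[OF K _ _ fps_scale_ode[OF spitzer_sum]])
       (simp_all add: asum_def acoef_def msum_def mtot_eq mm_0)
  thus ?thesis unfolding Mtot_suminf by (simp add: Cst_def)
qed

text \<open>The coefficients of \<open>C / (\<tau> - u) * M(\<rho>, u)\<close> as a power series in \<open>u\<close>.\<close>
definition betas :: "nat \<Rightarrow> real" where
  "betas k = (\<Sum>i=0..k. Cst / \<tau> ^ Suc i * Mv rho (k - i))"

text \<open>Leading coefficients propagate along \<open>spitzer_cols\<close> by the product rule of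
  \<open>srate_mult\<close>. That they are \<open>betas\<close> is the identity (F * H)' = A' * (F *
  H) + F' * H for series in u, where H(u) = M(\<rho>, u) satisfies H' = A' * H.\<close>

lemma mcol_rate: "\<exists>K. srate (betas k) K (fps_scale rho (mcol k))"
proof -
  define al where "al = (\<lambda>k. sqrt (2 / s2) / \<tau> ^ k)"
  define Av where "Av = (\<lambda>k. suminf (fps_nth (fps_scale rho (acol k))))"
  have al: "Cst / \<tau> ^ Suc k = al k" for k using tau_pos by (simp add: Cst_def al_def)
  have ac: "\<exists>K. srate (al k) K (fps_scale rho (acol k))" for k unfolding al_def by (rule acol_rate)
  have be: "betas k = (\<Sum>i=0..k. al i * Mv rho (k - i))" for k by (simp only: betas_def al)
  note rec = mcol_scaled_rec[where t = rho]
  have srsum: "\<exists>K. srate (\<Sum>i\<in>I. x i) K (\<Sum>i\<in>I. f i)" if "finite I" "\<And>i. i \<in> I \<Longrightarrow> \<exists>K. srate (x i) K (f i)" for I :: "nat set" and x f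
    using that
  proof (induction I rule: finite_induct)
    case empty show ?case by (rule exI[of _ 0]) (simp add: srate_def)
  next
    case (insert i I)
    then obtain K L where "srate (x i) K (f i)" "srate (sum x I) L (sum f I)" by (metis insertI1 insertI2)
    from srate_add[OF this] show ?case using insert.hyps by auto
  qed
  show ?thesis
  proof (induction k rule: less_induct)
    case (less k)
    show ?case
    proof (cases k)
      case 0
      obtain K where K: "srate (al 0) K (fps_scale rho (acol 0))" using ac by blast
      have "\<exists>K. srate (al 0 * suminf (fps_nth (fps_scale rho (mcol 0)))) K (fps_scale rho (mcol 0))"
        by (rule srate_exp[OF K _ _ fps_scale_ode[OF spitzer_col0]])
           (simp_all add: acol_def acoef_def mcol_def mm_0)
      thus ?thesis unfolding Mv_suminf by (simp add: 0 be)
    next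
      case (Suc m)
      have IH: "\<exists>K. srate (betas j) K (fps_scale rho (mcol j))" if "j \<le> m" for j using less[of j] that Suc by simp
      define y where "y = (\<lambda>i. al (Suc i) * Mv rho (m - i) + betas (m - i) * Av (Suc i))"
      have t: "\<exists>K. srate (real (Suc i) * y i) K (fps_const (real (Suc i)) * (fps_scale rho (acol (Suc i)) * fps_scale rho (mcol (m - i))))" if "i \<in> {0..m}" for i
      proof -
        obtain K1 where K1: "srate (al (Suc i)) K1 (fps_scale rho (acol (Suc i)))" using ac by blast
        obtain K2 where K2: "srate (betas (m - i)) K2 (fps_scale rho (mcol (m - i)))" using IH[OF diff_le_self] by blast
        show ?thesis using srate_cmult[OF srate_mult[OF K1 K2], of "real (Suc i)"] unfolding Mv_suminf Av_def y_def by blast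
      qed
      have "\<exists>K. srate (\<Sum>i=0..m. real (Suc i) * y i) K (fps_const (real (Suc m)) * fps_scale rho (mcol (Suc m)))"
        unfolding rec[of m] by (rule srsum[OF finite_atLeastAtMost t])
      then obtain K where K: "srate (\<Sum>i=0..m. real (Suc i) * y i) K (fps_const (real (Suc m)) * fps_scale rho (mcol (Suc m)))"
        by (elim exE)
      have "srate (1 / real (Suc m) * (\<Sum>i=0..m. real (Suc i) * y i)) (\<bar>1 / real (Suc m)\<bar> * K) (fps_scale rho (mcol (Suc m)))"
        using srate_cmult[OF K, of "1 / real (Suc m)"] by (simp add: mult.assoc[symmetric] del: of_nat_Suc)
      moreover have "(\<Sum>i=0..m. real (Suc i) * y i) = real (Suc m) * betas (Suc m)"
      proof -
        define F where "F = Abs_fps al"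
        define H where "H = Abs_fps (Mv rho)"
        define A where "A = Abs_fps Av"
        have Hn: "real (Suc j) * Mv rho (Suc j) = (\<Sum>i=0..j. real (Suc i) * (Av (Suc i) * Mv rho (j - i)))" if "j \<le> m" for j
          unfolding Av_def
        proof (rule Mv_rec)
          fix i assume "i \<le> j"
          obtain K1 where K1: "srate (al (Suc i)) K1 (fps_scale rho (acol (Suc i)))" using ac by blast
          obtain K2 where K2: "srate (betas (j - i)) K2 (fps_scale rho (mcol (j - i)))" using IH[OF order.trans[OF diff_le_self \<open>j \<le> m\<close>]] by blast
          show "summable (\<lambda>n. \<bar>fps_nth (fps_scale rho (acol (Suc i))) n\<bar>)" "summable (\<lambda>n. \<bar>fps_nth (fps_scale rho (mcol (j - i))) n\<bar>)"
            by (rule srate_abs_summable[OF K1], rule srate_abs_summable[OF K2])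
        qed
        \<comment> \<open>Only columns up to m are known to converge at this stage, so H' = A' * H
          is available only up to order m.\<close>
        have trunc: "fps_nth (fps_deriv H) j = fps_nth (fps_deriv A * H) j" if "j \<le> m" for j
          using Hn[OF that] by (simp add: H_def A_def fps_mult_nth mult.assoc)
        have bF: "betas j = fps_nth (F * H) j" for j by (simp add: be F_def H_def fps_mult_nth)
        have "real (Suc m) * betas (Suc m) = fps_nth (fps_deriv (F * H)) m" by (simp only: bF fps_deriv_nth Suc_eq_plus1)
        also have "\<dots> = fps_nth (F * fps_deriv H) m + fps_nth (fps_deriv F * H) m" by (simp only: fps_deriv_mult fps_add_nth)
        also have "fps_nth (F * fps_deriv H) m = fps_nth (F * (fps_deriv A * H)) m"
          unfolding fps_mult_nth[of F] by (intro sum.cong refl) (simp only: trunc diff_le_self)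
        also have "F * (fps_deriv A * H) = fps_deriv A * (F * H)" by (simp only: mult_ac)
        also have "fps_nth (fps_deriv A * (F * H)) m + fps_nth (fps_deriv F * H) m = (\<Sum>i=0..m. real (Suc i) * y i)"
          unfolding fps_mult_nth[of "fps_deriv A"] fps_mult_nth[of "fps_deriv F"] bF[symmetric] sum.distrib[symmetric]
          by (intro sum.cong refl) (simp add: A_def F_def H_def y_def algebra_simps)
        finally show ?thesis ..
      qed
      ultimately show ?thesis unfolding Suc by (auto simp del: of_nat_Suc)
    qed
  qed
qed

end

section \<open>Kernel factorization over the large roots\<close>

lemma order_linear_factor: "order w [:- z, 1:] = (if w = z then 1 else 0)" for w z :: complex
proof (cases "w = z")
  case True
  have "order z ([:- z, 1:] ^ 1) = 1" by (rule order_power_n_n)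
  thus ?thesis using True by simp
next
  case False
  thus ?thesis by (simp add: order_0I)
qed

lemma order_prod_linear:
  fixes z :: "nat \<Rightarrow> complex"
  assumes "finite A"
  shows "order w (\<Prod>l\<in>A. [:- z l, 1:]) = card {l\<in>A. z l = w}"
  using assms
proof (induction A rule: finite_induct)
  case (insert a A)
  have "[:- z a, 1:] \<noteq> 0" "(\<Prod>l\<in>A. [:- z l, 1:]) \<noteq> 0" using insert by (auto simp: prod_zero_iff)
  hence nz: "[:- z a, 1:] * (\<Prod>l\<in>A. [:- z l, 1:]) \<noteq> 0" by (rule no_zero_divisors)
  have "{l \<in> insert a A. z l = w} = (if z a = w then insert a {l\<in>A. z l = w} else {l\<in>A. z l = w})" by auto
  thus ?case using insert order_mult[OF nz, of w] by (auto simp: order_linear_factor)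
qed auto

lemma dvd_if_order_le:
  fixes p q :: "complex poly"
  assumes "p \<noteq> 0" "q \<noteq> 0" "\<And>w. order w p \<le> order w q"
  shows "p dvd q"
  using assms
proof (induction "degree p" arbitrary: p q)
  case 0
  then obtain a where "p = [:a:]" "a \<noteq> 0" by (metis degree_eq_zeroE pCons_0_0)
  thus ?case by (simp add: const_poly_dvd_iff) (metis dvd_field_iff)
next
  case (Suc n)
  have "\<not> constant (poly p)" using Suc(2) by (simp add: constant_degree)
  then obtain w where w: "poly p w = 0" using fundamental_theorem_of_algebra by blast
  hence "order w p \<ge> 1" using Suc.prems(1) order_root[of p w] by auto
  hence "order w q \<ge> 1" using Suc.prems(3)[of w] by linarith
  hence wq: "poly q w = 0" using order_root[of q w] by auto
  obtain p' where p': "p = [:- w, 1:] * p'" using w by (auto simp: poly_eq_0_iff_dvd)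
  obtain q' where q': "q = [:- w, 1:] * q'" using wq by (auto simp: poly_eq_0_iff_dvd)
  have nz: "p' \<noteq> 0" "q' \<noteq> 0" using Suc.prems p' q' by auto
  have "p' dvd q'"
  proof (rule Suc(1))
    show "n = degree p'" using Suc(2) nz unfolding p' by (subst (asm) degree_mult_eq) auto
    show "order x p' \<le> order x q'" for x
      using Suc.prems(3)[of x] order_mult[of "[:- w, 1:]" p' x] order_mult[of "[:- w, 1:]" q' x] nz Suc.prems(1,2)
      unfolding p' q' by simp
  qed (use nz in auto)
  thus ?case unfolding p' q' by (intro mult_dvd_mono) auto
qed

lemma coeff_prod_linear_continuous:
  fixes v :: "nat \<Rightarrow> real \<Rightarrow> complex"
  assumes "finite A" "\<And>l. l \<in> A \<Longrightarrow> continuous_on X (v l)"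
  shows "continuous_on X (\<lambda>t. coeff (\<Prod>l\<in>A. [:- v l t, 1:]) k)"
  using assms
proof (induction A arbitrary: k rule: finite_induct)
  case (insert a A)
  have *: "coeff ([:- x, 1:] * q) k = - x * coeff q k + (if k = 0 then 0 else coeff q (k - 1))" for x :: complex and q
    by (cases k) (auto simp: coeff_pCons)
  show ?case unfolding prod.insert[OF insert.hyps(1,2)] *
    by (cases "k = 0") (auto intro!: continuous_intros insert.IH insert.prems)
qed auto

context critical_walk
begin

lemma Pv_eq: "Pv x = jump_poly_real c d p x"
  by (simp add: Pv_def jump_poly_real_def)

lemma Pv_continuous: "x > 0 \<Longrightarrow> isCont Pv x"
  unfolding Pv_def by (intro continuous_intros) auto

lemma Mv_term_bound:
  assumes "x > 0" "t \<ge> 0"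
  shows "mm n (int k) * t ^ n \<le> (t * Pv x) ^ n / x ^ k"
  using mult_right_mono[OF mm_le[OF assms(1), of n k], of "t ^ n"] assms by (simp add: power_mult_distrib mult_ac)

lemma acoef_le_pw: "acoef n k \<le> pw n (int k)"
  using pw_nonneg[of n "int k"] by (auto simp: acoef_def divide_simps mult_le_cancel_left1)

lemma acoef_term_bound:
  assumes "x > 0" "t \<ge> 0"
  shows "acoef n k * t ^ n \<le> (t * Pv x) ^ n / x ^ k"
proof -
  have "acoef n k * x ^ k \<le> Pv x ^ n"
  proof -
    have "acoef n k * x ^ k \<le> pw n (int k) * x ^ k" using assms by (intro mult_right_mono acoef_le_pw) auto
    thus ?thesis using pw_le[OF assms(1), of n "int k"] by simp
  qed
  hence "acoef n k * x ^ k * t ^ n \<le> Pv x ^ n * t ^ n" using assms by (intro mult_right_mono) auto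
  thus ?thesis using assms by (simp add: field_simps)
qed

text \<open>Every x > 0 with t * P(x) < 1 makes the columns decay like x^(-k). For t < \<rho> this
  includes \<tau> and, by continuity, points beyond it.\<close>

lemma summable_at:
  assumes "x > 0" "t \<ge> 0" "t * Pv x < 1"
  shows "summable (\<lambda>n. mm n (int k) * t ^ n)" and "summable (\<lambda>n. acoef n k * t ^ n)"
    and "Mv t k \<le> 1 / (1 - t * Pv x) / x ^ k"
proof -
  have q: "0 \<le> t * Pv x" using assms Pv_nonneg by simp
  have g: "(\<lambda>n. (t * Pv x) ^ n / x ^ k) sums (1 / (1 - t * Pv x) / x ^ k)"
    using assms q by (intro sums_divide geometric_sums) auto
  show s: "summable (\<lambda>n. mm n (int k) * t ^ n)"
    by (rule summable_comparison_test'[OF sums_summable[OF g], of 0]) (use Mv_term_bound[OF assms(1,2)] mm_nonneg assms(2) in simp)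
  show "summable (\<lambda>n. acoef n k * t ^ n)"
    by (rule summable_comparison_test'[OF sums_summable[OF g], of 0]) (use acoef_term_bound[OF assms(1,2)] acoef_nonneg assms(2) in simp)
  show "Mv t k \<le> 1 / (1 - t * Pv x) / x ^ k"
    unfolding Mv_def sums_unique[OF g] by (intro suminf_le Mv_term_bound assms s sums_summable[OF g])
qed

lemma t_Pv_tau: "t < rho \<Longrightarrow> t * Pv \<tau> < 1"
  using Pv_pos[OF tau_pos] by (simp add: rho_def pos_less_divide_eq)

lemma Mv_kernel_rec:
  assumes t: "0 \<le> t" "t < rho"
  defines "Mi \<equiv> \<lambda>k::int. \<Sum>n. mm n k * t ^ n"
  shows "k \<ge> 0 \<Longrightarrow> Mi k = (if k = 0 then 1 else 0) + t * (\<Sum>j\<in>J. p j * Mi (k - j))"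
proof -
  assume k: "k \<ge> 0"
  have sm: "summable (\<lambda>n. mm n i * t ^ n)" for i
    using summable_at(1)[OF tau_pos t(1) t_Pv_tau[OF t(2)], of "nat i"] by (cases "i \<ge> 0") (auto simp: mm_neg)
  have "Mi k = mm 0 k * t ^ 0 + (\<Sum>n. mm (Suc n) k * t ^ Suc n)"
    unfolding Mi_def using suminf_split_head[OF sm[of k]] by simp
  also have "(\<Sum>n. mm (Suc n) k * t ^ Suc n) = (\<Sum>n. \<Sum>j\<in>J. t * (p j * (mm n (k - j) * t ^ n)))"
    using k by (simp add: mm_Suc sum_distrib_right sum_distrib_left mult_ac)
  also have "\<dots> = (\<Sum>j\<in>J. \<Sum>n. t * (p j * (mm n (k - j) * t ^ n)))"
    by (intro suminf_sum summable_mult sm)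
  also have "\<dots> = (\<Sum>j\<in>J. t * (p j * Mi (k - j)))"
    unfolding Mi_def by (intro sum.cong refl) (simp add: suminf_mult[OF summable_mult[OF sm]] suminf_mult[OF sm])
  finally show ?thesis by (simp add: mm_0 sum_distrib_left)
qed

lemma coeff_kernel_poly: "coeff (kernel_poly c d p t) m = (if m = c then 1 else 0) - of_real (t * p (int m - int c))"
proof -
  have "coeff (\<Sum>i\<in>J. monom (complex_of_real (p i)) (nat (i + int c))) m = (\<Sum>i\<in>J. if i = int m - int c then of_real (p i) else 0)"
    unfolding coeff_sum coeff_monom by (intro sum.cong refl) auto
  also have "\<dots> = of_real (p (int m - int c))" using p_supp[of "int m - int c"] by (auto simp: not_le)
  finally show ?thesis by (simp add: kernel_poly_def)
qed

lemma poly_kernel: "u \<noteq> 0 \<Longrightarrow> poly (kernel_poly c d p t) u = u ^ c * (1 - of_real t * jump_poly_complex c d p u)"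
proof -
  assume u: "u \<noteq> 0"
  have "poly (\<Sum>i\<in>J. monom (complex_of_real (p i)) (nat (i + int c))) u = (\<Sum>i\<in>J. u ^ c * (of_real (p i) * u powi i))"
    unfolding poly_sum poly_monom
  proof (intro sum.cong refl)
    fix i assume i: "i \<in> J"
    have "u ^ nat (i + int c) = u powi (i + int c)" using i by (simp add: power_int_def)
    also have "\<dots> = u powi i * u ^ c" using u by (simp add: power_int_add)
    finally show "of_real (p i) * u ^ nat (i + int c) = u ^ c * (of_real (p i) * u powi i)" by simp
  qed
  thus ?thesis by (simp add: kernel_poly_def poly_monom jump_poly_complex_def sum_distrib_left algebra_simps)
qed

lemma jump_poly_complex_of_real: "jump_poly_complex c d p (of_real x) = of_real (Pv x)"
  by (simp add: jump_poly_complex_def Pv_def of_real_power_int)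

lemma norm_jump_poly_le: "norm (jump_poly_complex c d p u) \<le> Pv (norm u)"
  unfolding jump_poly_complex_def Pv_def
  by (rule sum_norm_le) (simp add: norm_mult norm_power_int p_nonneg)

definition Mfps :: "real \<Rightarrow> complex fps" where "Mfps t = Abs_fps (\<lambda>k. of_real (Mv t k))"

text \<open>Stated for any series dominated by the M_k(t), so that it applies to M(t, u) and,
  through \<open>Mfps_inverse_bound\<close>, to its inverse.\<close>

lemma Mfps_radius:
  assumes "x > 0" "t \<ge> 0" "t * Pv x < 1" "\<And>k. norm (fps_nth f k) \<le> B * Mv t k" "B \<ge> 0"
  shows "fps_conv_radius (f :: complex fps) \<ge> ereal x"
  unfolding fps_conv_radius_def
proof (rule conv_radius_geI_ex)
  fix r assume r: "0 < r" "ereal r < ereal x"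
  define C where "C = B * (1 / (1 - t * Pv x))"
  have "summable (\<lambda>n. fps_nth f n * of_real r ^ n)"
  proof (rule summable_comparison_test'[of "\<lambda>n. C * (r / x) ^ n" 0])
    show "summable (\<lambda>n. C * (r / x) ^ n)" using r assms by (intro summable_mult summable_geometric) auto
    show "norm (fps_nth f n * of_real r ^ n) \<le> C * (r / x) ^ n" for n
    proof -
      have "norm (fps_nth f n) \<le> B * (1 / (1 - t * Pv x) / x ^ n)"
        using order.trans[OF assms(4)[of n] mult_left_mono[OF summable_at(3)[OF assms(1-3), of n] assms(5)]] .
      hence "norm (fps_nth f n) * r ^ n \<le> B * (1 / (1 - t * Pv x) / x ^ n) * r ^ n" using r by (intro mult_right_mono) auto
      thus ?thesis using r by (simp add: norm_mult norm_power C_def power_divide)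
    qed
  qed
  thus "\<exists>z. norm z = r \<and> summable (\<lambda>n. fps_nth f n * z ^ n)" using r by (intro exI[of _ "of_real r"]) auto
qed

lemma Mv_nonneg:
  assumes "t \<ge> 0" "t < rho"
  shows "Mv t k \<ge> 0"
  unfolding Mv_def using assms
  by (intro suminf_nonneg summable_at(1)[OF tau_pos] t_Pv_tau mult_nonneg_nonneg mm_nonneg) auto

lemma Mv_0_ge_1:
  assumes "t \<ge> 0" "t < rho"
  shows "Mv t 0 \<ge> 1"
proof -
  have "(\<Sum>n\<in>{0}. mm n (int 0) * t ^ n) \<le> Mv t 0"
    unfolding Mv_def using assms
    by (intro sum_le_suminf summable_at(1)[OF tau_pos] t_Pv_tau mult_nonneg_nonneg mm_nonneg) auto
  thus ?thesis by (simp add: mm_0)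
qed

text \<open>Writing \<open>M = exp A\<close> with \<open>A \<ge> 0\<close> coefficientwise, the coefficients of \<open>exp (- A)\<close> are dominated by those of \<open>exp A\<close>.\<close>
lemma Mfps_inverse_bound:
  assumes t: "t \<ge> 0" "t < rho"
  shows "norm (fps_nth (inverse (Mfps t)) k) \<le> 1 / (Mv t 0)^2 * Mv t k"
proof -
  define Av where "Av = (\<lambda>k. suminf (fps_nth (fps_scale t (acol k))))"
  have M0: "Mv t 0 \<ge> 1" by (rule Mv_0_ge_1[OF t])
  have sA: "summable (\<lambda>n. acoef n k * t ^ n)" and sM: "summable (\<lambda>n. mm n (int k) * t ^ n)" for k
    using summable_at[OF tau_pos t(1) t_Pv_tau[OF t(2)]] by auto
  have Ann: "Av k \<ge> 0" for k unfolding Av_def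
    using sA[of k] t by (intro suminf_nonneg) (auto simp: acol_def acoef_nonneg fps_scale_nth[abs_def])
  have rec: "real (Suc j) * Mv t (Suc j) = (\<Sum>i=0..j. real (Suc i) * (Av (Suc i) * Mv t (j - i)))" for j
    unfolding Av_def
  proof (rule Mv_rec)
    fix i
    show "summable (\<lambda>n. \<bar>fps_nth (fps_scale t (acol (Suc i))) n\<bar>)" using sA[of "Suc i"] t by (simp add: acol_def acoef_nonneg)
    show "summable (\<lambda>n. \<bar>fps_nth (fps_scale t (mcol (j - i))) n\<bar>)" using sM[of "j - i"] t by (simp add: mcol_def mm_nonneg)
  qed
  define Ac where "Ac = Abs_fps (\<lambda>k. complex_of_real (Av k))"
  have ode: "fps_deriv (Mfps t) = fps_deriv Ac * Mfps t"
  proof (rule fps_ext)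
    fix j
    have "complex_of_real (real (Suc j) * Mv t (Suc j)) = of_real (\<Sum>i=0..j. real (Suc i) * (Av (Suc i) * Mv t (j - i)))"
      by (simp only: rec)
    thus "fps_nth (fps_deriv (Mfps t)) j = fps_nth (fps_deriv Ac * Mfps t) j"
      by (simp add: Mfps_def Ac_def fps_mult_nth mult.assoc del: of_nat_Suc) 
  qed
  define I where "I = inverse (Mfps t)"
  have I1: "I * Mfps t = 1" unfolding I_def using M0 by (intro inverse_mult_eq_1) (simp add: Mfps_def)
  have "fps_deriv I = - (fps_deriv Ac * Mfps t * (I * I))" using fps_deriv_of_inverse[OF I1] by (simp add: ode)
  also have "\<dots> = - (fps_deriv Ac * I * (I * Mfps t))" by (simp only: mult_ac)
  finally have Iode: "fps_deriv I = - (fps_deriv Ac * I)" by (simp add: I1)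
  have "norm (fps_nth I k) \<le> 1 / (Mv t 0)^2 * Mv t k" for k
  proof (induction k rule: less_induct)
    case (less k)
    show ?case
    proof (cases k)
      case 0
      have "fps_nth I 0 = 1 / of_real (Mv t 0)" by (simp add: I_def Mfps_def divide_inverse)
      thus ?thesis using M0 0 by (simp add: norm_divide power2_eq_square)
    next
      case (Suc j)
      have "real (Suc j) * norm (fps_nth I (Suc j)) = norm (fps_nth (fps_deriv I) j)"
        unfolding fps_deriv_nth by (simp only: norm_mult norm_of_nat Suc_eq_plus1)
      also have "\<dots> \<le> (\<Sum>i=0..j. real (Suc i) * (Av (Suc i) * (1 / (Mv t 0)^2 * Mv t (j - i))))"
        unfolding Iode fps_neg_nth norm_minus_cancel fps_mult_nth
      proof (rule sum_norm_le)
        fix i assume i: "i \<in> {0..j}"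
        have "norm (fps_nth (fps_deriv Ac) i * fps_nth I (j - i)) = real (Suc i) * (Av (Suc i) * norm (fps_nth I (j - i)))"
          unfolding fps_deriv_nth norm_mult norm_of_nat Suc_eq_plus1 using Ann[of "Suc i"] by (simp add: Ac_def)
        also have "\<dots> \<le> real (Suc i) * (Av (Suc i) * (1 / (Mv t 0)^2 * Mv t (j - i)))"
          using less[of "j - i"] i Suc Ann by (intro mult_left_mono) auto
        finally show "norm (fps_nth (fps_deriv Ac) i * fps_nth I (j - i)) \<le> real (Suc i) * (Av (Suc i) * (1 / (Mv t 0)^2 * Mv t (j - i)))" .
      qed
      also have "\<dots> = 1 / (Mv t 0)^2 * (\<Sum>i=0..j. real (Suc i) * (Av (Suc i) * Mv t (j - i)))"
        by (simp only: sum_distrib_left mult_ac)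
      also have "\<dots> = 1 / (Mv t 0)^2 * (real (Suc j) * Mv t (Suc j))" by (simp only: rec)
      finally have "real (Suc j) * norm (fps_nth I (Suc j)) \<le> real (Suc j) * (1 / (Mv t 0)^2 * Mv t (Suc j))" by (simp only: mult_ac)
      thus ?thesis unfolding Suc by (rule mult_left_le_imp_le) simp
    qed
  qed
  thus ?thesis by (simp add: I_def)
qed

end

context critical_walk
begin

text \<open>On the circle of radius \<tau> one has |t * P(u)| \<le> t * P(\<tau>) < 1, so no root
  lies there for t < \<rho>. A branch that comes from infinity cannot cross this circle, by the
  intermediate value theorem.\<close>

lemma large_root_norm:
  assumes v: "large_roots c d p rho v" and l: "l < d" and t: "0 < t" "t < rho"
  shows "norm (v l t) > \<tau>"
proof (rule ccontr)
  assume "\<not> norm (v l t) > \<tau>"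
  hence le: "norm (v l t) \<le> \<tau>" by simp
  have cont: "continuous_on {0<..rho} (v l)" and lim: "filterlim (\<lambda>t. norm (v l t)) at_top (at_right 0)"
    and root: "\<And>t. t \<in> {0<..rho} \<Longrightarrow> v l t \<noteq> 0 \<and> 1 - complex_of_real t * jump_poly_complex c d p (v l t) = 0"
    using v l unfolding large_roots_def by auto
  have "\<forall>\<^sub>F s in at_right 0. norm (v l s) > \<tau>" using lim by (simp add: filterlim_at_top_dense)
  moreover have "\<forall>\<^sub>F s in at_right 0. s \<in> {0<..<t}" using t by (intro eventually_at_right_real) auto
  ultimately have "\<forall>\<^sub>F s in at_right 0. norm (v l s) > \<tau> \<and> s \<in> {0<..<t}" by eventually_elim auto
  then obtain s where s: "norm (v l s) > \<tau>" "0 < s" "s < t"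
    using eventually_happens'[OF trivial_limit_at_right_real] by (metis (no_types, lifting) greaterThanLessThan_iff)
  have "\<exists>x\<ge>s. x \<le> t \<and> norm (v l x) = \<tau>"
  proof (rule IVT2')
    show "continuous_on {s..t} (\<lambda>x. norm (v l x))"
      using s t by (intro continuous_intros continuous_on_subset[OF cont]) auto
  qed (use s le in auto)
  then obtain x where x: "s \<le> x" "x \<le> t" "norm (v l x) = \<tau>" by blast
  have "complex_of_real x * jump_poly_complex c d p (v l x) = 1" using root[of x] x s t by auto
  hence "1 = norm (complex_of_real x * jump_poly_complex c d p (v l x))" by simp
  also have "\<dots> \<le> x * Pv \<tau>" using norm_jump_poly_le[of "v l x"] x s by (simp add: norm_mult mult_left_mono)
  also have "\<dots> < 1" using x t by (intro t_Pv_tau) auto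
  finally show False by simp
qed

lemma kernel_poly_props:
  assumes "t > 0"
  shows "degree (kernel_poly c d p t) = c + d" and "coeff (kernel_poly c d p t) (c + d) = - of_real (t * p (int d))"
    and "kernel_poly c d p t \<noteq> 0"
proof -
  show lc: "coeff (kernel_poly c d p t) (c + d) = - of_real (t * p (int d))"
    using d_pos by (simp add: coeff_kernel_poly)
  have nz: "coeff (kernel_poly c d p t) (c + d) \<noteq> 0" unfolding lc using assms p_d by simp
  have "degree (kernel_poly c d p t) \<le> c + d"
    by (rule degree_le) (auto simp: coeff_kernel_poly p_supp)
  thus "degree (kernel_poly c d p t) = c + d" using le_degree[OF nz] by simp
  show "kernel_poly c d p t \<noteq> 0" using nz by auto
qed

text \<open>The product of M(t, u) with the kernel is a polynomial N of degree c. Its zeros lie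
  inside the circle of radius \<tau>, where M has none, and so are zeros of the kernel; the d large
  roots lie outside. Comparing degrees gives kernel = a * V * N, and cancelling N leaves M * a * V =
  1.\<close>

lemma kernel_factorization:
  assumes v: "large_roots c d p rho v" and t: "0 < t" "t < rho"
  shows "Mfps t * fps_of_poly (smult (- of_real (t * p (int d))) (\<Prod>l<d. [:- v l t, 1:])) = 1"
proof -
  define K where "K = kernel_poly c d p t"
  define Mi where "Mi = (\<lambda>k::int. \<Sum>n. mm n k * t ^ n)"
  have Mi: "Mi (int k) = Mv t k" for k by (simp add: Mi_def Mv_def)
  have Min: "k < 0 \<Longrightarrow> Mi k = 0" for k by (simp add: Mi_def mm_neg)
  have Mirec: "k \<ge> 0 \<Longrightarrow> Mi k = (if k = 0 then 1 else 0) + t * (\<Sum>j\<in>J. p j * Mi (k - j))" for k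
    unfolding Mi_def using t by (intro Mv_kernel_rec) auto
  have Minn: "Mi k \<ge> 0" for k
  proof (cases "k \<ge> 0")
    case True
    thus ?thesis using Mv_nonneg[of t "nat k"] t Mi[of "nat k"] by simp
  qed (simp add: Min)
  \<comment> \<open>The coefficients of M times the kernel: from c on, the recurrence of the M_k
    leaves only a 1 at c; below c only the nonpositive terms from steps to negative altitudes
    remain.\<close>
  define Nr where "Nr = (\<lambda>k. Mi (int k - int c) - t * (\<Sum>j\<in>J. p j * Mi (int k - int c - j)))"
  have NrK: "fps_nth (Mfps t * fps_of_poly K) k = of_real (Nr k)" for k
  proof -
    have "fps_nth (Mfps t * fps_of_poly K) k = (\<Sum>m=0..k. coeff K m * of_real (Mv t (k - m)))"
      by (subst mult.commute) (simp add: fps_mult_nth Mfps_def)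
    also have "\<dots> = (\<Sum>m=0..k. of_real ((if m = c then Mi (int k - int m) else 0) - t * (p (int m - int c) * Mi (int k - int m))))"
      by (intro sum.cong refl) (auto simp: K_def coeff_kernel_poly Mi[symmetric] of_nat_diff algebra_simps)
    also have "\<dots> = of_real ((\<Sum>m=0..k. if m = c then Mi (int k - int m) else 0) - t * (\<Sum>m=0..k. p (int m - int c) * Mi (int k - int m)))"
      by (simp only: of_real_sum[symmetric] sum_subtractf sum_distrib_left)
    also have "(\<Sum>m=0..k. if m = c then Mi (int k - int m) else 0) = Mi (int k - int c)"
      by (auto simp: Min)
    also have "(\<Sum>m=0..k. p (int m - int c) * Mi (int k - int m)) = (\<Sum>j\<in>{- int c..int k - int c}. p j * Mi (int k - int c - j))"
      by (rule sum.reindex_bij_witness[where i = "\<lambda>j. nat (j + int c)" and j = "\<lambda>m. int m - int c"]) auto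
    also have "\<dots> = (\<Sum>j\<in>{- int c..max (int d) (int k - int c)}. p j * Mi (int k - int c - j))"
      by (rule sum.mono_neutral_left) (auto simp: Min)
    also have "\<dots> = (\<Sum>j\<in>J. p j * Mi (int k - int c - j))"
      by (rule sum.mono_neutral_right) (auto simp: p_supp)
    finally show ?thesis by (simp add: Nr_def)
  qed
  have Nr_ge: "Nr k = (if k = c then 1 else 0)" if "k \<ge> c" for k
    using Mirec[of "int k - int c"] that by (auto simp: Nr_def)
  have Nr_lt: "Nr k \<le> 0" if "k < c" for k
    using that t by (auto simp: Nr_def Min intro!: mult_nonneg_nonneg sum_nonneg p_nonneg Minn)
  define N where "N = monom 1 c + (\<Sum>k<c. monom (complex_of_real (Nr k)) k)"
  have coeffN: "coeff N k = of_real (Nr k)" for k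
  proof -
    have "coeff (\<Sum>k<c. monom (complex_of_real (Nr k)) k) k = (\<Sum>i<c. if i = k then complex_of_real (Nr i) else 0)"
      by (simp add: coeff_sum)
    also have "\<dots> = (if k < c then of_real (Nr k) else 0)" by simp
    finally show ?thesis using Nr_ge[of k] by (auto simp: N_def)
  qed
  have MKN: "Mfps t * fps_of_poly K = fps_of_poly N"
    by (rule fps_ext) (simp add: NrK coeffN)
  have degN: "degree N = c"
  proof (rule antisym)
    show "degree N \<le> c" by (rule degree_le) (auto simp: coeffN Nr_ge)
    show "c \<le> degree N" by (rule le_degree) (simp add: coeffN Nr_ge)
  qed
  have N0: "N \<noteq> 0" using coeffN[of c] Nr_ge[of c] by auto
  \<comment> \<open>A point slightly beyond \<tau>, so that the closed disc of radius \<tau> lies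
    inside the discs of convergence of M and 1 / M.\<close>
  obtain x where x: "x > \<tau>" "t * Pv x < 1"
  proof -
    have "isCont (\<lambda>x. t * Pv x) \<tau>" by (intro continuous_intros Pv_continuous tau_pos)
    hence "((\<lambda>x. t * Pv x) \<longlongrightarrow> t * Pv \<tau>) (at \<tau>)" by (simp add: isCont_def)
    hence "((\<lambda>x. t * Pv x) \<longlongrightarrow> t * Pv \<tau>) (at_right \<tau>)" by (rule filterlim_mono) (auto simp: at_le)
    hence "\<forall>\<^sub>F x in at_right \<tau>. t * Pv x < 1" using t_Pv_tau[OF t(2)] by (rule order_tendstoD(2))
    moreover have "\<forall>\<^sub>F x in at_right \<tau>. x > \<tau>" by (simp add: eventually_at_filter)
    ultimately have "\<forall>\<^sub>F x in at_right \<tau>. x > \<tau> \<and> t * Pv x < 1" by eventually_elim auto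
    thus ?thesis using that eventually_happens'[OF trivial_limit_at_right_real] by blast
  qed
  have x0: "x > 0" using x tau_pos by simp
  have radM: "fps_conv_radius (Mfps t) \<ge> ereal x"
    by (rule Mfps_radius[OF x0 _ x(2), where B = 1]) (use t Mv_nonneg in \<open>auto simp: Mfps_def\<close>)
  have radI: "fps_conv_radius (inverse (Mfps t)) \<ge> ereal x"
    by (rule Mfps_radius[OF x0 _ x(2), where B = "1 / (Mv t 0)^2"]) (use t Mfps_inverse_bound in auto)
  have inr: "ereal (norm u) < fps_conv_radius (Mfps t)" "ereal (norm u) < fps_conv_radius (inverse (Mfps t))" if "norm u < x" for u :: complex
    using that by (auto intro: less_le_trans[OF _ radM] less_le_trans[OF _ radI])
  have Mnz: "eval_fps (Mfps t) u \<noteq> 0" if "norm u < x" for u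
  proof -
    have "inverse (Mfps t) * Mfps t = 1" using Mv_0_ge_1[of t] t by (intro inverse_mult_eq_1) (simp add: Mfps_def)
    hence "eval_fps (inverse (Mfps t)) u * eval_fps (Mfps t) u = 1"
      using eval_fps_mult[OF inr(2)[OF that] inr(1)[OF that]] by simp
    thus ?thesis by auto
  qed
  have evK: "eval_fps (Mfps t) u * poly K u = poly N u" if "norm u < x" for u
    using eval_fps_mult[of u "Mfps t" "fps_of_poly K"] inr[OF that] by (simp add: MKN)
  have polyN: "poly N u = u ^ c - (\<Sum>k<c. of_real (- Nr k) * u ^ k)" for u
    by (simp add: N_def poly_sum poly_monom sum_negf)
  \<comment> \<open>N(\<tau>) = M(t, \<tau>) * \<tau>^c * (1 - t * P(\<tau>)) is positive, which
    says that the leading term of N dominates the others at \<tau>.\<close>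
  have Sc: "(\<Sum>k<c. - Nr k * \<tau> ^ k) < \<tau> ^ c"
  proof -
    have "ereal (norm (complex_of_real \<tau>)) < fps_conv_radius (Mfps t)" using x tau_pos by (intro inr) auto
    from sums_eval_fps[OF this] have s: "(\<lambda>k. of_real (Mv t k * \<tau> ^ k)) sums eval_fps (Mfps t) (of_real \<tau>)" by (simp add: Mfps_def)
    have sR: "(\<lambda>k. Mv t k * \<tau> ^ k) sums Re (eval_fps (Mfps t) (of_real \<tau>))" using sums_Re[OF s] by simp
    have sI: "(\<lambda>k. 0) sums Im (eval_fps (Mfps t) (of_real \<tau>))" using sums_Im[OF s] by simp
    have "(\<Sum>k\<in>{0}. Mv t k * \<tau> ^ k) \<le> Re (eval_fps (Mfps t) (of_real \<tau>))"
      unfolding sums_unique[OF sR] using Mv_nonneg t tau_pos by (intro sum_le_suminf sums_summable[OF sR]) auto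
    hence Re1: "Re (eval_fps (Mfps t) (of_real \<tau>)) > 0" using Mv_0_ge_1[of t] t by simp
    have Im0: "Im (eval_fps (Mfps t) (of_real \<tau>)) = 0" using sums_unique2[OF sI sums_zero] .
    have Kt: "poly K (of_real \<tau>) = of_real (\<tau> ^ c * (1 - t * Pv \<tau>))"
      using tau_pos by (simp add: K_def poly_kernel jump_poly_complex_of_real)
    have "poly N (of_real \<tau>) = of_real (\<tau> ^ c - (\<Sum>k<c. - Nr k * \<tau> ^ k))" by (simp add: polyN)
    hence "\<tau> ^ c - (\<Sum>k<c. - Nr k * \<tau> ^ k) = Re (eval_fps (Mfps t) (of_real \<tau>) * poly K (of_real \<tau>))"
      using evK[of "of_real \<tau>"] x tau_pos by simp
    also have "\<dots> = Re (eval_fps (Mfps t) (of_real \<tau>)) * (\<tau> ^ c * (1 - t * Pv \<tau>))"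
      unfolding Kt by (simp add: Im0)
    also have "\<dots> > 0" using Re1 tau_pos t_Pv_tau[OF t(2)] by (intro mult_pos_pos) auto
    finally show ?thesis by simp
  qed
  \<comment> \<open>The domination at \<tau> persists for |w| \<ge> \<tau>, because the lower terms
    grow more slowly than |w|^c.\<close>
  have rootN: "norm w < \<tau>" if "poly N w = 0" for w
  proof (rule ccontr)
    assume "\<not> norm w < \<tau>"
    hence w: "norm w \<ge> \<tau>" by simp
    have "norm w ^ c = norm (\<Sum>k<c. of_real (- Nr k) * w ^ k)" using that by (simp add: polyN norm_power[symmetric])
    also have "\<dots> \<le> (\<Sum>k<c. - Nr k * norm w ^ k)"
      by (rule sum_norm_le) (use Nr_lt in \<open>auto simp: norm_mult norm_power\<close>)
    also have "\<dots> \<le> (\<Sum>k<c. - Nr k * \<tau> ^ k * (norm w / \<tau>) ^ c)"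
    proof (rule sum_mono)
      fix k assume k: "k \<in> {..<c}"
      have "norm w ^ k = \<tau> ^ k * (norm w / \<tau>) ^ k" using tau_pos by (simp add: power_divide)
      also have "\<dots> \<le> \<tau> ^ k * (norm w / \<tau>) ^ c" using k w tau_pos by (intro mult_left_mono power_increasing) auto
      finally have "- Nr k * norm w ^ k \<le> - Nr k * (\<tau> ^ k * (norm w / \<tau>) ^ c)" using Nr_lt[of k] k by (intro mult_left_mono) auto
      thus "- Nr k * norm w ^ k \<le> - Nr k * \<tau> ^ k * (norm w / \<tau>) ^ c" by simp
    qed
    also have "\<dots> = (\<Sum>k<c. - Nr k * \<tau> ^ k) * (norm w / \<tau>) ^ c" by (simp add: sum_distrib_right)
    also have "\<dots> < \<tau> ^ c * (norm w / \<tau>) ^ c" using Sc w tau_pos by (intro mult_strict_right_mono zero_less_power divide_pos_pos) auto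
    also have "\<dots> = norm w ^ c" using tau_pos by (simp add: power_divide)
    finally show False by simp
  qed
  have K0: "K \<noteq> 0" unfolding K_def using kernel_poly_props t by auto
  \<comment> \<open>If w had higher order in N than in the kernel, cancelling the common power and
    letting u tend to w would give M(t, w) = 0.\<close>
  have ordNK: "order w N \<le> order w K" if w: "poly N w = 0" for w
  proof (rule ccontr)
    assume "\<not> order w N \<le> order w K"
    hence lt: "order w K < order w N" by simp
    obtain K1 where K1: "K = [:- w, 1:] ^ order w K * K1" "\<not> [:- w, 1:] dvd K1" using order_decomp[OF K0] by blast
    obtain N1 where N1: "N = [:- w, 1:] ^ order w N * N1" "\<not> [:- w, 1:] dvd N1" using order_decomp[OF N0] by blast
    have K1w: "poly K1 w \<noteq> 0" using K1(2) by (simp add: poly_eq_0_iff_dvd)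
    have nw: "norm w < x" using rootN[OF w] x by simp
    define h where "h = (\<lambda>u. eval_fps (Mfps t) u * poly K1 u - (u - w) ^ (order w N - order w K) * poly N1 u)"
    have hz: "h u = 0" if u: "u \<noteq> w" "norm u < x" for u
    proof -
      have "poly K u = (u - w) ^ order w K * poly K1 u" by (subst K1(1)) (simp add: poly_power)
      moreover have "poly N u = (u - w) ^ order w K * ((u - w) ^ (order w N - order w K) * poly N1 u)"
      proof -
        have "poly N u = (u - w) ^ order w N * poly N1 u" by (subst N1(1)) (simp add: poly_power)
        also have "(u - w) ^ order w N = (u - w) ^ order w K * (u - w) ^ (order w N - order w K)" using lt by (simp flip: power_add)
        finally show ?thesis by simp
      qed
      ultimately have "(u - w) ^ order w K * h u = 0" using evK[OF u(2)] by (simp add: h_def algebra_simps)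
      thus ?thesis using u by simp
    qed
    have "isCont h w" unfolding h_def using inr(1)[OF nw] by (intro continuous_intros) auto
    hence "(h \<longlongrightarrow> h w) (at w)" by (simp add: isCont_def)
    moreover have "\<forall>\<^sub>F u in at w. h u = 0"
    proof -
      have "\<forall>\<^sub>F u in at w. norm u < x"
        using order_tendstoD(2)[OF tendsto_norm[OF tendsto_ident_at] nw] .
      moreover have "\<forall>\<^sub>F u in at w. u \<noteq> w" by (simp add: eventually_at_filter)
      ultimately show ?thesis by eventually_elim (use hz in auto)
    qed
    ultimately have "h w = 0" using tendsto_eventually tendsto_unique[OF trivial_limit_at] by metis
    moreover have "(0 :: complex) ^ (order w N - order w K) = 0" using lt by simp
    ultimately show False using K1w Mnz[OF nw] by (simp add: h_def)
  qed
  define V where "V = (\<Prod>l<d. [:- v l t, 1:])"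
  have V0: "V \<noteq> 0" unfolding V_def by (simp add: prod_zero_iff)
  have degV: "degree V = d" unfolding V_def by (subst degree_prod_eq_sum_degree) auto
  \<comment> \<open>The roots of V and N are separated by the circle of radius \<tau>, so at each
    point only one factor contributes to the order.\<close>
  have "V * N dvd K"
  proof (rule dvd_if_order_le)
    show VN: "V * N \<noteq> 0" using V0 N0 by simp
    show "K \<noteq> 0" by (rule K0)
    fix w
    have oV: "order w V = card {l\<in>{..<d}. v l t = w}" unfolding V_def by (rule order_prod_linear) simp
    have "order w (V * N) = order w V + order w N" by (rule order_mult[OF VN])
    also have "\<dots> \<le> order w K"
    proof (cases "poly N w = 0")
      case True
      have "{l\<in>{..<d}. v l t = w} = {}"
        using rootN[OF True] large_root_norm[OF v _ t] by force
      hence "order w V = 0" unfolding oV by (simp only: card.empty)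
      thus ?thesis using ordNK[OF True] by simp
    next
      case False
      hence "order w N = 0" by (rule order_0I)
      moreover have "order w V \<le> order w K" unfolding oV K_def using v t unfolding large_roots_def by auto
      ultimately show ?thesis by simp
    qed
    finally show "order w (V * N) \<le> order w K" .
  qed
  then obtain R where R: "K = V * N * R" by auto
  have R0: "R \<noteq> 0" using R K0 by auto
  have "degree K = degree (V * N) + degree R" unfolding R using V0 N0 R0 by (intro degree_mult_eq) auto
  also have "degree (V * N) = d + c" using V0 N0 degV degN by (simp add: degree_mult_eq)
  finally have "degree R = 0" using kernel_poly_props(1)[OF t(1)] by (simp add: K_def)
  then obtain a where a: "R = [:a:]" by (metis degree_eq_zeroE)
  have lcV: "lead_coeff V = 1" unfolding V_def by (simp add: lead_coeff_prod)
  have lcN: "lead_coeff N = 1" by (simp add: degN coeffN Nr_ge)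
  have "lead_coeff K = lead_coeff V * lead_coeff N * a" unfolding R a by (simp add: lead_coeff_mult del: mult_pCons_right)
  hence "a = lead_coeff K" by (simp add: lcV lcN)
  hence aval: "a = - of_real (t * p (int d))" using kernel_poly_props[OF t(1)] by (simp add: K_def)
  have "Mfps t * fps_of_poly (smult a V) * fps_of_poly N = Mfps t * fps_of_poly K"
    unfolding R a by (simp add: fps_of_poly_mult fps_of_poly_smult mult_ac)
  also have "\<dots> = 1 * fps_of_poly N" by (simp add: MKN)
  finally have "Mfps t * fps_of_poly (smult a V) = 1"
    using N0 fps_of_poly_eq_iff[of N 0] mult_right_cancel[of "fps_of_poly N"] by (metis fps_of_poly_0)
  thus ?thesis by (simp only: aval V_def)
qed

lemma mcol_summable_rho: "summable (\<lambda>n. mm n (int k) * rho ^ n)"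
proof -
  obtain K where "srate (betas k) K (fps_scale rho (mcol k))" using mcol_rate by blast
  from srate_summable[OF this] show ?thesis by (simp add: mcol_def fps_scale_nth[abs_def])
qed

text \<open>At t = \<rho> the strict inequality t * P(\<tau>) < 1 fails, so the identity is
  transported by continuity of each coefficient: the M_k are continuous up to \<rho> since their
  series converge there, the roots by assumption.\<close>

lemma kernel_factorization_le:
  assumes v: "large_roots c d p rho v" and t: "0 < t" "t \<le> rho"
  shows "Mfps t * fps_of_poly (smult (- of_real (t * p (int d))) (\<Prod>l<d. [:- v l t, 1:])) = 1"
proof (rule fps_ext)
  fix k
  define X where "X = {rho / 2..rho}"
  define f where "f = (\<lambda>t. fps_nth (Mfps t * fps_of_poly (smult (- of_real (t * p (int d))) (\<Prod>l<d. [:- v l t, 1:]))) k)"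
  have Mc: "continuous_on {0..rho} (\<lambda>t. Mv t k)" for k
  proof -
    have "uniform_limit {0..rho} (\<lambda>N t. \<Sum>n<N. mm n (int k) * t ^ n) (\<lambda>t. Mv t k) sequentially"
      unfolding Mv_def
    proof (rule Weierstrass_m_test[OF _ mcol_summable_rho[of k]])
      fix n t assume "t \<in> {0..rho}"
      thus "norm (mm n (int k) * t ^ n) \<le> mm n (int k) * rho ^ n" using mm_nonneg[of n "int k"]
        by (simp add: abs_mult mult_left_mono power_mono)
    qed
    thus ?thesis by (rule uniform_limit_theorem[rotated]) (auto intro!: always_eventually continuous_intros)
  qed
  have "continuous_on X f"
    unfolding f_def Mfps_def fps_mult_nth fps_nth_Abs_fps fps_of_poly_nth coeff_smult
  proof (intro continuous_intros)
    fix i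
    show "continuous_on X (\<lambda>t. Mv t i)" by (rule continuous_on_subset[OF Mc]) (use rho_pos in \<open>auto simp: X_def\<close>)
    show "continuous_on X (\<lambda>t. coeff (\<Prod>l<d. [:- v l t, 1:]) (k - i))"
    proof (rule coeff_prod_linear_continuous)
      fix l assume "l \<in> {..<d}"
      hence "continuous_on {0<..rho} (v l)" using v unfolding large_roots_def by auto
      thus "continuous_on X (v l)" by (rule continuous_on_subset) (use rho_pos in \<open>auto simp: X_def\<close>)
    qed auto
  qed
  hence "(f \<longlongrightarrow> f rho) (at rho within X)" using rho_pos by (auto simp: continuous_on_def X_def)
  hence lim: "(f \<longlongrightarrow> f rho) (at_left rho)"
    using at_within_Icc_at_left[of "rho / 2" rho] rho_pos by (simp add: X_def)
  have "\<forall>\<^sub>F t in at_left rho. f t = fps_nth 1 k"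
  proof -
    have "\<forall>\<^sub>F t in at_left rho. t \<in> {0<..<rho}" using rho_pos by (intro eventually_at_left_real)
    thus ?thesis by eventually_elim (use kernel_factorization[OF v] in \<open>auto simp: f_def\<close>)
  qed
  hence "f rho = fps_nth 1 k" using lim tendsto_eventually tendsto_unique[OF trivial_limit_at_left_real] by metis
  thus "fps_nth (Mfps t * fps_of_poly (smult (- of_real (t * p (int d))) (\<Prod>l<d. [:- v l t, 1:]))) k = fps_nth 1 k"
    using kernel_factorization[OF v t(1)] t by (cases "t = rho") (auto simp: f_def)
qed

end

section \<open>Catastrophes\<close>

text \<open>T = (1 - Q) / (1 - x) is the series of tails of Q; it converges beyond the unit disc and
  has no zero in the closed disc. Hence 1 / T converges beyond 1 as well, and the coefficients of D
  = (1 / T) / (1 - x) are the partial sums of 1 / T, with limit 1 / T(1).\<close>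

lemma renewal_positive_recurrent:
  fixes Q D :: "real fps"
  assumes Qnn: "\<And>n. fps_nth Q n \<ge> 0" and Q0: "fps_nth Q 0 = 0"
    and R: "R > 1" "summable (\<lambda>n. fps_nth Q n * R ^ n)"
    and Q1: "suminf (fps_nth Q) = 1" and Qpos: "\<And>n. n \<ge> n0 \<Longrightarrow> fps_nth Q n > 0"
    and D_eq: "D = 1 + Q * D"
  shows "\<exists>\<delta>>0. fps_nth D \<longlonglongrightarrow> \<delta>"
proof -
  have Qs: "summable (fps_nth Q)"
  proof (rule summable_comparison_test'[OF R(2), of 0])
    show "norm (fps_nth Q n) \<le> fps_nth Q n * R ^ n" for n
      using Qnn[of n] R(1) by (simp add: mult_le_cancel_left1)
  qed
  define T where "T = Abs_fps (\<lambda>n. complex_of_real (1 - (\<Sum>j\<le>n. fps_nth Q j)))"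
  define Qc where "Qc = Abs_fps (\<lambda>n. complex_of_real (fps_nth Q n))"
  define Dc where "Dc = Abs_fps (\<lambda>n. complex_of_real (fps_nth D n))"
  have TQ: "(1 - fps_X) * T = 1 - Qc"
  proof (rule fps_ext)
    fix n show "fps_nth ((1 - fps_X) * T) n = fps_nth (1 - Qc) n"
      by (cases n) (auto simp: left_diff_distrib T_def Qc_def)
  qed
  have Dc1: "Dc * (1 - Qc) = 1"
  proof -
    have "Dc = 1 + Qc * Dc"
    proof (rule fps_ext)
      fix n
      have "fps_nth D n = fps_nth 1 n + (\<Sum>i=0..n. fps_nth Q i * fps_nth D (n - i))"
        by (subst D_eq) (simp add: fps_mult_nth)
      thus "fps_nth Dc n = fps_nth (1 + Qc * Dc) n"
        by (simp add: Dc_def Qc_def fps_mult_nth flip: of_real_mult of_real_sum)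
    qed
    thus ?thesis by (simp add: algebra_simps)
  qed
  define B where "B = (\<Sum>n. fps_nth Q n * R ^ n)"
  have tail: "0 \<le> 1 - (\<Sum>j\<le>n. fps_nth Q j) \<and> (1 - (\<Sum>j\<le>n. fps_nth Q j)) * R ^ n \<le> B" for n
  proof
    show "0 \<le> 1 - (\<Sum>j\<le>n. fps_nth Q j)" using sum_le_suminf[OF Qs, of "{..n}"] Qnn Q1 by simp
    have "1 - (\<Sum>j\<le>n. fps_nth Q j) = (\<Sum>i. fps_nth Q (i + Suc n))"
      using suminf_minus_initial_segment[OF Qs, of "Suc n"] Q1 by (simp add: lessThan_Suc_atMost)
    hence "(1 - (\<Sum>j\<le>n. fps_nth Q j)) * R ^ n = (\<Sum>i. fps_nth Q (i + Suc n) * R ^ n)"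
      using suminf_mult2[of "\<lambda>i. fps_nth Q (i + Suc n)" "R ^ n"] summable_ignore_initial_segment[OF Qs, of "Suc n"] by simp
    also have "\<dots> \<le> (\<Sum>i. fps_nth Q (i + Suc n) * R ^ (i + Suc n))"
      using R Qnn
      by (intro suminf_le summable_mult2 summable_ignore_initial_segment[OF Qs, of "Suc n"]
            summable_ignore_initial_segment[OF R(2), of "Suc n"] mult_left_mono power_increasing) auto
    also have "\<dots> \<le> B"
    proof -
      have "0 \<le> (\<Sum>i<Suc n. fps_nth Q i * R ^ i)" using Qnn R by (intro sum_nonneg mult_nonneg_nonneg) auto
      thus ?thesis unfolding B_def suminf_minus_initial_segment[OF R(2), of "Suc n"] by linarith
    qed
    finally show "(1 - (\<Sum>j\<le>n. fps_nth Q j)) * R ^ n \<le> B" .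
  qed
  have radT: "fps_conv_radius T \<ge> ereal R"
    unfolding fps_conv_radius_def
  proof (rule conv_radius_geI_ex)
    fix r assume r: "0 < r" "ereal r < ereal R"
    have "summable (\<lambda>n. fps_nth T n * of_real r ^ n)"
    proof (rule summable_comparison_test'[of "\<lambda>n. B * (r / R) ^ n" 0])
      show "summable (\<lambda>n. B * (r / R) ^ n)" using r R by (intro summable_mult summable_geometric) auto
      show "norm (fps_nth T n * of_real r ^ n) \<le> B * (r / R) ^ n" for n
      proof -
        have "norm (fps_nth T n) = 1 - (\<Sum>j\<le>n. fps_nth Q j)" unfolding T_def fps_nth_Abs_fps norm_of_real using tail[of n] by simp
        hence "norm (fps_nth T n) * R ^ n \<le> B" using tail[of n] by simp
        hence "norm (fps_nth T n) \<le> B / R ^ n" using R by (simp add: pos_le_divide_eq)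
        hence "norm (fps_nth T n) * r ^ n \<le> B / R ^ n * r ^ n" using r by (intro mult_right_mono) auto
        thus ?thesis using r by (simp add: norm_mult norm_power power_divide)
      qed
    qed
    thus "\<exists>z. norm z = r \<and> summable (\<lambda>n. fps_nth T n * z ^ n)" using r by (intro exI[of _ "of_real r"]) auto
  qed
  have inT: "ereal (norm x) < fps_conv_radius T" if "norm x < R" for x :: complex
    using that by (auto intro: less_le_trans[OF _ radT])
  have T1: "eval_fps T 1 = of_real (Re (eval_fps T 1))" "Re (eval_fps T 1) \<ge> 1"
  proof -
    have s: "(\<lambda>n. complex_of_real (1 - (\<Sum>j\<le>n. fps_nth Q j))) sums eval_fps T 1"
      using sums_eval_fps[OF inT[of 1]] R by (simp add: T_def)
    have "(\<lambda>n. 0) sums Im (eval_fps T 1)" using sums_Im[OF s] by simp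
    hence "Im (eval_fps T 1) = 0" using sums_unique2[OF _ sums_zero] by blast
    thus "eval_fps T 1 = of_real (Re (eval_fps T 1))" by (simp add: complex_eq_iff)
    have sR: "(\<lambda>n. 1 - (\<Sum>j\<le>n. fps_nth Q j)) sums Re (eval_fps T 1)" using sums_Re[OF s] by simp
    have "(\<Sum>n\<in>{0}. 1 - (\<Sum>j\<le>n. fps_nth Q j)) \<le> Re (eval_fps T 1)"
      unfolding sums_unique[OF sR] using tail by (intro sum_le_suminf sums_summable[OF sR]) auto
    thus "Re (eval_fps T 1) \<ge> 1" by (simp add: Q0)
  qed
  have Tnz: "eval_fps T x \<noteq> 0" if x: "norm x \<le> 1" for x
  proof (cases "x = 1")
    case True thus ?thesis using T1 by (metis not_one_le_zero zero_complex.simps(1))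
  next
    case False
    have "(\<Sum>n. of_real (fps_nth Q n) * x ^ n) \<noteq> 1"
      by (rule powser_neq_1[OF Qnn Qs Q1 Qpos x False])
    hence "eval_fps Qc x \<noteq> 1" by (simp add: Qc_def eval_fps_def)
    moreover have "ereal (norm x) < fps_conv_radius Qc"
    proof -
      have "Qc = 1 - (1 - fps_X) * T" by (simp add: TQ)
      moreover have "fps_conv_radius (1 - (1 - fps_X) * T) \<ge> ereal R"
        by (intro order.trans[OF _ fps_conv_radius_diff] order.trans[OF _ fps_conv_radius_mult] min.boundedI) (auto simp: radT)
      ultimately show ?thesis using x R by (auto intro: less_le_trans[of _ "ereal R"])
    qed
    ultimately have "eval_fps (1 - Qc) x \<noteq> 0" by (subst eval_fps_diff) auto
    moreover have "eval_fps (1 - Qc) x = eval_fps (1 - fps_X) x * eval_fps T x"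
      unfolding TQ[symmetric] using inT[of x] x R
      by (subst eval_fps_mult) (auto intro: less_le_trans[OF _ fps_conv_radius_diff])
    ultimately show ?thesis by auto
  qed
  \<comment> \<open>A radius strictly below R, so that T is continuous on the closed disc and its
    zeros there form a compact set.\<close>
  define R' where "R' = (1 + R) / 2"
  have R': "1 < R'" "R' < R" using R by (auto simp: R'_def)
  define Z where "Z = {x \<in> cball 0 R'. eval_fps T x = 0}"
  have "\<exists>r>1. r \<le> R' \<and> (\<forall>x. norm x < r \<longrightarrow> eval_fps T x \<noteq> 0)"
  proof (cases "Z = {}")
    case True
    thus ?thesis using R' by (intro exI[of _ R']) (auto simp: Z_def)
  next
    case False
    have cont: "continuous_on (cball 0 R') (eval_fps T)"
      by (rule continuous_on_subset[OF continuous_on_eval_fps]) (use inT R' in \<open>auto simp: eball_def\<close>)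
    have "closed Z" unfolding Z_def using continuous_closed_preimage_constant[OF cont, of 0] by (simp add: vimage_def Int_def conj_commute)
    hence "compact Z" using compact_Int_closed[of "cball 0 R'" Z] by (auto simp: Z_def Int_def)
    then obtain z where z: "z \<in> Z" "\<And>x. x \<in> Z \<Longrightarrow> norm z \<le> norm x"
      using continuous_attains_inf[of Z norm] False continuous_on_norm_id by blast
    have "norm z > 1" using Tnz[of z] z(1) by (force simp: Z_def)
    moreover have "eval_fps T x \<noteq> 0" if "norm x < norm z" for x
    proof
      assume "eval_fps T x = 0"
      moreover have "norm z \<le> R'" using z(1) by (simp add: Z_def)
      ultimately have "x \<in> Z" using that by (simp add: Z_def)
      thus False using z(2)[of x] that by simp
    qed
    ultimately show ?thesis using z(1) by (intro exI[of _ "norm z"]) (auto simp: Z_def)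
  qed
  then obtain r where r: "r > 1" "r \<le> R'" "\<And>x. norm x < r \<Longrightarrow> eval_fps T x \<noteq> 0" by blast
  define I where "I = inverse T"
  have T0: "fps_nth T 0 \<noteq> 0" using Tnz[of 0] by (simp add: eval_fps_at_0)
  have "fps_conv_radius I \<ge> min (ereal r) (fps_conv_radius T)"
    unfolding I_def by (rule fps_conv_radius_inverse) (use r in auto)
  moreover have "min (ereal r) (fps_conv_radius T) \<ge> ereal r" using r R' by (auto intro: order.trans[OF _ radT])
  ultimately have radI: "fps_conv_radius I \<ge> ereal r" by (rule order.trans[rotated])
  have in1: "ereal (norm (1 :: complex)) < fps_conv_radius I" using r by (auto intro: less_le_trans[OF _ radI])
  have IT: "I * T = 1" unfolding I_def by (rule inverse_mult_eq_1[OF T0])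
  have I1: "eval_fps I 1 * eval_fps T 1 = 1"
    using eval_fps_mult[OF in1 inT[of 1]] R by (simp add: IT)
  have DI: "Dc * (1 - fps_X) = I"
  proof -
    have "Dc * (1 - fps_X) * T = 1" using Dc1 unfolding TQ[symmetric] by (simp only: mult.assoc)
    hence "Dc * (1 - fps_X) * T * I = I" by simp
    thus ?thesis using IT by (simp only: mult.assoc mult.commute[of T] mult_1_right)
  qed
  have Dn: "fps_nth Dc n = (\<Sum>i\<le>n. fps_nth I i)" for n
  proof (induction n)
    case 0 show ?case using arg_cong[OF DI, of "\<lambda>f. fps_nth f 0"] by simp
  next
    case (Suc n)
    have "fps_nth (Dc * (1 - fps_X)) (Suc n) = fps_nth Dc (Suc n) - fps_nth Dc n" by (simp add: right_diff_distrib)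
    thus ?case using Suc unfolding DI by simp
  qed
  have "(\<lambda>n. \<Sum>i\<le>n. fps_nth I i) \<longlonglongrightarrow> eval_fps I 1"
    using sums_eval_fps[OF in1] by (simp add: sums_def_le)
  hence "fps_nth Dc \<longlonglongrightarrow> eval_fps I 1" by (simp add: Dn[abs_def])
  hence "(\<lambda>n. Re (fps_nth Dc n)) \<longlonglongrightarrow> Re (eval_fps I 1)" by (rule tendsto_Re)
  hence "fps_nth D \<longlonglongrightarrow> Re (eval_fps I 1)" by (simp add: Dc_def)
  moreover have "eval_fps I 1 = of_real (1 / Re (eval_fps T 1))"
  proof -
    have "eval_fps I 1 = 1 / eval_fps T 1" using I1 Tnz[of 1] by (simp add: field_simps)
    thus ?thesis using T1(1) by (metis of_real_1 of_real_divide)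
  qed
  ultimately show ?thesis using T1(2) by (intro exI[of _ "1 / Re (eval_fps T 1)"]) auto
qed

lemma sums_swap_nonneg:
  fixes f :: "nat \<Rightarrow> nat \<Rightarrow> real"
  assumes f: "\<And>n k. f n k \<ge> 0" and g: "\<And>n. (\<lambda>k. f n k) sums g n" and gs: "summable g"
  shows "(\<lambda>k. \<Sum>n. f n k) sums suminf g"
proof -
  have le: "f n k \<le> g n" for n k using sum_le_suminf[OF sums_summable[OF g[of n]], of "{k}"] f sums_unique[OF g[of n]] by simp
  have sn: "summable (\<lambda>n. f n k)" for k
    by (rule summable_comparison_test'[OF gs, of 0]) (use f le in auto)
  have "((\<lambda>N. \<Sum>n. \<Sum>k<N. f n k) \<longlongrightarrow> (\<Sum>n. g n)) sequentially"
  proof (rule conjunct2[OF conjunct2[OF tannerys_theorem[where M = g]]])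
    show "(\<lambda>N. \<Sum>k<N. f n k) \<longlonglongrightarrow> g n" for n using g[of n] by (simp add: sums_def)
    show "\<forall>\<^sub>F (n, N) in at_top \<times>\<^sub>F sequentially. norm (\<Sum>k<N. f n k) \<le> g n"
    proof (intro always_eventually, clarify)
      fix n N
      show "norm (\<Sum>k<N. f n k) \<le> g n"
        using sum_le_suminf[OF sums_summable[OF g[of n]], of "{..<N}"] f sums_unique[OF g[of n]] by (simp add: sum_nonneg)
    qed
  qed (use gs in auto)
  thus ?thesis unfolding sums_def by (simp add: suminf_sum[OF sn])
qed

locale catastrophe_walk = critical_walk +
  fixes q :: real
  assumes q_pos: "q > 0"
begin

text \<open>The altitudes from which no catastrophe is possible.\<close>
definition S0 :: "nat set" where "S0 = insert 0 {j. j > 0 \<and> - int j \<in> jumpset p}"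

lemma finite_S0: "finite S0"
  using jumpset_subset by (intro finite_subset[of S0 "{..c}"]) (auto simp: S0_def)

lemma S0_le: "k \<in> S0 \<Longrightarrow> k \<le> c"
  using jumpset_subset by (auto simp: S0_def)

lemma Qcoef_0: "Qcoef p q 0 = 0" by (simp add: Qcoef_def)

lemma Qcoef_Suc: "Qcoef p q (Suc n) = q * (mtot p n - (\<Sum>j\<in>S0. mm n (int j)))"
proof -
  have "(\<Sum>j\<in>S0. mm n (int j)) = mm n 0 + (\<Sum>j\<in>{j. j > 0 \<and> - int j \<in> jumpset p}. mm n (int j))"
    unfolding S0_def by (subst sum.insert) (use finite_S0 in \<open>auto simp: S0_def\<close>)
  thus ?thesis by (simp add: Qcoef_def mcoef_eq_mm)
qed

text \<open>A single altitude outside \<open>S0\<close> bounds the catastrophe weight from below;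
  altitude c + 1 serves for signs and for the leading constant of Q, the top altitude for strict
  positivity.\<close>

lemma mtot_ge_insert:
  assumes "k \<notin> S0"
  shows "mtot p n - (\<Sum>j\<in>S0. mm n (int j)) \<ge> mm n (int k)"
proof -
  have "(\<Sum>j\<in>insert k S0. mm n (int j)) \<le> (\<Sum>j. mm n (int j))"
    using finite_S0 by (intro sum_le_suminf sums_summable[OF finite_supp_sums(2)] mm_nonneg) auto
  also have "\<dots> = mtot p n" using sums_unique[OF finite_supp_sums(2)] by simp
  finally show ?thesis using assms finite_S0 by simp
qed

lemma Qcoef_nonneg: "Qcoef p q n \<ge> 0"
proof (cases n)
  case (Suc m)
  have "Suc c \<notin> S0" using S0_le[of "Suc c"] by auto
  from mtot_ge_insert[OF this, of m] show ?thesis using q_pos mm_nonneg[of m "int (Suc c)"] by (simp add: Suc Qcoef_Suc)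
qed (simp add: Qcoef_0)

lemma mm_top_pos: "mm n (int (d * n)) > 0"
proof (induction n)
  case (Suc n)
  have "0 < p (int d) * mm n (int (d * Suc n) - int d)" using Suc p_d_pos by simp
  also have "\<dots> \<le> (\<Sum>j\<in>J. p j * mm n (int (d * Suc n) - j))"
    by (rule member_le_sum) (auto intro!: mult_nonneg_nonneg p_nonneg mm_nonneg)
  also have "\<dots> = mm (Suc n) (int (d * Suc n))" by (simp add: mm_Suc)
  finally show ?case .
qed (simp add: mm_0)

text \<open>After at least c + 1 maximal jumps the altitude exceeds c, so a catastrophe is possible;
  the additional step is the catastrophe itself. Positivity from some index on is the aperiodicity
  that \<open>powser_neq_1\<close> requires.\<close>

lemma Qcoef_pos: "n \<ge> c + 2 \<Longrightarrow> Qcoef p q n > 0"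
proof -
  assume n: "n \<ge> c + 2"
  then obtain m where m: "n = Suc m" "m \<ge> c + 1" by (cases n) auto
  have "1 * m \<le> d * m" using d_pos by (intro mult_le_mono1)
  hence "c < d * m" using m by linarith
  hence "d * m \<notin> S0" using S0_le[of "d * m"] by linarith
  from mtot_ge_insert[OF this, of m] show ?thesis using q_pos mm_top_pos[of m] by (simp add: m Qcoef_Suc)
qed

definition Qf :: "real fps" where "Qf = Abs_fps (Qcoef p q)"

lemma Dfps_eq: "Dfps p q = 1 + Qf * Dfps p q"
proof -
  have "Dfps p q * (1 - Qf) = 1"
    unfolding Dfps_def Qf_def by (rule inverse_mult_eq_1) (simp add: Qcoef_0)
  thus ?thesis by (simp add: algebra_simps)
qed

lemma Dfps_scaled: "fps_scale t (Dfps p q) = 1 + fps_scale t Qf * fps_scale t (Dfps p q)"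
proof -
  have "fps_scale t (1 + f) = 1 + fps_scale t f" for f by (rule fps_ext) (simp add: distrib_right)
  thus ?thesis by (subst Dfps_eq) (simp only: fps_scale_mult)
qed

lemma Fcoef_scaled: "Fcoef p q n k * t ^ n = fps_nth (fps_scale t (Dfps p q) * fps_scale t (mcol k)) n"
  unfolding fps_scale_mult[symmetric]
  by (simp add: fps_mult_nth Fcoef_def mcol_def mcoef_eq_mm atMost_atLeast0)

lemma F1coef_scaled: "F1coef p q n * t ^ n = fps_nth (fps_scale t (Dfps p q) * fps_scale t msum) n"
  unfolding fps_scale_mult[symmetric]
  by (simp add: fps_mult_nth F1coef_def msum_def atMost_atLeast0)

lemma prob_alt_limit:
  assumes t: "t > 0" and w: "\<forall>\<^sub>F n in sequentially. w n \<noteq> 0"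
    and F: "(\<lambda>n. fps_nth (fps_scale t (Dfps p q) * fps_scale t (mcol k)) n / w n) \<longlonglongrightarrow> A"
    and F1: "(\<lambda>n. fps_nth (fps_scale t (Dfps p q) * fps_scale t msum) n / w n) \<longlonglongrightarrow> B" and B: "B \<noteq> 0"
  shows "(\<lambda>n. prob_alt p q n k) \<longlonglongrightarrow> A / B"
proof -
  have "(\<lambda>n. (Fcoef p q n k * t ^ n / w n) / (F1coef p q n * t ^ n / w n)) \<longlonglongrightarrow> A / B"
    unfolding Fcoef_scaled F1coef_scaled by (intro tendsto_divide F F1 B)
  moreover have "\<forall>\<^sub>F n in sequentially. (Fcoef p q n k * t ^ n / w n) / (F1coef p q n * t ^ n / w n) = prob_alt p q n k"
    using w by eventually_elim (use t in \<open>simp add: prob_alt_def\<close>)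
  ultimately show ?thesis using tendsto_cong by fastforce
qed

definition Qs :: "real \<Rightarrow> real" where "Qs t = (\<Sum>n. Qcoef p q n * t ^ n)"

lemma Q_summable_mono:
  assumes "0 \<le> s" "s \<le> t" "summable (\<lambda>n. Qcoef p q n * t ^ n)"
  shows "summable (\<lambda>n. Qcoef p q n * s ^ n)"
  by (rule summable_comparison_test'[OF assms(3), of 0])
     (use assms Qcoef_nonneg in \<open>auto intro!: mult_left_mono power_mono\<close>)

lemma Q_IVT:
  assumes R: "R > 0" "summable (\<lambda>n. Qcoef p q n * R ^ n)" "Qs R \<ge> 1"
  shows "\<exists>z. 0 < z \<and> z \<le> R \<and> (\<lambda>n. Qcoef p q n * z ^ n) sums 1"
proof -
  have "uniform_limit {0..R} (\<lambda>N t. \<Sum>n<N. Qcoef p q n * t ^ n) Qs sequentially"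
    unfolding Qs_def
  proof (rule Weierstrass_m_test[OF _ R(2)])
    fix n t assume "t \<in> {0..R}"
    thus "norm (Qcoef p q n * t ^ n) \<le> Qcoef p q n * R ^ n" using Qcoef_nonneg[of n]
      by (simp add: abs_mult mult_left_mono power_mono)
  qed
  hence cont: "continuous_on {0..R} Qs" by (rule uniform_limit_theorem[rotated]) (auto intro!: always_eventually continuous_intros)
  have Q0: "Qs 0 = 0" unfolding Qs_def using powser_zero[of "Qcoef p q"] by (simp add: Qcoef_0)
  obtain z where z: "0 \<le> z" "z \<le> R" "Qs z = 1"
    using IVT'[of Qs 0 1 R] R cont Q0 by auto
  have "z \<noteq> 0" using z Q0 by auto
  moreover have "(\<lambda>n. Qcoef p q n * z ^ n) sums 1"
    using summable_sums[OF Q_summable_mono[OF z(1,2) R(2)]] z(3) by (simp add: Qs_def)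
  ultimately show ?thesis using z by (intro exI[of _ z]) auto
qed

text \<open>Write x = \<tau> * exp y. Then exp s \<ge> 1 + s applies termwise, and the linear term
  vanishes by \<open>crit\<close>.\<close>

lemma Pv_tau_le: "x > 0 \<Longrightarrow> Pv \<tau> \<le> Pv x"
proof -
  assume x: "x > 0"
  define y where "y = ln (x / \<tau>)"
  have xy: "x = \<tau> * exp y" using x tau_pos by (simp add: y_def)
  have pe: "exp y powi j = exp (of_int j * y)" for j :: int
    by (simp add: exp_power_int)
  have "Pv \<tau> = (\<Sum>j\<in>J. p j * \<tau> powi j) + y * (\<Sum>j\<in>J. of_int j * p j * \<tau> powi j)" by (simp add: crit Pv_def)
  also have "\<dots> = (\<Sum>j\<in>J. p j * \<tau> powi j * (1 + of_int j * y))" by (simp add: sum_distrib_left sum.distrib algebra_simps)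
  also have "\<dots> \<le> (\<Sum>j\<in>J. p j * \<tau> powi j * exp (of_int j * y))"
    using p_nonneg tau_pos by (intro sum_mono mult_left_mono) auto
  also have "\<dots> = Pv x" unfolding Pv_def xy power_int_mult_distrib pe by (simp add: mult.assoc)
  finally show ?thesis .
qed

text \<open>Each j * x^j increases with x > 0, so the drift at 1 is at least the one at \<tau>,
  which is 0.\<close>

lemma drift_nonneg: "\<tau> \<le> 1 \<Longrightarrow> (\<Sum>j\<in>J. of_int j * p j) \<ge> 0"
proof -
  assume le: "\<tau> \<le> 1"
  have "(\<Sum>j\<in>J. of_int j * p j * \<tau> powi j) \<le> (\<Sum>j\<in>J. of_int j * p j)"
  proof (rule sum_mono)
    fix j :: int
    have "of_int j * \<tau> powi j \<le> of_int j * 1"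
    proof (cases "j \<ge> 0")
      case True
      have "\<tau> powi j \<le> 1" using True le tau_pos by (simp add: power_int_def power_le_one)
      thus ?thesis using True by (intro mult_left_mono) auto
    next
      case False
      have "1 \<le> inverse \<tau> ^ nat (- j)" using le tau_pos by (intro one_le_power) (simp add: one_le_inverse_iff)
      hence "\<tau> powi j \<ge> 1" using False by (simp add: power_int_def)
      thus ?thesis using False by (intro mult_left_mono_neg) auto
    qed
    hence "p j * (of_int j * \<tau> powi j) \<le> p j * (of_int j * 1)" by (rule mult_left_mono) (rule p_nonneg)
    thus "of_int j * p j * \<tau> powi j \<le> of_int j * p j" by (simp add: mult_ac)
  qed
  thus ?thesis by (simp add: crit)
qed

lemma mm_summable_le_rho:
  assumes "0 \<le> t" "t \<le> rho"
  shows "summable (\<lambda>n. mm n (int k) * t ^ n)"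
  by (rule summable_comparison_test'[OF mcol_summable_rho[of k], of 0])
     (use assms mm_nonneg in \<open>auto intro!: mult_left_mono power_mono\<close>)

lemma mtot_summable_if_Q:
  assumes "0 < t" "t \<le> rho" "summable (\<lambda>n. Qcoef p q n * t ^ n)"
  shows "summable (\<lambda>n. mtot p n * t ^ n)"
proof -
  have "summable (\<lambda>n. Qcoef p q (Suc n) * t ^ Suc n)" using assms(3) by (subst summable_Suc_iff)
  hence "summable (\<lambda>n. 1 / (q * t) * (Qcoef p q (Suc n) * t ^ Suc n))" by (rule summable_mult)
  moreover have "(\<lambda>n. 1 / (q * t) * (Qcoef p q (Suc n) * t ^ Suc n)) = (\<lambda>n. mtot p n * t ^ n - (\<Sum>j\<in>S0. mm n (int j) * t ^ n))"
  proof
    fix n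
    have "1 / (q * t) * (q * x * t ^ Suc n) = x * t ^ n" for x using assms(1) q_pos by simp
    thus "1 / (q * t) * (Qcoef p q (Suc n) * t ^ Suc n) = mtot p n * t ^ n - (\<Sum>j\<in>S0. mm n (int j) * t ^ n)"
      by (simp only: Qcoef_Suc left_diff_distrib sum_distrib_right)
  qed
  ultimately have 1: "summable (\<lambda>n. mtot p n * t ^ n - (\<Sum>j\<in>S0. mm n (int j) * t ^ n))" by simp
  have 2: "summable (\<lambda>n. \<Sum>j\<in>S0. mm n (int j) * t ^ n)" using assms by (intro summable_sum mm_summable_le_rho) auto
  show ?thesis using summable_add[OF 1 2] by simp
qed

lemma Q_summable_if_mtot:
  assumes "0 \<le> t" "summable (\<lambda>n. mtot p n * t ^ n)"
  shows "summable (\<lambda>n. Qcoef p q n * t ^ n)"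
proof -
  have "summable (\<lambda>n. Qcoef p q (Suc n) * t ^ Suc n)"
  proof (rule summable_comparison_test'[OF summable_mult[OF assms(2), of "q * t"], of 0])
    fix n
    have "Qcoef p q (Suc n) \<le> q * mtot p n"
      using q_pos by (auto simp: Qcoef_Suc intro!: mult_left_mono sum_nonneg mm_nonneg)
    hence "Qcoef p q (Suc n) * t ^ Suc n \<le> q * mtot p n * t ^ Suc n" using assms by (intro mult_right_mono) auto
    thus "norm (Qcoef p q (Suc n) * t ^ Suc n) \<le> q * t * (mtot p n * t ^ n)"
      using Qcoef_nonneg[of "Suc n"] assms by (simp add: mult_ac)
  qed
  thus ?thesis by (subst (asm) summable_Suc_iff)
qed

text \<open>The lower bound of \<open>mtot_lower\<close> makes the series of M at 1 / P(1) at least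
  a multiple of the harmonic series; minimality of P at \<tau> places this point at or below
  \<rho>.\<close>

lemma not_summable_at_Pv1:
  assumes "\<tau> \<le> 1"
  shows "\<not> summable (\<lambda>n. Qcoef p q n * (1 / Pv 1) ^ n)" and "1 / Pv 1 \<le> rho"
proof -
  show le: "1 / Pv 1 \<le> rho" unfolding rho_def using Pv_tau_le[of 1] Pv_pos[OF tau_pos] by (intro divide_left_mono) auto
  have P1: "Pv 1 > 0" by (rule Pv_pos) simp
  show "\<not> summable (\<lambda>n. Qcoef p q n * (1 / Pv 1) ^ n)"
  proof
    assume "summable (\<lambda>n. Qcoef p q n * (1 / Pv 1) ^ n)"
    hence s: "summable (\<lambda>n. mtot p n * (1 / Pv 1) ^ n)" using P1 le by (intro mtot_summable_if_Q) auto
    have "summable (\<lambda>n. 1 / (real d + 1) * (1 / (real n + 1)))"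
    proof (rule summable_comparison_test'[OF s, of 0])
      fix n
      have "1 / (real d + 1) * (1 / (real n + 1)) = 1 / ((real d + 1) * (real n + 1))" by simp
      also have "\<dots> \<le> 1 / (real d * real n + 1)" 
      proof (rule divide_left_mono)
        show "real d * real n + 1 \<le> (real d + 1) * (real n + 1)" by (simp add: algebra_simps)
        show "0 < (real d + 1) * (real n + 1) * (real d * real n + 1)" by (intro mult_pos_pos add_nonneg_pos) auto
      qed auto
      also have "\<dots> = (Pv 1 ^ n / (real d * real n + 1)) * (1 / Pv 1) ^ n" using P1 by (simp add: power_divide)
      also have "\<dots> \<le> mtot p n * (1 / Pv 1) ^ n" using mtot_lower[OF drift_nonneg[OF assms], of n] P1 by (intro mult_right_mono) auto
      finally show "norm (1 / (real d + 1) * (1 / (real n + 1))) \<le> mtot p n * (1 / Pv 1) ^ n" by simp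
    qed
    hence "summable (\<lambda>n. (real d + 1) * (1 / (real d + 1) * (1 / (real n + 1))))" by (rule summable_mult)
    hence "summable (\<lambda>n. 1 / (real n + 1))" by (simp add: add_nonneg_eq_0_iff)
    hence "summable (\<lambda>n. 1 / real (Suc n))" by (simp add: add.commute)
    hence "summable (\<lambda>n. 1 / real n)" by (subst (asm) summable_Suc_iff)
    thus False using not_summable_harmonic[where 'a = real] by (simp add: inverse_eq_divide)
  qed
qed

text \<open>Either the decay of the columns in 1/\<tau> makes the sum over altitudes geometric, or
  the trivial bound P(1)^n for the total weight suffices.\<close>

lemma mtot_summable_below:
  assumes t: "0 \<le> t" "t < rho" and 1: "\<tau> > 1 \<or> t < 1 / Pv 1"
  shows "summable (\<lambda>n. mtot p n * t ^ n)"
  using 1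
proof
  assume tau: "\<tau> > 1"
  show ?thesis
  proof (rule summable_comparison_test'[of "\<lambda>n. (1 / (1 - 1 / \<tau>)) * (t * Pv \<tau>) ^ n" 0])
    have "0 \<le> t * Pv \<tau>" using t Pv_nonneg[OF tau_pos] by simp
    thus "summable (\<lambda>n. (1 / (1 - 1 / \<tau>)) * (t * Pv \<tau>) ^ n)" using t_Pv_tau[OF t(2)]
      by (intro summable_mult summable_geometric) auto
    fix n
    have g: "(\<lambda>k. Pv \<tau> ^ n * (1 / \<tau>) ^ k) sums (Pv \<tau> ^ n * (1 / (1 - 1 / \<tau>)))"
      using tau by (intro sums_mult geometric_sums) auto
    have "mtot p n = (\<Sum>k. mm n (int k))" using sums_unique[OF finite_supp_sums(2)] by simp
    also have "\<dots> \<le> (\<Sum>k. Pv \<tau> ^ n * (1 / \<tau>) ^ k)"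
      using mm_le[OF tau_pos] by (intro suminf_le sums_summable[OF finite_supp_sums(2)] sums_summable[OF g]) (auto simp: power_divide)
    also have "\<dots> = Pv \<tau> ^ n * (1 / (1 - 1 / \<tau>))" using sums_unique[OF g] by simp
    finally have "mtot p n * t ^ n \<le> Pv \<tau> ^ n * (1 / (1 - 1 / \<tau>)) * t ^ n" using t by (intro mult_right_mono) auto
    thus "norm (mtot p n * t ^ n) \<le> (1 / (1 - 1 / \<tau>)) * (t * Pv \<tau>) ^ n"
      using mtot_nonneg[of n] t by (simp add: power_mult_distrib mult_ac)
  qed
next
  assume lt: "t < 1 / Pv 1"
  have P1: "Pv 1 > 0" by (rule Pv_pos) simp
  show ?thesis
  proof (rule summable_comparison_test'[of "\<lambda>n. (t * Pv 1) ^ n" 0])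
    have "t * Pv 1 < 1" using lt P1 by (simp add: pos_less_divide_eq)
    thus "summable (\<lambda>n. (t * Pv 1) ^ n)" using t P1 by (intro summable_geometric) auto
    fix n
    show "norm (mtot p n * t ^ n) \<le> (t * Pv 1) ^ n"
      using mult_right_mono[OF mtot_le[of n], of "t ^ n"] mtot_nonneg[of n] t by (simp add: power_mult_distrib mult_ac)
  qed
qed

text \<open>For \<tau> \<le> 1, a root at or beyond 1 / P(1) would entail convergence of Q at that
  point.\<close>

lemma Q_sums_1_bound:
  assumes "0 < r" "r \<le> rho" "(\<lambda>n. Qcoef p q n * r ^ n) sums 1"
  shows "\<tau> > 1 \<or> r < 1 / Pv 1"
proof (rule ccontr)
  assume "\<not> (\<tau> > 1 \<or> r < 1 / Pv 1)"
  hence *: "\<tau> \<le> 1" "1 / Pv 1 \<le> r" by auto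
  have "summable (\<lambda>n. Qcoef p q n * (1 / Pv 1) ^ n)"
    by (rule Q_summable_mono[OF _ *(2) sums_summable[OF assms(3)]]) (use Pv_nonneg[of 1] in auto)
  thus False using not_summable_at_Pv1[OF *(1)] by simp
qed

text \<open>If \<tau> \<le> 1 and Q never equals 1, then Q < 1 below t1 = 1 / P(1) by the
  intermediate value theorem. The partial sums at t1 are then bounded by 1, so the series converges
  there, contrary to \<open>not_summable_at_Pv1\<close>.\<close>

lemma no_Q_root_imp:
  assumes "\<not> (\<exists>z. 0 < z \<and> z \<le> rho \<and> (\<lambda>n. Qcoef p q n * z ^ n) sums 1)"
  shows "\<tau> > 1"
proof (rule ccontr)
  assume "\<not> \<tau> > 1"
  hence le: "\<tau> \<le> 1" by simp
  define t1 where "t1 = 1 / Pv 1"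
  have t1: "t1 > 0" "t1 \<le> rho" using Pv_pos[of 1] not_summable_at_Pv1[OF le] by (auto simp: t1_def)
  have lt1: "Qs t < 1" "summable (\<lambda>n. Qcoef p q n * t ^ n)" if "0 < t" "t < t1" for t
  proof -
    show s: "summable (\<lambda>n. Qcoef p q n * t ^ n)"
      using that t1 by (intro Q_summable_if_mtot mtot_summable_below) (auto simp: t1_def)
    show "Qs t < 1"
    proof (rule ccontr)
      assume "\<not> Qs t < 1"
      hence "\<exists>z. 0 < z \<and> z \<le> t \<and> (\<lambda>n. Qcoef p q n * z ^ n) sums 1" using that s by (intro Q_IVT) auto
      thus False using assms that t1 by (meson less_imp_le order.trans)
    qed
  qed
  have "summable (\<lambda>n. Qcoef p q n * t1 ^ n)"
  proof (rule bounded_imp_summable)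
    show "0 \<le> Qcoef p q n * t1 ^ n" for n using Qcoef_nonneg t1 by simp
    fix N
    have "((\<lambda>t. \<Sum>n\<le>N. Qcoef p q n * t ^ n) \<longlongrightarrow> (\<Sum>n\<le>N. Qcoef p q n * t1 ^ n)) (at_left t1)"
      by (intro tendsto_intros)
    moreover have "\<forall>\<^sub>F t in at_left t1. (\<Sum>n\<le>N. Qcoef p q n * t ^ n) \<le> 1"
    proof -
      have "\<forall>\<^sub>F t in at_left t1. t \<in> {0<..<t1}" using t1 by (intro eventually_at_left_real)
      thus ?thesis
      proof eventually_elim
        case (elim t)
        have "(\<Sum>n\<le>N. Qcoef p q n * t ^ n) \<le> Qs t" unfolding Qs_def
          using elim lt1(2)[of t] Qcoef_nonneg by (intro sum_le_suminf) auto
        thus ?case using lt1(1)[of t] elim by auto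
      qed
    qed
    ultimately show "(\<Sum>n\<le>N. Qcoef p q n * t1 ^ n) \<le> 1"
      by (rule tendsto_upperbound) (rule trivial_limit_at_left_real)
  qed
  thus False using not_summable_at_Pv1[OF le] by (simp add: t1_def)
qed

end

text \<open>The factor z of Q enters as a product with \<open>fps_X\<close>; 4 = (1 + 1)^2 is the
  weight of its single coefficient.\<close>

lemma srate_fps_X: "srate 0 4 fps_X" and suminf_fps_X: "suminf (fps_nth (fps_X :: real fps)) = 1"
proof -
  have "\<bar>fps_nth (fps_X :: real fps) n - 0 * bb n\<bar> \<le> 4 / (real n + 1)\<^sup>2" for n
    by (cases "n = 1") (auto simp: fps_X_nth)
  thus "srate 0 4 fps_X" by (simp add: srate_def)
  have "(\<lambda>n. if n = 1 then 1 else 0 :: real) sums 1" using sums_If_finite[of "\<lambda>n. n = 1" "\<lambda>_. 1 :: real"] by simp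
  thus "suminf (fps_nth (fps_X :: real fps)) = 1" by (simp add: sums_iff fps_X_nth[abs_def])
qed

lemma taylor_coeff_eq: "f has_fps_expansion F \<Longrightarrow> taylor_coeff f k = fps_nth F k"
  by (simp add: taylor_coeff_def fps_nth_fps_expansion)

context catastrophe_walk
begin

lemma Mtot_sums:
  assumes "0 \<le> t" "summable (\<lambda>n. mtot p n * t ^ n)"
  shows "(\<lambda>k. Mv t k) sums Mtot t"
  unfolding Mv_def Mtot_def
  by (rule sums_swap_nonneg) (use assms mm_nonneg finite_supp_sums(2) in \<open>auto intro: sums_mult2\<close>)

lemma Mv_nonneg': "0 \<le> t \<Longrightarrow> t \<le> rho \<Longrightarrow> Mv t k \<ge> 0"
  unfolding Mv_def by (intro suminf_nonneg mm_summable_le_rho mult_nonneg_nonneg mm_nonneg) auto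

lemma Mtot_ge_1:
  assumes "0 \<le> t" "summable (\<lambda>n. mtot p n * t ^ n)"
  shows "Mtot t \<ge> 1"
proof -
  have "(\<Sum>n\<in>{0}. mtot p n * t ^ n) \<le> Mtot t"
    unfolding Mtot_def using assms mtot_nonneg by (intro sum_le_suminf) auto
  thus ?thesis by (simp add: mtot_eq mm_0)
qed

text \<open>Evaluating M(t, u) * H(u) = 1 at u = 1 yields 1 / M(t) = H(1), so M(t, u) / M(t) = H(1)
  / H(u): the leading coefficient of H cancels and the product of quotients remains.\<close>

lemma omega_expansion:
  assumes v: "large_roots c d p rho v" and t: "0 < t" "t \<le> rho" and sm: "summable (\<lambda>n. mtot p n * t ^ n)"
  shows "(\<lambda>u. \<Prod>l<d. (1 - v l t) / (u - v l t)) has_fps_expansion fps_const (1 / of_real (Mtot t)) * Mfps t"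
proof -
  define a where "a = - complex_of_real (t * p (int d))"
  define H where "H = smult a (\<Prod>l<d. [:- v l t, 1:])"
  have a0: "a \<noteq> 0" using t p_d by (simp add: a_def)
  have MH: "Mfps t * fps_of_poly H = 1"
    unfolding H_def a_def by (rule kernel_factorization_le[OF v t])
  have pH: "poly H u = a * (\<Prod>l<d. u - v l t)" for u
    by (simp add: H_def poly_prod)
  have s1: "fps_nth (Mfps t) sums of_real (Mtot t)"
    using sums_of_real[OF Mtot_sums[OF less_imp_le[OF t(1)] sm], where 'a = complex] by (simp add: Mfps_def fps_nth_Abs_fps[abs_def])
  have a1: "summable (\<lambda>k. norm (fps_nth (Mfps t) k))"
    using sums_summable[OF Mtot_sums[OF less_imp_le[OF t(1)] sm]] Mv_nonneg' t by (simp add: Mfps_def)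
  have s2: "fps_nth (fps_of_poly H) sums poly H 1"
  proof -
    have "(\<lambda>n. coeff H n) sums (\<Sum>n\<le>degree H. coeff H n)" by (rule sums_finite) (auto simp: coeff_eq_0)
    thus ?thesis by (simp add: poly_altdef fps_of_poly_nth[abs_def])
  qed
  have a2: "summable (\<lambda>k. norm (fps_nth (fps_of_poly H) k))"
    by (rule summable_finite[of "{..degree H}"]) (auto simp: coeff_eq_0)
  have "fps_nth (1 :: complex fps) sums (of_real (Mtot t) * poly H 1)"
    using fps_mult_sums[OF a1 a2] sums_unique[OF s1] sums_unique[OF s2] by (simp only: MH)
  moreover have "fps_nth (1 :: complex fps) sums 1"
    using sums_If_finite[of "\<lambda>n. n = 0" "\<lambda>_. 1 :: complex"] by (simp add: fps_one_nth[abs_def])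
  ultimately have M1: "of_real (Mtot t) * poly H 1 = 1" by (rule sums_unique2)
  have M0: "Mtot t \<noteq> 0" using Mtot_ge_1[OF less_imp_le[OF t(1)] sm] by simp
  have "eval_fps (fps_of_poly H) has_fps_expansion fps_of_poly H"
    by (rule eval_fps_has_fps_expansion) simp
  hence e1: "(\<lambda>u. poly H u) has_fps_expansion fps_of_poly H" by (simp add: eval_fps_of_poly[abs_def])
  have H0: "fps_nth (fps_of_poly H) 0 \<noteq> 0"
    using arg_cong[OF MH, of "\<lambda>f. fps_nth f 0"] by auto
  have inv: "inverse (fps_of_poly H) = Mfps t" by (rule fps_inverse_unique) (use MH in \<open>simp add: mult.commute\<close>)
  have "(\<lambda>u. inverse (poly H u)) has_fps_expansion Mfps t"
    using has_fps_expansion_inverse[OF e1 H0] by (simp add: inv)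
  hence "(\<lambda>u. (1 / of_real (Mtot t)) * inverse (poly H u)) has_fps_expansion fps_const (1 / of_real (Mtot t)) * Mfps t"
    by (rule has_fps_expansion_cmult_left)
  moreover have "(1 / of_real (Mtot t)) * inverse (poly H u) = (\<Prod>l<d. (1 - v l t) / (u - v l t))" for u
  proof -
    have "1 / of_real (Mtot t) = poly H 1" using M1 M0 by (simp add: field_simps)
    thus ?thesis using a0 by (simp add: pH prod_dividef divide_inverse[symmetric])
  qed
  ultimately show ?thesis by simp
qed

lemma Cst_pos: "Cst > 0" using s2_pos tau_pos by (simp add: Cst_def)

lemma betas_pos: "betas k > 0"
proof -
  have M0: "Mv rho 0 \<ge> 1"
  proof -
    have "(\<Sum>n\<in>{0}. mm n (int 0) * rho ^ n) \<le> Mv rho 0"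
      unfolding Mv_def using rho_pos by (intro sum_le_suminf mcol_summable_rho mult_nonneg_nonneg mm_nonneg) auto
    thus ?thesis by (simp add: mm_0)
  qed
  have "0 < Cst / \<tau> ^ Suc k * Mv rho (k - k)" using M0 Cst_pos tau_pos by simp
  also have "\<dots> \<le> betas k"
    unfolding betas_def using Cst_pos tau_pos rho_pos
    by (intro member_le_sum) (auto intro!: mult_nonneg_nonneg divide_nonneg_pos Mv_nonneg' simp del: times_divide_eq_left)
  finally show ?thesis .
qed

text \<open>The constant arises as a difference between that of M and those of finitely many
  columns. It is positive because the coefficients dominate those of column c + 1, whose constant
  \<open>betas (Suc c)\<close> is positive.\<close>

lemma Qf_rate:
  assumes tau: "\<tau> > 1"
  shows "\<exists>\<kappa> K. \<kappa> > 0 \<and> srate \<kappa> K (fps_scale rho Qf)"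
proof -
  define g where "g = fps_scale rho msum + fps_const (-1) * (\<Sum>j\<in>S0. fps_scale rho (mcol j))"
  define \<beta> where "\<beta> = Cst / (\<tau> - 1) * Mtot rho + -1 * (\<Sum>j\<in>S0. betas j)"
  have srsum: "\<exists>K. srate (\<Sum>j\<in>I. betas j) K (\<Sum>j\<in>I. fps_scale rho (mcol j))" if "finite I" for I
    using that
  proof (induction I rule: finite_induct)
    case empty show ?case by (rule exI[of _ 0]) (simp add: srate_def)
  next
    case (insert i I)
    obtain K where K: "srate (betas i) K (fps_scale rho (mcol i))" using mcol_rate by blast
    obtain L where "srate (sum betas I) L (\<Sum>j\<in>I. fps_scale rho (mcol j))" using insert.IH by blast
    from srate_add[OF K this] show ?case using insert.hyps by auto
  qed
  obtain K1 where K1: "srate (Cst / (\<tau> - 1) * Mtot rho) K1 (fps_scale rho msum)" using msum_rate[OF tau] by blast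
  obtain K2 where K2: "srate (\<Sum>j\<in>S0. betas j) K2 (\<Sum>j\<in>S0. fps_scale rho (mcol j))" using srsum[OF finite_S0] by blast
  have g: "srate \<beta> (K1 + \<bar>-1\<bar> * K2) g"
    unfolding \<beta>_def g_def by (rule srate_add[OF K1 srate_cmult[OF K2]])
  have gn: "fps_nth g n = (mtot p n - (\<Sum>j\<in>S0. mm n (int j))) * rho ^ n" for n
    by (simp add: g_def msum_def mcol_def fps_sum_nth sum_distrib_right left_diff_distrib)
  have eq: "fps_scale rho Qf = fps_const (q * rho) * (fps_X * g)"
  proof (rule fps_ext)
    fix n
    show "fps_nth (fps_scale rho Qf) n = fps_nth (fps_const (q * rho) * (fps_X * g)) n"
    proof (cases n)
      case 0 thus ?thesis by (simp add: Qf_def Qcoef_0)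
    next
      case (Suc m)
      thus ?thesis by (simp add: Qf_def Qcoef_Suc gn)
    qed
  qed
  have "\<beta> \<ge> betas (Suc c)"
  proof (rule tendsto_le[OF _ srate_asymp[OF g]])
    obtain K where K: "srate (betas (Suc c)) K (fps_scale rho (mcol (Suc c)))" using mcol_rate by blast
    show "(\<lambda>n. fps_nth (fps_scale rho (mcol (Suc c))) n / bb n) \<longlonglongrightarrow> betas (Suc c)" by (rule srate_asymp[OF K])
    have ns: "Suc c \<notin> S0" using S0_le[of "Suc c"] by auto
    have "fps_nth (fps_scale rho (mcol (Suc c))) n / bb n \<le> fps_nth g n / bb n" for n
      using mult_right_mono[OF mtot_ge_insert[OF ns, of n], of "rho ^ n"] rho_pos bb_nonneg[of n]
      by (intro divide_right_mono) (auto simp: gn mcol_def)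
    thus "\<forall>\<^sub>F n in sequentially. fps_nth (fps_scale rho (mcol (Suc c))) n / bb n \<le> fps_nth g n / bb n" by simp
  qed simp
  hence \<beta>0: "\<beta> > 0" using betas_pos[of "Suc c"] by linarith
  have "srate (q * rho * (0 * suminf (fps_nth g) + \<beta> * suminf (fps_nth (fps_X :: real fps)))) (\<bar>q * rho\<bar> * (16 * Wsq * (\<bar>0\<bar> + 4) * (\<bar>\<beta>\<bar> + (K1 + \<bar>-1\<bar> * K2)))) (fps_scale rho Qf)"
    unfolding eq by (rule srate_cmult[OF srate_mult[OF srate_fps_X g]])
  moreover have "q * rho * (0 * suminf (fps_nth g) + \<beta> * suminf (fps_nth (fps_X :: real fps))) > 0"
    using \<beta>0 q_pos rho_pos by (simp add: suminf_fps_X)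
  ultimately show ?thesis by blast
qed

text \<open>For r < \<rho> the scaled renewal sequence has a positive limit; for r = \<rho> it is of
  order \<open>cc n\<close>. In both cases D contributes the same factor to numerator and
  denominator, leaving M_k(r) / M(r).\<close>

lemma limit_root:
  assumes v: "large_roots c d p rho v" and r: "0 < r" "r \<le> rho" and Q1: "(\<lambda>n. Qcoef p q n * r ^ n) sums 1"
  shows "(\<lambda>n. complex_of_real (prob_alt p q n k)) \<longlonglongrightarrow> taylor_coeff (\<lambda>u. \<Prod>l<d. (1 - v l r) / (u - v l r)) k"
proof -
  have bnd: "\<tau> > 1 \<or> r < 1 / Pv 1" by (rule Q_sums_1_bound[OF r Q1])
  have sm: "summable (\<lambda>n. mtot p n * r ^ n)" by (rule mtot_summable_if_Q[OF r sums_summable[OF Q1]])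
  have M1: "Mtot r \<ge> 1" using r sm by (intro Mtot_ge_1) auto
  have Qsum: "suminf (fps_nth (fps_scale r Qf)) = 1" using Q1 by (simp add: Qf_def fps_scale_nth[abs_def] sums_iff)
  have Qnn: "fps_nth (fps_scale r Qf) n \<ge> 0" for n using Qcoef_nonneg r by (simp add: Qf_def)
  have Qpos: "n \<ge> c + 2 \<Longrightarrow> fps_nth (fps_scale r Qf) n > 0" for n using Qcoef_pos r by (simp add: Qf_def)
  have Q0: "fps_nth (fps_scale r Qf) 0 = 0" by (simp add: Qf_def Qcoef_0)
  have lim: "(\<lambda>n. prob_alt p q n k) \<longlonglongrightarrow> Mv r k / Mtot r"
  proof (cases "r < rho")
    case True
    \<comment> \<open>A radius beyond r at which Q still converges; t1 / r is the R > 1 of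
      \<open>renewal_positive_recurrent\<close>.\<close>
    obtain t1 where t1: "r < t1" "t1 < rho" "\<tau> > 1 \<or> t1 < 1 / Pv 1"
    proof (cases "\<tau> > 1")
      case True
      thus ?thesis using dense[OF \<open>r < rho\<close>] that by blast
    next
      case False
      hence "r < min rho (1 / Pv 1)" using bnd True by auto
      thus ?thesis using dense[of r "min rho (1 / Pv 1)"] that by auto
    qed
    have "summable (\<lambda>n. Qcoef p q n * t1 ^ n)"
      using t1 r by (intro Q_summable_if_mtot mtot_summable_below) auto
    hence "summable (\<lambda>n. fps_nth (fps_scale r Qf) n * (t1 / r) ^ n)" using r by (simp add: Qf_def power_divide)
    then obtain \<delta> where \<delta>: "\<delta> > 0" "fps_nth (fps_scale r (Dfps p q)) \<longlonglongrightarrow> \<delta>"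
      using renewal_positive_recurrent[OF Qnn Q0 _ _ Qsum Qpos Dfps_scaled, of "t1 / r"] t1 r by auto
    have 1: "fps_nth (fps_scale r (Dfps p q) * fps_scale r (mcol k)) \<longlonglongrightarrow> \<delta> * Mv r k"
      unfolding Mv_suminf[symmetric]
      by (rule tendsto_conv_summable[OF \<delta>(2)]) (use mm_summable_le_rho[of r k] r mm_nonneg in \<open>simp add: mcol_def\<close>)
    have 2: "fps_nth (fps_scale r (Dfps p q) * fps_scale r msum) \<longlonglongrightarrow> \<delta> * Mtot r"
      unfolding Mtot_suminf[symmetric]
      by (rule tendsto_conv_summable[OF \<delta>(2)]) (use sm r mtot_nonneg in \<open>simp add: msum_def\<close>)
    have "(\<lambda>n. prob_alt p q n k) \<longlonglongrightarrow> (\<delta> * Mv r k) / (\<delta> * Mtot r)"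
      by (rule prob_alt_limit[where w = "\<lambda>_. 1" and t = r]) (use 1 2 r \<delta> M1 in auto)
    thus ?thesis using \<delta> by simp
  next
    case False
    hence rr: "r = rho" using r by simp
    \<comment> \<open>For \<tau> \<le> 1 one has r < 1 / P(1) \<le> \<rho>, which excludes r =
      \<rho>.\<close>
    have tau: "\<tau> > 1"
    proof (rule ccontr)
      assume "\<not> \<tau> > 1"
      hence "r < 1 / Pv 1" "\<tau> \<le> 1" using bnd by auto
      thus False using not_summable_at_Pv1(2) rr by linarith
    qed
    obtain \<kappa> K where \<kappa>: "\<kappa> > 0" "srate \<kappa> K (fps_scale rho Qf)" using Qf_rate[OF tau] by blast
    have d: "(\<lambda>n. fps_nth (fps_scale rho (Dfps p q)) n / cc n) \<longlonglongrightarrow> 1 / \<kappa>"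
      by (rule renewal_critical[OF Qnn[unfolded rr] Q0[unfolded rr] \<kappa>(2,1) Qsum[unfolded rr] Qpos[unfolded rr] Dfps_scaled])
    obtain K1 where K1: "srate (betas k) K1 (fps_scale rho (mcol k))" using mcol_rate by blast
    obtain K2 where K2: "srate (Cst / (\<tau> - 1) * Mtot rho) K2 (fps_scale rho msum)" using msum_rate[OF tau] by blast
    have 1: "(\<lambda>n. fps_nth (fps_scale r (Dfps p q) * fps_scale r (mcol k)) n / cc n) \<longlonglongrightarrow> 1 / \<kappa> * Mv r k"
      unfolding Mv_suminf[symmetric] rr by (rule asymp_cc_mult[OF d srate_asymp[OF K1]])
    have 2: "(\<lambda>n. fps_nth (fps_scale r (Dfps p q) * fps_scale r msum) n / cc n) \<longlonglongrightarrow> 1 / \<kappa> * Mtot r"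
      unfolding Mtot_suminf[symmetric] rr by (rule asymp_cc_mult[OF d srate_asymp[OF K2]])
    have "(\<lambda>n. prob_alt p q n k) \<longlonglongrightarrow> (1 / \<kappa> * Mv r k) / (1 / \<kappa> * Mtot r)"
      by (rule prob_alt_limit[OF r(1) _ 1 2]) (use \<kappa> M1 cc_pos in \<open>auto intro!: always_eventually simp: less_imp_neq[OF cc_pos, symmetric]\<close>)
    thus ?thesis using \<kappa> by simp
  qed
  have "taylor_coeff (\<lambda>u. \<Prod>l<d. (1 - v l r) / (u - v l r)) k = of_real (Mv r k / Mtot r)"
    unfolding taylor_coeff_eq[OF omega_expansion[OF v r sm]] by (simp add: Mfps_def)
  thus ?thesis using tendsto_of_real[OF lim, where 'a = complex] by simp
qed

text \<open>With D and M_k both of order \<open>bb n\<close>, the product rule adds the contribution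
  of the singularity of D, \<eta> * D(\<rho>)^2 * M_k(\<rho>), to that of M_k, D(\<rho>) *
  \<open>betas k\<close>; dividing by D(\<rho>) gives the numerator of \<omega>.\<close>

lemma limit_no_root:
  assumes v: "large_roots c d p rho v"
    and no: "\<not> (\<exists>z. 0 < z \<and> z \<le> rho \<and> (\<lambda>n. Qcoef p q n * z ^ n) sums 1)"
    and \<eta>: "(\<lambda>z. Qfun p q z - (Qfun p q rho - \<eta> * sqrt (1 - z / rho))) \<in> O[at_left rho](\<lambda>z. 1 - z / rho)"
  shows "(\<lambda>n. complex_of_real (prob_alt p q n k)) \<longlonglongrightarrow> taylor_coeff (\<lambda>u.
     (complex_of_real (\<eta> / (1 - Qfun p q rho)) + complex_of_real Cst / (complex_of_real \<tau> - u))
       / (complex_of_real (\<eta> / (1 - Qfun p q rho)) + complex_of_real (Cst / (\<tau> - 1)))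
       * (\<Prod>l<d. (1 - v l rho) / (u - v l rho))) k"
proof -
  have tau: "\<tau> > 1" by (rule no_Q_root_imp[OF no])
  obtain \<kappa> K where \<kappa>: "\<kappa> > 0" "srate \<kappa> K (fps_scale rho Qf)" using Qf_rate[OF tau] by blast
  obtain K1 where K1: "srate (betas k) K1 (fps_scale rho (mcol k))" using mcol_rate by blast
  obtain K2 where K2: "srate (Cst / (\<tau> - 1) * Mtot rho) K2 (fps_scale rho msum)" using msum_rate[OF tau] by blast
  define S where "S = Qfun p q rho"
  have Qn: "fps_nth (fps_scale rho Qf) = (\<lambda>n. Qcoef p q n * rho ^ n)" by (simp add: Qf_def fps_scale_nth[abs_def])
  have S: "S = suminf (fps_nth (fps_scale rho Qf))" by (simp add: S_def Qfun_def Qn)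
  have Qsm: "summable (\<lambda>n. Qcoef p q n * rho ^ n)" using srate_summable[OF \<kappa>(2)] by (simp add: Qn)
  have S1: "S < 1"
  proof (rule ccontr)
    assume "\<not> S < 1"
    hence "Qs rho \<ge> 1" by (simp add: S_def Qs_def Qfun_def)
    thus False using Q_IVT[OF rho_pos Qsm] no by blast
  qed
  have sm: "summable (\<lambda>n. mtot p n * rho ^ n)" by (rule mtot_summable_if_Q[OF rho_pos order.refl Qsm])
  have M1: "Mtot rho \<ge> 1" using rho_pos sm by (intro Mtot_ge_1) auto
  \<comment> \<open>The assumed expansion and \<open>abelian_sqrt\<close> compute the limit of
    (Q(\<rho>) - Q(z)) / sqrt (1 - z / \<rho>) in two ways.\<close>
  have \<eta>\<kappa>: "\<eta> = \<kappa>"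
  proof -
    have A: "((\<lambda>x. (S - (\<Sum>n. fps_nth (fps_scale rho Qf) n * x ^ n)) / sqrt (1 - x)) \<longlongrightarrow> \<kappa>) (at_left 1)"
      unfolding S by (rule abelian_sqrt[OF srate_asymp[OF \<kappa>(2)]])
    have f: "filterlim (\<lambda>z. z / rho) (at_left 1) (at_left rho)"
    proof (rule filterlim_at_withinI)
      show "((\<lambda>z. z / rho) \<longlongrightarrow> 1) (at_left rho)"
      proof -
        have "((\<lambda>z. z / rho) \<longlongrightarrow> rho / rho) (at_left rho)" using rho_pos by (intro tendsto_intros) auto
        thus ?thesis using rho_pos by simp
      qed
      have "\<forall>\<^sub>F z in at_left rho. z < rho" by (simp add: eventually_at_filter)
      thus "\<forall>\<^sub>F z in at_left rho. z / rho \<in> {..<1} - {1}" by eventually_elim (use rho_pos in auto)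
    qed
    have B: "((\<lambda>z. (S - Qfun p q z) / sqrt (1 - z / rho)) \<longlongrightarrow> \<kappa>) (at_left rho)"
    proof -
      have "(\<Sum>n. fps_nth (fps_scale rho Qf) n * (z / rho) ^ n) = Qfun p q z" for z
        using rho_pos by (simp add: Qn Qfun_def power_divide)
      thus ?thesis using filterlim_compose[OF A f] by simp
    qed
    obtain L where L: "\<forall>\<^sub>F z in at_left rho. norm (Qfun p q z - (S - \<eta> * sqrt (1 - z / rho))) \<le> L * norm (1 - z / rho)"
      using \<eta> unfolding S_def by (elim landau_o.bigE)
    have "((\<lambda>z. (S - Qfun p q z) / sqrt (1 - z / rho) - \<eta>) \<longlongrightarrow> 0) (at_left rho)"
    proof (rule Lim_null_comparison)
      have "\<forall>\<^sub>F z in at_left rho. z < rho" by (simp add: eventually_at_filter)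
      with L show "\<forall>\<^sub>F z in at_left rho. norm ((S - Qfun p q z) / sqrt (1 - z / rho) - \<eta>) \<le> L * sqrt (1 - z / rho)"
      proof eventually_elim
        case (elim z)
        define y where "y = 1 - z / rho"
        have y: "y > 0" using elim rho_pos by (simp add: y_def)
        have "(S - Qfun p q z) / sqrt y - \<eta> = - (Qfun p q z - (S - \<eta> * sqrt y)) / sqrt y" using y by (simp add: field_simps)
        hence "norm ((S - Qfun p q z) / sqrt y - \<eta>) = norm (Qfun p q z - (S - \<eta> * sqrt y)) / sqrt y" using y by (simp add: norm_divide)
        also have "\<dots> \<le> (L * y) / sqrt y" using elim(1) y by (intro divide_right_mono) (auto simp: y_def)
        also have "\<dots> = L * sqrt y" using y unfolding times_divide_eq_right[symmetric] by (simp only: real_div_sqrt[OF less_imp_le])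
        finally show ?case by (simp add: y_def)
      qed
      have "((\<lambda>z. L * sqrt (1 - z / rho)) \<longlongrightarrow> L * sqrt (1 - rho / rho)) (at_left rho)" using rho_pos by (intro tendsto_intros) auto
      thus "((\<lambda>z. L * sqrt (1 - z / rho)) \<longlongrightarrow> 0) (at_left rho)" using rho_pos by simp
    qed
    hence "((\<lambda>z. (S - Qfun p q z) / sqrt (1 - z / rho)) \<longlongrightarrow> \<eta>) (at_left rho)" by (simp add: LIM_zero_iff)
    thus ?thesis using tendsto_unique[OF trivial_limit_at_left_real _ B] by blast
  qed
  have Qnn: "fps_nth (fps_scale rho Qf) n \<ge> 0" for n using Qcoef_nonneg rho_pos by (simp add: Qf_def)
  have Q0: "fps_nth (fps_scale rho Qf) 0 = 0" by (simp add: Qf_def Qcoef_0)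
  note ren = Qnn Q0 srate_asymp[OF \<kappa>(2)] S S1 Dfps_scaled[of rho]
  have d: "(\<lambda>n. fps_nth (fps_scale rho (Dfps p q)) n / bb n) \<longlonglongrightarrow> \<kappa> / (1 - S)^2"
    by (rule renewal_subcritical[OF ren])
  have dsum: "suminf (fps_nth (fps_scale rho (Dfps p q))) = 1 / (1 - S)"
    by (rule renewal_suminf[OF ren])
  \<comment> \<open>This is \<eta> * D(\<rho>), as D(\<rho>) = 1 / (1 - S).\<close>
  define A where "A = \<kappa> / (1 - S)"
  have A0: "A > 0" using \<kappa> S1 by (simp add: A_def)
  define G where "G = A * Mtot rho + Cst / (\<tau> - 1) * Mtot rho"
  have G0: "G > 0" unfolding G_def using A0 M1 Cst_pos tau by (intro add_pos_pos mult_pos_pos divide_pos_pos) auto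
  have fac: "\<kappa> / (1 - S)^2 * x + y * (1 / (1 - S)) = (A * x + y) / (1 - S)" for x y
    using S1 by (simp add: A_def power2_eq_square add_divide_distrib)
  have 1: "(\<lambda>n. fps_nth (fps_scale rho (Dfps p q) * fps_scale rho (mcol k)) n / bb n) \<longlonglongrightarrow> (A * Mv rho k + betas k) / (1 - S)"
    using asymp_bb_mult[OF d srate_asymp[OF K1]] unfolding dsum Mv_suminf fac .
  have 2: "(\<lambda>n. fps_nth (fps_scale rho (Dfps p q) * fps_scale rho msum) n / bb n) \<longlonglongrightarrow> G / (1 - S)"
    using asymp_bb_mult[OF d srate_asymp[OF K2]] unfolding dsum Mtot_suminf fac G_def .
  have "(\<lambda>n. prob_alt p q n k) \<longlonglongrightarrow> ((A * Mv rho k + betas k) / (1 - S)) / (G / (1 - S))"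
  proof (rule prob_alt_limit[OF rho_pos _ 1 2])
    show "\<forall>\<^sub>F n in sequentially. bb n \<noteq> 0" using eventually_gt_at_top[of 0]
    proof eventually_elim
      case (elim n) thus ?case using bb_pos[of n] by simp
    qed
  qed (use G0 S1 in auto)
  hence lim: "(\<lambda>n. prob_alt p q n k) \<longlonglongrightarrow> (A * Mv rho k + betas k) / G" using S1 by simp
  \<comment> \<open>The geometric expansion of C / (\<tau> - u) in u; its product with M(\<rho>, u)
    has the coefficients \<open>betas\<close>.\<close>
  define T where "T = Abs_fps (\<lambda>i. complex_of_real (Cst / \<tau> ^ Suc i))"
  have texp: "(\<lambda>u. complex_of_real Cst / (complex_of_real \<tau> - u)) has_fps_expansion T"
  proof -
    have tm: "T * (fps_const (of_real \<tau>) - fps_X) = fps_const (of_real Cst)"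
    proof (rule fps_ext)
      fix n show "fps_nth (T * (fps_const (of_real \<tau>) - fps_X)) n = fps_nth (fps_const (of_real Cst)) n"
        using tau_pos by (cases n) (auto simp: T_def right_diff_distrib)
    qed
    have l: "(\<lambda>u. complex_of_real \<tau> - u) has_fps_expansion (fps_const (of_real \<tau>) - fps_X)"
      by (intro fps_expansion_intros)
    have nz: "fps_nth (fps_const (complex_of_real \<tau>) - fps_X) 0 \<noteq> 0" using tau_pos by simp
    have "(\<lambda>u. complex_of_real Cst * inverse (complex_of_real \<tau> - u)) has_fps_expansion fps_const (of_real Cst) * inverse (fps_const (of_real \<tau>) - fps_X)"
      by (intro has_fps_expansion_cmult_left has_fps_expansion_inverse[OF l nz])
    also have "fps_const (of_real Cst) * inverse (fps_const (of_real \<tau>) - fps_X) = T"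
      unfolding tm[symmetric] using inverse_mult_eq_1[OF nz] by (simp add: mult.assoc mult.commute[of "fps_const (complex_of_real \<tau>) - fps_X"])
    finally show ?thesis by (simp add: divide_inverse)
  qed
  define B where "B = 1 / (complex_of_real A + complex_of_real (Cst / (\<tau> - 1)))"
  have "(\<lambda>u. B * ((complex_of_real A + complex_of_real Cst / (complex_of_real \<tau> - u)) * (\<Prod>l<d. (1 - v l rho) / (u - v l rho))))
    has_fps_expansion fps_const B * ((fps_const (of_real A) + T) * (fps_const (1 / of_real (Mtot rho)) * Mfps rho))"
    by (intro has_fps_expansion_cmult_left has_fps_expansion_mult has_fps_expansion_add has_fps_expansion_const texp
          omega_expansion[OF v rho_pos order.refl sm])
  hence "taylor_coeff (\<lambda>u. B * ((complex_of_real A + complex_of_real Cst / (complex_of_real \<tau> - u)) * (\<Prod>l<d. (1 - v l rho) / (u - v l rho)))) k =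
     B * (1 / of_real (Mtot rho)) * fps_nth ((fps_const (of_real A) + T) * Mfps rho) k"
    by (simp add: taylor_coeff_eq mult.left_commute[of "fps_const (of_real A) + T"] del: of_real_divide)
  also have "fps_nth ((fps_const (of_real A) + T) * Mfps rho) k = of_real (A * Mv rho k + betas k)"
  proof -
    have "fps_nth (T * Mfps rho) k = of_real (betas k)"
      by (simp add: fps_mult_nth T_def Mfps_def betas_def)
    thus ?thesis by (simp add: distrib_right Mfps_def)
  qed
  also have "B * (1 / of_real (Mtot rho)) = of_real (1 / G)"
  proof -
    have "G = (A + Cst / (\<tau> - 1)) * Mtot rho" by (simp add: G_def distrib_right)
    thus ?thesis by (simp add: B_def)
  qed
  also have "of_real (1 / G) * complex_of_real (A * Mv rho k + betas k) = of_real ((A * Mv rho k + betas k) / G)" by simp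
  finally have tc: "taylor_coeff (\<lambda>u. B * ((complex_of_real A + complex_of_real Cst / (complex_of_real \<tau> - u)) * (\<Prod>l<d. (1 - v l rho) / (u - v l rho)))) k
     = of_real ((A * Mv rho k + betas k) / G)" .
  have fe: "(\<lambda>u. (complex_of_real (\<eta> / (1 - Qfun p q rho)) + complex_of_real Cst / (complex_of_real \<tau> - u))
       / (complex_of_real (\<eta> / (1 - Qfun p q rho)) + complex_of_real (Cst / (\<tau> - 1)))
       * (\<Prod>l<d. (1 - v l rho) / (u - v l rho))) = (\<lambda>u. B * ((complex_of_real A + complex_of_real Cst / (complex_of_real \<tau> - u)) * (\<Prod>l<d. (1 - v l rho) / (u - v l rho))))"
    unfolding \<eta>\<kappa> S_def[symmetric] A_def[symmetric] B_def by (simp add: fun_eq_iff)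
  show ?thesis unfolding fe tc by (rule tendsto_of_real[OF lim])
qed

end

text \<open>A zero of 1 - Q is expressed by \<open>sums 1\<close>, which includes convergence of the
  series at that point; an equation for the value of the sum would also admit the unspecified value
  of a divergent series.\<close>

theorem theorem4p16:
  fixes c d :: nat and p :: "int \<Rightarrow> real" and q \<tau> \<rho> C :: real
    and v :: "nat \<Rightarrow> real \<Rightarrow> complex"
  assumes c_pos: "c \<ge> 1" and d_pos: "d \<ge> 1"
    and p_nonneg: "\<forall>i. p i \<ge> 0"
    and p_supp: "\<forall>i. (i < - int c \<or> i > int d) \<longrightarrow> p i = 0"
    and p_c: "p (- int c) \<noteq> 0" and p_d: "p (int d) \<noteq> 0"
    and aper: "aperiodic p"
    and q_pos: "q > 0"
    and tau_pos: "\<tau> > 0"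
    and tau_crit: "deriv (jump_poly_real c d p) \<tau> = 0"
    and tau_min: "\<forall>x. x > 0 \<and> deriv (jump_poly_real c d p) x = 0 \<longrightarrow> \<tau> \<le> x"
    and rho_def: "\<rho> = 1 / jump_poly_real c d p \<tau>"
    and C_def: "C = sqrt (2 * jump_poly_real c d p \<tau> / deriv (deriv (jump_poly_real c d p)) \<tau>)"
    and v_large: "large_roots c d p \<rho> v"
  shows
    "(\<forall>\<rho>0. (0 < \<rho>0 \<and> \<rho>0 \<le> \<rho> \<and> (\<lambda>n. Qcoef p q n * \<rho>0 ^ n) sums 1
             \<and> (\<forall>z. 0 < z \<and> z < \<rho>0 \<longrightarrow> \<not> ((\<lambda>n. Qcoef p q n * z ^ n) sums 1)))
        \<longrightarrow> (\<forall>k. (\<lambda>n. complex_of_real (prob_alt p q n k)) \<longlonglongrightarrow>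
               taylor_coeff (\<lambda>u. \<Prod>l<d. (1 - v l \<rho>0) / (u - v l \<rho>0)) k))
     \<and> ((\<not> (\<exists>z. 0 < z \<and> z \<le> \<rho> \<and> (\<lambda>n. Qcoef p q n * z ^ n) sums 1))
        \<longrightarrow> (\<forall>\<eta>::real.
              (\<lambda>z. Qfun p q z - (Qfun p q \<rho> - \<eta> * sqrt (1 - z / \<rho>)))
                 \<in> O[at_left \<rho>](\<lambda>z. 1 - z / \<rho>)
              \<longrightarrow> (\<forall>k. (\<lambda>n. complex_of_real (prob_alt p q n k)) \<longlonglongrightarrow>
                 taylor_coeff (\<lambda>u.
                   (complex_of_real (\<eta> / (1 - Qfun p q \<rho>)) + complex_of_real C / (complex_of_real \<tau> - u))
                   / (complex_of_real (\<eta> / (1 - Qfun p q \<rho>)) + complex_of_real (C / (\<tau> - 1)))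
                   * (\<Prod>l<d. (1 - v l \<rho>) / (u - v l \<rho>))) k)))"
proof -
  have deriv1: "(jump_poly_real c d p has_real_derivative (\<Sum>i\<in>{- int c..int d}. p i * (of_int i * x powi (i - 1)))) (at x)" if "x > 0" for x
    unfolding jump_poly_real_def[abs_def] using that by (auto intro!: derivative_eq_intros sum.cong simp: mult_ac)
  have crit: "(\<Sum>j\<in>{- int c..int d}. of_int j * p j * \<tau> powi j) = 0"
  proof -
    have "(\<Sum>i\<in>{- int c..int d}. p i * (of_int i * \<tau> powi (i - 1))) = 0"
      using DERIV_imp_deriv[OF deriv1[OF tau_pos]] tau_crit by simp
    hence "\<tau> * (\<Sum>i\<in>{- int c..int d}. p i * (of_int i * \<tau> powi (i - 1))) = 0" by simp
    also have "\<tau> * (\<Sum>i\<in>{- int c..int d}. p i * (of_int i * \<tau> powi (i - 1))) = (\<Sum>j\<in>{- int c..int d}. of_int j * p j * \<tau> powi j)"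
      unfolding sum_distrib_left using tau_pos by (intro sum.cong refl) (simp add: power_int_diff)
    finally show ?thesis .
  qed
  interpret catastrophe_walk c d p \<tau> q
    by unfold_locales (use p_nonneg p_supp c_pos d_pos p_c p_d aper tau_pos crit q_pos in auto)
  have rho: "\<rho> = rho" by (simp add: rho_def \<open>\<rho> = _\<close> Pv_eq)
  \<comment> \<open>Differentiating twice gives \<tau>^2 * P''(\<tau>) as the sum of (i^2 - i) * p_i
    * \<tau>^i, and the linear part vanishes by \<open>crit\<close>.\<close>
  have C: "C = Cst"
  proof -
    have ev: "\<forall>\<^sub>F x in nhds \<tau>. deriv (jump_poly_real c d p) x = (\<Sum>i\<in>{- int c..int d}. p i * (of_int i * x powi (i - 1)))"
    proof -
      have "\<forall>\<^sub>F x in nhds \<tau>. x \<in> {0<..}" using tau_pos by (intro eventually_nhds_in_open) auto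
      thus ?thesis by eventually_elim (use DERIV_imp_deriv[OF deriv1] in auto)
    qed
    have "((\<lambda>x. \<Sum>i\<in>{- int c..int d}. p i * (of_int i * x powi (i - 1))) has_real_derivative
       (\<Sum>i\<in>{- int c..int d}. p i * (of_int i * (of_int (i - 1) * \<tau> powi (i - 1 - 1))))) (at \<tau>)"
      using tau_pos by (auto intro!: derivative_eq_intros sum.cong simp: mult_ac)
    hence d2: "deriv (deriv (jump_poly_real c d p)) \<tau> = (\<Sum>i\<in>{- int c..int d}. p i * (of_int i * (of_int (i - 1) * \<tau> powi (i - 1 - 1))))"
      using deriv_cong_ev[OF ev refl] by (auto dest: DERIV_imp_deriv)
    have "\<tau>\<^sup>2 * deriv (deriv (jump_poly_real c d p)) \<tau> = (\<Sum>i\<in>{- int c..int d}. (of_int i)\<^sup>2 * p i * \<tau> powi i - of_int i * p i * \<tau> powi i)"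
      unfolding d2 sum_distrib_left using tau_pos
      by (intro sum.cong refl) (simp add: power_int_diff power2_eq_square field_simps)
    also have "\<dots> = (\<Sum>i\<in>{- int c..int d}. (of_int i)\<^sup>2 * p i * \<tau> powi i)" by (simp add: sum_subtractf crit)
    also have "\<dots> = s2 * Pv \<tau>"
      using Pv_pos[OF tau_pos] by (simp add: s2_def wt_def sum_distrib_right mult.assoc)
    finally have D2: "deriv (deriv (jump_poly_real c d p)) \<tau> = s2 * Pv \<tau> / \<tau>\<^sup>2" using tau_pos by (simp add: field_simps)
    have "2 * Pv \<tau> / (s2 * Pv \<tau> / \<tau>\<^sup>2) = 2 / s2 * \<tau>\<^sup>2" using Pv_pos[OF tau_pos] by simp
    moreover have "sqrt (2 / s2 * \<tau>\<^sup>2) = sqrt (2 / s2) * \<tau>" using tau_pos by (simp only: real_sqrt_mult real_sqrt_abs abs_of_pos)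
    ultimately show ?thesis using C_def unfolding D2 Pv_eq[symmetric] Cst_def by (simp only:)
  qed
  have v: "large_roots c d p rho v" using v_large rho by simp
  show ?thesis unfolding rho C
    using limit_root[OF v] limit_no_root[OF v] by blast
qed

end
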